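(* Suppose that $n_1n_2\neq0$. Then the instability index $\nu(\mathbf T)$ of the equation $\dot{\mathbf u}=i\omega\mathbf T\mathbf u$ is equal to $\pi_-(N)$, the number of negative eigenvalues of $N=\operatorname{diag}(1,n_1,n_2)$. In particular, the problem is stable if and only if the numbers $n_1$ and $n_2$ are positive.
   Context: Setting (rotating top with a cavity filled with viscous fluid). $\Omega\subset\Omega_1$ are bounded domains in $\mathbb R^3$; the rigid shell occupies $\Omega_1\setminus\Omega$, the cavity $\Omega$ is filled with fluid of density $1$; $\rho$ is the mass distribution on $\Omega_1$ (shell and fluid). The origin is the fixed point, and the coordinate axes (basis $e_0,e_1,e_2$, coordinates $x=(x_0,x_1,x_2)$) are principal axes of inertia of the body with frozen fluid. $[\cdot,\cdot]$ is the vector product, all spaces are complexified. Constants: $\omega>0$ (angular velocity), $\nu>0$ (viscosity), $k\in\mathbb R$ (gravity constant). $J_0(\Omega)$ is the closure in $L_2(\Omega)^3$ of the smooth compactly supported solenoidal vector fields; $P_0$ is the orthogonal projection of $L_2(\Omega)^3$ onto $J_0(\Omega)$. $R$ is the Stokes operator: the Friedrichs extension in $J_0(\Omega)$ of $-P_0\Delta$ defined on smooth compactly supported solenoidal fields. $B:\mathbb C^3\to J_0(\Omega)$, $Bw=P_0([w,x])$, and $B^*v=\int_\Omega[x,v(x)]\,dx$. The inertia operator $A$ on $\mathbb C^3$ is given by $(Aw,w)=\int_{\Omega_1}\|[w,x]\|^2d\rho(x)$, so $A=\operatorname{diag}(a_0,a_1,a_2)$; the operator $A_0$ given by $(A_0w,w)=\int_{\Omega_1\setminus\Omega}\|[w,x]\|^2d\rho(x)$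 is assumed positive definite. $H$ is defined by $iHx=[x,e_0]$, i.e. $H=\begin{pmatrix}0&0&0\\0&0&-i\\0&i&0\end{pmatrix}$. $G=-2P_0H$ on $J_0(\Omega)$ ($H$ acting pointwise), $D=G+i\nu\omega^{-1}R$. Put $n_j=a_0-a_j-k/\omega^2$, $j=1,2$, $N=\operatorname{diag}(1,n_1,n_2)$. In $\mathfrak H=\mathbb C^3\times\mathbb C^3\times J_0(\Omega)$, with elements $\mathbf u=(z,w,v)^t$, $$\mathbf W=\begin{pmatrix}I&0&0\\0&A&B^*\\0&B&I\end{pmatrix},\qquad \mathbf M=\begin{pmatrix}H&-\omega^{-1}H&0\\ k\omega^{-1}H&H(A-a_0I)&HB^*\\0&0&D\end{pmatrix},\qquad \mathcal D(\mathbf M)=\mathbb C^3\times\mathbb C^3\times\mathcal D(R);$$ $\mathbf W$ is boundedly invertible and $\mathbf T=\mathbf W^{-1}\mathbf M$. The linearized equations of motion are $\mathbf W\dot{\mathbf u}=i\omega\mathbf M\mathbf u$, equivalently $\dot{\mathbf u}=i\omega\mathbf T\mathbf u$, $t\ge0$. The instability index $\nu(\mathbf T)$ is the dimension of the quotient of the space of all solutions of $\dot{\mathbf u}=i\omega\mathbf T\mathbf u$ on $t\ge0$ by the subspace of bounded solutions; the problem is stable if all solutions are bounded. *)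

theory Defs
  imports "HOL-Analysis.Analysis" "HOL-Library.Function_Algebras"
begin

text \<open>
  Coordinates are indexed by \<^typ>\<open>3\<close>, i.e. by the integers modulo 3, written \<open>0, 1, 2\<close>.
  The library writes the same three indices as \<open>1, 2, 3\<close> with \<open>3 = 0\<close>; the two orderings
  differ by an even permutation, so the orientation is the usual one
  (see \<open>ccross_of_real\<close> below).
\<close>

definition cvec :: "real^3 \<Rightarrow> complex^3" where
  "cvec x = (\<chi> i. complex_of_real (x $ i))"

definition ccross :: "complex^3 \<Rightarrow> complex^3 \<Rightarrow> complex^3" where
  "ccross a b = (\<chi> i. a $ (i + 1) * b $ (i + 2) - a $ (i + 2) * b $ (i + 1))"

lemma ccross_of_real: "ccross (cvec a) (cvec b) = cvec (cross3 a b)"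
proof -
  have [simp]: "(4::3) = 1" "(5::3) = 2" by simp_all
  show ?thesis
    by (simp add: ccross_def cvec_def cross3_def vec_eq_iff forall_3)
qed

text \<open>The Hermitian inner product, linear in the first argument.\<close>

definition herm :: "complex^'n \<Rightarrow> complex^'n \<Rightarrow> complex" where
  "herm z w = (\<Sum>i\<in>UNIV. z $ i * cnj (w $ i))"

lemma Re_herm: "Re (herm z w) = z \<bullet> w"
  by (simp add: herm_def inner_vec_def inner_complex_def)

definition diag_mat :: "('n \<Rightarrow> 'a::zero) \<Rightarrow> 'a^'n^'n" where
  "diag_mat d = (\<chi> i j. if i = j then d i else 0)"

definition op_H :: "complex^3 \<Rightarrow> complex^3" where
  "op_H z = (- \<i>) *s ccross z (axis 0 1)"

lemma op_H_matrix:
  "op_H z $ 0 = 0" "op_H z $ 1 = - \<i> * z $ 2" "op_H z $ 2 = \<i> * z $ 1"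
proof -
  have [simp]: "(3::3) = 0" "(4::3) = 1" by simp_all
  show "op_H z $ 0 = 0" "op_H z $ 1 = - \<i> * z $ 2" "op_H z $ 2 = \<i> * z $ 1"
    by (simp_all add: op_H_def ccross_def axis_def)
qed

text \<open>
  The number of negative eigenvalues, counted with multiplicity.  For the self-adjoint
  matrices to which it is applied, geometric and algebraic multiplicities coincide.
\<close>

definition pi_minus :: "complex^'n^'n \<Rightarrow> nat" where
  "pi_minus N =
     (\<Sum>l | l < (0::real) \<and> (\<exists>x. x \<noteq> 0 \<and> N *v x = complex_of_real l *s x).
        vec.dim {x. N *v x = complex_of_real l *s x})"

text \<open>
  \<open>l2\<close> is \<open>L\<^sub>2(\<real>\<^sup>3)\<^sup>3\<close>, complexified.  For a measurable set \<open>\<Omega>\<close>, the space \<open>L\<^sub>2(\<Omega>)\<^sup>3\<close> is identified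
  with the closed subspace of classes vanishing almost everywhere outside \<open>\<Omega>\<close>.
\<close>

definition sq_int :: "(real^3 \<Rightarrow> complex^3) \<Rightarrow> bool" where
  "sq_int f \<longleftrightarrow> f \<in> borel_measurable lborel \<and> integrable lborel (\<lambda>x. (norm (f x))\<^sup>2)"

lemma sq_int_zero: "sq_int (\<lambda>x. 0)"
  by (simp add: sq_int_def)

lemma sq_int_add:
  assumes "sq_int f" "sq_int g" shows "sq_int (\<lambda>x. f x + g x)"
proof -
  have [measurable]: "f \<in> borel_measurable borel" "g \<in> borel_measurable borel"
    using assms by (auto simp: sq_int_def)
  have "integrable lborel (\<lambda>x. 2 * (norm (f x))\<^sup>2 + 2 * (norm (g x))\<^sup>2)"
    using assms by (auto simp: sq_int_def)
  moreover have "(norm (f x + g x))\<^sup>2 \<le> 2 * (norm (f x))\<^sup>2 + 2 * (norm (g x))\<^sup>2" for x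
  proof -
    have "(norm (f x + g x))\<^sup>2 \<le> (norm (f x) + norm (g x))\<^sup>2"
      by (intro power_mono norm_triangle_ineq) auto
    also have "\<dots> \<le> 2 * (norm (f x))\<^sup>2 + 2 * (norm (g x))\<^sup>2"
      using sum_squares_bound[of "norm (f x)" "norm (g x)"] by (simp add: power2_sum)
    finally show ?thesis .
  qed
  ultimately have "integrable lborel (\<lambda>x. (norm (f x + g x))\<^sup>2)"
    by (elim Bochner_Integration.integrable_bound) auto
  then show ?thesis by (simp add: sq_int_def)
qed

lemma norm_vector_scalar_mult: "norm (c *s z) = norm c * norm (z :: complex^'n)"
  by (simp add: norm_vec_def norm_mult L2_set_right_distrib)

lemma measurable_vector_scalar_mult [measurable (raw)]:
  fixes f :: "'a \<Rightarrow> complex^'n"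
  assumes "f \<in> borel_measurable M"
  shows "(\<lambda>x. c *s f x) \<in> borel_measurable M"
proof -
  have "continuous_on UNIV (\<lambda>z::complex^'n. c *s z)"
    unfolding vector_scalar_mult_def by (intro continuous_intros)
  then show ?thesis
    using assms by (metis borel_measurable_continuous_onI measurable_compose)
qed

lemma sq_int_scale:
  assumes "sq_int f" shows "sq_int (\<lambda>x. c *s f x)"
  using assms by (auto simp: sq_int_def norm_vector_scalar_mult power_mult_distrib)

lemma sq_int_scaleR:
  assumes "sq_int f" shows "sq_int (\<lambda>x. r *\<^sub>R f x)"
  using assms by (auto simp: sq_int_def power_mult_distrib)

lemma borel_measurable_herm [measurable (raw)]:
  fixes f g :: "'a \<Rightarrow> complex^'n"
  assumes "f \<in> borel_measurable M" "g \<in> borel_measurable M"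
  shows "(\<lambda>x. herm (f x) (g x)) \<in> borel_measurable M"
proof -
  have "continuous_on UNIV (\<lambda>p. herm (fst p) (snd p) :: complex)" for p :: "(complex^'n) \<times> (complex^'n)"
    unfolding herm_def by (intro continuous_intros)
  then have "(\<lambda>p. herm (fst p) (snd p)) \<in> borel_measurable (borel :: ((complex^'n) \<times> (complex^'n)) measure)"
    using borel_measurable_continuous_onI by blast
  from measurable_compose[OF borel_measurable_Pair[OF assms] this] show ?thesis by simp
qed

lemma norm_herm_le: "norm (herm z w) \<le> norm z * norm w" for z w :: "complex^'n"
proof -
  have "norm (herm z w) \<le> (\<Sum>i\<in>UNIV. \<bar>norm (z $ i)\<bar> * \<bar>norm (w $ i)\<bar>)"
    unfolding herm_def by (rule order_trans[OF norm_sum]) (simp add: norm_mult)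
  also have "\<dots> \<le> norm z * norm w"
    unfolding norm_vec_def by (rule L2_set_mult_ineq)
  finally show ?thesis .
qed

lemma integrable_herm:
  assumes "sq_int f" "sq_int g" shows "integrable lborel (\<lambda>x. herm (f x) (g x))"
proof -
  have [measurable]: "f \<in> borel_measurable borel" "g \<in> borel_measurable borel"
    using assms by (auto simp: sq_int_def)
  have "integrable lborel (\<lambda>x. (norm (f x))\<^sup>2 + (norm (g x))\<^sup>2)"
    using assms by (auto simp: sq_int_def)
  moreover have "norm (herm (f x) (g x)) \<le> norm ((norm (f x))\<^sup>2 + (norm (g x))\<^sup>2)" for x
  proof -
    have "2 * (norm (f x) * norm (g x)) \<le> (norm (f x))\<^sup>2 + (norm (g x))\<^sup>2"
      using sum_squares_bound[of "norm (f x)" "norm (g x)"] by (simp add: mult.assoc)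
    moreover have "0 \<le> norm (f x) * norm (g x)" by simp
    ultimately show ?thesis
      using norm_herm_le[of "f x" "g x"] by (simp only: real_norm_def)
  qed
  ultimately show ?thesis
    by (elim Bochner_Integration.integrable_bound) auto
qed

lemma integrable_inner_sq_int:
  assumes "sq_int f" "sq_int g" shows "integrable lborel (\<lambda>x. f x \<bullet> g x)"
  using integrable_Re[OF integrable_herm[OF assms]] by (simp add: Re_herm)

definition l2rel :: "(real^3 \<Rightarrow> complex^3) \<Rightarrow> (real^3 \<Rightarrow> complex^3) \<Rightarrow> bool" where
  "l2rel f g \<longleftrightarrow> sq_int f \<and> sq_int g \<and> (AE x in lborel. f x = g x)"

quotient_type l2 = "real^3 \<Rightarrow> complex^3" / partial: l2rel
proof (rule part_equivpI)
  show "\<exists>x. l2rel x x"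
    using sq_int_zero by (auto simp: l2rel_def)
  show "symp l2rel"
    unfolding symp_def l2rel_def by (simp add: eq_commute)
  have "l2rel f h" if "l2rel f g" "l2rel g h" for f g h
  proof -
    have "AE x in lborel. f x = g x" "AE x in lborel. g x = h x"
      using that by (simp_all add: l2rel_def)
    then have "AE x in lborel. f x = h x" by eventually_elim simp
    with that show ?thesis by (simp add: l2rel_def)
  qed
  then show "transp l2rel" by (blast intro: transpI)
qed

instantiation l2 :: real_inner
begin

lift_definition zero_l2 :: l2 is "\<lambda>x. 0"
  by (simp add: l2rel_def sq_int_zero)

lift_definition plus_l2 :: "l2 \<Rightarrow> l2 \<Rightarrow> l2" is "\<lambda>f g x. f x + g x"
  by (auto simp: l2rel_def sq_int_add)

lift_definition scaleR_l2 :: "real \<Rightarrow> l2 \<Rightarrow> l2" is "\<lambda>r f x. r *\<^sub>R f x"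
  by (auto simp: l2rel_def sq_int_scaleR)

definition "uminus f = (-1) *\<^sub>R f" for f :: l2

definition "f - g = f + - g" for f g :: l2

lift_definition inner_l2 :: "l2 \<Rightarrow> l2 \<Rightarrow> real" is "\<lambda>f g. LINT x|lborel. f x \<bullet> g x"
proof -
  fix f1 f2 g1 g2 assume *: "l2rel f1 f2" "l2rel g1 g2"
  then have "AE x in lborel. f1 x = f2 x" "AE x in lborel. g1 x = g2 x"
    by (auto simp: l2rel_def)
  then have "AE x in lborel. f1 x \<bullet> g1 x = f2 x \<bullet> g2 x" by eventually_elim simp
  then show "(LINT x|lborel. f1 x \<bullet> g1 x) = (LINT x|lborel. f2 x \<bullet> g2 x)"
    using *[unfolded l2rel_def]
    by (intro integral_cong_AE borel_measurable_integrable integrable_inner_sq_int) blast+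
qed

definition "norm f = sqrt (f \<bullet> f)" for f :: l2

definition "dist f g = norm (f - g)" for f g :: l2

definition "sgn f = inverse (norm f) *\<^sub>R f" for f :: l2

definition [code del]:
  "(uniformity :: (l2 \<times> l2) filter) = (INF e\<in>{0<..}. principal {(x, y). dist x y < e})"

definition [code del]:
  "open (U :: l2 set) \<longleftrightarrow> (\<forall>x\<in>U. eventually (\<lambda>(x', y). x' = x \<longrightarrow> y \<in> U) uniformity)"

instance
proof
  fix f g h :: l2 and a b r :: real
  show "f + g + h = f + (g + h)" by transfer (auto simp: l2rel_def add.assoc sq_int_add)
  show "f + g = g + f" by transfer (auto simp: l2rel_def add.commute sq_int_add)
  show "0 + f = f" by transfer (auto simp: l2rel_def)
  show "- f + f = 0"
    unfolding uminus_l2_def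
    by transfer (auto simp: l2rel_def sq_int_zero)
  show "f - g = f + - g" by (rule minus_l2_def)
  show "a *\<^sub>R (f + g) = a *\<^sub>R f + a *\<^sub>R g"
    by transfer (auto simp: l2rel_def scaleR_add_right sq_int_add sq_int_scaleR)
  show "(a + b) *\<^sub>R f = a *\<^sub>R f + b *\<^sub>R f"
    by transfer (auto simp: l2rel_def scaleR_add_left sq_int_add sq_int_scaleR)
  show "a *\<^sub>R b *\<^sub>R f = (a * b) *\<^sub>R f"
    by transfer (auto simp: l2rel_def sq_int_scaleR)
  show "1 *\<^sub>R f = f" by transfer (auto simp: l2rel_def)
  show "f \<bullet> g = g \<bullet> f" by transfer (simp add: inner_commute)
  show "(f + g) \<bullet> h = f \<bullet> h + g \<bullet> h"
    by transfer (auto simp: l2rel_def inner_add_left integrable_inner_sq_int)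
  show "(r *\<^sub>R f) \<bullet> g = r * (f \<bullet> g)"
    by transfer simp
  show "0 \<le> f \<bullet> f"
    by transfer simp
  show "(f \<bullet> f = 0) = (f = 0)"
  proof transfer
    fix f assume "l2rel f f"
    then have f: "sq_int f" by (simp add: l2rel_def)
    have "(LINT x|lborel. f x \<bullet> f x) = 0 \<longleftrightarrow> (AE x in lborel. f x \<bullet> f x = 0)"
      by (intro integral_nonneg_eq_0_iff_AE integrable_inner_sq_int f) auto
    then show "((LINT x|lborel. f x \<bullet> f x) = 0) = l2rel f (\<lambda>x. 0)"
      using f by (simp add: l2rel_def sq_int_zero)
  qed
  show "norm f = sqrt (f \<bullet> f)" by (rule norm_l2_def)
  show "dist f g = norm (f - g)" by (rule dist_l2_def)
  show "sgn f = inverse (norm f) *\<^sub>R f" by (rule sgn_l2_def)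
qed (rule uniformity_l2_def open_l2_def)+

end

lift_definition scaleC_l2 :: "complex \<Rightarrow> l2 \<Rightarrow> l2" is "\<lambda>c f x. c *s f x"
  by (auto simp: l2rel_def sq_int_scale)

lift_definition cinner_l2 :: "l2 \<Rightarrow> l2 \<Rightarrow> complex" is "\<lambda>f g. LINT x|lborel. herm (f x) (g x)"
proof -
  fix f1 f2 g1 g2 assume *: "l2rel f1 f2" "l2rel g1 g2"
  then have "AE x in lborel. f1 x = f2 x" "AE x in lborel. g1 x = g2 x"
    by (auto simp: l2rel_def)
  then have "AE x in lborel. herm (f1 x) (g1 x) = herm (f2 x) (g2 x)" by eventually_elim simp
  then show "(LINT x|lborel. herm (f1 x) (g1 x)) = (LINT x|lborel. herm (f2 x) (g2 x))"
    using *[unfolded l2rel_def]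
    by (intro integral_cong_AE borel_measurable_integrable integrable_herm) blast+
qed

lemma Re_cinner_l2: "Re (cinner_l2 f g) = f \<bullet> g"
  by transfer (simp add: l2rel_def integrable_herm Re_herm flip: integral_Re)

text \<open>
  \<open>abs_l2 f\<close> is the class of the square integrable field \<open>f\<close>, and \<open>rep_l2 v\<close> is some
  representative of the class \<open>v\<close>.
\<close>

definition pderiv_field :: "3 \<Rightarrow> (real^3 \<Rightarrow> complex^3) \<Rightarrow> real^3 \<Rightarrow> complex^3" where
  "pderiv_field i f x = frechet_derivative f (at x) (axis i 1)"

primrec Ck_field :: "nat \<Rightarrow> (real^3 \<Rightarrow> complex^3) \<Rightarrow> bool" where
  "Ck_field 0 f \<longleftrightarrow> continuous_on UNIV f"
| "Ck_field (Suc n) f \<longleftrightarrow> f differentiable_on UNIV \<and> (\<forall>i. Ck_field n (pderiv_field i f))"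

definition divergence :: "(real^3 \<Rightarrow> complex^3) \<Rightarrow> real^3 \<Rightarrow> complex" where
  "divergence f x = (\<Sum>i\<in>UNIV. pderiv_field i f x $ i)"

definition laplacian :: "(real^3 \<Rightarrow> complex^3) \<Rightarrow> real^3 \<Rightarrow> complex^3" where
  "laplacian f x = (\<Sum>i\<in>UNIV. pderiv_field i (pderiv_field i f) x)"

definition solenoidal_test :: "(real^3) set \<Rightarrow> (real^3 \<Rightarrow> complex^3) set" where
  "solenoidal_test \<Omega> =
     {f. (\<forall>n. Ck_field n f) \<and> compact (closure {x. f x \<noteq> 0}) \<and> closure {x. f x \<noteq> 0} \<subseteq> \<Omega>
         \<and> (\<forall>x. divergence f x = 0)}"

definition J0 :: "(real^3) set \<Rightarrow> l2 set" where
  "J0 \<Omega> = closure (abs_l2 ` solenoidal_test \<Omega>)"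

text \<open>
  The orthogonal projection onto \<open>J0 \<Omega>\<close>.  It is defined on all of \<open>l2\<close>; its restriction to the
  fields vanishing outside \<open>\<Omega>\<close> is the projection from \<open>L\<^sub>2(\<Omega>)\<^sup>3\<close>.
\<close>

definition P0 :: "(real^3) set \<Rightarrow> l2 \<Rightarrow> l2" where
  "P0 \<Omega> f = (THE p. p \<in> J0 \<Omega> \<and> (\<forall>q\<in>J0 \<Omega>. cinner_l2 (f - p) q = 0))"

text \<open>
  The Friedrichs extension, in the closed subspace \<open>E\<close>, of a nonnegative symmetric operator
  densely defined in \<open>E\<close>, both given by their graphs.  It is the restriction of the adjoint \<open>S\<^sup>*\<close>
  (last conjunct) to the energy space, i.e. to the limits \<open>u\<close> of sequences in the domain of \<open>S\<close>
  that are Cauchy for the quadratic form \<open>(S d, d)\<close>.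
\<close>

definition friedrichs :: "l2 set \<Rightarrow> (l2 \<times> l2) set \<Rightarrow> (l2 \<times> l2) set" where
  "friedrichs E S =
     {(u, f). u \<in> E \<and> f \<in> E \<and>
        (\<exists>d g. (\<forall>n::nat. (d n, g n) \<in> S) \<and> d \<longlonglongrightarrow> u \<and>
           (\<forall>e>0. \<exists>K. \<forall>m\<ge>K. \<forall>n\<ge>K. Re (cinner_l2 (g m - g n) (d m - d n)) < e)) \<and>
        (\<forall>(d, g)\<in>S. cinner_l2 u g = cinner_l2 f d)}"

definition stokes_graph :: "(real^3) set \<Rightarrow> (l2 \<times> l2) set" where
  "stokes_graph \<Omega> =
     friedrichs (J0 \<Omega>) {(abs_l2 f, - P0 \<Omega> (abs_l2 (laplacian f))) | f. f \<in> solenoidal_test \<Omega>}"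

definition stokes_dom :: "(real^3) set \<Rightarrow> l2 set" where
  "stokes_dom \<Omega> = Domain (stokes_graph \<Omega>)"

definition stokes :: "(real^3) set \<Rightarrow> l2 \<Rightarrow> l2" where
  "stokes \<Omega> u = (THE f. (u, f) \<in> stokes_graph \<Omega>)"

definition op_B :: "(real^3) set \<Rightarrow> complex^3 \<Rightarrow> l2" where
  "op_B \<Omega> w = P0 \<Omega> (abs_l2 (\<lambda>x. if x \<in> \<Omega> then ccross w (cvec x) else 0))"

definition op_B_adj :: "(real^3) set \<Rightarrow> l2 \<Rightarrow> complex^3" where
  "op_B_adj \<Omega> v = (LINT x:\<Omega>|lborel. ccross (cvec x) (rep_l2 v x))"

text \<open>
  \<open>a\<close> lists the principal moments of inertia.  That \<open>op_A a\<close> is the inertia operator of a given mass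
  distribution is expressed by prescribing its quadratic form.
\<close>

definition op_A :: "real^3 \<Rightarrow> complex^3 \<Rightarrow> complex^3" where
  "op_A a w = diag_mat (\<lambda>j. complex_of_real (a $ j)) *v w"

definition op_G :: "(real^3) set \<Rightarrow> l2 \<Rightarrow> l2" where
  "op_G \<Omega> v = scaleC_l2 (-2) (P0 \<Omega> (abs_l2 (\<lambda>x. op_H (rep_l2 v x))))"

definition op_D :: "(real^3) set \<Rightarrow> real \<Rightarrow> real \<Rightarrow> l2 \<Rightarrow> l2" where
  "op_D \<Omega> \<nu> \<omega> v = op_G \<Omega> v + scaleC_l2 (\<i> * \<nu> / \<omega>) (stokes \<Omega> v)"

definition n_coeff :: "real^3 \<Rightarrow> real \<Rightarrow> real \<Rightarrow> 3 \<Rightarrow> real" where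
  "n_coeff a k \<omega> j = a $ 0 - a $ j - k / \<omega>\<^sup>2"

definition N_mat :: "real^3 \<Rightarrow> real \<Rightarrow> real \<Rightarrow> complex^3^3" where
  "N_mat a k \<omega> = diag_mat (\<lambda>j. if j = 0 then 1 else complex_of_real (n_coeff a k \<omega> j))"

type_synonym state = "(complex^3) \<times> (complex^3) \<times> l2"

definition state_scale :: "complex \<Rightarrow> state \<Rightarrow> state" where
  "state_scale c = (\<lambda>(z, w, v). (c *s z, c *s w, scaleC_l2 c v))"

definition state_space :: "(real^3) set \<Rightarrow> state set" where
  "state_space \<Omega> = {(z, w, v). v \<in> J0 \<Omega>}"

definition op_W :: "(real^3) set \<Rightarrow> real^3 \<Rightarrow> state \<Rightarrow> state" where
  "op_W \<Omega> a = (\<lambda>(z, w, v). (z, op_A a w + op_B_adj \<Omega> v, op_B \<Omega> w + v))"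

definition op_M :: "(real^3) set \<Rightarrow> real^3 \<Rightarrow> real \<Rightarrow> real \<Rightarrow> real \<Rightarrow> state \<Rightarrow> state" where
  "op_M \<Omega> a k \<nu> \<omega> = (\<lambda>(z, w, v).
     (op_H z - (1 / \<omega>) *\<^sub>R op_H w,
      (k / \<omega>) *\<^sub>R op_H z + op_H (op_A a w - a $ 0 *\<^sub>R w) + op_H (op_B_adj \<Omega> v),
      op_D \<Omega> \<nu> \<omega> v))"

definition dom_M :: "(real^3) set \<Rightarrow> state set" where
  "dom_M \<Omega> = {(z, w, v). v \<in> stokes_dom \<Omega>}"

definition op_T :: "(real^3) set \<Rightarrow> real^3 \<Rightarrow> real \<Rightarrow> real \<Rightarrow> real \<Rightarrow> state \<Rightarrow> state" where
  "op_T \<Omega> a k \<nu> \<omega> u = inv_into (state_space \<Omega>) (op_W \<Omega> a) (op_M \<Omega> a k \<nu> \<omega> u)"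

text \<open>
  Solutions are functions on \<open>[0,\<infinity>)\<close> (the derivative at \<open>0\<close> is one-sided).  As a function on
  all of \<open>\<real>\<close>, a solution is normalized to vanish at negative arguments, so that distinct
  functions represent distinct solutions.
\<close>

definition solutions :: "(state \<Rightarrow> state) \<Rightarrow> state set \<Rightarrow> real \<Rightarrow> (real \<Rightarrow> state) set" where
  "solutions T Dom \<omega> =
     {u. (\<forall>t<0. u t = 0) \<and>
         (\<forall>t\<ge>0. u t \<in> Dom \<and>
            (u has_vector_derivative state_scale (\<i> * \<omega>) (T (u t))) (at t within {0..}))}"

definition bounded_solutions :: "(state \<Rightarrow> state) \<Rightarrow> state set \<Rightarrow> real \<Rightarrow> (real \<Rightarrow> state) set" where
  "bounded_solutions T Dom \<omega> = {u \<in> solutions T Dom \<omega>. bounded (u ` {0..})}"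

text \<open>
  The dimension of \<open>V / U\<close> for a subspace \<open>U\<close> of a complex vector space \<open>V\<close>: the supremum of the
  sizes of finite families in \<open>V\<close> that are linearly independent modulo \<open>U\<close>.
\<close>

definition quotient_dim :: "(complex \<Rightarrow> 'b \<Rightarrow> 'b) \<Rightarrow> 'b::ab_group_add set \<Rightarrow> 'b set \<Rightarrow> enat" where
  "quotient_dim smul V U =
     (SUP X\<in>{X. finite X \<and> X \<subseteq> V \<and>
                (\<forall>c. (\<Sum>x\<in>X. smul (c x) x) \<in> U \<longrightarrow> (\<forall>x\<in>X. c x = 0))}. enat (card X))"

definition instability_index :: "(state \<Rightarrow> state) \<Rightarrow> state set \<Rightarrow> real \<Rightarrow> enat" where
  "instability_index T Dom \<omega> =
     quotient_dim (\<lambda>c u t. state_scale c (u t)) (solutions T Dom \<omega>) (bounded_solutions T Dom \<omega>)"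

definition is_stable :: "(state \<Rightarrow> state) \<Rightarrow> state set \<Rightarrow> real \<Rightarrow> bool" where
  "is_stable T Dom \<omega> \<longleftrightarrow> (\<forall>u\<in>solutions T Dom \<omega>. bounded (u ` {0..}))"

end

theory Submission
  imports Defs "HOL-Computational_Algebra.Fundamental_Theorem_Algebra"
begin

text \<open>
  Why the theorem holds. Write \<open>\<bullet>\<close> for the real part of the inner products and put
  \<open>w' = w - \<omega> z\<close>. In the variables \<open>x = (z, w', v)\<close> the equations of motion have the weak form
  \<open>V x' \<phi> = s x \<phi> - \<nu> (R v) \<bullet> \<phi>\<^sub>v\<close> for all \<open>\<phi>\<close>, where \<open>s\<close> is bounded and antisymmetric and
  \<open>V x x = A w' \<bullet> w' + 2 (v \<bullet> B w') + v \<bullet> v + \<omega>\<^sup>2 (N z \<bullet> z)\<close>.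
  The first three summands are twice the kinetic energy; they are positive definite because the shell
  has inertia of its own. As \<open>n\<^sub>1 n\<^sub>2 \<noteq> 0\<close>, the form \<open>V\<close> is nondegenerate with exactly \<open>\<kappa> = \<pi>\<^sub>-(N)\<close>
  negative squares, and along solutions \<open>V x x\<close> decreases at the rate \<open>2 \<nu> (R v \<bullet> v)\<close>. What remains is a
  statement on dissipative operators in a Pontryagin space with index \<open>\<kappa>\<close>.

  Such an operator has an invariant subspace of dimension \<open>\<kappa>\<close> on which \<open>V\<close> is nonpositive
  (\<open>invariant_graph\<close>). For a bounded, strictly dissipative operator \<open>T\<close> it is the limit of the images
  of a negative subspace under the powers of \<open>1 + h T\<close> with small \<open>h\<close>
  (\<open>contraction_invariant_graph\<close>); the unbounded operator is approximated by bounded ones, and the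
  subspaces have a weak limit.

  A motion \<open>exp (l t) x\<close> with \<open>V x x \<le> 0\<close> in which the fluid is at rest relative to the body
  must vanish (\<open>no_neutral_mode\<close>), by the injectivity of \<open>B\<close> and the condition \<open>n\<^sub>1 n\<^sub>2 \<noteq> 0\<close>.
  Hence the energy strictly decreases along the motion of an eigenvector in the invariant subspace. It follows that \<open>V\<close> is
  negative definite on that subspace (\<open>graph_negative\<close>), that all its eigenvalues belong to growing
  motions (\<open>eigenvalue_Re_pos\<close>), and that every nonzero solution in it is unbounded
  (\<open>orbit_unbounded\<close>). So the instability index is at least \<open>\<kappa>\<close>.

  The same construction for the adjoint operator, with \<open>- s\<close> in place of \<open>s\<close>, yields \<open>\<kappa>\<close> linear
  conditions: a solution that starts \<open>V\<close>-orthogonal to the invariant subspace of the adjoint stays so,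
  \<open>V\<close> is positive definite on the orthogonal complement, and the decreasing energy bounds the solution
  (\<open>solution_bounded\<close>). So the index is at most \<open>\<kappa>\<close>.

  The Hilbert spaces are treated as real ones, with multiplication by \<open>\<i>\<close> as an isometry whose square
  is \<open>- 1\<close>. The Stokes operator enters only through its bounded inverse (\<open>stokes_inverse\<close>), which comes
  from Friedrichs' construction and the Poincare inequality. All operators are extended from
  \<open>J0 \<Omega>\<close> to all square integrable fields by unit damping on the orthogonal complement.
\<close>

section \<open>Quadratic estimates\<close>

lemma bounded_bilinear_add:
  assumes "bounded_bilinear f" "bounded_bilinear g"
  shows "bounded_bilinear (\<lambda>x y. f x y + g x y)"
proof -
  interpret f: bounded_bilinear f by fact
  interpret g: bounded_bilinear g by fact
  obtain A B where "\<And>x y. norm (f x y) \<le> norm x * norm y * A" "\<And>x y. norm (g x y) \<le> norm x * norm y * B"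
    using f.bounded g.bounded by blast
  then have bound: "norm (f x y + g x y) \<le> norm x * norm y * (A + B)" for x y
    by (intro norm_triangle_le) (simp add: distrib_left add_mono)
  show ?thesis
  proof
    show "\<exists>K. \<forall>x y. norm (f x y + g x y) \<le> norm x * norm y * K" using bound by blast
  qed (simp_all add: f.add_left f.add_right g.add_left g.add_right f.scaleR_left f.scaleR_right
        g.scaleR_left g.scaleR_right algebra_simps)
qed

lemma square_le_sum_squares:
  fixes x a b L :: real
  assumes "0 \<le> x" "x \<le> a + L * b"
  shows "x\<^sup>2 \<le> (2 + 2 * L\<^sup>2) * (a\<^sup>2 + b\<^sup>2)"
proof -
  have "x\<^sup>2 \<le> (a + L * b)\<^sup>2" using assms by (intro power_mono) auto
  also have "\<dots> \<le> 2 * a\<^sup>2 + 2 * (L * b)\<^sup>2"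
    using sum_squares_bound[of a "L * b"] by (simp add: power2_sum)
  also have "\<dots> \<le> (2 + 2 * L\<^sup>2) * (a\<^sup>2 + b\<^sup>2)" by (simp add: algebra_simps power_mult_distrib)
  finally show ?thesis .
qed

text \<open>
  Cancelling a norm that may vanish; this turns bounds of the form \<open>c |x|\<^sup>2 \<le> |x| b\<close> into bounds for
  \<open>|x|\<close>.
\<close>

lemma mult_left_le_imp_le_nonneg:
  fixes a b c :: real
  assumes "0 \<le> a" "0 \<le> b" "a * (c * a) \<le> a * b"
  shows "c * a \<le> b"
  using assms by (cases "a = 0") (auto simp: mult_le_cancel_left)

lemma energy_Cauchy_imp_Cauchy:
  fixes d :: "nat \<Rightarrow> 'a::real_normed_vector"
  assumes "c > 0" and coer: "\<And>m n. c * (norm (d m - d n))\<^sup>2 \<le> E m n"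
    and E: "\<forall>e>0. \<exists>K. \<forall>m\<ge>K. \<forall>n\<ge>K. E m n < e"
  shows "Cauchy d"
proof (rule metric_CauchyI)
  fix e :: real assume "e > 0"
  with \<open>c > 0\<close> have "c * e\<^sup>2 > 0" by simp
  from E[rule_format, OF this] obtain K where K: "\<forall>m\<ge>K. \<forall>n\<ge>K. E m n < c * e\<^sup>2" by blast
  have "dist (d m) (d n) < e" if "m \<ge> K" "n \<ge> K" for m n
  proof -
    have "c * (norm (d m - d n))\<^sup>2 < c * e\<^sup>2" by (rule order.strict_trans1[OF coer K[rule_format, OF that]])
    then have "(norm (d m - d n))\<^sup>2 < e\<^sup>2" using \<open>c > 0\<close> by simp
    then show ?thesis using \<open>e > 0\<close> by (simp add: dist_norm power_less_imp_less_base)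
  qed
  then show "\<exists>M. \<forall>m\<ge>M. \<forall>n\<ge>M. dist (d m) (d n) < e" by blast
qed

text \<open>
  The minimum on the unit sphere is attained; homogeneity carries it to the whole space.
\<close>

lemma positive_form_coercive:
  fixes f :: "'a::euclidean_space \<Rightarrow> real"
  assumes cont: "continuous_on UNIV f" and hom: "\<And>r z. f (r *\<^sub>R z) = r\<^sup>2 * f z"
    and pos: "\<And>z. z \<noteq> 0 \<Longrightarrow> 0 < f z"
  shows "\<exists>m>0. \<forall>z. m * (norm z)\<^sup>2 \<le> f z"
proof -
  have "sphere 0 1 \<noteq> ({} :: 'a set)" by simp
  moreover have "continuous_on (sphere 0 1) f" using cont continuous_on_subset by blast
  ultimately obtain x where x: "x \<in> sphere 0 1" "\<And>z. z \<in> sphere 0 1 \<Longrightarrow> f x \<le> f z"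
    using continuous_attains_inf[of "sphere 0 1" f] by auto
  have "f x * (norm z)\<^sup>2 \<le> f z" for z
  proof (cases "z = 0")
    case True
    then show ?thesis using hom[of 0 0] by simp
  next
    case False
    then have "f x \<le> f (inverse (norm z) *\<^sub>R z)" by (intro x(2)) simp
    also have "\<dots> = f z / (norm z)\<^sup>2" by (simp add: hom power2_eq_square field_simps)
    finally show ?thesis using False by (simp add: field_simps)
  qed
  moreover have "x \<noteq> 0" using x(1) by auto
  ultimately show ?thesis using pos by blast
qed

section \<open>Representation of functionals in Hilbert space\<close>

text \<open>
  A minimising sequence of \<open>r x x - 2 f x\<close> is Cauchy in energy by the parallelogram identity, and
  since the first variation at almost minimal points is small, \<open>r (d n) x\<close> tends to \<open>f x\<close>. The
  conclusion speaks of the sequence, and not of a limit, because the energy space need not be complete: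
  in this form the lemma yields the representation theorem, orthogonal projections and the Friedrichs
  extension alike.
\<close>

lemma energy_minimising_sequence:
  fixes r :: "'d::real_vector \<Rightarrow> 'd \<Rightarrow> real" and f :: "'d \<Rightarrow> real"
  assumes D: "subspace D"
    and lin1: "\<And>x. linear (r x)" and lin2: "\<And>y. linear (\<lambda>x. r x y)"
    and sym: "\<And>x y. x \<in> D \<Longrightarrow> y \<in> D \<Longrightarrow> r x y = r y x"
    and f: "linear f" and "C > 0" and bound: "\<And>x. x \<in> D \<Longrightarrow> (f x)\<^sup>2 \<le> C * r x x"
  shows "\<exists>d. (\<forall>n::nat. d n \<in> D)
      \<and> (\<forall>e>0. \<exists>K. \<forall>m\<ge>K. \<forall>n\<ge>K. r (d m - d n) (d m - d n) < e)
      \<and> (\<forall>x\<in>D. (\<lambda>n. r (d n) x) \<longlonglongrightarrow> f x)"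
proof -
  interpret r1: linear "r x" for x by (rule lin1)
  interpret r2: linear "\<lambda>x. r x y" for y by (rule lin2)
  interpret f: linear f by (rule f)
  define \<Phi> where "\<Phi> x = r x x - 2 * f x" for x
  have pos: "0 \<le> r x x" if "x \<in> D" for x
  proof -
    have "0 \<le> C * r x x" using bound[OF that] zero_le_power2[of "f x"] by linarith
    with \<open>C > 0\<close> show ?thesis by (simp add: zero_le_mult_iff)
  qed
  have low: "- C \<le> \<Phi> x" if "x \<in> D" for x
  proof -
    have "0 \<le> (f x - C)\<^sup>2" by simp
    then have "2 * f x * C \<le> (f x)\<^sup>2 + C\<^sup>2" by (simp add: power2_diff algebra_simps)
    also have "\<dots> \<le> C * r x x + C\<^sup>2" using bound[OF that] by simp
    finally have "C * (2 * f x) \<le> C * (r x x + C)" by (simp add: power2_eq_square algebra_simps)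
    with \<open>C > 0\<close> have "2 * f x \<le> r x x + C" by simp
    then show ?thesis by (simp add: \<Phi>_def)
  qed
  define m where "m = Inf (\<Phi> ` D)"
  have bdd: "bdd_below (\<Phi> ` D)" using low by (meson bdd_belowI2)
  have m: "m \<le> \<Phi> x" if "x \<in> D" for x
    unfolding m_def by (rule cInf_lower[OF imageI[OF that] bdd])
  have ne: "\<Phi> ` D \<noteq> {}" using subspace_0[OF D] by auto
  have "\<exists>x\<in>D. \<Phi> x < m + inverse (Suc n)" for n
  proof -
    have "Inf (\<Phi> ` D) < m + inverse (Suc n)" by (simp add: m_def)
    then show ?thesis using cInf_less_iff[OF ne bdd] by auto
  qed
  then obtain d where d: "\<And>n. d n \<in> D" "\<And>n. \<Phi> (d n) < m + inverse (Suc n)" by metis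
  have near: "r (d i - d j) (d i - d j) \<le> 2 * inverse (Suc i) + 2 * inverse (Suc j)" for i j
  proof -
    have "r (d i - d j) (d i - d j) = r (d i) (d i) - r (d i) (d j) - (r (d j) (d i) - r (d j) (d j))"
      by (simp only: r1.diff r2.diff)
    moreover define h where "h = (1/2) *\<^sub>R (d i + d j)"
    have "r h h = (1/2) * ((1/2) * (r (d i) (d i) + r (d i) (d j) + (r (d j) (d i) + r (d j) (d j))))"
      by (simp only: h_def r1.add r2.add r1.scaleR r2.scaleR real_scaleR_def distrib_left add_ac)
    moreover have "f h = (1/2) * (f (d i) + f (d j))"
      by (simp only: h_def f.add f.scaleR real_scaleR_def)
    moreover have "m \<le> \<Phi> h"
      unfolding h_def using d(1) D by (intro m) (simp add: subspace_add subspace_scale)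
    ultimately have "r (d i - d j) (d i - d j) = 2 * \<Phi> (d i) + 2 * \<Phi> (d j) - 4 * \<Phi> h" "m \<le> \<Phi> h"
      using sym[OF d(1) d(1), of i j] unfolding \<Phi>_def by simp_all
    then show ?thesis using d(2)[of i] d(2)[of j] by linarith
  qed
  have cauchy: "\<exists>K. \<forall>m\<ge>K. \<forall>n\<ge>K. r (d m - d n) (d m - d n) < e" if "e > 0" for e
  proof -
    obtain K where K: "inverse (real (Suc K)) < e / 4" using reals_Archimedean[of "e/4"] \<open>e > 0\<close> by auto
    have small: "inverse (real (Suc i)) < e / 4" if "i \<ge> K" for i
    proof -
      have "inverse (real (Suc i)) \<le> inverse (real (Suc K))" using that by (simp add: field_simps)
      with K show ?thesis by linarith
    qed
    have "r (d m - d n) (d m - d n) < e" if "m \<ge> K" "n \<ge> K" for m n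
      using near[of m n] small[OF that(1)] small[OF that(2)] by linarith
    then show ?thesis by blast
  qed
  have lim: "(\<lambda>n. r (d n) x) \<longlonglongrightarrow> f x" if x: "x \<in> D" for x
  proof -
    define R where "R = r x x + 1"
    have R: "R > 0" "r x x \<le> R" using pos[OF x] by (auto simp: R_def)
    have sq: "(r (d n) x - f x)\<^sup>2 \<le> R * inverse (Suc n)" for n
    proof -
      define a where "a = r (d n) x - f x"
      \<comment> \<open>the step that minimises \<open>2 t a + t\<^sup>2 R\<close>\<close>
      define t where "t = - a / R"
      have "m \<le> \<Phi> (d n + t *\<^sub>R x)" using d(1) D x by (intro m) (simp add: subspace_add subspace_scale)
      also have "\<Phi> (d n + t *\<^sub>R x) = r (d n) (d n) + t * r x (d n) + t * (r (d n) x + t * r x x) - 2 * (f (d n) + t * f x)"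
        by (simp only: \<Phi>_def r1.add r2.add r1.scaleR r2.scaleR f.add f.scaleR real_scaleR_def)
      also have "\<dots> = \<Phi> (d n) + 2 * t * a + t\<^sup>2 * r x x"
        unfolding \<Phi>_def a_def sym[OF x d(1)] by (simp add: algebra_simps power2_eq_square)
      also have "\<dots> \<le> \<Phi> (d n) + 2 * t * a + t\<^sup>2 * R" using R by (simp add: mult_left_mono)
      also have "\<dots> = \<Phi> (d n) - a\<^sup>2 / R"
        using R(1) by (simp add: t_def field_simps power2_eq_square)
      finally have "a\<^sup>2 / R \<le> inverse (Suc n)" using d(2)[of n] by linarith
      then show ?thesis using R(1) by (simp add: a_def field_simps)
    qed
    have "(\<lambda>n. R * inverse (real (Suc n))) \<longlonglongrightarrow> R * 0"
      by (intro tendsto_mult tendsto_const LIMSEQ_inverse_real_of_nat)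
    then have "(\<lambda>n. R * inverse (real (Suc n))) \<longlonglongrightarrow> 0" by simp
    then have "(\<lambda>n. (r (d n) x - f x)\<^sup>2) \<longlonglongrightarrow> 0"
      by (rule real_tendsto_sandwich[OF always_eventually always_eventually tendsto_const, rotated 2]) (use sq in simp_all)
    then have "(\<lambda>n. sqrt ((r (d n) x - f x)\<^sup>2)) \<longlonglongrightarrow> sqrt 0" by (rule tendsto_real_sqrt)
    then have "(\<lambda>n. r (d n) x - f x) \<longlonglongrightarrow> 0" by (simp add: tendsto_rabs_zero_cancel)
    then show ?thesis by (rule LIM_zero_cancel)
  qed
  show ?thesis using d(1) cauchy lim by blast
qed

text \<open>
  The symmetric case of the Lax--Milgram theorem.
\<close>

lemma coercive_form_represents:
  fixes r :: "'a::{real_inner,complete_space} \<Rightarrow> 'a \<Rightarrow> real"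
  assumes r: "bounded_bilinear r" and sym: "\<And>x y. r x y = r y x"
    and "c > 0" and coer: "\<And>x. c * (norm x)\<^sup>2 \<le> r x x" and f: "bounded_linear f"
  obtains x where "\<And>y. r x y = f y"
proof -
  interpret r: bounded_bilinear r by (rule r)
  interpret f: bounded_linear f by (rule f)
  obtain M where M: "M > 0" "\<And>x. norm (f x) \<le> norm x * M" using f.pos_bounded by blast
  have bound: "(f x)\<^sup>2 \<le> (M\<^sup>2 / c) * r x x" for x
  proof -
    have "(f x)\<^sup>2 \<le> (norm x * M)\<^sup>2" using M(2)[of x] by (simp add: abs_le_square_iff[symmetric] M(1) less_imp_le)
    also have "\<dots> = (M\<^sup>2 / c) * (c * (norm x)\<^sup>2)" using \<open>c > 0\<close> by (simp add: power_mult_distrib)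
    also have "\<dots> \<le> (M\<^sup>2 / c) * r x x" using \<open>c > 0\<close> by (intro mult_left_mono coer) simp
    finally show ?thesis .
  qed
  have pos: "M\<^sup>2 / c > 0" using M(1) \<open>c > 0\<close> by simp
  obtain d where d: "\<forall>e>0. \<exists>K. \<forall>m\<ge>K. \<forall>n\<ge>(K::nat). r (d m - d n) (d m - d n) < e"
      "\<forall>x\<in>UNIV. (\<lambda>n. r (d n) x) \<longlonglongrightarrow> f x"
    using energy_minimising_sequence[OF subspace_UNIV
      bounded_linear.linear[OF r.bounded_linear_right] bounded_linear.linear[OF r.bounded_linear_left]
      sym f.linear pos bound] by blast
  have "Cauchy d" by (rule energy_Cauchy_imp_Cauchy[OF \<open>c > 0\<close> coer d(1)])
  then obtain x where x: "d \<longlonglongrightarrow> x" by (auto simp: Cauchy_convergent_iff convergent_def)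
  have "r x y = f y" for y
    using LIMSEQ_unique[OF r.tendsto[OF x tendsto_const] d(2)[rule_format, OF UNIV_I]] .
  then show ?thesis by (rule that)
qed

lemma riesz_representation:
  fixes f :: "'a::{real_inner,complete_space} \<Rightarrow> real"
  assumes "bounded_linear f"
  obtains x where "\<And>y. f y = x \<bullet> y"
proof -
  obtain x where "\<And>y. x \<bullet> y = f y"
    using coercive_form_represents[OF bounded_bilinear_inner inner_commute, of 1 f] assms
    by (auto simp: power2_norm_eq_inner)
  then show ?thesis using that by metis
qed

lemma orthogonal_projection_exists:
  fixes S :: "'a::{real_inner,complete_space} set"
  assumes "subspace S" "closed S"
  shows "\<exists>p\<in>S. \<forall>q\<in>S. (x - p) \<bullet> q = 0"
proof -
  have bound: "(x \<bullet> y)\<^sup>2 \<le> ((norm x)\<^sup>2 + 1) * (y \<bullet> y)" for y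
  proof -
    have "(x \<bullet> y)\<^sup>2 \<le> (norm x)\<^sup>2 * (y \<bullet> y)"
      using Cauchy_Schwarz_ineq[of x y] by (simp add: dot_square_norm)
    also have "\<dots> \<le> ((norm x)\<^sup>2 + 1) * (y \<bullet> y)" by (intro mult_right_mono) auto
    finally show ?thesis .
  qed
  have pos: "(norm x)\<^sup>2 + 1 > 0" by (simp add: add_nonneg_pos)
  obtain d where d: "\<forall>n. d n \<in> S" "\<forall>e>0. \<exists>K. \<forall>m\<ge>K. \<forall>n\<ge>(K::nat). (d m - d n) \<bullet> (d m - d n) < e"
      "\<forall>y\<in>S. (\<lambda>n. d n \<bullet> y) \<longlonglongrightarrow> x \<bullet> y"
    using energy_minimising_sequence[OF assms(1)
      bounded_linear.linear[OF bounded_linear_inner_right] bounded_linear.linear[OF bounded_linear_inner_left]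
      inner_commute bounded_linear.linear[OF bounded_linear_inner_right] pos bound] by blast
  have "Cauchy d" by (rule energy_Cauchy_imp_Cauchy[OF zero_less_one _ d(2)]) (simp add: power2_norm_eq_inner)
  then obtain p where p: "d \<longlonglongrightarrow> p" by (auto simp: Cauchy_convergent_iff convergent_def)
  have "p \<in> S" using assms(2) d(1) p closed_sequentially by blast
  moreover have "p \<bullet> y = x \<bullet> y" if "y \<in> S" for y
    using LIMSEQ_unique[OF tendsto_inner[OF p tendsto_const] d(3)[rule_format, OF that]] .
  ultimately show ?thesis by (intro bexI[of _ p]) (auto simp: inner_diff_left)
qed

section \<open>Invariant nonpositive subspaces of dissipative operators\<close>

text \<open>
  The vectors fixed by \<open>coord_proj I\<close> are the model of a complex vector space of dimension \<open>card I\<close>.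
  In this way the dimension of the negative subspace is a number, and not part of a type.
\<close>

definition coord_proj :: "'n set \<Rightarrow> complex^'n \<Rightarrow> complex^'n" where
  "coord_proj I z = (\<chi> j. if j \<in> I then z $ j else 0)"

lemma linear_coord_proj: "linear (coord_proj I)"
  by (rule linearI) (auto simp: coord_proj_def vec_eq_iff)

lemma coord_proj_idem [simp]: "coord_proj I (coord_proj I z) = coord_proj I z"
  by (auto simp: coord_proj_def vec_eq_iff)

lemma coord_proj_scale: "coord_proj I (l *s z) = l *s coord_proj I z"
  by (auto simp: coord_proj_def vec_eq_iff)

lemma norm_coord_proj_le: "norm (coord_proj I z) \<le> norm z"
  unfolding norm_vec_def by (rule L2_set_mono) (auto simp: coord_proj_def)

lemma bounded_linear_vector_scale: "bounded_linear (\<lambda>z::complex^'n. l *s z)"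
  unfolding linear_conv_bounded_linear[symmetric] by (rule linearI) (simp_all add: vec_eq_iff algebra_simps)

lemma linear_funpow:
  fixes f :: "'a::real_vector \<Rightarrow> 'a"
  shows "linear f \<Longrightarrow> linear (f ^^ n)"
proof (induction n)
  case 0 show ?case by (simp add: linear_iff)
next
  case (Suc n) then show ?case using linear_compose[of "f ^^ n" f] by (simp add: comp_def)
qed

text \<open>
  A Pontryagin space, seen as a real Hilbert space with the isometry \<open>J\<close> as multiplication by \<open>\<i>\<close>.
  The indefinite form \<open>V\<close> is the real part of a Hermitian form. The map \<open>\<iota>\<close> parametrises a maximal
  negative subspace, \<open>\<pi>\<close> is the coordinate of the \<open>V\<close>-orthogonal projection onto it, and \<open>c\<close> measures
  how definite \<open>V\<close> is on this subspace and on its orthogonal complement.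
\<close>

locale pontryagin_space =
  fixes V :: "'h::{real_inner,complete_space} \<Rightarrow> 'h \<Rightarrow> real"
    and J :: "'h \<Rightarrow> 'h"
    and \<pi> :: "'h \<Rightarrow> complex^'n" and \<iota> :: "complex^'n \<Rightarrow> 'h"
    and I :: "'n set" and c :: real
  assumes bilinear_V: "bounded_bilinear V" and V_sym: "V x y = V y x"
    and linear_J: "bounded_linear J" and J_J: "J (J x) = - x"
    and V_J: "V (J x) (J y) = V x y" and inner_J: "J x \<bullet> J y = x \<bullet> y"
    and linear_\<pi>: "bounded_linear \<pi>" and linear_\<iota>: "bounded_linear \<iota>"
    and \<pi>_J: "\<pi> (J x) = \<i> *s \<pi> x" and \<iota>_J: "\<iota> (\<i> *s z) = J (\<iota> z)"
    and \<pi>_\<iota>: "\<pi> (\<iota> z) = coord_proj I z"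
    and proj_\<pi>: "coord_proj I (\<pi> x) = \<pi> x" and \<iota>_proj: "\<iota> (coord_proj I z) = \<iota> z"
    and c_pos: "c > 0"
    and V_pos: "\<pi> x = 0 \<Longrightarrow> c * (norm x)\<^sup>2 \<le> V x x"
    and V_neg: "V (\<iota> z) (\<iota> z) \<le> - c * (norm (coord_proj I z))\<^sup>2"
    and V_orth: "\<pi> x = 0 \<Longrightarrow> V (\<iota> z) x = 0"
begin

sublocale V: bounded_bilinear V by (rule bilinear_V)
sublocale J: bounded_linear J by (rule linear_J)
sublocale \<pi>: bounded_linear \<pi> by (rule linear_\<pi>)
sublocale \<iota>: bounded_linear \<iota> by (rule linear_\<iota>)

abbreviation "p \<equiv> coord_proj I"

lemma p_diff: "p (x - y) = p x - p y" and p_add: "p (x + y) = p x + p y" and p_0: "p 0 = 0"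
  by (rule linear_diff[OF linear_coord_proj] linear_add[OF linear_coord_proj] linear_0[OF linear_coord_proj])+

lemma V_split: "V x x = V (x - \<iota> (\<pi> x)) (x - \<iota> (\<pi> x)) + V (\<iota> (\<pi> x)) (\<iota> (\<pi> x))"
proof -
  have "\<pi> (x - \<iota> (\<pi> x)) = 0" by (simp add: \<pi>.diff \<pi>_\<iota> proj_\<pi>)
  from V_orth[OF this] have "V (\<iota> (\<pi> x)) (x - \<iota> (\<pi> x)) = 0" .
  then show ?thesis using V_sym[of "\<iota> (\<pi> x)" x] by (simp add: V.diff_left V.diff_right)
qed

lemma nonpositive_eq_0: "V x x \<le> 0 \<Longrightarrow> \<pi> x = 0 \<Longrightarrow> x = 0"
proof -
  assume "V x x \<le> 0" "\<pi> x = 0"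
  with V_pos[of x] have "c * (norm x)\<^sup>2 \<le> 0" by linarith
  with c_pos show "x = 0" by (simp add: mult_le_0_iff)
qed

text \<open>
  On a nonpositive vector the positive part of \<open>V\<close> is dominated by the negative part, which depends only
  on \<open>\<pi> x\<close>. Hence a nonpositive subspace is the graph of a bounded map over the negative coordinates.
\<close>

lemma nonpositive_norm_bound:
  obtains B where "B > 0" "\<And>x. V x x \<le> 0 \<Longrightarrow> norm x \<le> B * norm (\<pi> x)"
proof -
  obtain M where M: "M > 0" "\<And>x y. norm (V x y) \<le> norm x * norm y * M" using V.pos_bounded by blast
  obtain L where L: "L > 0" "\<And>x. norm (\<iota> x) \<le> norm x * L" using \<iota>.pos_bounded by blast
  define A where "A = sqrt (M * L\<^sup>2 / c)"
  have A: "A > 0" using M(1) L(1) c_pos by (simp add: A_def)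
  have "norm x \<le> (A + L) * norm (\<pi> x)" if "V x x \<le> 0" for x
  proof -
    define q where "q = x - \<iota> (\<pi> x)"
    have "\<pi> q = 0" by (simp add: q_def \<pi>.diff \<pi>_\<iota> proj_\<pi>)
    then have "c * (norm q)\<^sup>2 \<le> V q q" by (rule V_pos)
    also have "\<dots> \<le> - V (\<iota> (\<pi> x)) (\<iota> (\<pi> x))" using that V_split[of x] by (simp add: q_def)
    also have "\<dots> \<le> norm (\<iota> (\<pi> x)) * norm (\<iota> (\<pi> x)) * M" using M(2)[of "\<iota> (\<pi> x)" "\<iota> (\<pi> x)"] by (simp add: abs_le_iff)
    also have "\<dots> \<le> (norm (\<pi> x) * L) * (norm (\<pi> x) * L) * M"
      using L M(1) by (intro mult_mono) auto
    finally have "(norm q)\<^sup>2 \<le> (M * L\<^sup>2 / c) * (norm (\<pi> x))\<^sup>2"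
      using c_pos by (simp add: field_simps power2_eq_square)
    also have "M * L\<^sup>2 / c = A\<^sup>2" using M(1) L(1) c_pos by (simp add: A_def)
    finally have "(norm q)\<^sup>2 \<le> (A * norm (\<pi> x))\<^sup>2" by (simp add: power_mult_distrib)
    then have "norm q \<le> A * norm (\<pi> x)" by (rule power2_le_imp_le) (use A in simp)
    moreover have "norm x \<le> norm q + norm (\<iota> (\<pi> x))"
      using norm_triangle_ineq[of q "\<iota> (\<pi> x)"] by (simp add: q_def)
    ultimately show ?thesis using L(2)[of "\<pi> x"] by (simp add: algebra_simps)
  qed
  with A L(1) show ?thesis by (intro that[of "A + L"]) auto
qed

text \<open>
  The images \<open>(C ^^ n) (\<iota> z)\<close> of the negative subspace are again nonpositive, so they are graphs \<open>K n\<close>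
  over the same coordinates. On nonpositive vectors \<open>C\<close> is expanding: \<open>V\<close> is multiplied by at least some
  \<open>q > 1\<close> in each step, while \<open>- V\<close> is bounded by the square of the norm. For \<open>m, m' > n\<close> the vectors
  \<open>K m z\<close> and \<open>K m' z\<close> thus are images under \<open>C ^^ Suc n\<close> of vectors of order \<open>q\<close> to the power
  \<open>- n / 2\<close>. Their difference has no negative coordinate, so \<open>V\<close> bounds its norm from above,
  and \<open>V\<close> has decreased on the way from the preimages. Therefore the graphs converge geometrically, and
  the limit is mapped into itself by \<open>C\<close>.
\<close>

lemma contraction_invariant_graph:
  assumes C: "bounded_linear C" and "\<delta> > 0"
    and strict: "\<And>x. V (C x) (C x) \<le> V x x - \<delta> * (norm x)\<^sup>2"
  shows "\<exists>K. linear K \<and> (\<forall>z. K (p z) = K z) \<and> (\<forall>z. \<pi> (K z) = p z) \<and> (\<forall>z. V (K z) (K z) \<le> 0)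
           \<and> (\<forall>z. C (K z) = K (\<pi> (C (K z))))
           \<and> ((\<forall>x. C (J x) = J (C x)) \<longrightarrow> (\<forall>z. K (\<i> *s z) = J (K z)))"
proof -
  interpret C: bounded_linear C by (rule C)
  obtain M where M: "M > 0" "\<And>x y. norm (V x y) \<le> norm x * norm y * M" using V.pos_bounded by blast
  obtain B where B: "B > 0" "\<And>x. V x x \<le> 0 \<Longrightarrow> norm x \<le> B * norm (\<pi> x)"
    using nonpositive_norm_bound by blast
  have VM: "\<bar>V x x\<bar> \<le> M * (norm x)\<^sup>2" for x using M(2)[of x x] by (simp add: power2_eq_square mult_ac)
  define q where "q = 1 + \<delta> / M"
  have q: "q > 1" using \<open>\<delta> > 0\<close> M(1) by (simp add: q_def)
  have linCn: "linear (C ^^ n)" for n by (rule linear_funpow[OF C.linear])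
  have mono: "V ((C ^^ n) x) ((C ^^ n) x) \<le> V x x" for n x
  proof (induction n)
    case (Suc n)
    have "V ((C ^^ Suc n) x) ((C ^^ Suc n) x) \<le> V ((C ^^ n) x) ((C ^^ n) x)"
      using strict[of "(C ^^ n) x"] \<open>\<delta> > 0\<close> by (simp add: order_trans[OF strict])
    with Suc show ?case by linarith
  qed simp
  have step: "V (C x) (C x) \<le> q * V x x" for x
  proof -
    have "- V x x \<le> M * (norm x)\<^sup>2" using VM[of x] by linarith
    then have "(\<delta> / M) * (- V x x) \<le> (\<delta> / M) * (M * (norm x)\<^sup>2)"
      using \<open>\<delta> > 0\<close> M(1) by (intro mult_left_mono) auto
    then have "(\<delta> / M) * (- V x x) \<le> \<delta> * (norm x)\<^sup>2" using M(1) by simp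
    then show ?thesis using strict[of x] by (simp add: q_def algebra_simps)
  qed
  have growth: "V ((C ^^ n) x) ((C ^^ n) x) \<le> q ^ n * V x x" for n x
  proof (induction n)
    case (Suc n)
    have "V ((C ^^ Suc n) x) ((C ^^ Suc n) x) \<le> q * V ((C ^^ n) x) ((C ^^ n) x)"
      using step by simp
    also have "\<dots> \<le> q * (q ^ n * V x x)" using Suc q by (intro mult_left_mono) auto
    finally show ?case by (simp add: mult.assoc)
  qed simp
  have backward: "\<delta> * q ^ n * (norm x)\<^sup>2 \<le> M * (norm ((C ^^ Suc n) x))\<^sup>2" if "V x x \<le> 0" for n x
  proof -
    have "V ((C ^^ Suc n) x) ((C ^^ Suc n) x) \<le> q ^ n * V (C x) (C x)"
      using growth[of n "C x"] by (simp add: funpow_swap1)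
    also have "\<dots> \<le> q ^ n * (- \<delta> * (norm x)\<^sup>2)"
      using q strict[of x] that by (intro mult_left_mono) auto
    finally show ?thesis using VM[of "(C ^^ Suc n) x"] by (simp add: mult_ac)
  qed
  define F where "F n z = (C ^^ n) (\<iota> z)" for n z
  have linF: "linear (F n)" for n
    using linear_compose[OF \<iota>.linear linCn[of n]] by (simp add: F_def[abs_def] comp_def)
  have F_neg: "V (F n z) (F n z) \<le> - c * (norm (p z))\<^sup>2" for n z
    unfolding F_def using mono[of n "\<iota> z"] V_neg[of z] by linarith
  have F_nonpos: "V (F n z) (F n z) \<le> 0" for n z
    using F_neg[of n z] c_pos by (smt (verit) mult_minus_left mult_nonneg_nonneg zero_le_power2)
  have F_inj: "p z = 0" if "\<pi> (F n z) = 0" for n z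
  proof -
    have "F n z = 0" using nonpositive_eq_0[OF F_nonpos that] .
    with F_neg[of n z] have "c * (norm (p z))\<^sup>2 \<le> 0" by (simp add: V.zero_left)
    with c_pos show ?thesis by (simp add: mult_le_0_iff)
  qed
  \<comment> \<open>\<open>\<pi> \<circ> F n\<close> is only injective on the range of \<open>p\<close>; the summand \<open>z - p z\<close> makes it invertible on the whole space\<close>
  define H where "H n z = \<pi> (F n z) + (z - p z)" for n z
  have linH: "linear (H n)" for n
    unfolding H_def[abs_def]
    by (intro linear_compose_add linear_compose_sub linear_coord_proj linear_ident
          linear_compose[OF linF[of n] \<pi>.linear, unfolded comp_def])
  have "inj (H n)" for n
  proof (rule linear_injective_0[OF linH, THEN iffD2], intro allI impI)
    fix z assume H0: "H n z = 0"
    have "p (H n z) = \<pi> (F n z)" by (simp add: H_def p_add p_diff proj_\<pi>)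
    then have "\<pi> (F n z) = 0" using H0 by (simp add: p_0)
    then show "z = 0" using F_inj[of n z] H0 by (simp add: H_def)
  qed
  then have "\<exists>N. linear N \<and> (\<forall>z. H n (N z) = z)" for n
    using linear_injective_isomorphism[OF linH[of n]] by blast
  then obtain N where N: "\<And>n. linear (N n)" "\<And>n z. H n (N n z) = z" by metis
  define K where "K n z = F n (N n (p z))" for n z
  have linK: "linear (K n)" for n
    unfolding K_def[abs_def]
    using linear_compose[OF linear_compose[OF linear_coord_proj N(1)[of n]] linF[of n]] by (simp add: comp_def)
  have K_nonpos: "V (K n z) (K n z) \<le> 0" for n z unfolding K_def by (rule F_nonpos)
  have \<pi>K: "\<pi> (K n z) = p z" for n z
  proof -
    have "p (H n (N n (p z))) = \<pi> (K n z)" by (simp add: H_def K_def p_add p_diff proj_\<pi>)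
    then show ?thesis by (simp add: N(2))
  qed
  have K_unique: "F n y = K n z" if "\<pi> (F n y) = p z" for n y z
  proof -
    have "F n y - K n z = F n (y - N n (p z))" using linF[of n] by (simp add: K_def linear_diff)
    then have "V (F n y - K n z) (F n y - K n z) \<le> 0" using F_nonpos by metis
    moreover have "\<pi> (F n y - K n z) = 0" by (simp add: \<pi>.diff \<pi>K that)
    ultimately show ?thesis using nonpositive_eq_0 by fastforce
  qed
  have K_bound: "norm (K n z) \<le> B * norm z" for n z
  proof -
    have "norm (K n z) \<le> B * norm (p z)" using B(2)[OF K_nonpos[of n z]] by (simp add: \<pi>K)
    also have "\<dots> \<le> B * norm z" using B(1) by (intro mult_left_mono norm_coord_proj_le) auto
    finally show ?thesis .
  qed
  have preimage: "\<exists>y. K m z = (C ^^ Suc n) y \<and> V y y \<le> 0 \<and> \<delta> * q ^ n * (norm y)\<^sup>2 \<le> M * (B * norm z)\<^sup>2"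
    if "m \<ge> Suc n" for m n z
  proof -
    define y where "y = F (m - Suc n) (N m (p z))"
    have eq: "K m z = (C ^^ Suc n) y"
      using that by (metis K_def F_def y_def add_diff_inverse_nat comp_apply funpow_add not_less)
    have "M * (norm (K m z))\<^sup>2 \<le> M * (B * norm z)\<^sup>2"
      using M(1) K_bound[of m z] by (intro mult_left_mono power_mono) auto
    then show ?thesis using backward[of y n] F_nonpos[of "m - Suc n"] eq by (intro exI[of _ y]) (simp add: y_def)
  qed
  have close: "c * \<delta> * q ^ n * (norm (K m z - K m' z))\<^sup>2 \<le> 4 * M\<^sup>2 * (B * norm z)\<^sup>2"
    if m: "m \<ge> Suc n" and m': "m' \<ge> Suc n" for m m' n z
  proof -
    obtain y where y: "K m z = (C ^^ Suc n) y" "\<delta> * q ^ n * (norm y)\<^sup>2 \<le> M * (B * norm z)\<^sup>2"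
      using preimage[OF m] by blast
    obtain y' where y': "K m' z = (C ^^ Suc n) y'" "\<delta> * q ^ n * (norm y')\<^sup>2 \<le> M * (B * norm z)\<^sup>2"
      using preimage[OF m'] by blast
    have eq: "K m z - K m' z = (C ^^ Suc n) (y - y')" using linear_diff[OF linCn[of "Suc n"]] y(1) y'(1) by metis
    have "\<pi> (K m z - K m' z) = 0" by (simp add: \<pi>.diff \<pi>K)
    then have "c * (norm (K m z - K m' z))\<^sup>2 \<le> V (K m z - K m' z) (K m z - K m' z)" by (rule V_pos)
    also have "\<dots> \<le> V (y - y') (y - y')" unfolding eq by (rule mono)
    also have "\<dots> \<le> M * (norm (y - y'))\<^sup>2" using VM[of "y - y'"] by linarith
    also have "\<dots> \<le> M * (2 * (norm y)\<^sup>2 + 2 * (norm y')\<^sup>2)"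
    proof (intro mult_left_mono)
      have "(norm (y - y'))\<^sup>2 \<le> (norm y + norm y')\<^sup>2" by (intro power_mono norm_triangle_ineq4) auto
      also have "\<dots> \<le> 2 * (norm y)\<^sup>2 + 2 * (norm y')\<^sup>2"
        using sum_squares_bound[of "norm y" "norm y'"] by (simp add: power2_sum)
      finally show "(norm (y - y'))\<^sup>2 \<le> 2 * (norm y)\<^sup>2 + 2 * (norm y')\<^sup>2" .
    qed (use M(1) in simp)
    finally have *: "c * (norm (K m z - K m' z))\<^sup>2 \<le> M * (2 * (norm y)\<^sup>2 + 2 * (norm y')\<^sup>2)" .
    have "c * \<delta> * q ^ n * (norm (K m z - K m' z))\<^sup>2 = (\<delta> * q ^ n) * (c * (norm (K m z - K m' z))\<^sup>2)" by simp
    also have "\<dots> \<le> (\<delta> * q ^ n) * (M * (2 * (norm y)\<^sup>2 + 2 * (norm y')\<^sup>2))"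
      using \<open>\<delta> > 0\<close> q * by (intro mult_left_mono) auto
    also have "\<dots> = 2 * M * (\<delta> * q ^ n * (norm y)\<^sup>2) + 2 * M * (\<delta> * q ^ n * (norm y')\<^sup>2)" by (simp add: algebra_simps)
    also have "\<dots> \<le> 2 * M * (M * (B * norm z)\<^sup>2) + 2 * M * (M * (B * norm z)\<^sup>2)"
      using M(1) y(2) y'(2) by (intro add_mono mult_left_mono) auto
    also have "\<dots> = 4 * M\<^sup>2 * (B * norm z)\<^sup>2" by (simp add: power2_eq_square)
    finally show ?thesis .
  qed
  have "Cauchy (\<lambda>n. K n z)" for z
  proof (rule metric_CauchyI)
    fix e :: real assume "e > 0"
    define A where "A = 4 * M\<^sup>2 * (B * norm z)\<^sup>2"
    have ce: "c * \<delta> * e\<^sup>2 > 0" using c_pos \<open>\<delta> > 0\<close> \<open>e > 0\<close> by simp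
    obtain n where n: "A / (c * \<delta> * e\<^sup>2) < q ^ n" using real_arch_pow[OF q] by blast
    have "dist (K m z) (K m' z) < e" if "m \<ge> Suc n" "m' \<ge> Suc n" for m m'
    proof -
      define d where "d = norm (K m z - K m' z)"
      have cq: "c * \<delta> * q ^ n > 0" using c_pos \<open>\<delta> > 0\<close> q by simp
      have "c * \<delta> * q ^ n * d\<^sup>2 \<le> A" using close[OF that] by (simp add: A_def d_def)
      also have "A < c * \<delta> * q ^ n * e\<^sup>2" using n ce by (simp add: field_simps)
      finally have "d\<^sup>2 < e\<^sup>2" by (simp only: mult_less_cancel_left_pos[OF cq])
      then show ?thesis using \<open>e > 0\<close> by (simp add: d_def dist_norm power_less_imp_less_base)
    qed
    then show "\<exists>n. \<forall>m\<ge>n. \<forall>m'\<ge>n. dist (K m z) (K m' z) < e" by blast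
  qed
  then have "\<forall>z. \<exists>l. (\<lambda>n. K n z) \<longlonglongrightarrow> l" by (auto simp: Cauchy_convergent_iff convergent_def)
  then obtain L where L: "\<And>z. (\<lambda>n. K n z) \<longlonglongrightarrow> L z" by metis
  have "linear L"
  proof (rule linearI)
    fix x y and r :: real
    show "L (x + y) = L x + L y"
      using LIMSEQ_unique[OF L[of "x + y"]] tendsto_add[OF L[of x] L[of y]] by (simp add: linear_add[OF linK])
    show "L (r *\<^sub>R x) = r *\<^sub>R L x"
      using LIMSEQ_unique[OF L[of "r *\<^sub>R x"]] tendsto_scaleR[OF tendsto_const L[of x], of r] by (simp add: linear_scale[OF linK])
  qed
  moreover have "L (p z) = L z" for z
    using LIMSEQ_unique[OF L[of "p z"]] L[of z] by (simp add: K_def)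
  moreover have "\<pi> (L z) = p z" for z
    using LIMSEQ_unique[OF \<pi>.tendsto[OF L[of z]]] by (simp add: \<pi>K)
  moreover have "V (L z) (L z) \<le> 0" for z
    using LIMSEQ_le_const2[OF V.tendsto[OF L[of z] L[of z]], of 0] K_nonpos by blast
  moreover have "C (L z) = L (\<pi> (C (L z)))" for z
  proof -
    define a where "a = \<pi> (C (L z))"
    define b where "b n = \<pi> (C (K n z))" for n
    have b: "b \<longlonglongrightarrow> a" unfolding b_def[abs_def] a_def by (intro \<pi>.tendsto C.tendsto L)
    have "C (K n z) = K (Suc n) (b n)" for n
    proof -
      have "C (K n z) = F (Suc n) (N n (p z))" by (simp add: K_def F_def)
      moreover have "\<pi> (F (Suc n) (N n (p z))) = p (b n)" using calculation by (simp add: b_def proj_\<pi>)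
      ultimately show ?thesis using K_unique by metis
    qed
    then have 1: "C (K n z) = K (Suc n) (b n - a) + K (Suc n) a" for n
      by (simp add: linear_diff[OF linK])
    have "(\<lambda>n. K (Suc n) (b n - a)) \<longlonglongrightarrow> 0"
    proof (rule Lim_null_comparison)
      show "\<forall>\<^sub>F n in sequentially. norm (K (Suc n) (b n - a)) \<le> B * norm (b n - a)" using K_bound by simp
      show "(\<lambda>n. B * norm (b n - a)) \<longlonglongrightarrow> 0"
        using tendsto_mult_right_zero[OF tendsto_norm_zero[OF LIM_zero[OF b]]] by blast
    qed
    from tendsto_add[OF this LIMSEQ_Suc[OF L[of a]]] have "(\<lambda>n. C (K n z)) \<longlonglongrightarrow> L a" by (simp add: 1)
    with C.tendsto[OF L[of z]] show ?thesis using LIMSEQ_unique a_def by blast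
  qed
  moreover have "L (\<i> *s z) = J (L z)" if CJ: "\<forall>x. C (J x) = J (C x)" for z
  proof -
    have CnJ: "(C ^^ n) (J x) = J ((C ^^ n) x)" for n x by (induction n) (simp_all add: CJ)
    have "J (K n z) = K n (\<i> *s z)" for n
    proof -
      have "J (K n z) = F n (\<i> *s N n (p z))" by (simp add: K_def F_def CnJ \<iota>_J)
      moreover have "\<pi> (J (K n z)) = p (\<i> *s z)" by (simp add: \<pi>_J \<pi>K coord_proj_scale)
      ultimately show ?thesis using K_unique by metis
    qed
    with J.tendsto[OF L[of z]] L[of "\<i> *s z"] show ?thesis by (simp add: LIMSEQ_unique)
  qed
  ultimately show ?thesis by blast
qed

text \<open>
  For small \<open>h\<close> the map \<open>1 + h T\<close> decreases \<open>V\<close> strictly, since the first order gain of the dissipation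
  beats the second order term. A subspace that is invariant under \<open>1 + h T\<close> is invariant under \<open>T\<close>.
\<close>

lemma dissipative_invariant_graph:
  assumes T: "bounded_linear T" and "\<epsilon> > 0" and strict: "\<And>x. V (T x) x \<le> - \<epsilon> * (norm x)\<^sup>2"
  shows "\<exists>K. linear K \<and> (\<forall>z. K (p z) = K z) \<and> (\<forall>z. \<pi> (K z) = p z) \<and> (\<forall>z. V (K z) (K z) \<le> 0)
           \<and> (\<forall>z. T (K z) = K (\<pi> (T (K z))))
           \<and> ((\<forall>x. T (J x) = J (T x)) \<longrightarrow> (\<forall>z. K (\<i> *s z) = J (K z)))"
proof -
  interpret T: bounded_linear T by (rule T)
  obtain M where M: "M > 0" "\<And>x y. norm (V x y) \<le> norm x * norm y * M" using V.pos_bounded by blast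
  obtain B where B: "B > 0" "\<And>x. norm (T x) \<le> norm x * B" using T.pos_bounded by blast
  \<comment> \<open>then \<open>h\<^sup>2 V (T x) (T x)\<close> is at most half of the first order gain \<open>2 h \<epsilon> |x|\<^sup>2\<close>\<close>
  define h where "h = \<epsilon> / (M * B\<^sup>2)"
  have h: "h > 0" using \<open>\<epsilon> > 0\<close> M(1) B(1) by (simp add: h_def)
  define C where "C x = x + h *\<^sub>R T x" for x
  have C: "bounded_linear C" unfolding C_def[abs_def]
    by (intro bounded_linear_add bounded_linear_ident bounded_linear_scaleR_right T
          bounded_linear_compose[OF bounded_linear_scaleR_right T])
  have "V (C x) (C x) \<le> V x x - (h * \<epsilon>) * (norm x)\<^sup>2" for x
  proof -
    have "V (T x) (T x) \<le> norm (T x) * norm (T x) * M" using M(2)[of "T x" "T x"] by simp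
    also have "\<dots> \<le> (norm x * B) * (norm x * B) * M" using B M(1) by (intro mult_mono) auto
    finally have "h\<^sup>2 * V (T x) (T x) \<le> h\<^sup>2 * ((norm x * B) * (norm x * B) * M)" by (intro mult_left_mono) auto
    also have "\<dots> = h * \<epsilon> * (norm x)\<^sup>2" using M(1) B(1) by (simp add: h_def field_simps power2_eq_square)
    finally have 1: "h\<^sup>2 * V (T x) (T x) \<le> h * \<epsilon> * (norm x)\<^sup>2" .
    have 2: "h * V (T x) x \<le> h * (- \<epsilon> * (norm x)\<^sup>2)" using h strict by (intro mult_left_mono) auto
    have "V (C x) (C x) = V x x + 2 * (h * V (T x) x) + h\<^sup>2 * V (T x) (T x)"
      using V_sym[of x "T x"]
      by (simp add: C_def V.add_left V.add_right V.scaleR_left V.scaleR_right power2_eq_square algebra_simps)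
    with 1 2 show ?thesis by (simp add: algebra_simps)
  qed
  from contraction_invariant_graph[OF C _ this] h \<open>\<epsilon> > 0\<close> obtain K where
    K: "linear K" "\<And>z. K (p z) = K z" "\<And>z. \<pi> (K z) = p z" "\<And>z. V (K z) (K z) \<le> 0"
      "\<And>z. C (K z) = K (\<pi> (C (K z)))" "(\<forall>x. C (J x) = J (C x)) \<longrightarrow> (\<forall>z. K (\<i> *s z) = J (K z))"
    by (metis mult_pos_pos)
  have "T (K z) = K (\<pi> (T (K z)))" for z
  proof -
    have "K z + h *\<^sub>R T (K z) = K z + h *\<^sub>R K (\<pi> (T (K z)))"
      using K(5)[of z] by (simp add: C_def \<pi>.add \<pi>.scaleR linear_add[OF K(1)] linear_scale[OF K(1)] K(2,3))
    then show ?thesis using h by simp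
  qed
  moreover have "(\<forall>x. T (J x) = J (T x)) \<longrightarrow> (\<forall>z. K (\<i> *s z) = J (K z))"
    using K(6) by (simp add: C_def J.add J.scaleR)
  ultimately show ?thesis using K(1-4) by blast
qed

end

section \<open>Weak limits\<close>

text \<open>
  Tychonoff's theorem for a product of compact intervals. The index type may be uncountable, therefore
  the cluster point is reached along a finer filter and not along a subsequence.
\<close>

lemma bounded_functions_cluster:
  fixes X :: "'b \<Rightarrow> 'i \<Rightarrow> real"
  assumes "F0 \<noteq> bot" and bound: "\<And>n i. \<bar>X n i\<bar> \<le> b i"
  shows "\<exists>F l. F \<noteq> bot \<and> F \<le> F0 \<and> (\<forall>i. ((\<lambda>n. X n i) \<longlongrightarrow> l i) F)"
proof -
  define B where "B = (\<Pi>\<^sub>E i\<in>UNIV. {- b i .. b i})"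
  have "compactin (product_topology (\<lambda>i::'i. euclidean) UNIV) B"
    unfolding B_def by (simp add: compactin_PiE)
  then have "compact B" by (simp add: euclidean_product_topology)
  moreover have "\<forall>\<^sub>F f in filtermap X F0. f \<in> B"
    using bound by (simp add: eventually_filtermap B_def PiE_iff abs_le_iff minus_le_iff)
  moreover have "filtermap X F0 \<noteq> bot" using assms(1) by (simp add: filtermap_bot_iff)
  ultimately obtain l where l: "inf (nhds l) (filtermap X F0) \<noteq> bot"
    by (auto simp: compact_filter)
  define F where "F = inf F0 (filtercomap X (nhds l))"
  have "F \<noteq> bot"
  proof
    assume "F = bot"
    then have "eventually (\<lambda>_. False) F" by simp
    then obtain P Q where PQ: "eventually P F0" "eventually Q (filtercomap X (nhds l))" "\<And>n. P n \<Longrightarrow> Q n \<Longrightarrow> False"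
      unfolding F_def eventually_inf by blast
    from PQ(2) obtain R where R: "eventually R (nhds l)" "\<And>n. R (X n) \<Longrightarrow> Q n"
      unfolding eventually_filtercomap by blast
    have "eventually (\<lambda>f. \<not> R f) (filtermap X F0)"
      unfolding eventually_filtermap by (rule eventually_mono[OF PQ(1)]) (use PQ(3) R(2) in blast)
    then have "eventually (\<lambda>_. False) (inf (nhds l) (filtermap X F0))"
      unfolding eventually_inf using R(1) by blast
    with l show False by (simp add: trivial_limit_def)
  qed
  moreover have "F \<le> F0" by (simp add: F_def)
  moreover have "((\<lambda>n. X n i) \<longlongrightarrow> l i) F" for i
  proof -
    have "filterlim X (nhds l) F"
      unfolding filterlim_def F_def by (simp add: filtermap_le_iff_le_filtercomap)
    from continuous_on_tendsto_compose[OF continuous_on_product_coordinates this]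
    show ?thesis by simp
  qed
  ultimately show ?thesis by blast
qed

text \<open>
  Weak compactness of balls, for all members of a family at once. The family will be indexed by the
  arguments of linear maps, so that the limits again form a linear map.
\<close>

lemma bounded_weak_cluster:
  fixes u :: "'b \<Rightarrow> 'i \<Rightarrow> 'h::{real_inner,complete_space}"
  assumes "F0 \<noteq> bot" and bound: "\<And>n i. norm (u n i) \<le> b i"
  shows "\<exists>F l. F \<noteq> bot \<and> F \<le> F0 \<and> (\<forall>i f. bounded_linear f \<longrightarrow> ((\<lambda>n. f (u n i) :: real) \<longlongrightarrow> f (l i)) F)"
proof -
  have "\<bar>u n i \<bullet> y\<bar> \<le> b i * norm y" for n i y
    using Cauchy_Schwarz_ineq2[of "u n i" y] mult_right_mono[OF bound[of n i], of "norm y"] by simp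
  then have "\<bar>u n (fst j) \<bullet> snd j\<bar> \<le> b (fst j) * norm (snd j)" for n j by simp
  from bounded_functions_cluster[OF assms(1), of "\<lambda>n j. u n (fst j) \<bullet> snd j" "\<lambda>j. b (fst j) * norm (snd j)", OF this]
  obtain F k where F: "F \<noteq> bot" "F \<le> F0"
    and k': "\<forall>j. ((\<lambda>n. u n (fst j) \<bullet> snd j) \<longlongrightarrow> k j) F" by blast
  have k: "((\<lambda>n. u n i \<bullet> y) \<longlongrightarrow> k (i, y)) F" for i y using k'[rule_format, of "(i,y)"] by simp
  have "bounded_linear (\<lambda>y. k (i, y))" for i
  proof (rule bounded_linear_intro[where K="b i"])
    fix x y and r :: real
    show "k (i, x + y) = k (i, x) + k (i, y)"
      using tendsto_unique[OF F(1) k[of i "x + y"]] tendsto_add[OF k[of i x] k[of i y]] by (simp add: inner_add_right)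
    show "k (i, r *\<^sub>R x) = r *\<^sub>R k (i, x)"
      using tendsto_unique[OF F(1) k[of i "r *\<^sub>R x"]] tendsto_mult[OF tendsto_const k[of i x], of r] by simp
    have "\<bar>k (i, x)\<bar> \<le> b i * norm x"
    proof (rule tendsto_upperbound[OF tendsto_rabs[OF k[of i x]] _ F(1)])
      show "\<forall>\<^sub>F n in F. \<bar>u n i \<bullet> x\<bar> \<le> b i * norm x"
        using \<open>\<And>n i y. \<bar>u n i \<bullet> y\<bar> \<le> b i * norm y\<close> by simp
    qed
    then show "norm (k (i, x)) \<le> norm x * b i" by (simp add: mult.commute)
  qed
  then have "\<forall>i. \<exists>l. \<forall>y. k (i, y) = l \<bullet> y" using riesz_representation by metis
  then obtain l where l: "\<And>i y. k (i, y) = l i \<bullet> y" by metis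
  have "((\<lambda>n. f (u n i)) \<longlongrightarrow> f (l i)) F" if f: "bounded_linear f" for i and f :: "'h \<Rightarrow> real"
  proof -
    obtain y where y: "\<And>x. f x = y \<bullet> x" using riesz_representation[OF f] by blast
    show ?thesis using k[of i y] by (simp add: y l inner_commute)
  qed
  with F show ?thesis by blast
qed

section \<open>Invariant subspaces for unbounded dissipation\<close>

context pontryagin_space begin

text \<open>
  The fundamental symmetry: reversing the sign on the negative subspace turns \<open>V\<close> into an inner product
  that is equivalent to the given one.
\<close>

definition sg :: "'h \<Rightarrow> 'h" where "sg x = x - 2 *\<^sub>R \<iota> (\<pi> x)"

lemma linear_sg: "bounded_linear sg"
  unfolding sg_def[abs_def]
  by (intro bounded_linear_sub bounded_linear_ident bounded_linear_compose[OF bounded_linear_scaleR_right]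
        bounded_linear_compose[OF linear_\<iota> linear_\<pi>])

lemma sg_sg: "sg (sg x) = x"
  by (simp add: sg_def \<pi>.diff \<pi>.scaleR \<pi>_\<iota> proj_\<pi> \<iota>.diff \<iota>.scaleR \<pi>.add \<iota>.add \<iota>.neg scaleR_2)

lemma V_\<iota>: "V x (\<iota> z) = V (\<iota> (\<pi> x)) (\<iota> z)"
proof -
  have "\<pi> (x - \<iota> (\<pi> x)) = 0" by (simp add: \<pi>.diff \<pi>_\<iota> proj_\<pi>)
  from V_orth[OF this, of z] show ?thesis
    by (simp add: V.diff_right V_sym[of x] V_sym[of "\<iota> (\<pi> x)"])
qed

lemma V_sg_sym: "V x (sg y) = V y (sg x)"
  using V_\<iota>[of x "\<pi> y"] V_\<iota>[of y "\<pi> x"] V_sym[of x y] V_sym[of "\<iota> (\<pi> x)" "\<iota> (\<pi> y)"]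
  by (simp add: sg_def V.diff_right V.scaleR_right)

lemma V_sg_coercive: "\<exists>d>0. \<forall>x. d * (norm x)\<^sup>2 \<le> V x (sg x)"
proof -
  obtain L where L: "L > 0" "\<And>x. norm (\<iota> x) \<le> norm x * L" using \<iota>.pos_bounded by blast
  define d where "d = c / (2 + 2 * L\<^sup>2)"
  have L2: "2 + 2 * L\<^sup>2 > 0" by (simp add: add_pos_nonneg)
  have "d * (norm x)\<^sup>2 \<le> V x (sg x)" for x
  proof -
    define q where "q = x - \<iota> (\<pi> x)"
    have "\<pi> q = 0" by (simp add: q_def \<pi>.diff \<pi>_\<iota> proj_\<pi>)
    then have q: "c * (norm q)\<^sup>2 \<le> V q q" by (rule V_pos)
    have n: "c * (norm (\<pi> x))\<^sup>2 \<le> - V (\<iota> (\<pi> x)) (\<iota> (\<pi> x))" using V_neg[of "\<pi> x"] by (simp add: proj_\<pi>)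
    have eq: "V x (sg x) = V q q - V (\<iota> (\<pi> x)) (\<iota> (\<pi> x))"
      using V_split[of x] V_\<iota>[of x "\<pi> x"] by (simp add: sg_def q_def V.diff_right V.scaleR_right)
    have "norm x \<le> norm q + norm (\<iota> (\<pi> x))"
      using norm_triangle_ineq[of q "\<iota> (\<pi> x)"] by (simp add: q_def)
    then have "norm x \<le> norm q + L * norm (\<pi> x)" using L(2)[of "\<pi> x"] by (simp add: mult.commute)
    from square_le_sum_squares[OF norm_ge_zero this]
    have "d * (norm x)\<^sup>2 \<le> d * ((2 + 2 * L\<^sup>2) * ((norm q)\<^sup>2 + (norm (\<pi> x))\<^sup>2))"
      using L2 c_pos by (intro mult_left_mono) (auto simp: d_def)
    also have "\<dots> = c * ((norm q)\<^sup>2 + (norm (\<pi> x))\<^sup>2)" using L2 by (simp add: d_def)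
    finally have "d * (norm x)\<^sup>2 \<le> c * ((norm q)\<^sup>2 + (norm (\<pi> x))\<^sup>2)" .
    with q n eq show ?thesis by (simp add: algebra_simps)
  qed
  moreover have "d > 0" using c_pos L2 by (simp add: d_def)
  ultimately show ?thesis by blast
qed

lemma V_nondegenerate:
  assumes "\<And>y. V x y = V x' y" shows "x = x'"
proof -
  obtain d where d: "d > 0" "\<And>x. d * (norm x)\<^sup>2 \<le> V x (sg x)" using V_sg_coercive by blast
  have "V (x - x') (sg (x - x')) = 0" using assms by (simp add: V.diff_left)
  with d(2)[of "x - x'"] have "d * (norm (x - x'))\<^sup>2 \<le> 0" by simp
  with d(1) show ?thesis by (simp add: mult_le_0_iff)
qed

lemma V_represents_form:
  assumes g: "bounded_bilinear g"
  shows "\<exists>T. bounded_linear T \<and> (\<forall>x y. V (T x) y = g x y)"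
proof -
  interpret g: bounded_bilinear g by (rule g)
  interpret sg: bounded_linear sg by (rule linear_sg)
  obtain d where d: "d > 0" "\<And>x. d * (norm x)\<^sup>2 \<le> V x (sg x)" using V_sg_coercive by blast
  have r: "bounded_bilinear (\<lambda>x y. V x (sg y))"
    using bounded_bilinear.comp[OF bilinear_V bounded_linear_ident linear_sg] .
  have "\<exists>t. \<forall>y. V t y = g x y" for x
  proof -
    have "bounded_linear (\<lambda>y. g x (sg y))"
      using bounded_linear_compose[OF g.bounded_linear_right linear_sg] .
    from coercive_form_represents[OF r V_sg_sym d(1) d(2) this]
    obtain t where "\<And>y. V t (sg y) = g x (sg y)" by blast
    then have "V t y = g x y" for y using sg_sg[of y] by metis
    then show ?thesis by blast
  qed
  then obtain T where T: "\<And>x y. V (T x) y = g x y" by metis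
  obtain M where M: "M > 0" "\<And>x y. norm (g x y) \<le> norm x * norm y * M" using g.pos_bounded by blast
  obtain L where L: "L > 0" "\<And>x. norm (sg x) \<le> norm x * L" using sg.pos_bounded by blast
  have "bounded_linear T"
  proof (rule bounded_linear_intro[where K="M * L / d"])
    fix x y and r :: real
    show "T (x + y) = T x + T y" by (rule V_nondegenerate) (simp add: V.add_left g.add_left T)
    show "T (r *\<^sub>R x) = r *\<^sub>R T x" by (rule V_nondegenerate) (simp add: V.scaleR_left g.scaleR_left T)
    have "d * (norm (T x))\<^sup>2 \<le> g x (sg (T x))" using d(2)[of "T x"] by (simp add: T)
    also have "\<dots> \<le> norm x * norm (sg (T x)) * M" using M(2)[of x "sg (T x)"] by simp
    also have "\<dots> \<le> norm x * (norm (T x) * L) * M" using L(2)[of "T x"] M(1) by (intro mult_right_mono mult_left_mono) auto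
    finally have *: "norm (T x) * (d * norm (T x)) \<le> norm (T x) * (norm x * (M * L))" by (simp add: power2_eq_square mult_ac)
    have "d * norm (T x) \<le> norm x * (M * L)"
      by (rule mult_left_le_imp_le_nonneg[OF _ _ *]) (use M(1) L(1) in auto)
    then show "norm (T x) \<le> norm x * (M * L / d)" using d(1) by (simp add: field_simps)
  qed
  with T show ?thesis by blast
qed

end

text \<open>
  If \<open>Q\<close> is the inverse of an unbounded nonnegative operator, then the bounded operators
  \<open>R = inverse (Q + d)\<close> are its Yosida approximations.
\<close>

lemma yosida_inverse:
  fixes Q :: "'v::{real_inner,complete_space} \<Rightarrow> 'v"
  assumes Q: "bounded_linear Q" and sym: "\<And>a b. Q a \<bullet> b = a \<bullet> Q b" and nonneg: "\<And>a. 0 \<le> Q a \<bullet> a"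
    and "d > 0"
  shows "\<exists>R. bounded_linear R \<and> (\<forall>a. Q (R a) + d *\<^sub>R R a = a) \<and> (\<forall>a. R (Q a + d *\<^sub>R a) = a) \<and> (\<forall>a. 0 \<le> R a \<bullet> a)"
proof -
  interpret Q: bounded_linear Q by (rule Q)
  have r: "bounded_bilinear (\<lambda>a b. (Q a + d *\<^sub>R a) \<bullet> b)"
    by (intro bounded_bilinear.comp1[OF bounded_bilinear_inner] bounded_linear_add Q bounded_linear_scaleR_right)
  have rs: "(Q a + d *\<^sub>R a) \<bullet> b = (Q b + d *\<^sub>R b) \<bullet> a" for a b
    using sym[of a b] by (simp add: inner_add_left inner_add_right inner_commute)
  have coer: "d * (norm a)\<^sup>2 \<le> (Q a + d *\<^sub>R a) \<bullet> a" for a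
    using nonneg[of a] by (simp add: inner_add_left power2_norm_eq_inner)
  have inj: "a = b" if "Q a + d *\<^sub>R a = Q b + d *\<^sub>R b" for a b
  proof -
    have "Q (a - b) + d *\<^sub>R (a - b) = 0" using that by (simp add: Q.diff algebra_simps)
    with coer[of "a - b"] have "d * (norm (a - b))\<^sup>2 \<le> 0" by simp
    with \<open>d > 0\<close> show ?thesis by (simp add: mult_le_0_iff)
  qed
  have "\<exists>x. Q x + d *\<^sub>R x = a" for a
  proof -
    obtain x where "\<And>y. (Q x + d *\<^sub>R x) \<bullet> y = a \<bullet> y"
      using coercive_form_represents[OF r rs \<open>d > 0\<close> coer bounded_linear_inner_right[of a]] by blast
    then show ?thesis using vector_eq_rdot by blast
  qed
  then obtain R where R: "\<And>a. Q (R a) + d *\<^sub>R R a = a" by metis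
  have "bounded_linear R"
  proof (rule bounded_linear_intro[where K="1/d"])
    fix x y and r :: real
    show "R (x + y) = R x + R y" 
    proof (rule inj)
      have "Q (R x + R y) + d *\<^sub>R (R x + R y) = (Q (R x) + d *\<^sub>R R x) + (Q (R y) + d *\<^sub>R R y)"
        by (simp add: Q.add scaleR_add_right)
      then show "Q (R (x + y)) + d *\<^sub>R R (x + y) = Q (R x + R y) + d *\<^sub>R (R x + R y)" by (simp add: R)
    qed
    show "R (r *\<^sub>R x) = r *\<^sub>R R x"
    proof (rule inj)
      have "Q (r *\<^sub>R R x) + d *\<^sub>R (r *\<^sub>R R x) = r *\<^sub>R (Q (R x) + d *\<^sub>R R x)"
        by (simp add: Q.scaleR scaleR_add_right mult.commute)
      then show "Q (R (r *\<^sub>R x)) + d *\<^sub>R R (r *\<^sub>R x) = Q (r *\<^sub>R R x) + d *\<^sub>R (r *\<^sub>R R x)" by (simp add: R)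
    qed
    have "d * (norm (R x))\<^sup>2 \<le> x \<bullet> R x" using coer[of "R x"] by (simp add: R)
    also have "\<dots> \<le> norm x * norm (R x)" by (rule norm_cauchy_schwarz)
    finally have *: "norm (R x) * (d * norm (R x)) \<le> norm (R x) * norm x" by (simp add: power2_eq_square mult_ac)
    have "d * norm (R x) \<le> norm x" by (rule mult_left_le_imp_le_nonneg[OF _ _ *]) auto
    then show "norm (R x) \<le> norm x * (1 / d)" using \<open>d > 0\<close> by (simp add: field_simps)
  qed
  moreover have "R (Q a + d *\<^sub>R a) = a" for a by (rule inj) (simp add: R)
  moreover have "0 \<le> R a \<bullet> a" for a
  proof -
    have "0 \<le> d * (norm (R a))\<^sup>2" using \<open>d > 0\<close> by simp
    also have "\<dots> \<le> (Q (R a) + d *\<^sub>R R a) \<bullet> R a" by (rule coer)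
    finally show ?thesis by (simp add: R inner_commute)
  qed
  ultimately show ?thesis using R by blast
qed

text \<open>
  The generator in weak form. The equation \<open>u' = T u\<close> means that \<open>V u' y = sk u y - r \<bullet> pr y\<close> for all
  \<open>y\<close>, where \<open>Q r = pr u\<close>: the antisymmetric form \<open>sk\<close> is the conservative part of the motion, and the
  damping acts on the component \<open>pr u\<close> through the unbounded operator inverse to \<open>Q\<close>. The existence of
  \<open>r\<close> expresses that \<open>u\<close> belongs to the domain of \<open>T\<close>.
\<close>

locale dissipative_pontryagin = pontryagin_space V J \<pi> \<iota> I c
  for V :: "'h::{real_inner,complete_space} \<Rightarrow> 'h \<Rightarrow> real" and J :: "'h \<Rightarrow> 'h"
    and \<pi> :: "'h \<Rightarrow> complex^'n" and \<iota> :: "complex^'n \<Rightarrow> 'h" and I :: "'n set" and c :: real +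
  fixes sk :: "'h \<Rightarrow> 'h \<Rightarrow> real"
    and pr :: "'h \<Rightarrow> 'v::{real_inner,complete_space}" and em :: "'v \<Rightarrow> 'h"
    and Q :: "'v \<Rightarrow> 'v" and Jv :: "'v \<Rightarrow> 'v"
  assumes bilinear_sk: "bounded_bilinear sk" and sk_anti: "sk x y = - sk y x"
    and sk_J: "sk (J x) (J y) = sk x y"
    and linear_pr: "bounded_linear pr" and linear_em: "bounded_linear em"
    and pr_em: "pr (em a) = a" and pr_\<iota>: "pr (\<iota> z) = 0"
    and linear_Q: "bounded_linear Q" and Q_sym: "Q a \<bullet> b = a \<bullet> Q b" and Q_nonneg: "0 \<le> Q a \<bullet> a"
    and Q_inj: "Q a = 0 \<Longrightarrow> a = 0"
    and linear_Jv: "bounded_linear Jv" and inner_Jv: "Jv a \<bullet> Jv b = a \<bullet> b"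
    and pr_J: "pr (J x) = Jv (pr x)" and Q_Jv: "Q (Jv a) = Jv (Q a)"
begin

sublocale sk: bounded_bilinear sk by (rule bilinear_sk)
sublocale pr: bounded_linear pr by (rule linear_pr)
sublocale em: bounded_linear em by (rule linear_em)
sublocale Q: bounded_linear Q by (rule linear_Q)
sublocale Jv: bounded_linear Jv by (rule linear_Jv)

lemma V_J_left: "V (J x) y = - V x (J y)"
  using V_J[of x "J y"] by (simp add: J_J V.minus_right)

text \<open>
  Replacing the inverse of \<open>Q\<close> by \<open>R = inverse (Q + d)\<close> and adding the damping \<open>- d\<close> gives a bounded
  and strictly dissipative operator. The last conjunct is the only information about \<open>R\<close> that survives
  in the limit.
\<close>

lemma approximate_graph:
  assumes "d > 0"
  shows "\<exists>K S R. linear K \<and> (\<forall>z. K (p z) = K z) \<and> (\<forall>z. \<pi> (K z) = p z) \<and> (\<forall>z. V (K z) (K z) \<le> 0)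
     \<and> (\<forall>z. K (\<i> *s z) = J (K z)) \<and> linear S \<and> (\<forall>z. p (S z) = S z) \<and> (\<forall>z. S (p z) = S z)
     \<and> (\<forall>z. S (\<i> *s z) = \<i> *s S z)
     \<and> (\<forall>z y. V (K (S z)) y = sk (K z) y - R (pr (K z)) \<bullet> pr y - d * (K z \<bullet> y))
     \<and> (\<forall>a b. R b \<bullet> (Q a + d *\<^sub>R a) = b \<bullet> a)"
proof -
  obtain R where R: "bounded_linear R" "\<And>a. Q (R a) + d *\<^sub>R R a = a" "\<And>a. R (Q a + d *\<^sub>R a) = a" "\<And>a. 0 \<le> R a \<bullet> a"
    using yosida_inverse[OF linear_Q Q_sym Q_nonneg \<open>d > 0\<close>] by auto
  define g where "g x y = sk x y - R (pr x) \<bullet> pr y - d * (x \<bullet> y)" for x y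
  have "bounded_bilinear (\<lambda>x y. - R (pr x) \<bullet> pr y)" "bounded_bilinear (\<lambda>x y. (- d *\<^sub>R x) \<bullet> y)"
    by (intro bounded_bilinear.comp[OF bounded_bilinear_inner] bounded_bilinear.comp1[OF bounded_bilinear_inner]
          bounded_linear_minus bounded_linear_compose[OF R(1) linear_pr] linear_pr bounded_linear_scaleR_right)+
  from bounded_bilinear_add[OF bounded_bilinear_add[OF bilinear_sk this(1)] this(2)]
  have g: "bounded_bilinear g" by (simp add: g_def[abs_def])
  interpret g: bounded_bilinear g by (rule g)
  obtain T where T: "bounded_linear T" "\<And>x y. V (T x) y = g x y" using V_represents_form[OF g] by auto
  have diss: "V (T x) x \<le> - d * (norm x)\<^sup>2" for x
  proof -
    have "sk x x = 0" using sk_anti[of x x] by simp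
    then show ?thesis using R(4)[of "pr x"] by (simp add: T(2) g_def power2_norm_eq_inner)
  qed
  have R_Jv: "R (Jv a) = Jv (R a)" for a
  proof -
    have "Jv a = Q (Jv (R a)) + d *\<^sub>R Jv (R a)" using R(2)[of a] by (metis Q_Jv Jv.add Jv.scaleR)
    then show ?thesis using R(3)[of "Jv (R a)"] by simp
  qed
  have g_J: "g (J x) (J y) = g x y" for x y
    by (simp add: g_def sk_J pr_J R_Jv inner_Jv inner_J)
  have TJ: "T (J x) = J (T x)" for x
  proof (rule V_nondegenerate)
    fix y
    have "g (J x) y = - g x (J y)" using g_J[of x "J y"] by (simp add: J_J g.minus_right)
    then show "V (T (J x)) y = V (J (T x)) y" by (simp add: T(2) V_J_left)
  qed
  obtain K where K: "linear K" "\<And>z. K (p z) = K z" "\<And>z. \<pi> (K z) = p z" "\<And>z. V (K z) (K z) \<le> 0"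
      "\<And>z. T (K z) = K (\<pi> (T (K z)))" "\<And>z. K (\<i> *s z) = J (K z)"
    using dissipative_invariant_graph[OF T(1) \<open>d > 0\<close> diss] TJ by metis
  define S where "S z = \<pi> (T (K z))" for z
  have "linear S" unfolding S_def[abs_def]
    using linear_compose[OF K(1) bounded_linear.linear[OF bounded_linear_compose[OF linear_\<pi> T(1)]]] by (simp add: comp_def)
  moreover have "V (K (S z)) y = sk (K z) y - R (pr (K z)) \<bullet> pr y - d * (K z \<bullet> y)" for z y
    using T(2)[of "K z" y] K(5)[of z] by (simp add: S_def g_def)
  moreover have "R b \<bullet> (Q a + d *\<^sub>R a) = b \<bullet> a" for a b
  proof -
    have "R b \<bullet> (Q a + d *\<^sub>R a) = (Q (R b) + d *\<^sub>R R b) \<bullet> a" by (simp add: inner_add_left inner_add_right Q_sym)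
    then show ?thesis by (simp add: R(2))
  qed
  moreover have "S (\<i> *s z) = \<i> *s S z" for z by (simp add: S_def K(6) TJ \<pi>_J)
  ultimately show ?thesis using K(1-4,6) by (intro exI[of _ K] exI[of _ S] exI[of _ R]) (simp add: S_def proj_\<pi>)
qed

text \<open>
  The limit \<open>d \<longlonglongrightarrow> 0\<close> of the approximations. The maps \<open>K n\<close> converge weakly, and the maps \<open>S n\<close> between
  finite dimensional spaces converge in norm, hence \<open>K n (S n z)\<close> converges weakly, too. Testing the
  equation with \<open>y = em (Q a + d a)\<close> replaces the approximation of the damping operator, about whose
  convergence nothing is known, by an inner product with \<open>a\<close>. The limit equation on the range of \<open>Q\<close>
  then gives the vector \<open>r\<close> by Riesz' theorem.
\<close>

lemma invariant_graph:
  shows "\<exists>K S. linear K \<and> (\<forall>z. K (p z) = K z) \<and> (\<forall>z. \<pi> (K z) = p z) \<and> (\<forall>z. V (K z) (K z) \<le> 0)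
     \<and> (\<forall>z. K (\<i> *s z) = J (K z)) \<and> linear S \<and> (\<forall>z. p (S z) = S z) \<and> (\<forall>z. S (p z) = S z)
     \<and> (\<forall>z. S (\<i> *s z) = \<i> *s S z)
     \<and> (\<forall>z. \<exists>r. Q r = pr (K z) \<and> (\<forall>y. V (K (S z)) y = sk (K z) y - r \<bullet> pr y))"
proof -
  define d where "d n = inverse (real (Suc n))" for n
  have d: "d n > 0" "d n \<le> 1" for n by (auto simp: d_def field_simps)
  define P where "P n K S R \<longleftrightarrow> linear K \<and> (\<forall>z. K (p z) = K z) \<and> (\<forall>z. \<pi> (K z) = p z) \<and> (\<forall>z. V (K z) (K z) \<le> 0)
     \<and> (\<forall>z. K (\<i> *s z) = J (K z)) \<and> linear S \<and> (\<forall>z. p (S z) = S z) \<and> (\<forall>z. S (p z) = S z)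
     \<and> (\<forall>z. S (\<i> *s z) = \<i> *s S z)
     \<and> (\<forall>z y. V (K (S z)) y = sk (K z) y - R (pr (K z)) \<bullet> pr y - d n * (K z \<bullet> y))
     \<and> (\<forall>a b. R b \<bullet> (Q a + d n *\<^sub>R a) = b \<bullet> a)" for n K S R
  have "\<exists>K S R. P n K S R" for n
    unfolding P_def by (rule approximate_graph[OF d(1)])
  then obtain K S R where P: "\<And>n. P n (K n) (S n) (R n)" by metis
  have K: "\<And>n. linear (K n)" "\<And>n z. K n (p z) = K n z" "\<And>n z. \<pi> (K n z) = p z"
     "\<And>n z. V (K n z) (K n z) \<le> 0" "\<And>n z. K n (\<i> *s z) = J (K n z)"
    and S: "\<And>n. linear (S n)" "\<And>n z. p (S n z) = S n z" "\<And>n z. S n (p z) = S n z" "\<And>n z. S n (\<i> *s z) = \<i> *s S n z"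
    and eq: "\<And>n z y. V (K n (S n z)) y = sk (K n z) y - R n (pr (K n z)) \<bullet> pr y - d n * (K n z \<bullet> y)"
    and R: "\<And>n a b. R n b \<bullet> (Q a + d n *\<^sub>R a) = b \<bullet> a"
    using P by (simp_all add: P_def)
  obtain B where B: "B > 0" "\<And>x. V x x \<le> 0 \<Longrightarrow> norm x \<le> B * norm (\<pi> x)"
    using nonpositive_norm_bound by blast
  obtain M where M: "M > 0" "\<And>x y. norm (V x y) \<le> norm x * norm y * M" using V.pos_bounded by blast
  obtain Ms where Ms: "Ms > 0" "\<And>x y. norm (sk x y) \<le> norm x * norm y * Ms" using sk.pos_bounded by blast
  obtain L where L: "L > 0" "\<And>x. norm (\<iota> x) \<le> norm x * L" using \<iota>.pos_bounded by blast
  have K_bound: "norm (K n z) \<le> B * norm z" for n z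
  proof -
    have "norm (K n z) \<le> B * norm (p z)" using B(2)[OF K(4)[of n z]] by (simp add: K(3))
    also have "\<dots> \<le> B * norm z" using B(1) by (intro mult_left_mono norm_coord_proj_le) auto
    finally show ?thesis .
  qed
  define D where "D = (Ms + 1) * B * L / c"
  have S_bound: "norm (S n z) \<le> D * norm z" for n z
  proof -
    define s where "s = S n z"
    have "V (K n s) (\<iota> s) = V (\<iota> s) (\<iota> s)" using V_\<iota>[of "K n s" s] by (simp add: K(3) s_def S(2))
    then have "V (\<iota> s) (\<iota> s) = sk (K n z) (\<iota> s) - d n * (K n z \<bullet> \<iota> s)"
      using eq[of n z "\<iota> s"] by (simp add: pr_\<iota> s_def)
    then have "c * (norm s)\<^sup>2 \<le> d n * (K n z \<bullet> \<iota> s) - sk (K n z) (\<iota> s)"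
      using V_neg[of s] by (simp add: s_def S(2))
    also have "\<dots> \<le> norm (K n z) * norm (\<iota> s) + norm (K n z) * norm (\<iota> s) * Ms"
    proof -
      have "d n * (K n z \<bullet> \<iota> s) \<le> d n * (norm (K n z) * norm (\<iota> s))"
        using d[of n] by (intro mult_left_mono norm_cauchy_schwarz) auto
      also have "\<dots> \<le> 1 * (norm (K n z) * norm (\<iota> s))"
        using d[of n] by (intro mult_right_mono) auto
      finally have "d n * (K n z \<bullet> \<iota> s) \<le> norm (K n z) * norm (\<iota> s)" by simp
      then show ?thesis using Ms(2)[of "K n z" "\<iota> s"] by simp
    qed
    also have "\<dots> = norm (K n z) * norm (\<iota> s) * (Ms + 1)" by (simp add: algebra_simps)
    also have "\<dots> \<le> (B * norm z) * (norm s * L) * (Ms + 1)"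
      using K_bound[of n z] L(2)[of s] B(1) Ms(1) by (intro mult_right_mono mult_mono) auto
    finally have *: "norm s * (c * norm s) \<le> norm s * (norm z * ((Ms + 1) * B * L))" by (simp add: power2_eq_square mult_ac)
    have "c * norm s \<le> norm z * ((Ms + 1) * B * L)"
      by (rule mult_left_le_imp_le_nonneg[OF _ _ *]) (use Ms(1) B(1) L(1) in auto)
    then show ?thesis using c_pos by (simp add: D_def s_def field_simps)
  qed
  obtain F0 K' where F0: "F0 \<noteq> bot" "F0 \<le> sequentially"
    and K0: "\<forall>z f. bounded_linear f \<longrightarrow> ((\<lambda>n. f (K n z) :: real) \<longlongrightarrow> f (K' z)) F0"
    using bounded_weak_cluster[where u=K and b="\<lambda>z. B * norm z", OF sequentially_bot K_bound] by blast
  obtain F S' where F: "F \<noteq> bot" "F \<le> F0"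
    and S0: "\<forall>z f. bounded_linear f \<longrightarrow> ((\<lambda>n. f (S n z) :: real) \<longlongrightarrow> f (S' z)) F"
    using bounded_weak_cluster[where u=S and b="\<lambda>z. D * norm z", OF F0(1) S_bound] by blast
  have K': "((\<lambda>n. f (K n z)) \<longlongrightarrow> f (K' z)) F" if "bounded_linear f" for f :: "'h \<Rightarrow> real" and z
    using tendsto_mono[OF F(2) K0[rule_format, OF that]] .
  have S': "((\<lambda>n. S n z) \<longlongrightarrow> S' z) F" for z
    using S0[rule_format, OF bounded_linear_inner_left] by (subst tendsto_componentwise_iff) auto
  have d0: "(d \<longlongrightarrow> 0) F"
    using LIMSEQ_inverse_real_of_nat tendsto_mono[OF order_trans[OF F(2) F0(2)]] unfolding d_def[abs_def] by blast
  have K_eqI: "x = y" if "\<And>f. bounded_linear f \<Longrightarrow> f x = (f y :: real)" for x y :: 'h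
    using that[OF bounded_linear_inner_left] vector_eq_rdot by blast
  have K1: "linear K'"
  proof (rule linearI)
    fix x y and r :: real
    show "K' (x + y) = K' x + K' y"
    proof (rule K_eqI)
      fix f :: "'h \<Rightarrow> real" assume f: "bounded_linear f"
      interpret f: bounded_linear f by (rule f)
      show "f (K' (x + y)) = f (K' x + K' y)"
        using tendsto_unique[OF F(1) K'[OF f, of "x + y"]] tendsto_add[OF K'[OF f, of x] K'[OF f, of y]]
        by (simp add: linear_add[OF K(1)] f.add)
    qed
    show "K' (r *\<^sub>R x) = r *\<^sub>R K' x"
    proof (rule K_eqI)
      fix f :: "'h \<Rightarrow> real" assume f: "bounded_linear f"
      interpret f: bounded_linear f by (rule f)
      show "f (K' (r *\<^sub>R x)) = f (r *\<^sub>R K' x)"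
        using tendsto_unique[OF F(1) K'[OF f, of "r *\<^sub>R x"]] tendsto_mult[OF tendsto_const K'[OF f, of x], of r]
        by (simp add: linear_scale[OF K(1)] f.scaleR)
    qed
  qed
  have K2: "K' (p z) = K' z" for z
    by (rule K_eqI, rule tendsto_unique[OF F(1) K'[of _ "p z"]]) (simp_all add: K' K(2))
  have K3: "\<pi> (K' z) = p z" for z
  proof (rule vector_eq_rdot[THEN iffD1], rule allI)
    fix y
    have "bounded_linear (\<lambda>x. \<pi> x \<bullet> y)" by (rule bounded_linear_compose[OF bounded_linear_inner_left linear_\<pi>])
    from K'[OF this, of z] show "\<pi> (K' z) \<bullet> y = p z \<bullet> y" by (simp add: K(3) tendsto_const_iff[OF F(1)])
  qed
  \<comment> \<open>The positive part of \<open>V\<close> is only weakly lower semicontinuous: it is bounded below by its tangent at \<open>q\<close>.\<close>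
  have K4: "V (K' z) (K' z) \<le> 0" for z
  proof -
    define w where "w = \<iota> (p z)"
    define q where "q = K' z - w"
    have split: "V (K n z) (K n z) = V (K n z - w) (K n z - w) + V w w" for n
      using V_split[of "K n z"] by (simp add: K(3) w_def)
    have "V q q + V w w = V (K' z) (K' z)" using V_split[of "K' z"] by (simp add: K3 w_def q_def)
    moreover have "((\<lambda>n. 2 * V (K n z - w) q - V q q + V w w) \<longlongrightarrow> 2 * V (K' z - w) q - V q q + V w w) F"
      unfolding V.diff_left by (intro tendsto_intros K' V.bounded_linear_left)
    then have "2 * V (K' z - w) q - V q q + V w w \<le> 0"
    proof (rule tendsto_upperbound[OF _ always_eventually F(1)], intro allI)
      fix n
      have "\<pi> (K n z - w - q) = 0" by (simp add: q_def w_def \<pi>.diff K(3) K3)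
      from V_pos[OF this] have "0 \<le> V (K n z - w - q) (K n z - w - q)"
        using c_pos by (smt (verit) mult_nonneg_nonneg zero_le_power2)
      also have "\<dots> = V (K n z - w) (K n z - w) - 2 * V (K n z - w) q + V q q"
        unfolding V.diff_left[of _ q] V.diff_right[of _ _ q] using V_sym[of q "K n z - w"] by simp
      finally show "2 * V (K n z - w) q - V q q + V w w \<le> 0" using split[of n] K(4)[of n z] by linarith
    qed
    ultimately show ?thesis by (simp add: q_def)
  qed
  have K5: "K' (\<i> *s z) = J (K' z)" for z
  proof (rule K_eqI)
    fix f :: "'h \<Rightarrow> real" assume f: "bounded_linear f"
    show "f (K' (\<i> *s z)) = f (J (K' z))"
      using tendsto_unique[OF F(1) K'[OF f, of "\<i> *s z"]] K'[OF bounded_linear_compose[OF f linear_J], of z]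
      by (simp add: K(5))
  qed
  have S1: "linear S'"
  proof (rule linearI)
    fix x y and r :: real
    show "S' (x + y) = S' x + S' y"
      using tendsto_unique[OF F(1) S'[of "x + y"]] tendsto_add[OF S'[of x] S'[of y]] by (simp add: linear_add[OF S(1)])
    show "S' (r *\<^sub>R x) = r *\<^sub>R S' x"
      using tendsto_unique[OF F(1) S'[of "r *\<^sub>R x"]] tendsto_scaleR[OF tendsto_const S'[of x], of r] by (simp add: linear_scale[OF S(1)])
  qed
  have p: "bounded_linear p" using linear_coord_proj by (simp add: linear_conv_bounded_linear)
  have S2: "p (S' z) = S' z" for z
    using tendsto_unique[OF F(1) bounded_linear.tendsto[OF p S'[of z]]] S'[of z] by (simp add: S(2))
  have S3: "S' (p z) = S' z" for z
    using tendsto_unique[OF F(1) S'[of "p z"]] S'[of z] by (simp add: S(3))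
  have S4: "S' (\<i> *s z) = \<i> *s S' z" for z
    using tendsto_unique[OF F(1) S'[of "\<i> *s z"]] bounded_linear.tendsto[OF bounded_linear_vector_scale S'[of z]] by (simp add: S(4))
  have lim_KS: "((\<lambda>n. V (K n (S n z)) y) \<longlongrightarrow> V (K' (S' z)) y) F" for z y
  proof -
    have "((\<lambda>n. V (K n (S n z - S' z)) y) \<longlongrightarrow> 0) F"
    proof (rule Lim_null_comparison)
      show "\<forall>\<^sub>F n in F. norm (V (K n (S n z - S' z)) y) \<le> norm (S n z - S' z) * (B * norm y * M)"
      proof (rule always_eventually, rule allI)
        fix n
        have "norm (V (K n (S n z - S' z)) y) \<le> norm (K n (S n z - S' z)) * norm y * M" by (rule M(2))
        also have "\<dots> \<le> (B * norm (S n z - S' z)) * norm y * M" using K_bound M(1) by (intro mult_right_mono) auto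
        finally show "norm (V (K n (S n z - S' z)) y) \<le> norm (S n z - S' z) * (B * norm y * M)" by (simp add: mult_ac)
      qed
      show "((\<lambda>n. norm (S n z - S' z) * (B * norm y * M)) \<longlongrightarrow> 0) F"
        by (intro tendsto_mult_left_zero tendsto_norm_zero LIM_zero S')
    qed
    from tendsto_add[OF this K'[OF V.bounded_linear_left[of y], of "S' z"]]
    show ?thesis by (simp add: linear_diff[OF K(1)] V.diff_left)
  qed
  have lim_sk: "((\<lambda>n. sk (K n z) y) \<longlongrightarrow> sk (K' z) y) F" for z y
    by (rule K'[OF sk.bounded_linear_left])
  have lim_in: "((\<lambda>n. K n z \<bullet> y) \<longlongrightarrow> K' z \<bullet> y) F" for z y
    by (rule K'[OF bounded_linear_inner_left])
  have lim_pr: "((\<lambda>n. pr (K n z) \<bullet> a) \<longlongrightarrow> pr (K' z) \<bullet> a) F" for z a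
    by (rule K'[OF bounded_linear_compose[OF bounded_linear_inner_left linear_pr]])
  have eq0: "V (K' (S' z)) y = sk (K' z) y" if "pr y = 0" for z y
  proof -
    have "((\<lambda>n. sk (K n z) y - d n * (K n z \<bullet> y)) \<longlongrightarrow> sk (K' z) y - 0 * (K' z \<bullet> y)) F"
      by (intro tendsto_intros lim_sk lim_in d0)
    with lim_KS[of z y] show ?thesis using that tendsto_unique[OF F(1)] by (simp add: eq)
  qed
  have eq1: "V (K' (S' z)) (em (Q a)) = sk (K' z) (em (Q a)) - pr (K' z) \<bullet> a" for z a
  proof -
    have 1: "V (K n (S n z)) (em (Q a)) + d n * V (K n (S n z)) (em a)
        = sk (K n z) (em (Q a)) + d n * sk (K n z) (em a) - pr (K n z) \<bullet> a
          - d n * (K n z \<bullet> em (Q a) + d n * (K n z \<bullet> em a))" for n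
      using eq[of n z "em (Q a + d n *\<^sub>R a)"] R[of n "pr (K n z)" a]
      by (simp add: pr_em pr.add pr.scaleR em.add em.scaleR V.add_right V.scaleR_right sk.add_right sk.scaleR_right inner_add_right)
    have "((\<lambda>n. V (K n (S n z)) (em (Q a)) + d n * V (K n (S n z)) (em a)) \<longlongrightarrow>
        V (K' (S' z)) (em (Q a)) + 0 * V (K' (S' z)) (em a)) F"
      by (intro tendsto_intros lim_KS d0)
    moreover have "((\<lambda>n. sk (K n z) (em (Q a)) + d n * sk (K n z) (em a) - pr (K n z) \<bullet> a
          - d n * (K n z \<bullet> em (Q a) + d n * (K n z \<bullet> em a))) \<longlongrightarrow>
        sk (K' z) (em (Q a)) + 0 * sk (K' z) (em a) - pr (K' z) \<bullet> a
          - 0 * (K' z \<bullet> em (Q a) + 0 * (K' z \<bullet> em a))) F"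
      by (intro tendsto_add tendsto_diff tendsto_mult lim_sk lim_pr lim_in d0)
    ultimately show ?thesis unfolding 1 using tendsto_unique[OF F(1)] by fastforce
  qed
  have res: "\<exists>r. Q r = pr (K' z) \<and> (\<forall>y. V (K' (S' z)) y = sk (K' z) y - r \<bullet> pr y)" for z
  proof -
    have "bounded_linear (\<lambda>b. sk (K' z) (em b) - V (K' (S' z)) (em b))"
      by (intro bounded_linear_sub bounded_linear_compose[OF sk.bounded_linear_right linear_em]
            bounded_linear_compose[OF V.bounded_linear_right linear_em])
    from riesz_representation[OF this] obtain r where r: "\<And>b. sk (K' z) (em b) - V (K' (S' z)) (em b) = r \<bullet> b" by blast
    have "Q r \<bullet> a = pr (K' z) \<bullet> a" for a using r[of "Q a"] eq1[of z a] by (simp add: Q_sym)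
    then have "Q r = pr (K' z)" using vector_eq_rdot by blast
    moreover have "V (K' (S' z)) y = sk (K' z) y - r \<bullet> pr y" for y
    proof -
      have "pr (y - em (pr y)) = 0" by (simp add: pr.diff pr_em)
      from eq0[OF this, of z] show ?thesis using r[of "pr y"] by (simp add: V.diff_right sk.diff_right)
    qed
    ultimately show ?thesis by blast
  qed
  show ?thesis using K1 K2 K3 K4 K5 S1 S2 S3 S4 res by blast
qed

end

section \<open>Linear algebra over the complex numbers\<close>

lemma vector_scale_Re_Im: "l *s z = Re l *\<^sub>R z + Im l *\<^sub>R (\<i> *s z)" for z :: "complex^'n"
  by (simp add: vec_eq_iff complex_eq_iff)

lemma linear_scale_complex:
  fixes S :: "complex^'n \<Rightarrow> 'h::real_vector"
  assumes "linear S" and "\<And>z. S (\<i> *s z) = J (S z)"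
  shows "S (l *s z) = Re l *\<^sub>R S z + Im l *\<^sub>R J (S z)"
  unfolding vector_scale_Re_Im[of l] by (simp add: linear_add[OF assms(1)] linear_scale[OF assms(1)] assms(2))

text \<open>
  The coefficients are indexed by \<open>X\<close>, so that a repeated value of \<open>f\<close> counts as a linear relation.
\<close>

lemma nontrivial_relation:
  fixes f :: "'a \<Rightarrow> complex^'n"
  assumes "finite X" "card I < card X" and f: "\<And>x j. x \<in> X \<Longrightarrow> j \<notin> I \<Longrightarrow> f x $ j = 0"
  shows "\<exists>c. (\<exists>x\<in>X. c x \<noteq> 0) \<and> (\<Sum>x\<in>X. c x *s f x) = 0"
proof (cases "inj_on f X")
  case True
  define W where "W = {x::complex^'n. \<forall>i. i \<notin> I \<longrightarrow> x $ i = 0}"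
  have "vec.dependent (f ` X)"
  proof (rule ccontr)
    assume ind: "\<not> vec.dependent (f ` X)"
    have "f ` X \<subseteq> W" using f by (auto simp: W_def)
    from vec.independent_card_le_dim[OF this ind] have "card (f ` X) \<le> card I"
      unfolding W_def dim_substandard_cart .
    with assms(2) card_image[OF True] show False by simp
  qed
  then obtain u where "\<exists>v\<in>f ` X. u v \<noteq> 0" "(\<Sum>v\<in>f ` X. u v *s v) = 0"
    using vec.dependent_finite[of "f ` X"] assms(1) by auto
  then show ?thesis by (intro exI[of _ "u \<circ> f"]) (simp add: sum.reindex[OF True])
next
  case False
  then obtain x y where xy: "x \<in> X" "y \<in> X" "x \<noteq> y" "f x = f y" by (auto simp: inj_on_def)
  define c where "c w = (if w = x then 1 else if w = y then -1 else 0 :: complex)" for w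
  have "(\<Sum>w\<in>X. c w *s f w) = (\<Sum>w\<in>{x,y}. c w *s f w)"
    using assms(1) xy by (intro sum.mono_neutral_right) (auto simp: c_def)
  also have "\<dots> = 0" using xy(3,4) by (simp add: c_def vec_eq_iff)
  finally show ?thesis using xy(1) by (intro exI[of _ c]) (auto simp: c_def)
qed

text \<open>
  The vector \<open>q(S) y\<close> by Horner's scheme.
\<close>

definition poly_act :: "(complex^'n \<Rightarrow> complex^'n) \<Rightarrow> complex^'n \<Rightarrow> complex poly \<Rightarrow> complex^'n" where
  "poly_act S y q = fold_coeffs (\<lambda>a w. a *s y + S w) q 0"

lemma poly_act_0 [simp]: "poly_act S y 0 = 0"
  by (simp add: poly_act_def)

lemma poly_act_pCons [simp]: "S 0 = 0 \<Longrightarrow> poly_act S y (pCons a q) = a *s y + S (poly_act S y q)"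
  by (cases "q = 0 \<and> a = 0") (auto simp: poly_act_def)

text \<open>
  Let \<open>q\<close> be a polynomial of least degree with \<open>q(S) y = 0\<close>. It has a root \<open>l\<close>, and \<open>q / (X - l)\<close>
  applied to \<open>y\<close> is an eigenvector. It is obtained from \<open>y\<close> by operations under which \<open>Y\<close> is closed.
\<close>

lemma invariant_subspace_eigenvector:
  fixes S :: "complex^'n \<Rightarrow> complex^'n"
  assumes S: "linear S" "\<And>z. S (\<i> *s z) = \<i> *s S z"
    and Y: "\<And>x y. x \<in> Y \<Longrightarrow> y \<in> Y \<Longrightarrow> x + y \<in> Y" "\<And>l x. x \<in> Y \<Longrightarrow> l *s x \<in> Y" "\<And>x. x \<in> Y \<Longrightarrow> S x \<in> Y"
    and y: "y \<in> Y" "y \<noteq> 0"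
  shows "\<exists>x\<in>Y. \<exists>l. x \<noteq> 0 \<and> S x = l *s x"
proof -
  have S_scale: "S (l *s z) = l *s S z" for l z
    using linear_scale_complex[OF S] by (simp add: vec_eq_iff complex_eq_iff)
  have S0: "S 0 = 0" by (rule linear_0[OF S(1)])
  have zero: "0 \<in> Y" using Y(2)[OF y(1), of 0] by simp
  define A where "A = poly_act S y"
  have A_pCons: "A (pCons a q) = a *s y + S (A q)" for a q by (simp add: A_def S0)
  have A0: "A 0 = 0" by (simp add: A_def)
  have A_Y: "A q \<in> Y" for q by (induction q) (auto simp: A0 A_pCons zero intro!: Y y)
  have A_add: "A (q + r) = A q + A r" for q r
  proof (induction q r rule: poly_induct2)
    case (pCons a p b q)
    then show ?case by (simp add: A_pCons linear_add[OF S(1)] vector_sadd_rdistrib add_ac)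
  qed (simp add: A0)
  have A_smult: "A (smult l q) = l *s A q" for l q
    by (induction q) (simp_all add: A0 A_pCons S_scale vector_add_ldistrib vector_smult_assoc)
  have A_monom: "A (monom l n) = l *s (S ^^ n) y" for l n
  proof (induction n)
    case 0
    show ?case by (simp only: monom_0 A_pCons A0 S0) simp
  next
    case (Suc n)
    show ?case by (simp only: monom_Suc A_pCons Suc S_scale) simp
  qed
  have A_sum: "A (\<Sum>n\<in>X. q n) = (\<Sum>n\<in>X. A (q n))" for X and q :: "nat \<Rightarrow> complex poly"
    by (induction X rule: infinite_finite_induct) (simp_all add: A0 A_add)
  define N where "N = CARD('n)"
  obtain c where c: "\<exists>n\<in>{..N}. c n \<noteq> (0::complex)" "(\<Sum>n\<in>{..N}. c n *s (S ^^ n) y) = 0"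
    using nontrivial_relation[of "{..N}" UNIV "\<lambda>n. (S ^^ n) y"] by (auto simp: N_def)
  define q0 where "q0 = (\<Sum>n\<in>{..N}. monom (c n) n)"
  have "A q0 = 0" using c(2) by (simp add: q0_def A_sum A_monom)
  moreover have "q0 \<noteq> 0"
  proof -
    obtain n where n: "n \<le> N" "c n \<noteq> 0" using c(1) by auto
    have "coeff q0 n = (\<Sum>k\<le>N. if k = n then c k else 0)" by (simp add: q0_def coeff_sum)
    also have "\<dots> = c n" using n(1) by simp
    finally show ?thesis using n(2) by auto
  qed
  ultimately have "\<exists>q. q \<noteq> 0 \<and> A q = 0" by blast
  then obtain q where q: "q \<noteq> 0" "A q = 0" "\<And>r. r \<noteq> 0 \<Longrightarrow> A r = 0 \<Longrightarrow> degree q \<le> degree r"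
    using ex_has_least_nat[of "\<lambda>q. q \<noteq> 0 \<and> A q = 0" _ degree] by blast
  have "degree q \<noteq> 0"
  proof
    assume "degree q = 0"
    then obtain a where a: "q = [:a:]" by (auto elim: degree_eq_zeroE)
    with q y(2) show False by (simp add: A_pCons A0 S0)
  qed
  then have "\<not> constant (poly q)" by (simp add: constant_degree)
  then obtain l where "poly q l = 0" using fundamental_theorem_of_algebra by blast
  then obtain r where r: "q = [:-l, 1:] * r" by (auto simp: poly_eq_0_iff_dvd elim: dvdE)
  have r0: "r \<noteq> 0" using q(1) r by auto
  have "degree q = Suc (degree r)" unfolding r by (subst degree_mult_eq) (use r0 in auto)
  then have "A r \<noteq> 0" using q(3)[OF r0] by auto
  moreover have "S (A r) = l *s A r"
  proof -
    have "q = smult (-l) r + pCons 0 r" unfolding r by simp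
    then have "0 = (-l) *s A r + S (A r)" using q(2) by (simp only: A_add A_smult A_pCons) simp
    then show ?thesis by (simp add: vec_eq_iff eq_neg_iff_add_eq_0 add.commute)
  qed
  ultimately show ?thesis using A_Y by blast
qed

section \<open>The exponential of a linear map\<close>

text \<open>
  The exponential \<open>exp (t S) z\<close>.
\<close>

definition flow :: "('a \<Rightarrow> 'a) \<Rightarrow> real \<Rightarrow> 'a \<Rightarrow> 'a::euclidean_space" where
  "flow S t z = (\<Sum>n. (t ^ n / fact n) *\<^sub>R (S ^^ n) z)"

lemma funpow_norm_bound:
  fixes S :: "'a::real_normed_vector \<Rightarrow> 'a"
  assumes "\<And>x. norm (S x) \<le> norm x * M" "M > 0"
  shows "norm ((S ^^ n) z) \<le> M ^ n * norm z"
proof (induction n)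
  case (Suc n)
  have "norm ((S ^^ Suc n) z) \<le> norm ((S ^^ n) z) * M" using assms(1) by simp
  also have "\<dots> \<le> (M ^ n * norm z) * M" using Suc assms(2) by (intro mult_right_mono) auto
  finally show ?case by (simp add: mult_ac)
qed simp

context
  fixes S :: "'a \<Rightarrow> 'a::euclidean_space"
  assumes S: "linear S"
begin

lemma flow_summable: "summable (\<lambda>n. (t ^ n / fact n) *\<^sub>R (S ^^ n) z)"
proof -
  obtain M where M: "M > 0" "\<And>x. norm (S x) \<le> norm x * M"
    using bounded_linear.pos_bounded[of S] S by (auto simp: linear_conv_bounded_linear)
  have "summable (\<lambda>n. (\<bar>t\<bar> * M) ^ n /\<^sub>R fact n * norm z)"
    by (intro summable_mult2 summable_exp_generic)
  then show ?thesis
  proof (rule summable_comparison_test'[where N=0])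
    fix n
    have "norm ((t ^ n / fact n) *\<^sub>R (S ^^ n) z) = \<bar>t\<bar> ^ n / fact n * norm ((S ^^ n) z)"
      by (simp add: power_abs)
    also have "\<dots> \<le> \<bar>t\<bar> ^ n / fact n * (M ^ n * norm z)"
      using funpow_norm_bound[OF M(2,1)] by (intro mult_left_mono) auto
    finally show "norm ((t ^ n / fact n) *\<^sub>R (S ^^ n) z) \<le> (\<bar>t\<bar> * M) ^ n /\<^sub>R fact n * norm z"
      by (simp add: power_mult_distrib field_simps)
  qed
qed

lemma flow_0: "flow S 0 z = z"
proof -
  have "(\<Sum>n. (0 ^ n / fact n) *\<^sub>R (S ^^ n) z) = (\<Sum>n\<in>{0}. (0 ^ n / fact n :: real) *\<^sub>R (S ^^ n) z)"
    by (rule suminf_finite) auto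
  then show ?thesis by (simp add: flow_def)
qed

lemma flow_bounded_linear:
  assumes f: "bounded_linear f" and comm: "\<And>x. f (S x) = S' (f x)"
  shows "f (flow S t z) = (\<Sum>n. (t ^ n / fact n) *\<^sub>R (S' ^^ n) (f z))"
proof -
  have pow: "f ((S ^^ n) z) = (S' ^^ n) (f z)" for n by (induction n) (simp_all add: comm)
  show ?thesis unfolding flow_def
    using bounded_linear.suminf[OF f flow_summable[of t z]]
    by (simp add: linear_scale[OF bounded_linear.linear[OF f]] pow)
qed

lemma flow_S: "flow S t (S z) = S (flow S t z)"
  using flow_bounded_linear[of S S t z] S by (simp add: flow_def linear_conv_bounded_linear)

lemma flow_add: "flow S t (x + y) = flow S t x + flow S t y"
  unfolding flow_def suminf_add[OF flow_summable flow_summable]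
  by (simp add: linear_add[OF linear_funpow[OF S]] scaleR_add_right)

lemma flow_has_derivative:
  "((\<lambda>t. flow S t z) has_vector_derivative S (flow S t z)) (at t within A)"
proof -
  have D: "((\<lambda>t. flow S t z \<bullet> b) has_field_derivative S (flow S t z) \<bullet> b) (at t)" for b
  proof -
    define c where "c n = ((S ^^ n) z \<bullet> b) / fact n" for n
    have inner: "flow S s x \<bullet> b = (\<Sum>n. ((S ^^ n) x \<bullet> b) / fact n * s ^ n)" for s x
      unfolding flow_def using bounded_linear.suminf[OF bounded_linear_inner_left flow_summable[of s x], of b]
      by (simp add: mult.commute)
    have "summable (\<lambda>n. c n * s ^ n)" for s
      using bounded_linear.summable[OF bounded_linear_inner_left flow_summable[of s z], of b]
      by (simp add: c_def mult.commute)
    from termdiffs_strong_converges_everywhere[OF this]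
    have "((\<lambda>s. \<Sum>n. c n * s ^ n) has_field_derivative (\<Sum>n. diffs c n * t ^ n)) (at t)" .
    moreover have "diffs c n = ((S ^^ n) (S z) \<bullet> b) / fact n" for n
      by (simp add: diffs_def c_def funpow_swap1 field_simps del: of_nat_Suc)
    ultimately show ?thesis using inner[of _ z] inner[of t "S z"] by (simp add: c_def flow_S)
  qed
  have "((\<lambda>t. flow S t z \<bullet> b) has_derivative (\<lambda>h. (h *\<^sub>R S (flow S t z)) \<bullet> b)) (at t)" for b
    using D[of b] unfolding has_field_derivative_def by (rule has_derivative_eq_rhs) (auto simp: fun_eq_iff)
  then have "((\<lambda>t. flow S t z) has_vector_derivative S (flow S t z)) (at t)"
    unfolding has_vector_derivative_def by (subst has_derivative_componentwise_within) blast
  then show ?thesis by (rule has_vector_derivative_at_within)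
qed

end

lemma flow_eigenvector:
  fixes S :: "complex^'n \<Rightarrow> complex^'n"
  assumes S: "linear S" "\<And>z. S (\<i> *s z) = \<i> *s S z" and eigen: "S x = l *s x"
  shows "flow S t x = exp (of_real t * l) *s x"
proof -
  have S_scale: "S (l *s z) = l *s S z" for l z
    using linear_scale_complex[OF S] by (simp add: vec_eq_iff complex_eq_iff)
  have pow: "(S ^^ n) x = l ^ n *s x" for n
    by (induction n) (simp_all add: S_scale eigen vector_smult_assoc mult.commute)
  have bl: "bounded_linear (\<lambda>c. c *s x)"
    unfolding linear_conv_bounded_linear[symmetric] by (rule linearI) (simp_all add: vec_eq_iff algebra_simps)
  have "exp (of_real t * l) *s x = (\<Sum>n. ((of_real t * l) ^ n /\<^sub>R fact n) *s x)"
    unfolding exp_def by (rule bounded_linear.suminf[OF bl summable_exp_generic])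
  also have "\<dots> = flow S t x"
    unfolding flow_def pow by (intro suminf_cong) (simp add: vec_eq_iff, simp add: power_mult_distrib scaleR_conv_of_real field_simps)
  finally show ?thesis by simp
qed

section \<open>Definiteness and growth\<close>

lemma nonincreasing_on_halfline:
  fixes f :: "real \<Rightarrow> real"
  assumes d: "\<And>t. t \<ge> 0 \<Longrightarrow> (f has_real_derivative f' t) (at t within {0..})"
    and "\<And>t. t \<ge> 0 \<Longrightarrow> f' t \<le> 0" and "t \<ge> 0"
  shows "f t \<le> f 0"
proof (cases "t = 0")
  case False
  then have "0 < t" using \<open>t \<ge> 0\<close> by simp
  show ?thesis
  proof (rule DERIV_nonpos_imp_decreasing_open[OF less_imp_le[OF \<open>0 < t\<close>]])
    fix x assume "0 < x" "x < t"
    then have "at x within {0..} = at x" by (intro at_within_interior) auto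
    then show "\<exists>y. (f has_real_derivative y) (at x) \<and> y \<le> 0"
      using d[of x] assms(2)[of x] \<open>0 < x\<close> by auto
  next
    show "continuous_on {0..t} f"
      using DERIV_continuous_on[of "{0..}" f f'] d continuous_on_subset[of "{0..}" f "{0..t}"] by auto
  qed
qed simp

text \<open>
  The additional hypothesis excludes eigenvectors in the cone \<open>V x x \<le> 0\<close> that are not damped. Here
  \<open>a + b \<i>\<close> is the eigenvalue.
\<close>

locale growing_pontryagin = dissipative_pontryagin +
  assumes no_neutral: "pr x = 0 \<Longrightarrow> V x x \<le> 0 \<Longrightarrow> (\<And>y. V (a *\<^sub>R x + b *\<^sub>R J x) y = sk x y) \<Longrightarrow> x = 0"
begin

definition invariant_graph_of :: "(complex^'b \<Rightarrow> 'a) \<Rightarrow> (complex^'b \<Rightarrow> complex^'b) \<Rightarrow> bool" where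
  "invariant_graph_of K S \<longleftrightarrow> linear K \<and> (\<forall>z. K (p z) = K z) \<and> (\<forall>z. \<pi> (K z) = p z) \<and> (\<forall>z. V (K z) (K z) \<le> 0)
     \<and> (\<forall>z. K (\<i> *s z) = J (K z)) \<and> linear S \<and> (\<forall>z. p (S z) = S z) \<and> (\<forall>z. S (p z) = S z)
     \<and> (\<forall>z. S (\<i> *s z) = \<i> *s S z)
     \<and> (\<forall>z. \<exists>r. Q r = pr (K z) \<and> (\<forall>y. V (K (S z)) y = sk (K z) y - r \<bullet> pr y))"

lemma exists_invariant_graph: "\<exists>K S. invariant_graph_of K S"
  unfolding invariant_graph_of_def by (rule invariant_graph)

text \<open>
  The Cauchy--Schwarz inequality for the semidefinite form \<open>Q a \<bullet> b\<close>.
\<close>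

lemma Q_eq_0I: "Q r = 0" if "r \<bullet> Q r = 0"
proof -
  define m where "m = Q r \<bullet> Q r"
  define k where "k = Q (Q r) \<bullet> Q r + 1"
  have k: "k > 0" using Q_nonneg[of "Q r"] by (simp add: k_def)
  have *: "0 \<le> 2 * t * m + t\<^sup>2 * (k - 1)" for t
  proof -
    have "0 \<le> Q (r + t *\<^sub>R Q r) \<bullet> (r + t *\<^sub>R Q r)" by (rule Q_nonneg)
    also have "\<dots> = Q r \<bullet> r + t * (Q r \<bullet> Q r) + t * (Q (Q r) \<bullet> r + t * (Q (Q r) \<bullet> Q r))"
      by (simp add: Q.add Q.scaleR inner_add_left inner_add_right algebra_simps)
    also have "\<dots> = 2 * t * m + t\<^sup>2 * (k - 1)"
      using that inner_commute[of "Q r" r] Q_sym[of "Q r" r]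
      by (simp add: m_def k_def power2_eq_square algebra_simps)
    finally show ?thesis .
  qed
  have "0 \<le> 2 * (- m / k) * m + (- m / k)\<^sup>2 * (k - 1)" by (rule *)
  also have "\<dots> \<le> 2 * (- m / k) * m + (- m / k)\<^sup>2 * k" by (intro add_left_mono mult_left_mono) auto
  also have "\<dots> = - (m\<^sup>2 / k)" using k by (simp add: power2_eq_square field_simps)
  finally have "m\<^sup>2 / k \<le> 0" by simp
  with k have "m = 0" by (simp add: divide_le_0_iff)
  then show ?thesis by (simp add: m_def)
qed

lemma V_J_self: "V (J x) x = 0"
  using V_J_left[of x x] V_sym[of "J x" x] by simp

lemma sk_self: "sk x x = 0"
  using sk_anti[of x x] by simp

context
  fixes K S assumes graph: "invariant_graph_of K S"
begin

lemma K: "linear K" "K (p z) = K z" "\<pi> (K z) = p z" "V (K z) (K z) \<le> 0" "K (\<i> *s z) = J (K z)"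
  and S: "linear S" "p (S z) = S z" "S (p z) = S z" "S (\<i> *s z) = \<i> *s S z"
  using graph by (auto simp: invariant_graph_of_def)

lemma K_equation: "\<exists>r. Q r = pr (K z) \<and> (\<forall>y. V (K (S z)) y = sk (K z) y - r \<bullet> pr y)"
  using graph by (simp add: invariant_graph_of_def)

lemma S_scale: "S (l *s z) = l *s S z"
  using linear_scale_complex[OF S(1) S(4)] by (simp add: vec_eq_iff complex_eq_iff)

lemma K_scale: "K (l *s z) = Re l *\<^sub>R K z + Im l *\<^sub>R J (K z)"
  by (rule linear_scale_complex[OF K(1) K(5)])

lemma no_neutral_eigenvector:
  assumes eigen: "S z = l *s z" and "pr (K z) = 0"
  shows "p z = 0"
proof -
  obtain r where r: "Q r = pr (K z)" "\<forall>y. V (K (S z)) y = sk (K z) y - r \<bullet> pr y" using K_equation by blast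
  have "r = 0" using r(1) assms(2) Q_inj by simp
  then have "V (Re l *\<^sub>R K z + Im l *\<^sub>R J (K z)) y = sk (K z) y" for y
    using r(2)[rule_format, of y] by (simp add: eigen K_scale)
  from no_neutral[OF assms(2) K(4) this] have "K z = 0" .
  then show ?thesis using K(3)[of z] by (simp add: \<pi>.zero)
qed

text \<open>
  If \<open>V\<close> were only semidefinite on the graph, its null vectors would form a nonzero subspace \<open>Y\<close>, which
  is \<open>V\<close>-orthogonal to the whole graph. Therefore the energy has derivative zero along the motion of a
  null vector, so that null vectors are not damped, and for undamped vectors orthogonality to the graph
  passes from \<open>K x\<close> to \<open>K (S x)\<close>. An eigenvector in the invariant subspace \<open>Y\<close> contradicts the absence
  of neutral motions.
\<close>

lemma graph_negative: "V (K z) (K z) < 0" if "p z \<noteq> 0"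
proof (rule ccontr)
  assume "\<not> V (K z) (K z) < 0"
  with K(4)[of z] have Vz: "V (K z) (K z) = 0" by simp
  define Y where "Y = {z. V (K z) (K z) = 0 \<and> p z = z}"
  have isotropic: "V (K x) (K y) = 0" if "x \<in> Y" for x y
  proof -
    have *: "2 * t * V (K x) (K y) + V (K y) (K y) \<le> 0" for t
    proof -
      have "V (K (t *\<^sub>R x + y)) (K (t *\<^sub>R x + y)) \<le> 0" by (rule K(4))
      then show ?thesis using that V_sym[of "K y" "K x"]
        by (simp add: Y_def linear_add[OF K(1)] linear_scale[OF K(1)] V.add_left V.add_right V.scaleR_left V.scaleR_right)
    qed
    show ?thesis
    proof (rule ccontr)
      assume "V (K x) (K y) \<noteq> 0"
      then have "2 * ((1 - V (K y) (K y)) / (2 * V (K x) (K y))) * V (K x) (K y) = 1 - V (K y) (K y)" by simp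
      with *[of "(1 - V (K y) (K y)) / (2 * V (K x) (K y))"] show False by linarith
    qed
  qed
  have Y_dest: "pr (K x) = 0" "S x \<in> Y" if "x \<in> Y" for x
  proof -
    obtain r where r: "Q r = pr (K x)" "\<forall>y. V (K (S x)) y = sk (K x) y - r \<bullet> pr y" using K_equation by blast
    have "V (K (S x)) (K x) = 0" using isotropic[OF that, of "S x"] by (simp add: V_sym)
    then have "r \<bullet> Q r = 0" using r(2)[rule_format, of "K x"] by (simp add: sk_self r(1))
    then have 0: "Q r = 0" by (rule Q_eq_0I)
    then show pr0: "pr (K x) = 0" by (simp add: r(1))
    have "r = 0" using 0 by (rule Q_inj)
    have "V (K (S x)) (K y) = 0" for y
    proof -
      obtain r' where r': "\<forall>u. V (K (S y)) u = sk (K y) u - r' \<bullet> pr u" using K_equation by blast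
      have "V (K (S y)) (K x) = 0" using isotropic[OF that, of "S y"] by (simp add: V_sym)
      then have "sk (K y) (K x) = 0" using r'[rule_format, of "K x"] by (simp add: pr0)
      then show ?thesis using r(2)[rule_format, of "K y"] sk_anti[of "K x" "K y"] \<open>r = 0\<close> by simp
    qed
    then show "S x \<in> Y" by (simp add: Y_def S(2))
  qed
  have "\<exists>x\<in>Y. \<exists>l. x \<noteq> 0 \<and> S x = l *s x"
  proof (rule invariant_subspace_eigenvector[OF S(1) S(4)])
    fix x y assume "x \<in> Y" "y \<in> Y"
    then show "x + y \<in> Y"
      using isotropic[of x y] V_sym[of "K x" "K y"]
      by (simp add: Y_def linear_add[OF K(1)] V.add_left V.add_right p_add)
  next
    fix l x assume "x \<in> Y"
    then show "l *s x \<in> Y"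
      using V_J_self[of "K x"] V_sym[of "K x" "J (K x)"] V_J[of "K x" "K x"]
      by (simp add: Y_def K_scale coord_proj_scale V.add_left V.add_right V.scaleR_left V.scaleR_right)
  next
    show "p z \<in> Y" using Vz by (simp add: Y_def K(2))
  qed (use that Y_dest(2) in auto)
  then obtain x l where x: "x \<in> Y" "x \<noteq> 0" "S x = l *s x" by blast
  from no_neutral_eigenvector[OF x(3) Y_dest(1)[OF x(1)]] x(1,2) show False by (simp add: Y_def)
qed

text \<open>
  Testing the equation with the eigenvector itself gives \<open>Re l * V (K z) (K z) = - (r \<bullet> Q r)\<close>, and both
  \<open>V (K z) (K z)\<close> and the right-hand side are negative.
\<close>

lemma eigenvalue_Re_pos:
  assumes eigen: "S z = l *s z" and z: "p z \<noteq> 0"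
  shows "Re l > 0"
proof -
  obtain r where r: "Q r = pr (K z)" "\<forall>y. V (K (S z)) y = sk (K z) y - r \<bullet> pr y" using K_equation by blast
  have "Re l * V (K z) (K z) = - (r \<bullet> Q r)"
    using r(2)[rule_format, of "K z"] by (simp add: eigen K_scale V.add_left V.scaleR_left V_J_self sk_self r(1))
  moreover have "r \<bullet> Q r > 0"
  proof (rule ccontr)
    assume "\<not> r \<bullet> Q r > 0"
    then have "r \<bullet> Q r = 0" using Q_nonneg[of r] inner_commute[of r "Q r"] by linarith
    from Q_eq_0I[OF this] have "pr (K z) = 0" by (simp add: r(1))
    from no_neutral_eigenvector[OF eigen this] z show False by simp
  qed
  ultimately have "Re l * V (K z) (K z) < 0" by simp
  with graph_negative[OF z] show ?thesis by (simp add: mult_less_0_iff)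
qed

text \<open>
  The initial values of bounded orbits form an invariant subspace. If it were not zero, it would
  contain an eigenvector, whose orbit grows exponentially.
\<close>

lemma orbit_unbounded:
  assumes z: "p z = z" "z \<noteq> 0"
  shows "\<not> bounded ((\<lambda>t. flow S t z) ` {0..})"
proof
  assume b: "bounded ((\<lambda>t. flow S t z) ` {0..})"
  define Y where "Y = {z. p z = z \<and> bounded ((\<lambda>t. flow S t z) ` {0..})}"
  have bl: "bounded_linear S" using S(1) by (simp add: linear_conv_bounded_linear)
  have "\<exists>x\<in>Y. \<exists>l. x \<noteq> 0 \<and> S x = l *s x"
  proof (rule invariant_subspace_eigenvector[OF S(1) S(4)])
    fix x y assume "x \<in> Y" "y \<in> Y"
    then show "x + y \<in> Y"
      using bounded_plus_comp[of "\<lambda>t. flow S t x" "{0..}" "\<lambda>t. flow S t y"]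
      by (simp add: Y_def p_add flow_add[OF S(1)])
  next
    fix l x assume x: "x \<in> Y"
    have "flow S t (l *s x) = l *s flow S t x" for t
      using flow_bounded_linear[OF S(1) bounded_linear_vector_scale[of l], of S t x] by (simp add: S_scale flow_def)
    then have "(\<lambda>t. flow S t (l *s x)) ` {0..} = (\<lambda>x. l *s x) ` (\<lambda>t. flow S t x) ` {0..}" by (simp add: image_image)
    then have "bounded ((\<lambda>t. flow S t (l *s x)) ` {0..})"
      using x bounded_linear_image[OF _ bounded_linear_vector_scale[of l], of "(\<lambda>t. flow S t x) ` {0..}"] unfolding Y_def by simp
    then show "l *s x \<in> Y" using x by (simp add: Y_def coord_proj_scale)
  next
    fix x assume x: "x \<in> Y"
    have "(\<lambda>t. flow S t (S x)) ` {0..} = S ` (\<lambda>t. flow S t x) ` {0..}" by (simp add: image_image flow_S[OF S(1)])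
    then have "bounded ((\<lambda>t. flow S t (S x)) ` {0..})"
      using x bounded_linear_image[OF _ bl, of "(\<lambda>t. flow S t x) ` {0..}"] unfolding Y_def by simp
    then show "S x \<in> Y" by (simp add: Y_def S(2))
  qed (use z b in \<open>auto simp: Y_def\<close>)
  then obtain x l where x: "x \<in> Y" "x \<noteq> 0" "S x = l *s x" by blast
  have "Re l > 0" using eigenvalue_Re_pos[OF x(3)] x(1,2) by (simp add: Y_def)
  obtain B where B: "\<And>t. t \<ge> 0 \<Longrightarrow> norm (flow S t x) \<le> B"
    using x(1) by (auto simp: Y_def bounded_iff)
  define t where "t = (\<bar>B\<bar> / norm x) / Re l"
  have "t \<ge> 0" using \<open>Re l > 0\<close> by (simp add: t_def)
  have "norm (flow S t x) = exp (t * Re l) * norm x"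
    by (simp add: flow_eigenvector[OF S(1) S(4) x(3)] norm_vector_scalar_mult norm_exp_eq_Re)
  moreover have "t * Re l = \<bar>B\<bar> / norm x" using \<open>Re l > 0\<close> by (simp add: t_def)
  moreover have "(1 + \<bar>B\<bar> / norm x) * norm x \<le> exp (\<bar>B\<bar> / norm x) * norm x"
    by (intro mult_right_mono exp_ge_add_one_self) auto
  moreover have "(1 + \<bar>B\<bar> / norm x) * norm x = norm x + \<bar>B\<bar>" using x(2) by (simp add: field_simps)
  ultimately have "norm x + \<bar>B\<bar> \<le> B" using B[OF \<open>t \<ge> 0\<close>] by simp
  moreover have "norm x > 0" using x(2) by simp
  ultimately show False by linarith
qed

text \<open>
  For \<open>x\<close> orthogonal to the graph, \<open>x - K (\<pi> x)\<close> has no negative coordinate, and \<open>V x x\<close> is the sum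
  of its energy and of \<open>- V (K (\<pi> x)) (K (\<pi> x))\<close>, which is positive.
\<close>

lemma positive_on_complement:
  "\<exists>d>0. \<forall>x. (\<forall>z. V x (K z) = 0) \<longrightarrow> d * (norm x)\<^sup>2 \<le> V x x"
proof -
  have Kb: "bounded_linear K" using K(1) by (simp add: linear_conv_bounded_linear)
  interpret K: bounded_linear K by (rule Kb)
  have pb: "bounded_linear p" using linear_coord_proj by (simp add: linear_conv_bounded_linear)
  \<comment> \<open>the first summand makes \<open>f\<close> definite on the kernel of \<open>p\<close> as well, where \<open>K\<close> vanishes\<close>
  define f where "f z = (norm (z - p z))\<^sup>2 - V (K z) (K z)" for z
  have "continuous_on UNIV f" unfolding f_def[abs_def]
    by (intro continuous_intros V.continuous_on linear_continuous_on Kb pb)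
  moreover have "f (r *\<^sub>R z) = r\<^sup>2 * f z" for r z
    using linear_scale[OF linear_coord_proj, of I r z]
    by (simp add: f_def K.scaleR V.scaleR_left V.scaleR_right scaleR_diff_right[symmetric] power_mult_distrib)
      (simp add: power2_eq_square algebra_simps)
  moreover have "0 < f z" if "z \<noteq> 0" for z
  proof (cases "p z = 0")
    case True
    have "0 < (norm z)\<^sup>2" using that by simp
    then show ?thesis using K(4)[of z] unfolding f_def True diff_zero by linarith
  next
    case False
    then show ?thesis using graph_negative[OF False] zero_le_power2[of "norm (z - p z)"] unfolding f_def by linarith
  qed
  ultimately obtain m where m: "m > 0" "\<And>z. m * (norm z)\<^sup>2 \<le> f z"
    using positive_form_coercive[of f] by blast
  have low: "m * (norm z)\<^sup>2 \<le> - V (K z) (K z)" if "p z = z" for z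
    using m(2)[of z] that by (simp add: f_def)
  obtain L where L: "L > 0" "\<And>z. norm (K z) \<le> norm z * L" using K.pos_bounded by blast
  define d where "d = min c m / (2 + 2 * L\<^sup>2)"
  have L2: "2 + 2 * L\<^sup>2 > 0" by (simp add: add_pos_nonneg)
  have "d * (norm x)\<^sup>2 \<le> V x x" if x: "\<forall>z. V x (K z) = 0" for x
  proof -
    define q where "q = x - K (\<pi> x)"
    have "\<pi> q = 0" by (simp add: q_def \<pi>.diff K(3) proj_\<pi>)
    from V_pos[OF this] have "c * (norm q)\<^sup>2 \<le> V q q" .
    moreover have "V q q = V x x + V (K (\<pi> x)) (K (\<pi> x))"
      using x V_sym[of "K (\<pi> x)" x] by (simp add: q_def V.diff_left V.diff_right)
    moreover have "m * (norm (\<pi> x))\<^sup>2 \<le> - V (K (\<pi> x)) (K (\<pi> x))" by (rule low[OF proj_\<pi>])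
    ultimately have 1: "c * (norm q)\<^sup>2 + m * (norm (\<pi> x))\<^sup>2 \<le> V x x" by linarith
    have "norm x \<le> norm q + norm (K (\<pi> x))"
      using norm_triangle_ineq[of q "K (\<pi> x)"] by (simp add: q_def)
    then have "norm x \<le> norm q + L * norm (\<pi> x)" using L(2)[of "\<pi> x"] by (simp add: mult.commute)
    from square_le_sum_squares[OF norm_ge_zero this]
    have "d * (norm x)\<^sup>2 \<le> d * ((2 + 2 * L\<^sup>2) * ((norm q)\<^sup>2 + (norm (\<pi> x))\<^sup>2))"
      using L2 c_pos m(1) by (intro mult_left_mono) (auto simp: d_def)
    also have "\<dots> = min c m * (norm q)\<^sup>2 + min c m * (norm (\<pi> x))\<^sup>2" using L2 by (simp add: d_def distrib_left)
    also have "\<dots> \<le> c * (norm q)\<^sup>2 + m * (norm (\<pi> x))\<^sup>2" by (intro add_mono mult_right_mono) auto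
    finally show ?thesis using 1 by linarith
  qed
  moreover have "d > 0" using c_pos m(1) L2 by (simp add: d_def)
  ultimately show ?thesis by blast
qed

end

end

section \<open>Boundedness on the complement of the adjoint subspace\<close>

text \<open>
  Gronwall's argument for the square of the norm.
\<close>

lemma linear_system_zero:
  fixes x :: "real \<Rightarrow> 'e::euclidean_space"
  assumes S: "linear S"
    and x: "\<And>t z. t \<ge> 0 \<Longrightarrow> ((\<lambda>t. x t \<bullet> z) has_real_derivative x t \<bullet> S z) (at t within {0..})"
    and "x 0 = 0" and "t \<ge> 0"
  shows "x t = 0"
proof -
  obtain M where M: "M > 0" "\<And>z. norm (S z) \<le> norm z * M"
    using bounded_linear.pos_bounded[of S] S by (auto simp: linear_conv_bounded_linear)
  define N where "N t = (\<Sum>b\<in>Basis. (x t \<bullet> b)\<^sup>2)" for t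
  define N' where "N' t = (\<Sum>b\<in>Basis. 2 * (x t \<bullet> b) * (x t \<bullet> S b))" for t
  have N_norm: "N t = (norm (x t))\<^sup>2" for t
    unfolding N_def power2_norm_eq_inner euclidean_inner[of "x t" "x t"] by (simp add: power2_eq_square)
  have dN: "(N has_real_derivative N' t) (at t within {0..})" if "t \<ge> 0" for t
    unfolding N_def[abs_def] N'_def
    by (rule DERIV_sum) (auto intro!: derivative_eq_intros x that)
  define A where "A = 2 * M * real (DIM('e))"
  have bound: "N' t \<le> A * N t" for t
  proof -
    have "N' t \<le> (\<Sum>b\<in>(Basis::'e set). 2 * M * N t)"
      unfolding N'_def
    proof (rule sum_mono)
      fix b :: 'e assume b: "b \<in> Basis"
      have "(x t \<bullet> b) * (x t \<bullet> S b) \<le> \<bar>x t \<bullet> b\<bar> * \<bar>x t \<bullet> S b\<bar>" by (simp add: abs_mult[symmetric])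
      also have "\<dots> \<le> norm (x t) * (norm (x t) * norm (S b))"
        using Cauchy_Schwarz_ineq2[of "x t" b] Cauchy_Schwarz_ineq2[of "x t" "S b"] b by (intro mult_mono) auto
      also have "\<dots> \<le> norm (x t) * (norm (x t) * M)" using M(2)[of b] b by (intro mult_left_mono) auto
      finally show "2 * (x t \<bullet> b) * (x t \<bullet> S b) \<le> 2 * M * N t" by (simp add: N_norm power2_eq_square mult_ac)
    qed
    then show ?thesis by (simp add: A_def mult_ac)
  qed
  have "exp (- A * t) * N t \<le> exp (- A * 0) * N 0"
  proof (rule nonincreasing_on_halfline[OF _ _ \<open>t \<ge> 0\<close>])
    fix t :: real assume "t \<ge> 0"
    show "((\<lambda>t. exp (- A * t) * N t) has_real_derivative exp (- A * t) * (N' t - A * N t)) (at t within {0..})"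
      by (auto intro!: derivative_eq_intros dN \<open>t \<ge> 0\<close> simp: algebra_simps)
    show "exp (- A * t) * (N' t - A * N t) \<le> 0"
      using bound[of t] by (simp add: mult_le_0_iff)
  qed
  then have "N t \<le> 0" using \<open>x 0 = 0\<close> by (simp add: N_norm mult_le_0_iff)
  then show ?thesis by (simp add: N_norm)
qed

context growing_pontryagin begin

text \<open>
  Changing the sign of the conservative part gives the adjoint with respect to \<open>V\<close>; the hypotheses are
  symmetric under this change.
\<close>

lemma adjoint: "growing_pontryagin V J \<pi> \<iota> I c (\<lambda>x y. - sk x y) pr em Q Jv"
proof -
  have "bounded_bilinear (\<lambda>x y. sk (- x) y)"
    by (rule bounded_bilinear.comp1[OF bilinear_sk bounded_linear_minus[OF bounded_linear_ident]])
  then have bil: "bounded_bilinear (\<lambda>x y. - sk x y)" by (simp add: sk.minus_left)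
  have "dissipative_pontryagin V J \<pi> \<iota> I c (\<lambda>x y. - sk x y) pr em Q Jv"
  proof (rule dissipative_pontryagin.intro[OF pontryagin_space_axioms], rule dissipative_pontryagin_axioms.intro)
    show "- sk x y = - (- sk y x)" for x y using sk_anti[of x y] by simp
    show "- sk (J x) (J y) = - sk x y" for x y by (simp add: sk_J)
  qed (fact bil linear_pr linear_em pr_em pr_\<iota> linear_Q Q_sym Q_nonneg Q_inj linear_Jv inner_Jv pr_J Q_Jv)+
  then show ?thesis
  proof (rule growing_pontryagin.intro, intro growing_pontryagin_axioms.intro)
    fix x a b assume x: "pr x = 0" "V x x \<le> 0" "\<And>y. V (a *\<^sub>R x + b *\<^sub>R J x) y = - sk x y"
    have "V ((- a) *\<^sub>R x + (- b) *\<^sub>R J x) y = sk x y" for y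
      using x(3)[of y] by (simp add: V.add_left V.diff_left V.minus_left V.scaleR_left)
    then show "x = 0" by (rule no_neutral[OF x(1,2)])
  qed
qed

text \<open>
  The values \<open>V (u t) (K z)\<close> satisfy the linear system given by the adjoint matrix \<open>S\<close>, with initial
  value zero. So \<open>u t\<close> stays orthogonal to the invariant subspace of the adjoint. There \<open>V\<close> is
  positive definite, and \<open>V (u t) (u t)\<close> does not increase.
\<close>

lemma solution_bounded:
  assumes graph: "growing_pontryagin.invariant_graph_of V J \<pi> I (\<lambda>x y. - sk x y) pr Q K S"
    and u: "\<And>t. t \<ge> 0 \<Longrightarrow> (u has_vector_derivative u' t) (at t within {0..})"
    and eq: "\<And>t y. t \<ge> 0 \<Longrightarrow> V (u' t) y = sk (u t) y - r t \<bullet> pr y"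
    and r: "\<And>t. t \<ge> 0 \<Longrightarrow> Q (r t) = pr (u t)"
    and init: "\<And>z. V (u 0) (K z) = 0"
  shows "bounded (u ` {0..})"
proof -
  interpret adj: growing_pontryagin V J \<pi> \<iota> I c "\<lambda>x y. - sk x y" pr em Q Jv by (rule adjoint)
  note K = adj.K[OF graph] and S = adj.S[OF graph]
  have dual: "V (u' t) (K z) = V (u t) (K (S z))" if "t \<ge> 0" for t z
  proof -
    obtain q where q: "Q q = pr (K z)" "\<forall>y. V (K (S z)) y = - sk (K z) y - q \<bullet> pr y"
      using adj.K_equation[OF graph] by blast
    have "r t \<bullet> pr (K z) = pr (u t) \<bullet> q" using Q_sym[of "r t" q] by (simp add: q(1)[symmetric] r[OF that])
    then show ?thesis
      using eq[OF that, of "K z"] q(2)[rule_format, of "u t"] sk_anti[of "u t" "K z"] V_sym[of "u t" "K (S z)"]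
      by (simp add: inner_commute)
  qed
  define x where "x t = (\<Sum>b\<in>Basis. V (u t) (K b) *\<^sub>R b)" for t
  have x: "x t \<bullet> z = V (u t) (K z)" for t z
  proof -
    have "V (u t) (K z) = V (u t) (K (\<Sum>b\<in>Basis. (z \<bullet> b) *\<^sub>R b))" by (simp add: euclidean_representation)
    also have "\<dots> = (\<Sum>b\<in>Basis. V (u t) (K b) * (b \<bullet> z))"
      by (simp add: linear_sum[OF K(1)] linear_scale[OF K(1)] V.sum_right V.scaleR_right inner_commute mult.commute)
    finally show ?thesis by (simp add: x_def inner_sum_left)
  qed
  have "x t = 0" if "t \<ge> 0" for t
  proof (rule linear_system_zero[OF S(1) _ _ that])
    fix t z assume t: "(t::real) \<ge> 0"
    have "((\<lambda>t. V (u t) (K z)) has_vector_derivative V (u' t) (K z)) (at t within {0..})"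
      by (rule bounded_linear.has_vector_derivative[OF V.bounded_linear_left u[OF t]])
    then show "((\<lambda>t. x t \<bullet> z) has_real_derivative x t \<bullet> S z) (at t within {0..})"
      by (simp add: x dual[OF t] has_real_derivative_iff_has_vector_derivative)
  next
    show "x 0 = 0" by (simp add: x_def init)
  qed
  then have orth: "V (u t) (K z) = 0" if "t \<ge> 0" for t z using x[of t z] that by simp
  obtain d where d: "d > 0" "\<And>x. (\<forall>z. V x (K z) = 0) \<Longrightarrow> d * (norm x)\<^sup>2 \<le> V x x"
    using adj.positive_on_complement[OF graph] by blast
  have energy: "V (u t) (u t) \<le> V (u 0) (u 0)" if "t \<ge> 0" for t
  proof (rule nonincreasing_on_halfline[OF _ _ that])
    fix t assume t: "(t::real) \<ge> 0"
    have "((\<lambda>t. V (u t) (u t)) has_vector_derivative V (u t) (u' t) + V (u' t) (u t)) (at t within {0..})"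
      by (rule V.has_vector_derivative[OF u[OF t] u[OF t]])
    then show "((\<lambda>t. V (u t) (u t)) has_real_derivative 2 * V (u' t) (u t)) (at t within {0..})"
      using V_sym[of "u t" "u' t"] by (simp add: has_real_derivative_iff_has_vector_derivative)
    have "V (u' t) (u t) = - (r t \<bullet> Q (r t))" using eq[OF t, of "u t"] by (simp add: sk_self r[OF t])
    then show "2 * V (u' t) (u t) \<le> 0" using Q_nonneg[of "r t"] by (simp add: inner_commute)
  qed
  have "norm (u t) \<le> sqrt (V (u 0) (u 0) / d)" if "t \<ge> 0" for t
  proof (rule real_le_rsqrt)
    have "d * (norm (u t))\<^sup>2 \<le> V (u 0) (u 0)" using d(2)[of "u t"] orth[OF that] energy[OF that] by force
    then show "(norm (u t))\<^sup>2 \<le> V (u 0) (u 0) / d" using d(1) by (simp add: field_simps)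
  qed
  then show ?thesis by (auto simp: bounded_iff)
qed

end

section \<open>The Hilbert space of square integrable fields\<close>

lemma l2rel_self [simp]: "l2rel f f \<longleftrightarrow> sq_int f"
  by (simp add: l2rel_def)

lemma sq_int_rep_l2 [simp]: "sq_int (rep_l2 v)"
  using Quotient3_rel_rep[OF Quotient3_l2, of v v] by simp

lemma abs_rep_l2 [simp]: "abs_l2 (rep_l2 v) = v"
  by (rule Quotient3_abs_rep[OF Quotient3_l2])

lemma abs_l2_eq: "sq_int f \<Longrightarrow> sq_int g \<Longrightarrow> abs_l2 f = abs_l2 g \<longleftrightarrow> (AE x in lborel. f x = g x)"
  using Quotient3_rel[OF Quotient3_l2, of f g] by (auto simp: l2rel_def)

lemma rep_abs_l2: "sq_int f \<Longrightarrow> AE x in lborel. rep_l2 (abs_l2 f) x = f x"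
  using abs_l2_eq[of "rep_l2 (abs_l2 f)" f] by simp

lemma abs_l2_add: "sq_int f \<Longrightarrow> sq_int g \<Longrightarrow> abs_l2 f + abs_l2 g = abs_l2 (\<lambda>x. f x + g x)"
  by (simp add: plus_l2.abs_eq)

lemma abs_l2_scaleR: "sq_int f \<Longrightarrow> r *\<^sub>R abs_l2 f = abs_l2 (\<lambda>x. r *\<^sub>R f x)"
  by (simp add: scaleR_l2.abs_eq)

lemma abs_l2_scaleC: "sq_int f \<Longrightarrow> scaleC_l2 l (abs_l2 f) = abs_l2 (\<lambda>x. l *s f x)"
  by (simp add: scaleC_l2.abs_eq)

lemma sq_int_diff:
  assumes "sq_int f" "sq_int g" shows "sq_int (\<lambda>x. f x - g x)"
  using sq_int_add[OF assms(1) sq_int_scaleR[OF assms(2), of "-1"]] by simp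

lemma abs_l2_diff: "sq_int f \<Longrightarrow> sq_int g \<Longrightarrow> abs_l2 f - abs_l2 g = abs_l2 (\<lambda>x. f x - g x)"
  using abs_l2_add[of f "\<lambda>x. (-1) *\<^sub>R g x"] abs_l2_scaleR[of g "-1"] sq_int_scaleR[of g "-1"]
  by (simp add: diff_conv_add_uminus del: add_uminus_conv_diff)

lemma inner_abs_l2: "sq_int f \<Longrightarrow> sq_int g \<Longrightarrow> abs_l2 f \<bullet> abs_l2 g = (LINT x|lborel. f x \<bullet> g x)"
  by (simp add: inner_l2.abs_eq)

lemma norm_abs_l2: "sq_int f \<Longrightarrow> (norm (abs_l2 f))\<^sup>2 = (LINT x|lborel. (norm (f x))\<^sup>2)"
  by (simp add: power2_norm_eq_inner inner_abs_l2)

lemma sq_int_measurable: "sq_int f \<Longrightarrow> f \<in> borel_measurable borel"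
  by (simp add: sq_int_def)

lemma sq_int_integrable: "sq_int f \<Longrightarrow> integrable lborel (\<lambda>x. (norm (f x))\<^sup>2)"
  by (simp add: sq_int_def)

lemma nn_integral_sq: "sq_int f \<Longrightarrow> (\<integral>\<^sup>+x. ennreal ((norm (f x))\<^sup>2) \<partial>lborel) = ennreal ((norm (abs_l2 f))\<^sup>2)"
  unfolding norm_abs_l2 by (rule nn_integral_eq_integral[OF sq_int_integrable]) auto

lemma sq_int_if_nn_integral:
  assumes "f \<in> borel_measurable borel" "(\<integral>\<^sup>+x. ennreal ((norm (f x))\<^sup>2) \<partial>lborel) < \<infinity>"
  shows "sq_int f"
  unfolding sq_int_def using assms by (auto intro!: integrableI_bounded)

text \<open>
  The function \<open>\<Sum>n. 2 ^ n * |f (Suc n) x - f n x|\<^sup>2\<close> has a finite integral and is therefore finite almost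
  everywhere. At such a point the increments decay geometrically.
\<close>

lemma fast_cauchy_AE_convergent:
  fixes f :: "nat \<Rightarrow> real^3 \<Rightarrow> complex^3"
  assumes f: "\<And>n. sq_int (f n)" and fast: "\<And>n. norm (abs_l2 (f (Suc n)) - abs_l2 (f n)) \<le> (1/2) ^ n"
  shows "AE x in lborel. convergent (\<lambda>n. f n x)"
proof -
  have [measurable]: "f n \<in> borel_measurable borel" for n using f by (rule sq_int_measurable)
  define h where "h n x = f (Suc n) x - f n x" for n x
  have h: "sq_int (h n)" for n unfolding h_def[abs_def] by (rule sq_int_diff[OF f f])
  have [measurable]: "h n \<in> borel_measurable borel" for n using h by (rule sq_int_measurable)
  have hn: "norm (abs_l2 (h n)) \<le> (1/2) ^ n" for n
    using fast[of n] by (simp add: abs_l2_diff[OF f f] h_def[abs_def])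
  have summand: "(\<integral>\<^sup>+x. ennreal (2 ^ n * (norm (h n x))\<^sup>2) \<partial>lborel) \<le> ennreal ((1/2) ^ n)" for n
  proof -
    have "(\<integral>\<^sup>+x. ennreal (2 ^ n * (norm (h n x))\<^sup>2) \<partial>lborel) = ennreal (2 ^ n) * (\<integral>\<^sup>+x. ennreal ((norm (h n x))\<^sup>2) \<partial>lborel)"
      by (subst nn_integral_cmult[symmetric]) (auto simp: ennreal_mult)
    also have "\<dots> = ennreal (2 ^ n * (norm (abs_l2 (h n)))\<^sup>2)"
      by (simp add: nn_integral_sq[OF h] ennreal_mult)
    also have "\<dots> \<le> ennreal ((1/2) ^ n)"
    proof (rule ennreal_leI)
      have "2 ^ n * (norm (abs_l2 (h n)))\<^sup>2 \<le> 2 ^ n * ((1/2) ^ n)\<^sup>2"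
        using hn by (intro mult_left_mono power_mono) auto
      also have "\<dots> = (1/2) ^ n" by (simp add: power2_eq_square power_mult_distrib[symmetric])
      finally show "2 ^ n * (norm (abs_l2 (h n)))\<^sup>2 \<le> (1/2) ^ n" .
    qed
    finally show ?thesis .
  qed
  have "(\<integral>\<^sup>+x. (\<Sum>n. ennreal (2 ^ n * (norm (h n x))\<^sup>2)) \<partial>lborel) = (\<Sum>n. \<integral>\<^sup>+x. ennreal (2 ^ n * (norm (h n x))\<^sup>2) \<partial>lborel)"
    by (rule nn_integral_suminf) measurable
  also have "\<dots> \<le> (\<Sum>n. ennreal ((1/2) ^ n))" by (intro suminf_le summand) auto
  also have "\<dots> = ennreal (\<Sum>n. (1/2) ^ n)"
    by (rule suminf_ennreal2) (auto intro: summable_geometric)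
  also have "\<dots> < \<infinity>" by simp
  finally have "(\<integral>\<^sup>+x. (\<Sum>n. ennreal (2 ^ n * (norm (h n x))\<^sup>2)) \<partial>lborel) \<noteq> \<infinity>" by simp
  then have "AE x in lborel. (\<Sum>n. ennreal (2 ^ n * (norm (h n x))\<^sup>2)) \<noteq> \<infinity>"
    by (intro nn_integral_PInf_AE) measurable
  then show ?thesis
  proof eventually_elim
    fix x assume fin: "(\<Sum>n. ennreal (2 ^ n * (norm (h n x))\<^sup>2)) \<noteq> \<infinity>"
    define T where "T = (\<Sum>n. ennreal (2 ^ n * (norm (h n x))\<^sup>2))"
    have "T \<noteq> \<infinity>" using fin unfolding T_def .
    then obtain C where C: "C \<ge> 0" "T = ennreal C" by (cases T) auto
    have term_bound: "2 ^ n * (norm (h n x))\<^sup>2 \<le> C" for n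
    proof -
      have "ennreal (2 ^ n * (norm (h n x))\<^sup>2) = (\<Sum>k\<in>{n}. ennreal (2 ^ k * (norm (h k x))\<^sup>2))" by simp
      also have "\<dots> \<le> ennreal C" unfolding C(2)[symmetric] T_def by (intro sum_le_suminf) auto
      finally show ?thesis using C(1) by simp
    qed
    have bound: "norm (h n x) \<le> sqrt C * (sqrt (1/2)) ^ n" for n
    proof -
      have "(norm (h n x))\<^sup>2 \<le> C * (1/2) ^ n" using term_bound[of n] by (simp add: field_simps)
      then have "norm (h n x) \<le> sqrt (C * (1/2) ^ n)" by (rule real_le_rsqrt)
      then show ?thesis by (simp add: real_sqrt_mult real_sqrt_power)
    qed
    have "summable (\<lambda>n. sqrt C * (sqrt (1/2)) ^ n)"
      by (intro summable_mult summable_geometric) (simp add: real_sqrt_divide)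
    then have "summable (\<lambda>n. h n x)"
      by (rule summable_comparison_test'[where N=0]) (use bound in auto)
    then have "convergent (\<lambda>n. (\<Sum>k<n. h k x))" by (simp add: summable_iff_convergent)
    moreover have "(\<Sum>k<n. h k x) = f n x - f 0 x" for n
      using sum_lessThan_telescope[of "\<lambda>n. f n x" n] by (simp add: h_def)
    ultimately have "convergent (\<lambda>n. f n x - f 0 x)" by simp
    then have "convergent (\<lambda>n. (f n x - f 0 x) + f 0 x)" by (intro convergent_add convergent_const)
    then show "convergent (\<lambda>n. f n x)" by simp
  qed
qed

text \<open>
  By Fatou's lemma the pointwise limit is also the limit in mean square.
\<close>

lemma fast_cauchy_l2_convergent:
  fixes f :: "nat \<Rightarrow> real^3 \<Rightarrow> complex^3"
  assumes f: "\<And>n. sq_int (f n)" and fast: "\<And>m n. m \<ge> n \<Longrightarrow> norm (abs_l2 (f m) - abs_l2 (f n)) \<le> (1/2) ^ n"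
  shows "\<exists>v. (\<lambda>n. abs_l2 (f n)) \<longlonglongrightarrow> v"
proof -
  have [measurable]: "f n \<in> borel_measurable borel" for n using f by (rule sq_int_measurable)
  have conv: "AE x in lborel. convergent (\<lambda>n. f n x)"
    by (rule fast_cauchy_AE_convergent[OF f]) (rule fast, simp)
  define g where "g x = lim (\<lambda>n. f n x)" for x
  have [measurable]: "g \<in> borel_measurable borel"
    unfolding g_def[abs_def] by (rule borel_measurable_lim_metric) measurable
  have lim: "AE x in lborel. (\<lambda>n. f n x) \<longlonglongrightarrow> g x"
    using conv by eventually_elim (simp add: g_def convergent_LIMSEQ_iff)
  have fatou: "(\<integral>\<^sup>+x. ennreal ((norm (g x - f n x))\<^sup>2) \<partial>lborel) \<le> ennreal (((1/2) ^ n)\<^sup>2)" for n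
  proof -
    have "(\<integral>\<^sup>+x. ennreal ((norm (g x - f n x))\<^sup>2) \<partial>lborel) = (\<integral>\<^sup>+x. liminf (\<lambda>m. ennreal ((norm (f m x - f n x))\<^sup>2)) \<partial>lborel)"
    proof (rule nn_integral_cong_AE)
      show "AE x in lborel. ennreal ((norm (g x - f n x))\<^sup>2) = liminf (\<lambda>m. ennreal ((norm (f m x - f n x))\<^sup>2))"
        using lim
      proof eventually_elim
        fix x assume "(\<lambda>n. f n x) \<longlonglongrightarrow> g x"
        then have "(\<lambda>m. ennreal ((norm (f m x - f n x))\<^sup>2)) \<longlonglongrightarrow> ennreal ((norm (g x - f n x))\<^sup>2)"
          by (intro tendsto_ennrealI tendsto_intros)
        then show "ennreal ((norm (g x - f n x))\<^sup>2) = liminf (\<lambda>m. ennreal ((norm (f m x - f n x))\<^sup>2))"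
          by (rule lim_imp_Liminf[OF sequentially_bot, symmetric])
      qed
    qed
    also have "\<dots> \<le> liminf (\<lambda>m. \<integral>\<^sup>+x. ennreal ((norm (f m x - f n x))\<^sup>2) \<partial>lborel)"
      by (rule nn_integral_liminf) measurable
    also have "\<dots> \<le> ennreal (((1/2) ^ n)\<^sup>2)"
    proof (rule Liminf_le)
      have "(\<integral>\<^sup>+x. ennreal ((norm (f m x - f n x))\<^sup>2) \<partial>lborel) \<le> ennreal (((1/2) ^ n)\<^sup>2)" if "m \<ge> n" for m
        using fast[OF that]
        by (simp only: nn_integral_sq[OF sq_int_diff[OF f f]] abs_l2_diff[OF f f])
           (intro ennreal_leI power_mono, auto)
      then show "\<forall>\<^sub>F m in sequentially. (\<integral>\<^sup>+x. ennreal ((norm (f m x - f n x))\<^sup>2) \<partial>lborel) \<le> ennreal (((1/2) ^ n)\<^sup>2)"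
        by (rule eventually_sequentiallyI)
    qed simp
    finally show ?thesis .
  qed
  have gf: "sq_int (\<lambda>x. g x - f n x)" for n
    by (rule sq_int_if_nn_integral) (use fatou[of n] in \<open>auto intro: order.strict_trans1 simp: less_top\<close>)
  have g: "sq_int g" using sq_int_add[OF gf[of 0] f[of 0]] by simp
  have "norm (abs_l2 (f n) - abs_l2 g) \<le> (1/2) ^ n" for n
  proof -
    have "(norm (abs_l2 g - abs_l2 (f n)))\<^sup>2 \<le> ((1/2) ^ n)\<^sup>2"
      using fatou[of n] by (simp only: nn_integral_sq[OF gf] abs_l2_diff[OF g f]) simp
    then have "norm (abs_l2 g - abs_l2 (f n)) \<le> (1/2) ^ n" by (rule power2_le_imp_le) simp
    then show ?thesis by (simp add: norm_minus_commute)
  qed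
  then have "(\<lambda>n. abs_l2 (f n) - abs_l2 g) \<longlonglongrightarrow> 0"
    by (intro Lim_null_comparison[OF always_eventually LIMSEQ_power_zero[of "1/2 :: real"]]) auto
  then show ?thesis by (blast intro: LIM_zero_cancel)
qed

instance l2 :: complete_space
proof
  fix X :: "nat \<Rightarrow> l2" assume X: "Cauchy X"
  have "\<exists>N. \<forall>m\<ge>N. \<forall>n\<ge>N. dist (X m) (X n) < (1/2) ^ k" for k
    using X by (intro metric_CauchyD) auto
  then obtain N where N: "\<And>k m n. m \<ge> N k \<Longrightarrow> n \<ge> N k \<Longrightarrow> dist (X m) (X n) < (1/2) ^ k" by metis
  define r where "r = rec_nat (N 0) (\<lambda>k a. Suc (max a (N (Suc k))))"
  have r_Suc: "r (Suc k) = Suc (max (r k) (N (Suc k)))" for k by (simp add: r_def)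
  have "strict_mono r" by (simp add: strict_mono_Suc_iff r_Suc less_Suc_eq_le)
  have rN: "r k \<ge> N k" for k by (cases k) (simp_all add: r_Suc r_def)
  have "norm (abs_l2 (rep_l2 (X (r m))) - abs_l2 (rep_l2 (X (r n)))) \<le> (1/2) ^ n" if "m \<ge> n" for m n
  proof -
    have "r m \<ge> r n" using \<open>strict_mono r\<close> that by (simp add: strict_mono_less_eq)
    then have "r m \<ge> N n" "r n \<ge> N n" using rN[of n] by auto
    then have "dist (X (r m)) (X (r n)) < (1/2) ^ n" by (rule N)
    then show ?thesis by (simp add: dist_norm)
  qed
  from fast_cauchy_l2_convergent[OF sq_int_rep_l2 this]
  obtain v where "(\<lambda>n. abs_l2 (rep_l2 (X (r n)))) \<longlonglongrightarrow> v" by blast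
  then have "(X \<circ> r) \<longlonglongrightarrow> v" by (simp add: comp_def)
  then have "X \<longlonglongrightarrow> v" by (rule Cauchy_converges_subseq[OF X \<open>strict_mono r\<close>])
  then show "convergent X" by (auto simp: convergent_def)
qed

section \<open>Complex structure and the solenoidal projection\<close>

lemma l2_eqI: "(\<And>w. v \<bullet> w = v' \<bullet> w) \<Longrightarrow> v = (v' :: l2)"
  using vector_eq_rdot by blast

lemma scaleC_l2_Re_Im: "scaleC_l2 l v = Re l *\<^sub>R v + Im l *\<^sub>R scaleC_l2 \<i> v"
proof transfer
  fix l and v :: "real^3 \<Rightarrow> complex^3" assume "l2rel v v"
  moreover have "(\<lambda>x. l *s v x) = (\<lambda>x. Re l *\<^sub>R v x + Im l *\<^sub>R (\<i> *s v x))"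
    by (rule ext, rule vector_scale_Re_Im)
  ultimately show "l2rel (\<lambda>x. l *s v x) (\<lambda>x. Re l *\<^sub>R v x + Im l *\<^sub>R (\<i> *s v x))"
    by (metis l2rel_self sq_int_scale)
qed

lemma scaleC_i_i: "scaleC_l2 \<i> (scaleC_l2 \<i> v) = - v"
proof -
  have "scaleC_l2 \<i> (scaleC_l2 \<i> v) = (-1) *\<^sub>R v"
    by transfer (simp add: l2rel_def sq_int_scale sq_int_scaleR vec_eq_iff sq_int_scaleR[where r="-1", simplified])
  then show ?thesis by simp
qed

lemma inner_mult_i: "(\<i> *s y) \<bullet> (\<i> *s z) = y \<bullet> (z :: complex^'n)"
  by (simp add: inner_vec_def inner_complex_def add.commute)

lemma inner_scaleC_i: "scaleC_l2 \<i> v \<bullet> scaleC_l2 \<i> w = v \<bullet> w"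
  by transfer (simp add: inner_mult_i)

lemma scaleC_add: "scaleC_l2 l (v + w) = scaleC_l2 l v + scaleC_l2 l w"
  by transfer (simp add: l2rel_def sq_int_scale sq_int_add vector_add_ldistrib)

lemma scaleC_scaleR: "scaleC_l2 l (r *\<^sub>R v) = r *\<^sub>R scaleC_l2 l v"
  by transfer (simp add: l2rel_def sq_int_scale sq_int_scaleR vec_eq_iff)

lemma linear_scaleC_i: "bounded_linear (scaleC_l2 \<i>)"
proof (rule bounded_linear_intro[where K=1])
  show "norm (scaleC_l2 \<i> v) \<le> norm v * 1" for v
    using inner_scaleC_i[of v v] by (simp add: norm_eq_sqrt_inner)
qed (simp_all add: scaleC_add scaleC_scaleR)

lemma inner_scaleC_i_left: "scaleC_l2 \<i> v \<bullet> w = - (v \<bullet> scaleC_l2 \<i> w)"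
  using inner_scaleC_i[of v "scaleC_l2 \<i> w"] by (simp add: scaleC_i_i)

text \<open>
  The real inner product and multiplication by \<open>\<i>\<close> determine the Hermitian one. So orthogonality and
  symmetry in subspaces that are closed under multiplication by \<open>\<i>\<close> can be expressed by the real inner
  product alone.
\<close>

lemma cinner_l2_eq: "cinner_l2 v w = Complex (v \<bullet> w) (v \<bullet> scaleC_l2 \<i> w)"
proof -
  have "cinner_l2 v (scaleC_l2 \<i> w) = - \<i> * cinner_l2 v w"
  proof (transfer, simp only: l2rel_self)
    fix f g assume *: "sq_int f" "sq_int g"
    have "herm (f x) (\<i> *s g x) = - \<i> * herm (f x) (g x)" for x
      by (simp add: herm_def sum_distrib_left mult_ac)
    then show "(LINT x|lborel. herm (f x) (\<i> *s g x)) = - \<i> * (LINT x|lborel. herm (f x) (g x))"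
      by (simp only: integral_mult_right_zero)
  qed
  then have "Im (cinner_l2 v w) = v \<bullet> scaleC_l2 \<i> w" using Re_cinner_l2[of v "scaleC_l2 \<i> w"] by simp
  then show ?thesis by (simp add: complex_eq_iff Re_cinner_l2)
qed

section \<open>Smooth solenoidal fields\<close>

lemma Ck_field_differentiable: "Ck_field (Suc n) f \<Longrightarrow> f differentiable (at x)"
  by (simp add: differentiable_on_def)

lemma Ck_field_continuous: "Ck_field n f \<Longrightarrow> continuous_on UNIV f"
  by (cases n) (auto intro: differentiable_imp_continuous_on)

lemma pderiv_field_has_derivative:
  "(f has_derivative f') (at x) \<Longrightarrow> pderiv_field i f x = f' (axis i 1)"
  by (simp add: pderiv_field_def frechet_derivative_at[symmetric])

lemma pderiv_field_add:
  assumes "f differentiable (at x)" "g differentiable (at x)"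
  shows "pderiv_field i (\<lambda>x. f x + g x) x = pderiv_field i f x + pderiv_field i g x"
proof -
  obtain f' g' where "(f has_derivative f') (at x)" "(g has_derivative g') (at x)"
    using assms by (auto simp: differentiable_def)
  then show ?thesis
    using pderiv_field_has_derivative[OF has_derivative_add] by (simp add: pderiv_field_has_derivative)
qed

lemma pderiv_field_linear:
  assumes "f differentiable (at x)" "bounded_linear L"
  shows "pderiv_field i (\<lambda>x. L (f x)) x = L (pderiv_field i f x)"
proof -
  obtain f' where "(f has_derivative f') (at x)" using assms(1) by (auto simp: differentiable_def)
  then show ?thesis
    using pderiv_field_has_derivative[OF bounded_linear.has_derivative[OF assms(2)]]
    by (simp add: pderiv_field_has_derivative)
qed

lemma Ck_field_add: "Ck_field n f \<Longrightarrow> Ck_field n g \<Longrightarrow> Ck_field n (\<lambda>x. f x + g x)"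
proof (induction n arbitrary: f g)
  case (Suc n)
  have "pderiv_field i (\<lambda>x. f x + g x) = (\<lambda>x. pderiv_field i f x + pderiv_field i g x)" for i
    using Suc.prems by (intro ext pderiv_field_add Ck_field_differentiable)
  with Suc show ?case by (auto intro: differentiable_on_add)
qed (auto intro: continuous_on_add)

lemma Ck_field_linear: "bounded_linear L \<Longrightarrow> Ck_field n f \<Longrightarrow> Ck_field n (\<lambda>x. L (f x))"
proof (induction n arbitrary: f)
  case (Suc n)
  have "pderiv_field i (\<lambda>x. L (f x)) = (\<lambda>x. L (pderiv_field i f x))" for i
    using Suc.prems by (intro ext pderiv_field_linear Ck_field_differentiable)
  moreover have "(\<lambda>x. L (f x)) differentiable_on UNIV"
    using Suc.prems bounded_linear_imp_differentiable_on[of L]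
    by (metis Ck_field.simps(2) differentiable_on_def differentiable_compose bounded_linear_imp_differentiable UNIV_I)
  ultimately show ?case using Suc by auto
qed (auto intro: bounded_linear.continuous_on)

lemma test_Ck: "f \<in> solenoidal_test \<Omega> \<Longrightarrow> Ck_field n f"
  and test_divergence: "f \<in> solenoidal_test \<Omega> \<Longrightarrow> divergence f x = 0"
  and test_compact: "f \<in> solenoidal_test \<Omega> \<Longrightarrow> compact (closure {x. f x \<noteq> 0})"
  and test_support: "f \<in> solenoidal_test \<Omega> \<Longrightarrow> closure {x. f x \<noteq> 0} \<subseteq> \<Omega>"
  by (auto simp: solenoidal_test_def)

lemma compact_support_subset:
  fixes A B :: "(real^3) set"
  assumes "compact (closure A)" "B \<subseteq> closure A"
  shows "compact (closure B) \<and> closure B \<subseteq> closure A"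
  using closure_minimal[OF assms(2) closed_closure] bounded_subset[OF compact_imp_bounded[OF assms(1)] assms(2)]
  by (simp add: compact_closure)

lemma solenoidal_test_zero: "(\<lambda>x. 0) \<in> solenoidal_test \<Omega>"
proof -
  have "pderiv_field i (\<lambda>x. 0) = (\<lambda>x. 0)" for i
    using pderiv_field_has_derivative[OF has_derivative_const] by blast
  moreover have "Ck_field n (\<lambda>x. 0)" for n
    by (induction n) (simp_all add: calculation)
  ultimately show ?thesis by (simp add: solenoidal_test_def divergence_def)
qed

lemma solenoidal_test_add:
  assumes f: "f \<in> solenoidal_test \<Omega>" and g: "g \<in> solenoidal_test \<Omega>"
  shows "(\<lambda>x. f x + g x) \<in> solenoidal_test \<Omega>"
proof -
  have d: "f differentiable (at x)" "g differentiable (at x)" for x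
    using f g by (auto intro: Ck_field_differentiable test_Ck)
  have "divergence (\<lambda>x. f x + g x) x = divergence f x + divergence g x" for x
    by (simp add: divergence_def pderiv_field_add[OF d] sum.distrib)
  moreover have "closure {x. f x + g x \<noteq> 0} \<subseteq> closure {x. f x \<noteq> 0} \<union> closure {x. g x \<noteq> 0}"
    unfolding closure_Un[symmetric] by (rule closure_mono) auto
  moreover have "compact (closure {x. f x + g x \<noteq> 0})"
    unfolding compact_closure
  proof (rule bounded_subset)
    show "bounded (closure {x. f x \<noteq> 0} \<union> closure {x. g x \<noteq> 0})"
      unfolding bounded_Un using test_compact[OF f] test_compact[OF g] compact_imp_bounded by blast
    show "{x. f x + g x \<noteq> 0} \<subseteq> closure {x. f x \<noteq> 0} \<union> closure {x. g x \<noteq> 0}"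
      using calculation(2) closure_subset[of "{x. f x + g x \<noteq> 0}"] by (rule order_trans[rotated])
  qed
  ultimately show ?thesis
    using Ck_field_add[OF test_Ck[OF f] test_Ck[OF g]] test_divergence[OF f] test_divergence[OF g]
      test_support[OF f] test_support[OF g]
    by (simp add: solenoidal_test_def) blast
qed

lemma solenoidal_test_scale:
  assumes f: "f \<in> solenoidal_test \<Omega>"
  shows "(\<lambda>x. l *s f x) \<in> solenoidal_test \<Omega>"
proof -
  have d: "f differentiable (at x)" for x
    using f by (auto intro: Ck_field_differentiable test_Ck)
  have "divergence (\<lambda>x. l *s f x) x = l * divergence f x" for x
    by (simp add: divergence_def pderiv_field_linear[OF d bounded_linear_vector_scale] sum_distrib_left)
  moreover have "compact (closure {x. l *s f x \<noteq> 0}) \<and> closure {x. l *s f x \<noteq> 0} \<subseteq> closure {x. f x \<noteq> 0}"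
    using test_compact[OF f] by (rule compact_support_subset) (use closure_subset[of "{x. f x \<noteq> 0}"] in auto)
  ultimately show ?thesis
    using Ck_field_linear[OF bounded_linear_vector_scale test_Ck[OF f]] test_divergence[OF f] test_support[OF f]
    by (auto simp: solenoidal_test_def)
qed

lemma compact_support_integrable:
  fixes f :: "real^3 \<Rightarrow> 'b::{banach,second_countable_topology}"
  assumes "continuous_on UNIV f" "compact (closure {x. f x \<noteq> 0})"
  shows "integrable lborel f"
proof -
  have "integrable lborel (\<lambda>x. indicator (closure {x. f x \<noteq> 0}) x *\<^sub>R f x)"
    using borel_integrable_compact[OF assms(2)] continuous_on_subset[OF assms(1)] by blast
  moreover have "(\<lambda>x. indicator (closure {x. f x \<noteq> 0}) x *\<^sub>R f x) = f"
    using closure_subset[of "{x. f x \<noteq> 0}"] by (auto simp: indicator_def fun_eq_iff)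
  ultimately show ?thesis by simp
qed

lemma compact_support_sq_int:
  assumes "continuous_on UNIV f" "compact (closure {x. f x \<noteq> 0})"
  shows "sq_int f"
proof -
  have "integrable lborel (\<lambda>x. (norm (f x))\<^sup>2)"
    using assms by (intro compact_support_integrable continuous_intros) simp_all
  then show ?thesis using assms(1) by (simp add: sq_int_def borel_measurable_continuous_onI)
qed

lemma test_sq_int: "f \<in> solenoidal_test \<Omega> \<Longrightarrow> sq_int f"
  using compact_support_sq_int[OF Ck_field_continuous[OF test_Ck] test_compact] by blast

lemma abs_test_subspace: "subspace (abs_l2 ` solenoidal_test \<Omega>)"
proof (rule subspaceI)
  show "0 \<in> abs_l2 ` solenoidal_test \<Omega>"
    unfolding zero_l2_def by (rule imageI[OF solenoidal_test_zero])
next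
  fix u v assume "u \<in> abs_l2 ` solenoidal_test \<Omega>" "v \<in> abs_l2 ` solenoidal_test \<Omega>"
  then show "u + v \<in> abs_l2 ` solenoidal_test \<Omega>"
    by (auto simp: abs_l2_add test_sq_int intro!: imageI solenoidal_test_add)
next
  fix r u assume "u \<in> abs_l2 ` solenoidal_test \<Omega>"
  then obtain f where f: "f \<in> solenoidal_test \<Omega>" "u = abs_l2 f" by blast
  have "(\<lambda>x. r *\<^sub>R f x) = (\<lambda>x. complex_of_real r *s f x)" by (simp add: fun_eq_iff vec_eq_iff) (simp add: scaleR_conv_of_real)
  then show "r *\<^sub>R u \<in> abs_l2 ` solenoidal_test \<Omega>"
    using solenoidal_test_scale[OF f(1), of "complex_of_real r"] f by (auto simp: abs_l2_scaleR test_sq_int)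
qed

lemma abs_test_in_J0: "f \<in> solenoidal_test \<Omega> \<Longrightarrow> abs_l2 f \<in> J0 \<Omega>"
  unfolding J0_def using closure_subset[of "abs_l2 ` solenoidal_test \<Omega>"] by blast

lemma closure_subspace:
  fixes S :: "'a::real_normed_vector set"
  assumes S: "subspace S" shows "subspace (closure S)"
proof (rule subspaceI)
  show "0 \<in> closure S" using subspace_0[OF S] closure_subset[of S] by blast
next
  fix x y assume "x \<in> closure S" "y \<in> closure S"
  then obtain u v where "\<forall>n. u n \<in> S" "u \<longlonglongrightarrow> x" "\<forall>n. v n \<in> S" "v \<longlonglongrightarrow> y"
    unfolding closure_sequential by blast
  then have "\<forall>n. u n + v n \<in> S" "(\<lambda>n. u n + v n) \<longlonglongrightarrow> x + y"
    using subspace_add[OF S] by (auto intro: tendsto_add)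
  then show "x + y \<in> closure S" unfolding closure_sequential by (intro exI[of _ "\<lambda>n. u n + v n"] conjI)
next
  fix c x assume "x \<in> closure S"
  then obtain u where "\<forall>n. u n \<in> S" "u \<longlonglongrightarrow> x" unfolding closure_sequential by blast
  then have "\<forall>n. c *\<^sub>R u n \<in> S" "(\<lambda>n. c *\<^sub>R u n) \<longlonglongrightarrow> c *\<^sub>R x"
    using subspace_scale[OF S] by (auto intro: tendsto_scaleR)
  then show "c *\<^sub>R x \<in> closure S" unfolding closure_sequential by (intro exI[of _ "\<lambda>n. c *\<^sub>R u n"] conjI)
qed

lemma subspace_J0: "subspace (J0 \<Omega>)"
  unfolding J0_def by (rule closure_subspace[OF abs_test_subspace])

lemma closed_J0: "closed (J0 \<Omega>)"
  unfolding J0_def by simp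

lemma J0_scaleC_i: "v \<in> J0 \<Omega> \<Longrightarrow> scaleC_l2 \<i> v \<in> J0 \<Omega>"
proof -
  have "scaleC_l2 \<i> ` closure (abs_l2 ` solenoidal_test \<Omega>) \<subseteq> closure (scaleC_l2 \<i> ` abs_l2 ` solenoidal_test \<Omega>)"
    using linear_scaleC_i by (intro continuous_image_closure_subset[where A=UNIV] linear_continuous_on) auto
  also have "\<dots> \<subseteq> closure (abs_l2 ` solenoidal_test \<Omega>)"
    by (intro closure_mono) (auto simp: abs_l2_scaleC test_sq_int intro!: imageI solenoidal_test_scale)
  finally show "v \<in> J0 \<Omega> \<Longrightarrow> scaleC_l2 \<i> v \<in> J0 \<Omega>" unfolding J0_def by blast
qed

lemma J0_scaleC: "v \<in> J0 \<Omega> \<Longrightarrow> scaleC_l2 l v \<in> J0 \<Omega>"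
  unfolding scaleC_l2_Re_Im[of l] by (intro subspace_add subspace_scale subspace_J0 J0_scaleC_i)

lemma P0_unique:
  assumes "p \<in> J0 \<Omega>" "\<And>q. q \<in> J0 \<Omega> \<Longrightarrow> (v - p) \<bullet> q = 0"
  shows "P0 \<Omega> v = p"
  unfolding P0_def
proof (rule the_equality)
  show "p \<in> J0 \<Omega> \<and> (\<forall>q\<in>J0 \<Omega>. cinner_l2 (v - p) q = 0)"
    using assms J0_scaleC_i by (auto simp: cinner_l2_eq complex_eq_iff)
next
  fix p' assume p': "p' \<in> J0 \<Omega> \<and> (\<forall>q\<in>J0 \<Omega>. cinner_l2 (v - p') q = 0)"
  have *: "p' - p \<in> J0 \<Omega>" using p' assms(1) subspace_diff[OF subspace_J0] by blast
  then have "(v - p') \<bullet> (p' - p) = 0" "(v - p) \<bullet> (p' - p) = 0"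
    using p' assms(2) Re_cinner_l2[of "v - p'" "p' - p"] by auto
  then have "(p' - p) \<bullet> (p' - p) = 0" by (simp add: inner_diff_left)
  then show "p' = p" by simp
qed

lemma P0_in_J0: "P0 \<Omega> v \<in> J0 \<Omega>" and P0_orth: "q \<in> J0 \<Omega> \<Longrightarrow> (v - P0 \<Omega> v) \<bullet> q = 0"
proof -
  obtain p where p: "p \<in> J0 \<Omega>" "\<forall>q\<in>J0 \<Omega>. (v - p) \<bullet> q = 0"
    using orthogonal_projection_exists[OF subspace_J0 closed_J0] by blast
  have "P0 \<Omega> v = p" by (rule P0_unique) (use p in auto)
  with p show "P0 \<Omega> v \<in> J0 \<Omega>" "q \<in> J0 \<Omega> \<Longrightarrow> (v - P0 \<Omega> v) \<bullet> q = 0" by auto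
qed

lemma P0_inner: "q \<in> J0 \<Omega> \<Longrightarrow> P0 \<Omega> v \<bullet> q = v \<bullet> q"
  using P0_orth[of q \<Omega> v] by (simp add: inner_diff_left)

lemma P0_ident: "v \<in> J0 \<Omega> \<Longrightarrow> P0 \<Omega> v = v"
  by (rule P0_unique) auto

lemma P0_sym: "P0 \<Omega> v \<bullet> w = v \<bullet> P0 \<Omega> w"
  using P0_inner[OF P0_in_J0, of \<Omega> v w] P0_inner[OF P0_in_J0, of \<Omega> w v] by (simp add: inner_commute)

lemma linear_P0: "bounded_linear (P0 \<Omega>)"
proof (rule bounded_linear_intro[where K=1])
  show "P0 \<Omega> (v + w) = P0 \<Omega> v + P0 \<Omega> w" for v w
    by (rule P0_unique) (auto simp: P0_in_J0 subspace_add[OF subspace_J0] inner_diff_left inner_add_left P0_inner)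
  show "P0 \<Omega> (r *\<^sub>R v) = r *\<^sub>R P0 \<Omega> v" for r v
    by (rule P0_unique) (auto simp: P0_in_J0 subspace_scale[OF subspace_J0] inner_diff_left P0_inner)
  fix v
  have "(norm (P0 \<Omega> v))\<^sup>2 = v \<bullet> P0 \<Omega> v" by (simp add: power2_norm_eq_inner P0_inner[OF P0_in_J0])
  also have "\<dots> \<le> norm v * norm (P0 \<Omega> v)" by (rule norm_cauchy_schwarz)
  finally show "norm (P0 \<Omega> v) \<le> norm v * 1"
    by (cases "norm (P0 \<Omega> v) = 0") (simp_all add: power2_eq_square mult_le_cancel_right)
qed

lemma P0_scaleC_i: "P0 \<Omega> (scaleC_l2 \<i> v) = scaleC_l2 \<i> (P0 \<Omega> v)"
proof (rule P0_unique)
  fix q assume "q \<in> J0 \<Omega>"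
  then show "(scaleC_l2 \<i> v - scaleC_l2 \<i> (P0 \<Omega> v)) \<bullet> q = 0"
    by (simp add: inner_diff_left inner_scaleC_i_left P0_inner J0_scaleC_i)
qed (simp add: J0_scaleC_i P0_in_J0)

section \<open>The Friedrichs extension of a coercive operator\<close>

text \<open>
  Linear operators are given by their graphs. The energy of \<open>(d, g)\<close> in the graph is \<open>g \<bullet> d\<close>, and the
  sequences considered here are those that define the energy space of \<open>S\<close>.
\<close>

definition energy_seq :: "('a::real_inner \<times> 'a) set \<Rightarrow> 'a \<Rightarrow> (nat \<Rightarrow> 'a) \<Rightarrow> (nat \<Rightarrow> 'a) \<Rightarrow> bool" where
  "energy_seq S u d g \<longleftrightarrow> (\<forall>n. (d n, g n) \<in> S) \<and> d \<longlonglongrightarrow> u \<and>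
     (\<forall>e>0. \<exists>K. \<forall>m\<ge>K. \<forall>n\<ge>K. (g m - g n) \<bullet> (d m - d n) < e)"

text \<open>
  Friedrichs' extension over the real scalars; \<open>stokes_graph_eq\<close> relates it to the complex one.
\<close>

definition real_friedrichs :: "('a::real_inner \<times> 'a) set \<Rightarrow> ('a \<times> 'a) set" where
  "real_friedrichs S = {(u, f). u \<in> closure (Domain S) \<and> f \<in> closure (Domain S) \<and>
     (\<exists>d g. energy_seq S u d g) \<and> (\<forall>(d, g)\<in>S. u \<bullet> g = f \<bullet> d)}"

locale coercive_graph =
  fixes S :: "('a::{real_inner,complete_space} \<times> 'a) set" and c :: real
  assumes subspace: "subspace S" and sym: "(d, g) \<in> S \<Longrightarrow> (d', g') \<in> S \<Longrightarrow> g \<bullet> d' = d \<bullet> g'"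
    and c_pos: "c > 0" and coercive: "(d, g) \<in> S \<Longrightarrow> c * (norm d)\<^sup>2 \<le> g \<bullet> d"
begin

lemma energy_nonneg: "(d, g) \<in> S \<Longrightarrow> 0 \<le> g \<bullet> d"
  using coercive[of d g] c_pos by (smt (verit) mult_nonneg_nonneg zero_le_power2)

lemma diff_in: "(d, g) \<in> S \<Longrightarrow> (d', g') \<in> S \<Longrightarrow> (d - d', g - g') \<in> S"
  using subspace_diff[OF subspace, of "(d, g)" "(d', g')"] by simp

lemma scale_in: "(d, g) \<in> S \<Longrightarrow> (r *\<^sub>R d, r *\<^sub>R g) \<in> S"
  using subspace_scale[OF subspace, of "(d, g)" r] by simp

lemma add_in: "(d, g) \<in> S \<Longrightarrow> (d', g') \<in> S \<Longrightarrow> (d + d', g + g') \<in> S"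
  using subspace_add[OF subspace, of "(d, g)" "(d', g')"] by simp

lemma energy_Cauchy_Schwarz:
  assumes s: "(d, g) \<in> S" "(d', g') \<in> S"
  shows "(g \<bullet> d')\<^sup>2 \<le> (g \<bullet> d) * (g' \<bullet> d')"
proof -
  have quad: "0 \<le> g \<bullet> d + 2 * t * (g \<bullet> d') + t\<^sup>2 * (g' \<bullet> d')" for t
  proof -
    have "0 \<le> (g + t *\<^sub>R g') \<bullet> (d + t *\<^sub>R d')" by (intro energy_nonneg add_in scale_in s)
    also have "\<dots> = g \<bullet> d + t * (g \<bullet> d') + (t * (g' \<bullet> d) + t * (t * (g' \<bullet> d')))"
      by (simp add: inner_add_left inner_add_right algebra_simps)
    also have "g' \<bullet> d = g \<bullet> d'" using sym[OF s(2,1)] by (simp add: inner_commute)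
    finally show ?thesis by (simp add: power2_eq_square algebra_simps)
  qed
  define k where "k = g' \<bullet> d'"
  show ?thesis
  proof (cases "k = 0")
    case True
    have "g \<bullet> d' = 0"
    proof (rule ccontr)
      assume n: "g \<bullet> d' \<noteq> 0"
      have "2 * (- (g \<bullet> d + 1) / (2 * (g \<bullet> d'))) * (g \<bullet> d') = - (g \<bullet> d + 1)" using n by simp
      with quad[of "- (g \<bullet> d + 1) / (2 * (g \<bullet> d'))"] True show False unfolding k_def by simp
    qed
    then show ?thesis using True by (simp add: k_def)
  next
    case False
    then have k: "k > 0" using energy_nonneg[OF s(2)] by (simp add: k_def)
    have "0 \<le> g \<bullet> d + 2 * (- (g \<bullet> d') / k) * (g \<bullet> d') + (- (g \<bullet> d') / k)\<^sup>2 * k"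
      using quad[of "- (g \<bullet> d') / k"] by (simp only: k_def)
    also have "\<dots> = g \<bullet> d - (g \<bullet> d')\<^sup>2 / k" using k by (simp add: field_simps power2_eq_square)
    finally show ?thesis using k by (simp add: field_simps k_def[symmetric])
  qed
qed

lemma energy_Cauchy_bounded:
  assumes d: "\<And>n. (d n, g n) \<in> S"
    and e: "\<forall>e>0. \<exists>K. \<forall>m\<ge>K. \<forall>n\<ge>K. (g m - g n) \<bullet> (d m - d n) < e"
  shows "\<exists>M>0. \<exists>K::nat. \<forall>n\<ge>K. g n \<bullet> d n \<le> M"
proof -
  obtain K where K: "\<forall>m\<ge>K. \<forall>n\<ge>K. (g m - g n) \<bullet> (d m - d n) < 1"
    using e[rule_format, of 1] zero_less_one by blast
  define M where "M = 2 * (g K \<bullet> d K) + 2"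
  have "g n \<bullet> d n \<le> M" if "n \<ge> K" for n
  proof -
    have "0 \<le> (g n - 2 *\<^sub>R g K) \<bullet> (d n - 2 *\<^sub>R d K)" by (intro energy_nonneg diff_in scale_in d)
    also have "\<dots> = 2 * ((g n - g K) \<bullet> (d n - d K)) + 2 * (g K \<bullet> d K) - g n \<bullet> d n"
      by (simp add: inner_diff_left inner_diff_right algebra_simps)
    finally show ?thesis using K[rule_format, OF that order_refl] by (simp add: M_def)
  qed
  moreover have "M > 0" using energy_nonneg[OF d[of K]] by (simp add: M_def)
  ultimately show ?thesis by blast
qed

text \<open>
  For fixed \<open>n\<close> the pairing \<open>g m \<bullet> d' n\<close> tends to \<open>f \<bullet> d' n\<close> as \<open>m\<close> grows, by the weak equation for
  \<open>(u, f)\<close>. The Cauchy--Schwarz inequality for the energy makes this uniform in \<open>n\<close>.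
\<close>

lemma energy_limit:
  assumes uf: "\<And>d g. (d, g) \<in> S \<Longrightarrow> u \<bullet> g = f \<bullet> d"
    and dg: "energy_seq S u d g" and dg': "energy_seq S u' d' g'"
  shows "(\<lambda>n. g n \<bullet> d' n) \<longlonglongrightarrow> f \<bullet> u'"
proof -
  have dS: "(d n, g n) \<in> S" and d'S: "(d' n, g' n) \<in> S" for n
    using dg dg' by (auto simp: energy_seq_def)
  have du: "d \<longlonglongrightarrow> u" and d'u: "d' \<longlonglongrightarrow> u'"
    using dg dg' by (auto simp: energy_seq_def)
  have e: "\<forall>e>0. \<exists>K. \<forall>m\<ge>K. \<forall>n\<ge>K. (g m - g n) \<bullet> (d m - d n) < e"
    and e': "\<forall>e>0. \<exists>K. \<forall>m\<ge>K. \<forall>n\<ge>K. (g' m - g' n) \<bullet> (d' m - d' n) < e"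
    using dg dg' unfolding energy_seq_def by blast+
  obtain M K1 where M: "M > 0" "\<forall>n\<ge>K1. g' n \<bullet> d' n \<le> M"
    using energy_Cauchy_bounded[OF d'S e'] by blast
  have "(\<lambda>n. g n \<bullet> d' n - f \<bullet> d' n) \<longlonglongrightarrow> 0"
  proof (rule LIMSEQ_I)
    fix \<epsilon> :: real assume "\<epsilon> > 0"
    then have "(\<epsilon> / 2)\<^sup>2 / M > 0" using M(1) by simp
    from e[rule_format, OF this] obtain K where
      K: "\<forall>m\<ge>K. \<forall>n\<ge>K. (g m - g n) \<bullet> (d m - d n) < (\<epsilon> / 2)\<^sup>2 / M" by blast
    have "norm (g n \<bullet> d' n - f \<bullet> d' n - 0) < \<epsilon>" if n: "n \<ge> max K K1" for n
    proof -
      have close: "\<bar>g n \<bullet> d' n - g m \<bullet> d' n\<bar> \<le> \<epsilon> / 2" if "m \<ge> K" for m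
      proof -
        have "((g n - g m) \<bullet> d' n)\<^sup>2 \<le> ((g n - g m) \<bullet> (d n - d m)) * (g' n \<bullet> d' n)"
          by (intro energy_Cauchy_Schwarz diff_in dS d'S)
        also have "\<dots> \<le> ((\<epsilon> / 2)\<^sup>2 / M) * M"
          using K[rule_format, of n m] M(2)[rule_format, of n] n that M(1)
          by (intro mult_mono energy_nonneg d'S) auto
        also have "\<dots> = (\<epsilon> / 2)\<^sup>2" using M(1) by simp
        finally have "\<bar>(g n - g m) \<bullet> d' n\<bar> \<le> \<bar>\<epsilon> / 2\<bar>" by (simp only: abs_le_square_iff)
        then show ?thesis using \<open>\<epsilon> > 0\<close> by (simp add: inner_diff_left)
      qed
      have "(\<lambda>m. d m \<bullet> g' n) \<longlonglongrightarrow> u \<bullet> g' n" by (intro tendsto_inner du tendsto_const)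
      then have "(\<lambda>m. g m \<bullet> d' n) \<longlonglongrightarrow> f \<bullet> d' n" using sym[OF dS d'S[of n]] uf[OF d'S[of n]] by simp
      then have "(\<lambda>m. \<bar>g n \<bullet> d' n - g m \<bullet> d' n\<bar>) \<longlonglongrightarrow> \<bar>g n \<bullet> d' n - f \<bullet> d' n\<bar>"
        by (intro tendsto_rabs tendsto_diff tendsto_const)
      then have "\<bar>g n \<bullet> d' n - f \<bullet> d' n\<bar> \<le> \<epsilon> / 2"
        by (rule LIMSEQ_le_const2) (use close in blast)
      then show ?thesis using \<open>\<epsilon> > 0\<close> by simp
    qed
    then show "\<exists>no. \<forall>n\<ge>no. norm (g n \<bullet> d' n - f \<bullet> d' n - 0) < \<epsilon>" by blast
  qed
  from tendsto_add[OF this tendsto_inner[OF tendsto_const d'u, of f]] show ?thesis by simp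
qed

lemma friedrichs_symmetric:
  assumes "(u, f) \<in> real_friedrichs S" "(u', f') \<in> real_friedrichs S"
  shows "f \<bullet> u' = u \<bullet> f'"
proof -
  obtain d g d' g' where s: "energy_seq S u d g" "energy_seq S u' d' g'"
    using assms by (auto simp: real_friedrichs_def)
  have "(\<lambda>n. g n \<bullet> d' n) \<longlonglongrightarrow> f \<bullet> u'"
    by (rule energy_limit[OF _ s]) (use assms in \<open>auto simp: real_friedrichs_def\<close>)
  moreover have "(\<lambda>n. g' n \<bullet> d n) \<longlonglongrightarrow> f' \<bullet> u"
    by (rule energy_limit[OF _ s(2,1)]) (use assms in \<open>auto simp: real_friedrichs_def\<close>)
  moreover have "g n \<bullet> d' n = g' n \<bullet> d n" for n
    using sym[of "d n" "g n" "d' n" "g' n"] s by (simp add: inner_commute energy_seq_def)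
  ultimately show ?thesis by (simp add: LIMSEQ_unique inner_commute)
qed

lemma friedrichs_coercive:
  assumes "(u, f) \<in> real_friedrichs S"
  shows "c * (norm u)\<^sup>2 \<le> f \<bullet> u"
proof -
  obtain d g where s: "energy_seq S u d g" using assms by (auto simp: real_friedrichs_def)
  have 1: "(\<lambda>n. g n \<bullet> d n) \<longlonglongrightarrow> f \<bullet> u"
    by (rule energy_limit[OF _ s s]) (use assms in \<open>auto simp: real_friedrichs_def\<close>)
  have 2: "(\<lambda>n. c * (norm (d n))\<^sup>2) \<longlonglongrightarrow> c * (norm u)\<^sup>2"
    using s by (intro tendsto_intros) (simp add: energy_seq_def)
  have "c * (norm (d n))\<^sup>2 \<le> g n \<bullet> d n" for n using s by (intro coercive) (simp add: energy_seq_def)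
  then show ?thesis by (intro LIMSEQ_le[OF 2 1]) blast
qed

lemma subspace_Domain: "subspace (Domain S)"
proof -
  have "Domain S = fst ` S" by force
  then show ?thesis using linear_subspace_image[OF bounded_linear.linear[OF bounded_linear_fst] subspace] by simp
qed

lemma friedrichs_functional:
  assumes "(u, f) \<in> real_friedrichs S" "(u, f') \<in> real_friedrichs S"
  shows "f = f'"
proof -
  have *: "(f - f') \<bullet> d = 0" if "d \<in> Domain S" for d
    using assms that by (fastforce simp: real_friedrichs_def inner_diff_left)
  have "closed {d. (f - f') \<bullet> d = 0}" by (intro closed_Collect_eq continuous_intros)
  then have "closure (Domain S) \<subseteq> {d. (f - f') \<bullet> d = 0}" using * by (intro closure_minimal) auto
  moreover have "f - f' \<in> closure (Domain S)"
    using assms by (intro subspace_diff closure_subspace subspace_Domain) (auto simp: real_friedrichs_def)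
  ultimately have "(f - f') \<bullet> (f - f') = 0" by blast
  then show ?thesis by simp
qed

text \<open>
  The weak equation is solved by minimising the energy; coercivity makes the minimising sequence
  converge in norm, and the limit lies in the energy space by construction.
\<close>

lemma friedrichs_surjective:
  assumes f: "f \<in> closure (Domain S)"
  shows "\<exists>u. (u, f) \<in> real_friedrichs S"
proof -
  \<comment> \<open>the energy, as a form on pairs\<close>
  define r where "r x y = snd x \<bullet> fst y" for x y :: "'a \<times> 'a"
  have r1: "linear (r x)" for x unfolding r_def[abs_def] by (rule linearI) (simp_all add: inner_add_right)
  have r2: "linear (\<lambda>x. r x y)" for y unfolding r_def by (rule linearI) (simp_all add: inner_add_left)
  have r3: "r x y = r y x" if "x \<in> S" "y \<in> S" for x y
    using sym[of "fst x" "snd x" "fst y" "snd y"] that by (simp add: r_def inner_commute)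
  have r4: "linear (\<lambda>x::'a\<times>'a. f \<bullet> fst x)" by (rule linearI) (simp_all add: inner_add_right)
  have r5: "(f \<bullet> fst x)\<^sup>2 \<le> (((norm f)\<^sup>2 + 1) / c) * r x x" if x: "x \<in> S" for x
  proof -
    have "(f \<bullet> fst x)\<^sup>2 \<le> (norm f)\<^sup>2 * (norm (fst x))\<^sup>2"
      using Cauchy_Schwarz_ineq[of f "fst x"] by (simp add: power2_norm_eq_inner)
    also have "\<dots> \<le> ((norm f)\<^sup>2 + 1) * (norm (fst x))\<^sup>2" by (intro mult_right_mono) auto
    also have "\<dots> = (((norm f)\<^sup>2 + 1) / c) * (c * (norm (fst x))\<^sup>2)" using c_pos by simp
    also have "\<dots> \<le> (((norm f)\<^sup>2 + 1) / c) * r x x"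
      using coercive[of "fst x" "snd x"] x c_pos by (intro mult_left_mono) (auto simp: r_def)
    finally show ?thesis .
  qed
  have r6: "((norm f)\<^sup>2 + 1) / c > 0" using c_pos by (simp add: add_nonneg_pos)
  obtain x where x: "\<forall>n::nat. x n \<in> S" "\<forall>e>0. \<exists>K. \<forall>m\<ge>K. \<forall>n\<ge>K. r (x m - x n) (x m - x n) < e"
      "\<forall>y\<in>S. (\<lambda>n. r (x n) y) \<longlonglongrightarrow> f \<bullet> fst y"
    using energy_minimising_sequence[OF subspace r1 r2 r3 r4 r6 r5] by blast
  define d where "d n = fst (x n)" for n
  define g where "g n = snd (x n)" for n
  have dg: "(d n, g n) \<in> S" for n using x(1) by (simp add: d_def g_def)
  have e: "\<forall>e>0. \<exists>K. \<forall>m\<ge>K. \<forall>n\<ge>K. (g m - g n) \<bullet> (d m - d n) < e"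
    using x(2) by (simp add: r_def d_def g_def)
  have "Cauchy d" by (rule energy_Cauchy_imp_Cauchy[OF c_pos coercive[OF diff_in[OF dg dg]] e])
  then obtain u where u: "d \<longlonglongrightarrow> u" by (auto simp: Cauchy_convergent_iff convergent_def)
  have "d n \<in> Domain S" for n using dg[of n] by blast
  then have uE: "u \<in> closure (Domain S)" using u by (auto simp: closure_sequential)
  have eq: "u \<bullet> g' = f \<bullet> d'" if "(d', g') \<in> S" for d' g'
  proof -
    have "(\<lambda>n. g n \<bullet> d') \<longlonglongrightarrow> f \<bullet> d'" using x(3)[rule_format, OF that] by (simp add: r_def g_def)
    moreover have "g n \<bullet> d' = d n \<bullet> g'" for n by (rule sym[OF dg that])
    ultimately show ?thesis using LIMSEQ_unique[OF tendsto_inner[OF u tendsto_const[of g']]] by simp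
  qed
  have "energy_seq S u d g" using dg u e by (simp add: energy_seq_def)
  then show ?thesis unfolding real_friedrichs_def using f uE eq by blast
qed

end

section \<open>Integration by parts and the Poincare inequality\<close>

lemma lborel_integral_translation:
  fixes h :: "real^3 \<Rightarrow> real"
  assumes [measurable]: "h \<in> borel_measurable borel"
  shows "(LINT x|lborel. h (a + x)) = (LINT x|lborel. h x)"
proof -
  have "(LINT x|lborel. h x) = (LINT x|distr lborel borel ((+) a). h x)" by (simp add: lborel_distr_plus)
  also have "\<dots> = (LINT x|lborel. h (a + x))" by (rule integral_distr) auto
  finally show ?thesis by simp
qed

text \<open>
  Difference quotients have integral zero by translation invariance, and they converge boundedly, with
  supports in a fixed ball.
\<close>

lemma integral_partial_derivative_zero:
  fixes h g :: "real^3 \<Rightarrow> real"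
  assumes der: "\<And>x. (h has_derivative D x) (at x)" and g: "\<And>x. D x (axis i 1) = g x"
    and cont: "continuous_on UNIV g" and supp: "compact (closure {x. h x \<noteq> 0})"
  shows "integrable lborel g \<and> (LINT x|lborel. g x) = 0"
proof -
  define e :: "real^3" where "e = axis i 1"
  have norm_e: "norm e = 1" by (simp add: e_def)
  have g_supp: "g x = 0" if "x \<notin> closure {x. h x \<noteq> 0}" for x
  proof -
    have "(h has_derivative (\<lambda>_. 0)) (at x)"
    proof (rule has_derivative_transform_within_open[of "\<lambda>_. 0"])
      show "open (- closure {x. h x \<noteq> 0})" by (rule open_Compl[OF closed_closure])
      show "0 = h y" if "y \<in> - closure {x. h x \<noteq> 0}" for y
        using that closure_subset[of "{x. h x \<noteq> 0}"] by auto
    qed (use that in auto)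
    then have "D x = (\<lambda>_. 0)" using has_derivative_unique[OF der] by blast
    then show ?thesis using g[of x] by simp
  qed
  have g_compact: "compact (closure {x. g x \<noteq> 0})"
    using compact_support_subset[OF supp, of "{x. g x \<noteq> 0}"] g_supp by blast
  have int_g: "integrable lborel g" by (rule compact_support_integrable[OF cont g_compact])
  have cont_h: "continuous_on UNIV h"
    using der by (intro continuous_at_imp_continuous_on) (auto intro: has_derivative_continuous)
  have [measurable]: "h \<in> borel_measurable borel" "g \<in> borel_measurable borel"
    using cont cont_h by (auto intro: borel_measurable_continuous_onI)
  have int_h: "integrable lborel h" by (rule compact_support_integrable[OF cont_h supp])
  have int_h': "integrable lborel (\<lambda>x. h (a + x))" for a
    using integrable_distr_eq[of "(+) a" lborel borel h] int_h by (simp add: lborel_distr_plus)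
  obtain M where M: "M > 0" "\<And>x. \<bar>g x\<bar> \<le> M"
  proof -
    have "compact (g ` closure {x. g x \<noteq> 0})"
      by (rule compact_continuous_image[OF continuous_on_subset[OF cont] g_compact]) simp
    then obtain M where "M > 0" "\<forall>y\<in>g ` closure {x. g x \<noteq> 0}. norm y \<le> M"
      using bounded_pos compact_imp_bounded by blast
    moreover have "\<bar>g x\<bar> \<le> M" for x
      using calculation closure_subset[of "{x. g x \<noteq> 0}"] by (cases "g x = 0") auto
    ultimately show ?thesis using that by blast
  qed
  obtain R where R: "\<And>x. h x \<noteq> 0 \<Longrightarrow> norm x \<le> R"
    using compact_imp_bounded[OF supp] closure_subset[of "{x. h x \<noteq> 0}"] by (auto simp: bounded_iff)
  define t where "t n = inverse (real (Suc n))" for n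
  have t: "t n > 0" "t n \<le> 1" for n by (auto simp: t_def field_simps)
  have line: "((\<lambda>s. h (s *\<^sub>R e + x)) has_real_derivative g (s *\<^sub>R e + x)) (at s)" for s x
  proof -
    have "((\<lambda>s. h (s *\<^sub>R e + x)) has_derivative (\<lambda>r. D (s *\<^sub>R e + x) (r *\<^sub>R e))) (at s)"
      by (rule has_derivative_compose[of "\<lambda>s. s *\<^sub>R e + x" "\<lambda>r. r *\<^sub>R e" s UNIV h, OF _ der])
        (auto intro!: derivative_eq_intros)
    moreover have "D (s *\<^sub>R e + x) (r *\<^sub>R e) = g (s *\<^sub>R e + x) * r" for r
      using linear_scale[OF has_derivative_linear[OF der], of "s *\<^sub>R e + x" r e] by (simp add: g[symmetric] e_def mult.commute)
    ultimately show ?thesis by (simp add: has_field_derivative_def)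
  qed
  define q where "q n x = (h (t n *\<^sub>R e + x) - h x) / t n" for n x
  have q_bound: "\<bar>q n x\<bar> \<le> M * indicator (cball 0 (\<bar>R\<bar> + 1)) x" for n x
  proof (cases "x \<in> cball 0 (\<bar>R\<bar> + 1)")
    case True
    obtain s where "0 < s" "s < t n" "h (t n *\<^sub>R e + x) - h (0 *\<^sub>R e + x) = (t n - 0) * g (s *\<^sub>R e + x)"
      using MVT2[of 0 "t n" "\<lambda>s. h (s *\<^sub>R e + x)" "\<lambda>s. g (s *\<^sub>R e + x)"] line t(1)[of n] by blast
    then have "q n x = g (s *\<^sub>R e + x)" using t(1)[of n] by (simp add: q_def field_simps)
    then show ?thesis using M(2) True by simp
  next
    case False
    then have "norm x > \<bar>R\<bar> + 1" by simp
    moreover have "norm x \<le> norm (t n *\<^sub>R e + x) + norm (t n *\<^sub>R e)"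
      using norm_triangle_ineq4[of "t n *\<^sub>R e + x" "t n *\<^sub>R e"] by simp
    ultimately have "norm (t n *\<^sub>R e + x) > \<bar>R\<bar>" using t[of n] norm_e by simp
    then have "h x = 0" "h (t n *\<^sub>R e + x) = 0" using R[of x] R[of "t n *\<^sub>R e + x"] \<open>norm x > \<bar>R\<bar> + 1\<close> by fastforce+
    then show ?thesis using False by (simp add: q_def)
  qed
  have t0: "t \<longlonglongrightarrow> 0" unfolding t_def[abs_def] by (rule LIMSEQ_inverse_real_of_nat)
  have q_lim: "(\<lambda>n. q n x) \<longlonglongrightarrow> g x" for x
  proof -
    have "((\<lambda>s. (h (s *\<^sub>R e + x) - h (0 *\<^sub>R e + x)) / s) \<longlongrightarrow> g (0 *\<^sub>R e + x)) (at 0)"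
      using line[of x 0] by (simp add: has_field_derivative_iff)
    moreover have "filterlim t (at 0) sequentially"
      using t0 t(1) by (intro filterlim_atI) (auto simp: less_imp_neq[symmetric])
    ultimately have "(\<lambda>n. (h (t n *\<^sub>R e + x) - h (0 *\<^sub>R e + x)) / t n) \<longlonglongrightarrow> g (0 *\<^sub>R e + x)"
      by (rule filterlim_compose)
    then show ?thesis by (simp add: q_def[abs_def])
  qed
  have "(LINT x|lborel. q n x) = 0" for n
    using int_h int_h'[of "t n *\<^sub>R e"] lborel_integral_translation[of h "t n *\<^sub>R e"] by (simp add: q_def)
  moreover have "(\<lambda>n. LINT x|lborel. q n x) \<longlonglongrightarrow> (LINT x|lborel. g x)"
  proof (rule integral_dominated_convergence)
    show "integrable lborel (\<lambda>x::real^3. M * indicator (cball 0 (\<bar>R\<bar> + 1)) x)"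
      by (intro integrable_mult_right integrable_real_indicator emeasure_bounded_finite) auto
    show "AE x in lborel. (\<lambda>n. q n x) \<longlonglongrightarrow> g x" using q_lim by simp
    show "AE x in lborel. norm (q n x) \<le> M * indicator (cball 0 (\<bar>R\<bar> + 1)) x" for n using q_bound by simp
  qed (auto simp: q_def)
  ultimately have "(LINT x|lborel. g x) = 0" using LIMSEQ_unique[OF _ tendsto_const] by simp
  with int_g show ?thesis by blast
qed

lemma Ck1_derivative:
  assumes "Ck_field (Suc 0) f"
  shows "(f has_derivative frechet_derivative f (at x)) (at x)"
    and "continuous_on UNIV (pderiv_field i f)"
  using assms by (auto simp: frechet_derivative_works[symmetric] differentiable_on_def)

lemma pderiv_support:
  assumes "Ck_field (Suc 0) f"
  shows "{x. pderiv_field i f x \<noteq> 0} \<subseteq> closure {x. f x \<noteq> 0}"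
proof
  fix x assume x: "x \<in> {x. pderiv_field i f x \<noteq> 0}"
  show "x \<in> closure {x. f x \<noteq> 0}"
  proof (rule ccontr)
    assume n: "x \<notin> closure {x. f x \<noteq> 0}"
    have "(f has_derivative (\<lambda>_. 0)) (at x)"
    proof (rule has_derivative_transform_within_open[of "\<lambda>_. 0"])
      show "open (- closure {x. f x \<noteq> 0})" by (rule open_Compl[OF closed_closure])
      show "0 = f y" if "y \<in> - closure {x. f x \<noteq> 0}" for y
        using that closure_subset[of "{x. f x \<noteq> 0}"] by auto
    qed (use n in auto)
    then have "pderiv_field i f x = 0" by (rule pderiv_field_has_derivative)
    with x show False by simp
  qed
qed

lemma pderiv_compact:
  assumes "Ck_field (Suc 0) f" "compact (closure {x. f x \<noteq> 0})"
  shows "compact (closure {x. pderiv_field i f x \<noteq> 0})"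
  using compact_support_subset[OF assms(2) pderiv_support[OF assms(1)]] by blast

lemma integration_by_parts:
  assumes f: "Ck_field (Suc 0) f" "compact (closure {x. f x \<noteq> 0})" and g: "Ck_field (Suc 0) g"
  shows "(LINT x|lborel. pderiv_field i f x \<bullet> g x) = - (LINT x|lborel. f x \<bullet> pderiv_field i g x)"
proof -
  have cont: "continuous_on UNIV f" "continuous_on UNIV g"
    using Ck_field_continuous f(1) g by blast+
  note cont' = Ck1_derivative(2)[OF f(1), of i] Ck1_derivative(2)[OF g, of i]
  have supp: "compact (closure {x. f x \<bullet> g x \<noteq> 0})"
    using compact_support_subset[OF f(2), of "{x. f x \<bullet> g x \<noteq> 0}"] closure_subset[of "{x. f x \<noteq> 0}"] by fastforce
  have "((\<lambda>x. f x \<bullet> g x) has_derivative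
      (\<lambda>v. f x \<bullet> frechet_derivative g (at x) v + frechet_derivative f (at x) v \<bullet> g x)) (at x)" for x
    by (rule has_derivative_inner[OF Ck1_derivative(1)[OF f(1)] Ck1_derivative(1)[OF g]])
  note der = this
  have "continuous_on UNIV (\<lambda>x. f x \<bullet> pderiv_field i g x + pderiv_field i f x \<bullet> g x)"
    by (intro continuous_intros cont cont')
  from integral_partial_derivative_zero[OF der _ this supp, of i]
  have "(LINT x|lborel. f x \<bullet> pderiv_field i g x + pderiv_field i f x \<bullet> g x) = 0"
    by (simp add: pderiv_field_def)
  moreover have "integrable lborel (\<lambda>x. f x \<bullet> pderiv_field i g x)"
    using cont cont' compact_support_subset[OF f(2), of "{x. f x \<bullet> pderiv_field i g x \<noteq> 0}"] closure_subset[of "{x. f x \<noteq> 0}"]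
    by (intro compact_support_integrable continuous_intros) fastforce+
  moreover have "integrable lborel (\<lambda>x. pderiv_field i f x \<bullet> g x)"
    using cont cont' compact_support_subset[OF f(2), of "{x. pderiv_field i f x \<bullet> g x \<noteq> 0}"] pderiv_support[OF f(1), of i]
    by (intro compact_support_integrable continuous_intros) fastforce+
  ultimately show ?thesis by simp
qed

text \<open>
  Integrating the derivative of \<open>x\<^sub>i |f|\<^sup>2\<close> in the direction \<open>i\<close> gives
  \<open>|f|\<^sup>2 = - 2 (x\<^sub>i f) \<bullet> (pderiv_field i f)\<close> after integration, and \<open>|x\<^sub>i| \<le> M\<close> on the support.
\<close>

lemma poincare_inequality:
  assumes f: "Ck_field (Suc 0) f" "compact (closure {x. f x \<noteq> 0})"
    and M: "\<And>x. f x \<noteq> 0 \<Longrightarrow> \<bar>x $ i\<bar> \<le> M" and "M \<ge> 0"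
  shows "norm (abs_l2 f) \<le> 2 * M * norm (abs_l2 (pderiv_field i f))"
proof -
  have cont: "continuous_on UNIV f" using Ck_field_continuous f(1) by blast
  note cont' = Ck1_derivative(2)[OF f(1), of i]
  have f2: "sq_int f" by (rule compact_support_sq_int[OF cont f(2)])
  have pf2: "sq_int (pderiv_field i f)" by (rule compact_support_sq_int[OF cont' pderiv_compact[OF f]])
  define xf where "xf x = (x $ i) *\<^sub>R f x" for x
  have cont_xf: "continuous_on UNIV xf" unfolding xf_def[abs_def] by (intro continuous_intros cont)
  have xf2: "sq_int xf"
    using compact_support_subset[OF f(2), of "{x. xf x \<noteq> 0}"] closure_subset[of "{x. f x \<noteq> 0}"]
    by (intro compact_support_sq_int cont_xf) (auto simp: xf_def)
  have xf_le: "norm (abs_l2 xf) \<le> M * norm (abs_l2 f)"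
  proof -
    have "(LINT x|lborel. (norm (xf x))\<^sup>2) \<le> (LINT x|lborel. M\<^sup>2 * (norm (f x))\<^sup>2)"
    proof (rule integral_mono)
      show "(norm (xf x))\<^sup>2 \<le> M\<^sup>2 * (norm (f x))\<^sup>2" for x
      proof (cases "f x = 0")
        case False
        then have "(x $ i)\<^sup>2 \<le> M\<^sup>2" using M[OF False] \<open>M \<ge> 0\<close> by (simp add: abs_le_square_iff[symmetric])
        then show ?thesis by (simp add: xf_def power_mult_distrib mult_right_mono)
      qed (simp add: xf_def)
    qed (use xf2 f2 in \<open>auto simp: sq_int_def\<close>)
    then have "(norm (abs_l2 xf))\<^sup>2 \<le> (M * norm (abs_l2 f))\<^sup>2"
      by (simp add: norm_abs_l2 xf2 f2 power_mult_distrib)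
    then show ?thesis by (rule power2_le_imp_le) (use \<open>M \<ge> 0\<close> in simp)
  qed
  have der: "((\<lambda>x. (x $ i) * (f x \<bullet> f x)) has_derivative
      (\<lambda>v. (x $ i) * (f x \<bullet> frechet_derivative f (at x) v + frechet_derivative f (at x) v \<bullet> f x) + v $ i * (f x \<bullet> f x))) (at x)" for x
    by (rule has_derivative_mult[OF bounded_linear.has_derivative[OF bounded_linear_vec_nth has_derivative_ident]
          has_derivative_inner[OF Ck1_derivative(1)[OF f(1)] Ck1_derivative(1)[OF f(1)]]])
  have supp: "compact (closure {x. (x $ i) * (f x \<bullet> f x) \<noteq> 0})"
    using compact_support_subset[OF f(2), of "{x. (x $ i) * (f x \<bullet> f x) \<noteq> 0}"] closure_subset[of "{x. f x \<noteq> 0}"] by fastforce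
  have "continuous_on UNIV (\<lambda>x. 2 * (xf x \<bullet> pderiv_field i f x) + f x \<bullet> f x)"
    by (intro continuous_intros cont cont' cont_xf)
  from integral_partial_derivative_zero[OF der _ this supp, of i]
  have "(LINT x|lborel. 2 * (xf x \<bullet> pderiv_field i f x) + f x \<bullet> f x) = 0"
    by (simp add: pderiv_field_def xf_def inner_commute)
  moreover have "integrable lborel (\<lambda>x. xf x \<bullet> pderiv_field i f x)" "integrable lborel (\<lambda>x. f x \<bullet> f x)"
    by (intro integrable_inner_sq_int xf2 pf2 f2)+
  ultimately have "(norm (abs_l2 f))\<^sup>2 = - 2 * (abs_l2 xf \<bullet> abs_l2 (pderiv_field i f))"
    by (simp add: power2_norm_eq_inner inner_abs_l2 f2 xf2 pf2)
  also have "\<dots> \<le> 2 * (norm (abs_l2 xf) * norm (abs_l2 (pderiv_field i f)))"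
    using Cauchy_Schwarz_ineq2[of "abs_l2 xf" "abs_l2 (pderiv_field i f)"] by simp
  also have "\<dots> \<le> 2 * ((M * norm (abs_l2 f)) * norm (abs_l2 (pderiv_field i f)))"
    by (intro mult_left_mono mult_right_mono xf_le) auto
  finally have "norm (abs_l2 f) * norm (abs_l2 f) \<le> norm (abs_l2 f) * (2 * M * norm (abs_l2 (pderiv_field i f)))"
    by (simp add: power2_eq_square mult_ac)
  then show ?thesis using \<open>M \<ge> 0\<close> by (cases "norm (abs_l2 f) = 0") (auto simp: mult_le_cancel_left)
qed

section \<open>The Stokes operator\<close>

lemma pderiv_sq_int: "f \<in> solenoidal_test \<Omega> \<Longrightarrow> sq_int (pderiv_field i f)"
  by (intro compact_support_sq_int Ck1_derivative(2) pderiv_compact test_compact test_Ck)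

lemma Ck_pderiv: "f \<in> solenoidal_test \<Omega> \<Longrightarrow> Ck_field n (pderiv_field i f)"
  using test_Ck[of f \<Omega> "Suc n"] by simp

lemma laplacian_sq_int:
  assumes f: "f \<in> solenoidal_test \<Omega>" shows "sq_int (laplacian f)"
proof -
  have "sq_int (pderiv_field i (pderiv_field i f))" for i
    by (intro compact_support_sq_int Ck1_derivative(2) pderiv_compact Ck_pderiv[OF f] test_compact[OF f] test_Ck[OF f])
  then have "sq_int (\<lambda>x. pderiv_field 1 (pderiv_field 1 f) x + pderiv_field 2 (pderiv_field 2 f) x + pderiv_field 3 (pderiv_field 3 f) x)"
    by (intro sq_int_add)
  then show ?thesis by (simp add: laplacian_def[abs_def] sum_3)
qed

lemma laplacian_inner:
  assumes f: "f \<in> solenoidal_test \<Omega>" and g: "g \<in> solenoidal_test \<Omega>"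
  shows "- (abs_l2 (laplacian f) \<bullet> abs_l2 g) = (\<Sum>i\<in>UNIV. abs_l2 (pderiv_field i f) \<bullet> abs_l2 (pderiv_field i g))"
proof -
  have sq: "sq_int (pderiv_field i (pderiv_field i f))" for i
    by (intro compact_support_sq_int Ck1_derivative(2) pderiv_compact Ck_pderiv[OF f] test_compact[OF f] test_Ck[OF f])
  have "abs_l2 (laplacian f) \<bullet> abs_l2 g = (LINT x|lborel. (\<Sum>i\<in>UNIV. pderiv_field i (pderiv_field i f) x \<bullet> g x))"
    by (simp add: inner_abs_l2 laplacian_sq_int[OF f] test_sq_int[OF g] laplacian_def inner_sum_left)
  also have "\<dots> = (\<Sum>i\<in>UNIV. LINT x|lborel. pderiv_field i (pderiv_field i f) x \<bullet> g x)"
    by (rule Bochner_Integration.integral_sum) (intro integrable_inner_sq_int sq test_sq_int[OF g])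
  also have "\<dots> = (\<Sum>i\<in>UNIV. - (abs_l2 (pderiv_field i f) \<bullet> abs_l2 (pderiv_field i g)))"
    using integration_by_parts[OF Ck_pderiv[OF f] pderiv_compact[OF test_Ck[OF f] test_compact[OF f]] test_Ck[OF g]]
    by (intro sum.cong refl) (simp add: inner_abs_l2 pderiv_sq_int[OF f] pderiv_sq_int[OF g])
  finally show ?thesis by (simp add: sum_negf)
qed

definition stokes_pregraph :: "(real^3) set \<Rightarrow> (l2 \<times> l2) set" where
  "stokes_pregraph \<Omega> = {(abs_l2 f, - P0 \<Omega> (abs_l2 (laplacian f))) | f. f \<in> solenoidal_test \<Omega>}"

lemma laplacian_add:
  assumes "f \<in> solenoidal_test \<Omega>" "g \<in> solenoidal_test \<Omega>"
  shows "laplacian (\<lambda>x. f x + g x) x = laplacian f x + laplacian g x"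
proof -
  have "pderiv_field i (\<lambda>x. f x + g x) = (\<lambda>x. pderiv_field i f x + pderiv_field i g x)" for i
    using assms by (intro ext pderiv_field_add Ck_field_differentiable test_Ck)
  moreover have "pderiv_field i (\<lambda>x. pderiv_field i f x + pderiv_field i g x) x
      = pderiv_field i (pderiv_field i f) x + pderiv_field i (pderiv_field i g) x" for i
    using assms by (intro pderiv_field_add Ck_field_differentiable Ck_pderiv)
  ultimately show ?thesis by (simp add: laplacian_def sum.distrib)
qed

lemma laplacian_scale:
  assumes "f \<in> solenoidal_test \<Omega>"
  shows "laplacian (\<lambda>x. l *s f x) x = l *s laplacian f x"
proof -
  have "pderiv_field i (\<lambda>x. l *s f x) = (\<lambda>x. l *s pderiv_field i f x)" for i
    using assms by (intro ext pderiv_field_linear[OF _ bounded_linear_vector_scale] Ck_field_differentiable test_Ck)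
  moreover have "pderiv_field i (\<lambda>x. l *s pderiv_field i f x) x = l *s pderiv_field i (pderiv_field i f) x" for i
    using assms by (intro pderiv_field_linear[OF _ bounded_linear_vector_scale] Ck_field_differentiable Ck_pderiv)
  ultimately show ?thesis by (simp add: laplacian_def vec_eq_iff sum_distrib_left)
qed

lemma stokes_pregraph_scale:
  assumes "(d, g) \<in> stokes_pregraph \<Omega>"
  shows "(scaleC_l2 l d, scaleC_l2 l g) \<in> stokes_pregraph \<Omega>"
proof -
  interpret P: bounded_linear "P0 \<Omega>" by (rule linear_P0)
  obtain f where f: "f \<in> solenoidal_test \<Omega>" "d = abs_l2 f" "g = - P0 \<Omega> (abs_l2 (laplacian f))"
    using assms by (auto simp: stokes_pregraph_def)
  have "P0 \<Omega> (scaleC_l2 l v) = scaleC_l2 l (P0 \<Omega> v)" for v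
    by (simp add: scaleC_l2_Re_Im[of l] P.add P.scaleR P0_scaleC_i)
  moreover have "scaleC_l2 l (- v) = - scaleC_l2 l v" for v
    using scaleC_scaleR[of l "-1" v] by simp
  moreover have "abs_l2 (laplacian (\<lambda>x. l *s f x)) = scaleC_l2 l (abs_l2 (laplacian f))"
  proof -
    have "laplacian (\<lambda>x. l *s f x) = (\<lambda>x. l *s laplacian f x)" using laplacian_scale[OF f(1)] by blast
    then show ?thesis by (simp add: abs_l2_scaleC laplacian_sq_int[OF f(1)])
  qed
  ultimately show ?thesis
    unfolding stokes_pregraph_def using solenoidal_test_scale[OF f(1), of l] f
    by (auto simp: abs_l2_scaleC test_sq_int[OF f(1)] intro!: exI[of _ "\<lambda>x. l *s f x"])
qed

lemma stokes_pregraph_subspace: "subspace (stokes_pregraph \<Omega>)"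
proof (rule subspaceI)
  interpret P: bounded_linear "P0 \<Omega>" by (rule linear_P0)
  have zero: "(scaleC_l2 0 v) = 0" for v using scaleC_l2_Re_Im[of 0 v] by simp
  have "(abs_l2 (\<lambda>x. 0), - P0 \<Omega> (abs_l2 (laplacian (\<lambda>x. 0)))) \<in> stokes_pregraph \<Omega>"
    using solenoidal_test_zero[of \<Omega>] by (auto simp: stokes_pregraph_def)
  from stokes_pregraph_scale[OF this, of 0] show "0 \<in> stokes_pregraph \<Omega>"
    by (simp add: zero zero_prod_def)
next
  fix x y assume "x \<in> stokes_pregraph \<Omega>" "y \<in> stokes_pregraph \<Omega>"
  then obtain f g where f: "f \<in> solenoidal_test \<Omega>" "x = (abs_l2 f, - P0 \<Omega> (abs_l2 (laplacian f)))"
    and g: "g \<in> solenoidal_test \<Omega>" "y = (abs_l2 g, - P0 \<Omega> (abs_l2 (laplacian g)))"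
    by (auto simp: stokes_pregraph_def)
  interpret P: bounded_linear "P0 \<Omega>" by (rule linear_P0)
  have "laplacian (\<lambda>x. f x + g x) = (\<lambda>x. laplacian f x + laplacian g x)"
    using laplacian_add[OF f(1) g(1)] by blast
  then have "x + y = (abs_l2 (\<lambda>x. f x + g x), - P0 \<Omega> (abs_l2 (laplacian (\<lambda>x. f x + g x))))"
    using f g by (simp add: abs_l2_add[symmetric] test_sq_int laplacian_sq_int P.add)
  then show "x + y \<in> stokes_pregraph \<Omega>"
    unfolding stokes_pregraph_def using solenoidal_test_add[OF f(1) g(1)] by blast
next
  fix r x assume "x \<in> stokes_pregraph \<Omega>"
  then have "(scaleC_l2 (of_real r) (fst x), scaleC_l2 (of_real r) (snd x)) \<in> stokes_pregraph \<Omega>"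
    by (intro stokes_pregraph_scale) simp
  moreover have "scaleC_l2 (of_real r) v = r *\<^sub>R v" for v using scaleC_l2_Re_Im[of "of_real r" v] by simp
  ultimately show "r *\<^sub>R x \<in> stokes_pregraph \<Omega>" by (simp add: scaleR_prod_def)
qed

lemma Domain_stokes_pregraph: "closure (Domain (stokes_pregraph \<Omega>)) = J0 \<Omega>"
proof -
  have "Domain (stokes_pregraph \<Omega>) = abs_l2 ` solenoidal_test \<Omega>" by (auto simp: stokes_pregraph_def)
  then show ?thesis by (simp add: J0_def)
qed

text \<open>
  After integration by parts the energy is the sum of the squares of the derivatives, which the Poincare
  inequality in one direction bounds from below.
\<close>

lemma stokes_coercive_graph:
  assumes "bounded \<Omega>"
  shows "\<exists>c. coercive_graph (stokes_pregraph \<Omega>) c"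
proof -
  obtain M where M: "M > 0" "\<And>x. x \<in> \<Omega> \<Longrightarrow> norm x \<le> M" using assms by (auto simp: bounded_pos)
  have form: "(- P0 \<Omega> (abs_l2 (laplacian f))) \<bullet> abs_l2 g = (\<Sum>i\<in>UNIV. abs_l2 (pderiv_field i f) \<bullet> abs_l2 (pderiv_field i g))"
    if "f \<in> solenoidal_test \<Omega>" "g \<in> solenoidal_test \<Omega>" for f g
    using laplacian_inner[OF that] P0_inner[OF abs_test_in_J0[OF that(2)]] by simp
  have "coercive_graph (stokes_pregraph \<Omega>) (1 / (2 * M)\<^sup>2)"
  proof
    fix d g d' g' assume "(d, g) \<in> stokes_pregraph \<Omega>" "(d', g') \<in> stokes_pregraph \<Omega>"
    then obtain f f' where f: "f \<in> solenoidal_test \<Omega>" "f' \<in> solenoidal_test \<Omega>"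
      "d = abs_l2 f" "g = - P0 \<Omega> (abs_l2 (laplacian f))" "d' = abs_l2 f'" "g' = - P0 \<Omega> (abs_l2 (laplacian f'))"
      by (auto simp: stokes_pregraph_def)
    show "g \<bullet> d' = d \<bullet> g'"
      unfolding f(3-6) inner_commute[of "abs_l2 f"] form[OF f(1,2)] form[OF f(2,1)] by (simp add: inner_commute)
  next
    fix d g assume "(d, g) \<in> stokes_pregraph \<Omega>"
    then obtain f where f: "f \<in> solenoidal_test \<Omega>" "d = abs_l2 f" "g = - P0 \<Omega> (abs_l2 (laplacian f))"
      by (auto simp: stokes_pregraph_def)
    have "\<bar>x $ 1\<bar> \<le> M" if "f x \<noteq> 0" for x
      using M(2)[of x] that test_support[OF f(1)] closure_subset[of "{x. f x \<noteq> 0}"] component_le_norm_cart[of x 1] by fastforce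
    then have "norm d \<le> 2 * M * norm (abs_l2 (pderiv_field 1 f))"
      unfolding f(2) using M(1) by (intro poincare_inequality test_Ck[OF f(1)] test_compact[OF f(1)]) auto
    then have "(norm d)\<^sup>2 \<le> (2 * M * norm (abs_l2 (pderiv_field 1 f)))\<^sup>2" by (intro power_mono) auto
    then have "1 / (2 * M)\<^sup>2 * (norm d)\<^sup>2 \<le> (norm (abs_l2 (pderiv_field 1 f)))\<^sup>2"
      using M(1) by (simp add: power_mult_distrib field_simps)
    also have "\<dots> \<le> (\<Sum>i\<in>UNIV. (norm (abs_l2 (pderiv_field i f)))\<^sup>2)" by (rule member_le_sum) auto
    also have "\<dots> = g \<bullet> d" unfolding f(2,3) form[OF f(1) f(1)] by (simp add: power2_norm_eq_inner)
    finally show "1 / (2 * M)\<^sup>2 * (norm d)\<^sup>2 \<le> g \<bullet> d" .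
  qed (use M(1) stokes_pregraph_subspace in auto)
  then show ?thesis by blast
qed

text \<open>
  The graph of the Stokes operator on test fields is closed under multiplication by \<open>\<i>\<close>, so the weak
  equation for the real inner product implies the one for the Hermitian product.
\<close>

lemma stokes_graph_eq: "stokes_graph \<Omega> = real_friedrichs (stokes_pregraph \<Omega>)"
proof -
  have weak: "(\<forall>(d, g)\<in>stokes_pregraph \<Omega>. cinner_l2 u g = cinner_l2 f d) \<longleftrightarrow> (\<forall>(d, g)\<in>stokes_pregraph \<Omega>. u \<bullet> g = f \<bullet> d)" for u f
  proof
    assume "\<forall>(d, g)\<in>stokes_pregraph \<Omega>. cinner_l2 u g = cinner_l2 f d"
    then show "\<forall>(d, g)\<in>stokes_pregraph \<Omega>. u \<bullet> g = f \<bullet> d" by (auto simp: cinner_l2_eq)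
  next
    assume *: "\<forall>(d, g)\<in>stokes_pregraph \<Omega>. u \<bullet> g = f \<bullet> d"
    show "\<forall>(d, g)\<in>stokes_pregraph \<Omega>. cinner_l2 u g = cinner_l2 f d"
    proof (clarify)
      fix d g assume "(d, g) \<in> stokes_pregraph \<Omega>"
      then show "cinner_l2 u g = cinner_l2 f d"
        using * stokes_pregraph_scale[of d g \<Omega> \<i>] by (auto simp: cinner_l2_eq)
    qed
  qed
  show ?thesis
    unfolding stokes_graph_def friedrichs_def real_friedrichs_def energy_seq_def Domain_stokes_pregraph
      stokes_pregraph_def[symmetric] weak Re_cinner_l2
    by simp
qed

text \<open>
  \<open>Q0\<close> inverts the Stokes operator on \<open>J0 \<Omega>\<close> and vanishes on the orthogonal complement.
\<close>

lemma stokes_inverse: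
  assumes "bounded \<Omega>"
  obtains Q0 where "bounded_linear Q0" "\<And>a b. Q0 a \<bullet> b = a \<bullet> Q0 b" "\<And>a. 0 \<le> Q0 a \<bullet> a"
    "\<And>a. Q0 (scaleC_l2 \<i> a) = scaleC_l2 \<i> (Q0 a)" "\<And>a. Q0 a = Q0 (P0 \<Omega> a)"
    "\<And>a. Q0 a \<in> stokes_dom \<Omega>" "\<And>a. stokes \<Omega> (Q0 a) = P0 \<Omega> a"
    "\<And>v. v \<in> stokes_dom \<Omega> \<Longrightarrow> Q0 (stokes \<Omega> v) = v" "\<And>v. v \<in> stokes_dom \<Omega> \<Longrightarrow> v \<in> J0 \<Omega> \<and> stokes \<Omega> v \<in> J0 \<Omega>"
proof -
  obtain c where "coercive_graph (stokes_pregraph \<Omega>) c" using stokes_coercive_graph[OF assms] by blast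
  then interpret coercive_graph "stokes_pregraph \<Omega>" c .
  define A where "A = stokes_graph \<Omega>"
  have A: "A = real_friedrichs (stokes_pregraph \<Omega>)" by (simp add: A_def stokes_graph_eq)
  have A_J0: "u \<in> J0 \<Omega>" "f \<in> J0 \<Omega>" if "(u, f) \<in> A" for u f
    using that by (auto simp: A real_friedrichs_def Domain_stokes_pregraph)
  have ex: "\<exists>u. (u, f) \<in> A" if "f \<in> J0 \<Omega>" for f
    using friedrichs_surjective[of f] that by (simp add: A Domain_stokes_pregraph)
  have A_sym: "f \<bullet> u' = u \<bullet> f'" if "(u, f) \<in> A" "(u', f') \<in> A" for u f u' f'
    using friedrichs_symmetric that by (simp add: A)
  have eqI: "u = u'" if "u \<in> J0 \<Omega>" "u' \<in> J0 \<Omega>" "\<And>h. h \<in> J0 \<Omega> \<Longrightarrow> u \<bullet> h = u' \<bullet> h" for u u'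
  proof -
    have "(u - u') \<bullet> (u - u') = 0"
      using that(3)[OF subspace_diff[OF subspace_J0 that(1,2)]] by (simp add: inner_diff_left)
    then show ?thesis by simp
  qed
  have A_inj: "u = u'" if "(u, f) \<in> A" "(u', f) \<in> A" for u u' f
  proof (rule eqI)
    fix h assume "h \<in> J0 \<Omega>"
    then obtain w where "(w, h) \<in> A" using ex by blast
    then show "u \<bullet> h = u' \<bullet> h" using A_sym[OF that(1)] A_sym[OF that(2)] by metis
  qed (use A_J0 that in auto)
  have A_fun: "f = f'" if "(u, f) \<in> A" "(u, f') \<in> A" for u f f'
    using friedrichs_functional that by (simp add: A)
  have "\<forall>a. \<exists>u. (u, P0 \<Omega> a) \<in> A" using ex P0_in_J0 by blast
  then obtain Q0 where Q0: "\<And>a. (Q0 a, P0 \<Omega> a) \<in> A" by metis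
  have Q0_J0: "Q0 a \<in> J0 \<Omega>" for a using A_J0 Q0 by blast
  have sym: "Q0 a \<bullet> b = a \<bullet> Q0 b" for a b
  proof -
    have "P0 \<Omega> a \<bullet> Q0 b = Q0 a \<bullet> P0 \<Omega> b" by (rule A_sym[OF Q0 Q0])
    then show ?thesis using P0_inner[OF Q0_J0, of a b] P0_inner[OF Q0_J0, of b a] by (simp add: inner_commute)
  qed
  have coer: "c * (norm (Q0 a))\<^sup>2 \<le> a \<bullet> Q0 a" for a
    using friedrichs_coercive[OF Q0[of a, unfolded A]] P0_inner[OF Q0_J0[of a], of a] by simp
  have 1: "bounded_linear Q0"
  proof (rule bounded_linear_intro[where K="1/c"])
    show "Q0 (a + b) = Q0 a + Q0 b" for a b by (rule l2_eqI) (simp add: sym inner_add_left)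
    show "Q0 (r *\<^sub>R a) = r *\<^sub>R Q0 a" for r a by (rule l2_eqI) (simp add: sym)
    fix a
    have "c * (norm (Q0 a))\<^sup>2 \<le> norm a * norm (Q0 a)" using coer norm_cauchy_schwarz by (rule order_trans)
    then have "norm (Q0 a) * (c * norm (Q0 a)) \<le> norm (Q0 a) * norm a" by (simp add: power2_eq_square mult_ac)
    then have "c * norm (Q0 a) \<le> norm a" by (cases "norm (Q0 a) = 0") (auto simp: mult_le_cancel_left)
    then show "norm (Q0 a) \<le> norm a * (1 / c)" using c_pos by (simp add: field_simps)
  qed
  have 2: "0 \<le> Q0 a \<bullet> a" for a
  proof -
    have "0 \<le> c * (norm (Q0 a))\<^sup>2" using c_pos by simp
    also note coer
    finally show ?thesis by (simp add: inner_commute)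
  qed
  have A_J: "(scaleC_l2 \<i> u, scaleC_l2 \<i> f) \<in> A" if uf: "(u, f) \<in> A" for u f
  proof -
    interpret Ji: bounded_linear "scaleC_l2 \<i>" by (rule linear_scaleC_i)
    obtain d g where s: "energy_seq (stokes_pregraph \<Omega>) u d g" using uf by (auto simp: A real_friedrichs_def)
    have "energy_seq (stokes_pregraph \<Omega>) (scaleC_l2 \<i> u) (\<lambda>n. scaleC_l2 \<i> (d n)) (\<lambda>n. scaleC_l2 \<i> (g n))"
      using s unfolding energy_seq_def
      by (simp add: stokes_pregraph_scale Ji.tendsto Ji.diff[symmetric] inner_scaleC_i)
    moreover have "scaleC_l2 \<i> u \<bullet> g = scaleC_l2 \<i> f \<bullet> d" if "(d, g) \<in> stokes_pregraph \<Omega>" for d g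
      using uf stokes_pregraph_scale[OF that, of \<i>]
      by (auto simp: A real_friedrichs_def inner_scaleC_i_left)
    ultimately show ?thesis using A_J0[OF uf] J0_scaleC_i
      by (auto simp: A real_friedrichs_def Domain_stokes_pregraph)
  qed
  have 3: "Q0 (scaleC_l2 \<i> a) = scaleC_l2 \<i> (Q0 a)" for a
    using A_inj[OF Q0[of "scaleC_l2 \<i> a"]] A_J[OF Q0[of a]] by (simp add: P0_scaleC_i)
  have 4: "Q0 a = Q0 (P0 \<Omega> a)" for a
    using A_inj[OF Q0[of a]] Q0[of "P0 \<Omega> a"] by (simp add: P0_ident P0_in_J0)
  have stokes: "stokes \<Omega> u = f" if "(u, f) \<in> A" for u f
    unfolding stokes_def using that A_fun by (auto simp: A_def)
  have 5: "Q0 a \<in> stokes_dom \<Omega>" "stokes \<Omega> (Q0 a) = P0 \<Omega> a" for a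
    using Q0[of a] stokes[OF Q0] by (auto simp: stokes_dom_def A_def)
  have dom: "(v, stokes \<Omega> v) \<in> A" if "v \<in> stokes_dom \<Omega>" for v
    using that stokes by (auto simp: stokes_dom_def A_def)
  have 6: "Q0 (stokes \<Omega> v) = v" if "v \<in> stokes_dom \<Omega>" for v
    using A_inj[OF Q0[of "stokes \<Omega> v"]] dom[OF that] A_J0[OF dom[OF that]] by (simp add: P0_ident)
  show ?thesis by (rule that[OF 1 sym 2 3 4 5 6]) (use A_J0 dom in blast)+
qed

section \<open>A solenoidal bump field\<close>

text \<open>
  The powers of \<open>s\<close> in the denominator make this family of flat functions closed under differentiation
  up to linear combinations.
\<close>

definition flat_exp :: "nat \<Rightarrow> real \<Rightarrow> real" where
  "flat_exp k s = (if s > 0 then exp (- 1 / s) / s ^ k else 0)"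

lemma flat_exp_nonneg: "0 \<le> flat_exp k s"
  by (simp add: flat_exp_def)

text \<open>
  One term of the exponential series bounds \<open>exp (1 / s)\<close> from below. The linear bound, for all \<open>k\<close>,
  yields the derivative at the origin.
\<close>

lemma flat_exp_bound: "\<bar>flat_exp k s\<bar> \<le> fact (Suc k) * \<bar>s\<bar>"
proof (cases "s > 0")
  case True
  have "(\<Sum>n\<in>{Suc k}. inverse (fact n) *\<^sub>R (1 / s) ^ n) \<le> exp (1 / s)"
    unfolding exp_def using True by (intro sum_le_suminf summable_exp_generic) auto
  then have exp_ge: "inverse (fact (Suc k)) * (1 / s) ^ Suc k \<le> exp (1 / s)" by (simp del: fact_Suc power_Suc)
  have "fact (Suc k) * (inverse (fact (Suc k)) * X) = X" for X :: real
    by (simp only: mult.assoc[symmetric] right_inverse[OF fact_nonzero] mult_1)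
  with mult_left_mono[OF exp_ge fact_ge_zero[of "Suc k"]]
  have "(1 / s) ^ Suc k \<le> fact (Suc k) * exp (1 / s)" by (simp only:)
  then have "(1 / s) ^ Suc k * s ^ Suc k \<le> fact (Suc k) * exp (1 / s) * s ^ Suc k"
    using True by (intro mult_right_mono) auto
  moreover have "(1 / s) ^ Suc k * s ^ Suc k = 1" using True by (simp only: power_mult_distrib[symmetric]) simp
  ultimately have "1 \<le> fact (Suc k) * exp (1 / s) * s ^ Suc k" by (simp only:)
  then have "exp (- 1 / s) * 1 \<le> exp (- 1 / s) * (fact (Suc k) * exp (1 / s) * s ^ Suc k)"
    by (intro mult_left_mono) auto
  also have "\<dots> = (exp (- 1 / s) * exp (1 / s)) * (fact (Suc k) * s ^ Suc k)" by (simp add: mult_ac)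
  also have "exp (- 1 / s) * exp (1 / s) = 1" by (simp add: exp_minus flip: minus_divide_left)
  finally have "exp (- 1 / s) \<le> (fact (Suc k) * s) * s ^ k" by (simp add: mult_ac)
  then show ?thesis using True by (simp add: flat_exp_def divide_le_eq del: fact_Suc)
next
  case False
  then have zero: "flat_exp k s = 0" by (simp add: flat_exp_def)
  show ?thesis unfolding zero by (simp del: fact_Suc)
qed

lemma flat_exp_has_derivative:
  "(flat_exp k has_real_derivative (flat_exp (k + 2) s - real k * flat_exp (k + 1) s)) (at s)"
proof -
  consider "s > 0" | "s < 0" | "s = 0" by linarith
  then show ?thesis
  proof cases
    case 1
    have E: "((\<lambda>s. exp (- 1 / s)) has_real_derivative exp (- 1 / s) * (1 / s\<^sup>2)) (at s)"
      using 1 by (auto intro!: derivative_eq_intros simp: power2_eq_square)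
    have "((\<lambda>s. s ^ k) has_real_derivative real k * s ^ (k - 1)) (at s)"
      by (auto intro!: derivative_eq_intros)
    from DERIV_divide[OF E this]
    have "((\<lambda>s. exp (- 1 / s) / s ^ k) has_real_derivative
        (exp (- 1 / s) * (1 / s\<^sup>2) * s ^ k - exp (- 1 / s) * (real k * s ^ (k - 1))) / (s ^ k * s ^ k)) (at s)"
      using 1 by simp
    also have "(exp (- 1 / s) * (1 / s\<^sup>2) * s ^ k - exp (- 1 / s) * (real k * s ^ (k - 1))) / (s ^ k * s ^ k)
        = flat_exp (k + 2) s - real k * flat_exp (k + 1) s"
    proof (cases k)
      case 0
      then show ?thesis using 1 by (simp add: flat_exp_def power2_eq_square)
    next
      case (Suc m)
      define q where "q = s ^ m"
      define e where "e = exp (- 1 / s)"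
      have q: "q > 0" using 1 by (simp add: q_def)
      have pows: "s ^ k = s * q" "s ^ (k - 1) = q" "s ^ (k + 2) = s * s * s * q" "s ^ (k + 1) = s * s * q"
        by (simp_all add: Suc q_def mult_ac)
      show ?thesis
        unfolding flat_exp_def pows e_def[symmetric] using 1 q by (simp add: field_simps power2_eq_square)
    qed
    finally have "((\<lambda>s. exp (- 1 / s) / s ^ k) has_real_derivative (flat_exp (k + 2) s - real k * flat_exp (k + 1) s)) (at s)" .
    then show ?thesis
      by (rule has_field_derivative_transform_within_open[of _ _ _ "{0<..}"]) (use 1 in \<open>auto simp: flat_exp_def\<close>)
  next
    case 2
    have "((\<lambda>s. 0) has_real_derivative 0) (at s)" by simp
    then have "(flat_exp k has_real_derivative 0) (at s)"
      by (rule has_field_derivative_transform_within_open[of _ _ _ "{..<0}"]) (use 2 in \<open>auto simp: flat_exp_def\<close>)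
    then show ?thesis using 2 by (simp add: flat_exp_def)
  next
    case 3
    have "((\<lambda>h. (flat_exp k (0 + h) - flat_exp k 0) / h) \<longlongrightarrow> 0) (at 0)"
    proof (rule Lim_null_comparison)
      have "\<bar>(flat_exp k h - flat_exp k 0) / h\<bar> \<le> fact (Suc (Suc k)) * \<bar>h\<bar>" for h
      proof (cases "h > 0")
        case True
        then have "(flat_exp k h - flat_exp k 0) / h = flat_exp (Suc k) h" by (simp add: flat_exp_def)
        then show ?thesis using flat_exp_bound[of "Suc k" h] by simp
      next
        case False
        then have zero: "(flat_exp k h - flat_exp k 0) / h = 0" by (simp add: flat_exp_def)
        show ?thesis unfolding zero by (simp del: fact_Suc)
      qed
      then show "\<forall>\<^sub>F h in at 0. norm ((flat_exp k (0 + h) - flat_exp k 0) / h) \<le> fact (Suc (Suc k)) * \<bar>h\<bar>"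
        by (simp del: fact_Suc)
      show "((\<lambda>h. fact (Suc (Suc k)) * \<bar>h\<bar>) \<longlongrightarrow> (0::real)) (at 0)"
        by (intro tendsto_mult_right_zero tendsto_rabs_zero tendsto_ident_at)
    qed
    then show ?thesis using 3 by (simp add: DERIV_def flat_exp_def)
  qed
qed

text \<open>
  Vector polynomials in \<open>x - c\<close>, generated in such a way that closure under partial derivatives follows by
  rule induction.
\<close>

inductive poly_field :: "real^3 \<Rightarrow> (real^3 \<Rightarrow> complex^3) \<Rightarrow> bool" for c where
  const: "poly_field c (\<lambda>x. v)"
| scale: "poly_field c q \<Longrightarrow> poly_field c (\<lambda>x. r *\<^sub>R q x)"
| mult: "poly_field c q \<Longrightarrow> poly_field c (\<lambda>x. (x $ i - c $ i) *\<^sub>R q x)"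
| add: "poly_field c q \<Longrightarrow> poly_field c q' \<Longrightarrow> poly_field c (\<lambda>x. q x + q' x)"

lemma poly_field_pderiv:
  assumes "poly_field c q"
  shows "(\<forall>x. q differentiable (at x)) \<and> (\<forall>j. poly_field c (pderiv_field j q))"
  using assms
proof induction
  case (const v)
  have "pderiv_field j (\<lambda>x. v) = (\<lambda>x. 0)" for j
    using pderiv_field_has_derivative[OF has_derivative_const] by blast
  then show ?case using poly_field.const[of c 0] by simp
next
  case (scale q r)
  have "pderiv_field j (\<lambda>x. r *\<^sub>R q x) = (\<lambda>x. r *\<^sub>R pderiv_field j q x)" for j
    using scale by (intro ext pderiv_field_linear[OF _ bounded_linear_scaleR_right]) blast
  then show ?case using scale poly_field.scale by auto
next
  case (mult q i)
  have der: "((\<lambda>x. (x $ i - c $ i) *\<^sub>R q x) has_derivative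
      (\<lambda>h. (x $ i - c $ i) *\<^sub>R frechet_derivative q (at x) h + (h $ i) *\<^sub>R q x)) (at x)" for x
  proof -
    have "((\<lambda>x. x $ i - c $ i) has_derivative (\<lambda>h. h $ i)) (at x)"
      by (auto intro!: derivative_eq_intros bounded_linear.has_derivative[OF bounded_linear_vec_nth])
    moreover have "(q has_derivative frechet_derivative q (at x)) (at x)"
      using mult by (simp add: frechet_derivative_works[symmetric])
    ultimately show ?thesis by (rule has_derivative_scaleR)
  qed
  have "pderiv_field j (\<lambda>x. (x $ i - c $ i) *\<^sub>R q x)
      = (\<lambda>x. (x $ i - c $ i) *\<^sub>R pderiv_field j q x + (axis j 1 $ i) *\<^sub>R q x)" for j
    using pderiv_field_has_derivative[OF der] by (simp add: fun_eq_iff pderiv_field_def)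
  then show ?case using mult der
    by (auto simp: differentiable_def intro!: poly_field.add poly_field.mult poly_field.scale)
next
  case (add q q')
  have "pderiv_field j (\<lambda>x. q x + q' x) = (\<lambda>x. pderiv_field j q x + pderiv_field j q' x)" for j
    using add by (intro ext pderiv_field_add) auto
  then show ?case using add by (auto intro!: poly_field.add)
qed

definition bump_arg :: "real \<Rightarrow> real^3 \<Rightarrow> real^3 \<Rightarrow> real" where
  "bump_arg r c x = r\<^sup>2 - (x - c) \<bullet> (x - c)"

lemma bump_arg_has_derivative: "(bump_arg r c has_derivative (\<lambda>h. - 2 * ((x - c) \<bullet> h))) (at x)"
  unfolding bump_arg_def[abs_def]
  by (auto intro!: derivative_eq_intros simp: inner_commute)

lemma flat_exp_bump_has_derivative:
  "((\<lambda>x. flat_exp k (bump_arg r c x)) has_derivative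
     (\<lambda>h. (flat_exp (k + 2) (bump_arg r c x) - real k * flat_exp (k + 1) (bump_arg r c x)) * (- 2 * ((x - c) \<bullet> h)))) (at x)"
  using has_derivative_compose[OF bump_arg_has_derivative
      flat_exp_has_derivative[of k "bump_arg r c x", unfolded has_field_derivative_def]] .

text \<open>
  Each partial derivative is a sum of functions of the same form, with other values of \<open>k\<close> and \<open>q\<close>.
\<close>

lemma flat_exp_bump_smooth:
  "poly_field c q \<Longrightarrow> Ck_field n (\<lambda>x. flat_exp k (bump_arg r c x) *\<^sub>R q x)"
proof (induction n arbitrary: k q)
  case 0
  have "continuous_on UNIV (\<lambda>x. flat_exp k (bump_arg r c x))"
    using flat_exp_bump_has_derivative by (intro continuous_at_imp_continuous_on) (blast intro: has_derivative_continuous)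
  moreover have "continuous_on UNIV q"
    using poly_field_pderiv[OF 0] by (auto intro!: differentiable_imp_continuous_on simp: differentiable_on_def)
  ultimately show ?case by (simp add: continuous_on_scaleR)
next
  case (Suc n)
  define s where "s = bump_arg r c"
  have q: "q differentiable (at x)" "poly_field c (pderiv_field j q)" for x j
    using poly_field_pderiv[OF Suc.prems] by auto
  have der: "((\<lambda>x. flat_exp k (s x) *\<^sub>R q x) has_derivative
      (\<lambda>h. flat_exp k (s x) *\<^sub>R frechet_derivative q (at x) h
        + ((flat_exp (k + 2) (s x) - real k * flat_exp (k + 1) (s x)) * (- 2 * ((x - c) \<bullet> h))) *\<^sub>R q x)) (at x)" for x
    unfolding s_def using q(1)
    by (intro has_derivative_scaleR flat_exp_bump_has_derivative) (simp add: frechet_derivative_works[symmetric])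
  have "pderiv_field i (\<lambda>x. flat_exp k (s x) *\<^sub>R q x)
      = (\<lambda>x. (flat_exp k (s x) *\<^sub>R pderiv_field i q x
          + flat_exp (k + 2) (s x) *\<^sub>R ((- 2) *\<^sub>R ((x $ i - c $ i) *\<^sub>R q x)))
          + flat_exp (k + 1) (s x) *\<^sub>R ((2 * real k) *\<^sub>R ((x $ i - c $ i) *\<^sub>R q x)))" for i
  proof
    fix x
    have e: "((A - K * B) * (- 2 * d)) *\<^sub>R v = A *\<^sub>R ((- 2) *\<^sub>R (d *\<^sub>R v)) + B *\<^sub>R ((2 * K) *\<^sub>R (d *\<^sub>R v))"
      for A B K d :: real and v :: "complex^3"
    proof -
      have "(A - K * B) * (- 2 * d) = A * ((- 2) * d) + B * ((2 * K) * d)" by (simp add: algebra_simps)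
      then show ?thesis by (simp only: scaleR_add_left scaleR_scaleR)
    qed
    have "(x - c) \<bullet> axis i 1 = x $ i - c $ i" by (simp add: inner_axis)
    then show "pderiv_field i (\<lambda>x. flat_exp k (s x) *\<^sub>R q x) x = (flat_exp k (s x) *\<^sub>R pderiv_field i q x
          + flat_exp (k + 2) (s x) *\<^sub>R ((- 2) *\<^sub>R ((x $ i - c $ i) *\<^sub>R q x)))
          + flat_exp (k + 1) (s x) *\<^sub>R ((2 * real k) *\<^sub>R ((x $ i - c $ i) *\<^sub>R q x))"
      unfolding pderiv_field_has_derivative[OF der] by (simp only: e pderiv_field_def add.assoc)
  qed
  moreover have "Ck_field n (\<lambda>x. (flat_exp k (s x) *\<^sub>R pderiv_field i q x
          + flat_exp (k + 2) (s x) *\<^sub>R ((- 2) *\<^sub>R ((x $ i - c $ i) *\<^sub>R q x)))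
          + flat_exp (k + 1) (s x) *\<^sub>R ((2 * real k) *\<^sub>R ((x $ i - c $ i) *\<^sub>R q x)))" for i
    unfolding s_def
    by (intro Ck_field_add Suc.IH q(2) poly_field.scale poly_field.mult Suc.prems)
  moreover have "(\<lambda>x. flat_exp k (s x) *\<^sub>R q x) differentiable_on UNIV"
    unfolding differentiable_on_def
  proof
    show "(\<lambda>x. flat_exp k (s x) *\<^sub>R q x) differentiable (at x)" for x using der by (rule differentiableI)
  qed
  ultimately show ?case by (simp add: s_def)
qed

section \<open>Rigid rotations of the fluid\<close>

lemma bounded_bilinear_ccross: "bounded_bilinear ccross"
  unfolding bilinear_conv_bounded_bilinear[symmetric] bilinear_def
  by (auto intro!: linearI simp: ccross_def vec_eq_iff algebra_simps)

lemma linear_cvec: "bounded_linear cvec"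
  unfolding linear_conv_bounded_linear[symmetric]
  by (auto intro!: linearI simp: cvec_def vec_eq_iff) (simp add: scaleR_conv_of_real)

lemma bounded_linear_ccross_cvec: "bounded_linear (\<lambda>x. ccross w (cvec x))"
  using bounded_linear_compose[OF bounded_bilinear.bounded_linear_right[OF bounded_bilinear_ccross] linear_cvec] .

lemma ccross_cvec_adjoint: "ccross (cvec x) v \<bullet> w = v \<bullet> ccross w (cvec x)"
proof -
  have [simp]: "(4::3) = 1" "(5::3) = 2" by simp_all
  show ?thesis
    by (simp add: ccross_def cvec_def inner_vec_def inner_complex_def sum_3 algebra_simps)
qed

lemma ccross_cvec_components:
  "ccross w (cvec x) = (x $ 1) *\<^sub>R ccross w (cvec (axis 1 1)) + (x $ 2) *\<^sub>R ccross w (cvec (axis 2 1))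
     + (x $ 3) *\<^sub>R ccross w (cvec (axis 3 1))"
proof -
  interpret C: bounded_linear "\<lambda>x. ccross w (cvec x)" by (rule bounded_linear_ccross_cvec)
  have "x = (x $ 1) *\<^sub>R axis 1 1 + (x $ 2) *\<^sub>R axis 2 1 + (x $ 3) *\<^sub>R axis 3 1"
    by (simp add: vec_eq_iff forall_3 axis_def)
  from arg_cong[OF this, of "\<lambda>x. ccross w (cvec x)"] show ?thesis by (simp only: C.add C.scaleR)
qed

lemma ccross_diag: "ccross w (cvec (axis i 1)) $ i = 0"
proof -
  have "i + 1 \<noteq> i" "i + 2 \<noteq> i" for i :: 3 using exhaust_3[of i] by auto
  then show ?thesis by (simp add: ccross_def cvec_def axis_def)
qed

lemma ccross_eq_0:
  assumes "\<And>i. ccross w (cvec (axis i 1)) = 0" shows "w = 0"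
proof -
  have "w $ (i + 1) = 0" for i
  proof -
    have "ccross w (cvec (axis (i + 3) 1)) $ (i + 2) = 0" by (simp add: assms)
    have "ccross w (cvec (axis i 1)) $ (i + 2) = 0" by (simp add: assms)
    moreover have "i + 2 + 1 = i" "i + 2 + 2 = i + 1" "i + 1 \<noteq> i" using exhaust_3[of i] by auto
    ultimately show ?thesis by (simp add: ccross_def cvec_def axis_def)
  qed
  from this[of 0] this[of 1] this[of 2] show ?thesis
    by (simp add: vec_eq_iff forall_3)
qed

definition rotation_field :: "(real^3) set \<Rightarrow> complex^3 \<Rightarrow> real^3 \<Rightarrow> complex^3" where
  "rotation_field \<Omega> w x = (if x \<in> \<Omega> then ccross w (cvec x) else 0)"

text \<open>
  A rotation about \<open>c\<close> that fades out radially. The parameter 2 of the bump is chosen such that the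
  field \<open>x - c\<close> times the bump is a multiple of the gradient of another bump, the one with parameter 0.
\<close>

definition vortex :: "real \<Rightarrow> real^3 \<Rightarrow> complex^3 \<Rightarrow> real^3 \<Rightarrow> complex^3" where
  "vortex r c w x = flat_exp 2 (bump_arg r c x) *\<^sub>R ccross w (cvec (x - c))"

lemma bump_support: "flat_exp k (bump_arg r c x) \<noteq> 0 \<Longrightarrow> r > 0 \<Longrightarrow> x \<in> cball c r"
proof -
  assume "flat_exp k (bump_arg r c x) \<noteq> 0" "r > 0"
  then have "(norm (x - c))\<^sup>2 < r\<^sup>2" by (simp add: flat_exp_def bump_arg_def power2_norm_eq_inner split: if_splits)
  then have "norm (x - c) < r" using \<open>r > 0\<close> by (simp add: power_less_imp_less_base)
  then show ?thesis by (simp add: dist_norm norm_minus_commute)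
qed

text \<open>
  The field is solenoidal, because the rotation \<open>ccross w (cvec (x - c))\<close> is so, and it is orthogonal to
  the gradient of the bump, which is radial.
\<close>

lemma vortex_test:
  assumes "r > 0" "cball c r \<subseteq> \<Omega>"
  shows "vortex r c w \<in> solenoidal_test \<Omega>"
proof -
  have "poly_field c (\<lambda>x. (x $ 1 - c $ 1) *\<^sub>R ccross w (cvec (axis 1 1)) + (x $ 2 - c $ 2) *\<^sub>R ccross w (cvec (axis 2 1))
     + (x $ 3 - c $ 3) *\<^sub>R ccross w (cvec (axis 3 1)))"
    by (intro poly_field.intros)
  then have "poly_field c (\<lambda>x. ccross w (cvec (x - c)))"
    using ccross_cvec_components[of w "_ - c"] by simp
  then have smooth: "Ck_field n (vortex r c w)" for n
    unfolding vortex_def[abs_def] by (rule flat_exp_bump_smooth)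
  have "{x. vortex r c w x \<noteq> 0} \<subseteq> cball c r"
    using bump_support[OF _ assms(1)] by (auto simp: vortex_def)
  then have supp: "closure {x. vortex r c w x \<noteq> 0} \<subseteq> cball c r" by (rule closure_minimal) simp
  then have "compact (closure {x. vortex r c w x \<noteq> 0})"
    by (metis bounded_cball bounded_subset closed_closure compact_eq_bounded_closed)
  moreover have "divergence (vortex r c w) x = 0" for x
  proof -
    define b where "b = flat_exp 2 (bump_arg r c x)"
    define b' where "b' = (flat_exp (2 + 2) (bump_arg r c x) - real 2 * flat_exp (2 + 1) (bump_arg r c x)) * (- 2)"
    have "((\<lambda>x. x - c) has_derivative (\<lambda>h. h)) (at x)" by (auto intro!: derivative_eq_intros)
    from bounded_linear.has_derivative[OF bounded_linear_ccross_cvec this]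
    have "((\<lambda>x. ccross w (cvec (x - c))) has_derivative (\<lambda>h. ccross w (cvec h))) (at x)" .
    from pderiv_field_has_derivative[OF has_derivative_scaleR[OF flat_exp_bump_has_derivative[of 2 r c x] this]]
    have "pderiv_field i (vortex r c w) x
        = b *\<^sub>R ccross w (cvec (axis i 1)) + (b' * (x $ i - c $ i)) *\<^sub>R ccross w (cvec (x - c))" for i
      unfolding vortex_def[abs_def] by (simp add: b_def b'_def inner_axis) (simp add: algebra_simps)
    then have "divergence (vortex r c w) x
        = (\<Sum>i\<in>UNIV. complex_of_real (b' * (x $ i - c $ i)) * ccross w (cvec (x - c)) $ i)"
      by (simp add: divergence_def ccross_diag) (simp add: scaleR_conv_of_real)
    also have "\<dots> = complex_of_real b' * (\<Sum>i\<in>UNIV. complex_of_real (x $ i - c $ i) * ccross w (cvec (x - c)) $ i)"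
      by (simp add: sum_distrib_left mult.assoc)
    also have "(\<Sum>i\<in>UNIV. complex_of_real (x $ i - c $ i) * ccross w (cvec (x - c)) $ i) = 0"
    proof -
      have [simp]: "(4::3) = 1" "(5::3) = 2" by simp_all
      show ?thesis by (simp add: sum_3 ccross_def cvec_def algebra_simps)
    qed
    finally show ?thesis by simp
  qed
  ultimately show ?thesis using smooth supp assms(2) by (auto simp: solenoidal_test_def)
qed

lemma continuous_nonneg_integral_zero:
  fixes f :: "real^3 \<Rightarrow> real"
  assumes "continuous_on UNIV f" "\<And>x. 0 \<le> f x" "integrable lborel f" "(LINT x|lborel. f x) = 0"
  shows "f x = 0"
proof -
  have "AE x in lborel. f x = 0"
    using integral_nonneg_eq_0_iff_AE[OF assms(3)] assms(2,4) by simp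
  then have "{x. f x \<noteq> 0} \<in> null_sets lborel"
    using assms(1) borel_measurable_continuous_onI[OF assms(1)]
    by (subst (asm) AE_iff_null) auto
  then have "negligible {x. f x \<noteq> 0}"
    by (simp add: negligible_iff_null_sets null_sets_completionI)
  moreover have "open {x. f x \<noteq> 0}"
    using assms(1) by (intro open_Collect_neq continuous_intros)
  ultimately have "{x. f x \<noteq> 0} = {}" using open_not_negligible by blast
  then show ?thesis by blast
qed

context
  fixes \<Omega> :: "(real^3) set"
  assumes \<Omega>: "open \<Omega>" "bounded \<Omega>" "\<Omega> \<noteq> {}"
begin

lemma rotation_field_sq_int: "sq_int (rotation_field \<Omega> w)"
proof -
  have meas: "(\<lambda>x. ccross w (cvec x)) \<in> borel_measurable borel"
    using bounded_linear_ccross_cvec[of w] by (intro borel_measurable_continuous_onI linear_continuous_on)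
  have [measurable]: "\<Omega> \<in> sets borel" using \<Omega>(1) by simp
  have [measurable]: "rotation_field \<Omega> w \<in> borel_measurable borel"
    unfolding rotation_field_def[abs_def] using meas by measurable
  obtain R where R: "\<And>x. x \<in> \<Omega> \<Longrightarrow> norm x \<le> R" using \<Omega>(2) by (auto simp: bounded_iff)
  obtain K where K: "K > 0" "\<And>x. norm (ccross w (cvec x)) \<le> norm x * K"
    using bounded_linear.pos_bounded[OF bounded_linear_ccross_cvec[of w]] by blast
  have "integrable lborel (\<lambda>x. (R * K)\<^sup>2 * indicator \<Omega> x :: real)"
    using emeasure_bounded_finite[OF \<Omega>(2)] by (intro integrable_mult_right integrable_real_indicator) auto
  then have "integrable lborel (\<lambda>x. (norm (rotation_field \<Omega> w x))\<^sup>2)"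
  proof (rule Bochner_Integration.integrable_bound)
    show "AE x in lborel. norm ((norm (rotation_field \<Omega> w x))\<^sup>2) \<le> norm ((R * K)\<^sup>2 * indicator \<Omega> x :: real)"
    proof (rule AE_I2)
      fix x
      show "norm ((norm (rotation_field \<Omega> w x))\<^sup>2) \<le> norm ((R * K)\<^sup>2 * indicator \<Omega> x :: real)"
      proof (cases "x \<in> \<Omega>")
        case True
        have "norm (ccross w (cvec x)) \<le> R * K"
          using K(2)[of x] mult_right_mono[OF R[OF True], of K] K(1) by linarith
        then have "(norm (ccross w (cvec x)))\<^sup>2 \<le> (R * K)\<^sup>2" by (intro power_mono) auto
        then show ?thesis using True by (simp add: rotation_field_def)
      qed (simp add: rotation_field_def)
    qed
  qed auto
  then show ?thesis by (simp add: sq_int_def)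
qed

lemma op_B_eq: "op_B \<Omega> w = P0 \<Omega> (abs_l2 (rotation_field \<Omega> w))"
  by (simp add: op_B_def rotation_field_def[abs_def])

lemma linear_op_B: "bounded_linear (op_B \<Omega>)"
proof -
  interpret P: bounded_linear "P0 \<Omega>" by (rule linear_P0)
  interpret C: bounded_bilinear ccross by (rule bounded_bilinear_ccross)
  have "rotation_field \<Omega> (v + w) = (\<lambda>x. rotation_field \<Omega> v x + rotation_field \<Omega> w x)"
    and "rotation_field \<Omega> (r *\<^sub>R w) = (\<lambda>x. r *\<^sub>R rotation_field \<Omega> w x)" for v w r
    by (auto simp: rotation_field_def fun_eq_iff C.add_left C.scaleR_left)
  then have "linear (op_B \<Omega>)"
    by (intro linearI) (simp_all add: op_B_eq abs_l2_add[symmetric] abs_l2_scaleR[symmetric] rotation_field_sq_int P.add P.scaleR)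
  then show ?thesis by (simp add: linear_conv_bounded_linear)
qed

lemma op_B_scaleC_i: "op_B \<Omega> (\<i> *s w) = scaleC_l2 \<i> (op_B \<Omega> w)"
proof -
  have "ccross (\<i> *s w) y = \<i> *s ccross w y" for y by (simp add: ccross_def vec_eq_iff algebra_simps)
  then have "rotation_field \<Omega> (\<i> *s w) = (\<lambda>x. \<i> *s rotation_field \<Omega> w x)"
    by (auto simp: rotation_field_def fun_eq_iff)
  then show ?thesis by (simp add: op_B_eq abs_l2_scaleC[symmetric] rotation_field_sq_int P0_scaleC_i)
qed

lemma op_B_J0: "op_B \<Omega> w \<in> J0 \<Omega>"
  by (simp add: op_B_eq P0_in_J0)

lemma op_B_adj_inner:
  assumes "v \<in> J0 \<Omega>"
  shows "op_B_adj \<Omega> v \<bullet> w = v \<bullet> op_B \<Omega> w"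
proof -
  define F where "F x = indicator \<Omega> x *\<^sub>R ccross (cvec x) (rep_l2 v x)" for x
  have Fw: "F x \<bullet> y = rep_l2 v x \<bullet> rotation_field \<Omega> y x" for x y
    by (simp add: F_def rotation_field_def ccross_cvec_adjoint indicator_def)
  have "integrable lborel F"
  proof -
    have "integrable lborel (\<lambda>x. F x \<bullet> b)" for b
      unfolding Fw by (rule integrable_inner_sq_int[OF sq_int_rep_l2 rotation_field_sq_int])
    then have "integrable lborel (\<lambda>x. \<Sum>b\<in>Basis. (F x \<bullet> b) *\<^sub>R b)"
      by (intro Bochner_Integration.integrable_sum integrable_scaleR_left) auto
    then show ?thesis by (simp add: euclidean_representation)
  qed
  moreover have "op_B_adj \<Omega> v = (LINT x|lborel. F x)"
    by (simp add: op_B_adj_def set_lebesgue_integral_def F_def)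
  ultimately have "op_B_adj \<Omega> v \<bullet> w = (LINT x|lborel. F x \<bullet> w)"
    by (simp only: integral_inner_left)
  also have "\<dots> = v \<bullet> abs_l2 (rotation_field \<Omega> w)"
    unfolding Fw using inner_abs_l2[OF sq_int_rep_l2 rotation_field_sq_int, of v w] by simp
  also have "\<dots> = v \<bullet> op_B \<Omega> w"
    using P0_inner[OF assms, of "abs_l2 (rotation_field \<Omega> w)"] by (simp add: op_B_eq inner_commute)
  finally show ?thesis .
qed

lemma norm_op_B_le: "(norm (op_B \<Omega> w))\<^sup>2 \<le> (LINT x:\<Omega>|lborel. (norm (ccross w (cvec x)))\<^sup>2)"
proof -
  have "(norm (op_B \<Omega> w))\<^sup>2 = abs_l2 (rotation_field \<Omega> w) \<bullet> op_B \<Omega> w"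
    by (simp add: op_B_eq power2_norm_eq_inner P0_inner[OF P0_in_J0])
  also have "\<dots> \<le> norm (abs_l2 (rotation_field \<Omega> w)) * norm (op_B \<Omega> w)" by (rule norm_cauchy_schwarz)
  finally have "norm (op_B \<Omega> w) \<le> norm (abs_l2 (rotation_field \<Omega> w))"
    by (cases "norm (op_B \<Omega> w) = 0") (simp_all add: power2_eq_square mult_le_cancel_right)
  then have "(norm (op_B \<Omega> w))\<^sup>2 \<le> (norm (abs_l2 (rotation_field \<Omega> w)))\<^sup>2" by (intro power_mono) auto
  also have "\<dots> = (LINT x|lborel. (norm (rotation_field \<Omega> w x))\<^sup>2)" by (rule norm_abs_l2[OF rotation_field_sq_int])
  also have "\<dots> = (LINT x:\<Omega>|lborel. (norm (ccross w (cvec x)))\<^sup>2)"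
    unfolding set_lebesgue_integral_def
    by (intro Bochner_Integration.integral_cong) (auto simp: rotation_field_def indicator_def)
  finally show ?thesis .
qed

text \<open>
  If the rotation \<open>ccross w (cvec x)\<close> is orthogonal to all solenoidal test fields, then it is in
  particular orthogonal to the vortex with the same \<open>w\<close> in a ball inside \<open>\<Omega>\<close>. The rotation differs from
  the one about the centre \<open>c\<close> by a constant field, which is orthogonal to the vortex since the first
  moments of the bump vanish. So the integral of a nonnegative continuous function is zero, and the
  product of \<open>w\<close> with every direction vanishes.
\<close>

lemma op_B_injective:
  assumes "op_B \<Omega> w = 0" shows "w = 0"
proof -
  interpret C: bounded_linear "\<lambda>x. ccross w (cvec x)" by (rule bounded_linear_ccross_cvec)
  obtain c where "c \<in> \<Omega>" using \<Omega>(3) by blast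
  then obtain r where r: "r > 0" "cball c r \<subseteq> \<Omega>" using \<Omega>(1) open_contains_cball by blast
  define b where "b x = flat_exp 2 (bump_arg r c x)" for x
  have b_supp: "x \<in> cball c r" if "b x \<noteq> 0" for x using bump_support[OF _ r(1)] that by (simp add: b_def)
  have b_cont: "continuous_on UNIV b" unfolding b_def[abs_def]
    using flat_exp_bump_has_derivative by (intro continuous_at_imp_continuous_on) (blast intro: has_derivative_continuous)
  have compact: "compact (closure {x. g x \<noteq> 0})" if "\<And>x. b x = 0 \<Longrightarrow> g x = 0" for g :: "real^3 \<Rightarrow> real"
  proof -
    have "closure {x. g x \<noteq> 0} \<subseteq> cball c r" using that b_supp by (intro closure_minimal subsetI closed_cball) blast
    then show ?thesis by (metis bounded_cball bounded_subset closed_closure compact_eq_bounded_closed)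
  qed
  have vortex: "vortex r c w x = b x *\<^sub>R ccross w (cvec (x - c))" for x by (simp add: vortex_def b_def)
  note test = vortex_test[OF r, of w]
  have cc: "continuous_on UNIV (\<lambda>x. ccross w (cvec (x - c)))"
    by (intro continuous_on_compose2[OF linear_continuous_on[OF bounded_linear_ccross_cvec]] continuous_intros) auto
  define f where "f x = b x * (norm (ccross w (cvec (x - c))))\<^sup>2" for x
  have f_cont: "continuous_on UNIV f" unfolding f_def[abs_def] by (intro continuous_intros b_cont cc)
  have f_int: "integrable lborel f" by (rule compact_support_integrable[OF f_cont compact]) (simp add: f_def)
  text \<open>The first moments of the bump vanish because they are derivatives of a bump.\<close>
  have moment: "integrable lborel (\<lambda>x. b x * (x $ i - c $ i)) \<and> (LINT x|lborel. b x * (x $ i - c $ i)) = 0" for i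
  proof -
    have "integrable lborel (\<lambda>x. - 2 * (b x * (x $ i - c $ i))) \<and> (LINT x|lborel. - 2 * (b x * (x $ i - c $ i))) = 0"
    proof (rule integral_partial_derivative_zero[OF flat_exp_bump_has_derivative[of 0 r c]])
      show "(flat_exp (0 + 2) (bump_arg r c x) - real 0 * flat_exp (0 + 1) (bump_arg r c x)) * (- 2 * ((x - c) \<bullet> axis i 1))
          = - 2 * (b x * (x $ i - c $ i))" for x
        by (simp add: b_def inner_axis numeral_2_eq_2 algebra_simps)
      show "continuous_on UNIV (\<lambda>x. - 2 * (b x * (x $ i - c $ i)))" by (intro continuous_intros b_cont)
      show "compact (closure {x. flat_exp 0 (bump_arg r c x) \<noteq> 0})"
        by (rule compact) (simp add: b_def flat_exp_def split: if_splits)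
    qed
    then show ?thesis by simp
  qed
  have "(LINT x|lborel. rotation_field \<Omega> w x \<bullet> vortex r c w x) = (LINT x|lborel. f x)"
  proof -
    have eq: "rotation_field \<Omega> w x \<bullet> vortex r c w x = f x
        + (b x * (x $ 1 - c $ 1)) * (ccross w (cvec c) \<bullet> ccross w (cvec (axis 1 1)))
        + (b x * (x $ 2 - c $ 2)) * (ccross w (cvec c) \<bullet> ccross w (cvec (axis 2 1)))
        + (b x * (x $ 3 - c $ 3)) * (ccross w (cvec c) \<bullet> ccross w (cvec (axis 3 1)))" for x
    proof (cases "b x = 0")
      case True
      then show ?thesis by (simp add: vortex f_def)
    next
      case False
      then have "x \<in> \<Omega>" using b_supp r(2) by blast
      then have "rotation_field \<Omega> w x = ccross w (cvec (x - c)) + ccross w (cvec c)"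
        by (simp add: rotation_field_def C.diff)
      then have "rotation_field \<Omega> w x \<bullet> vortex r c w x = f x + b x * (ccross w (cvec c) \<bullet> ccross w (cvec (x - c)))"
        by (simp add: vortex f_def inner_add_left power2_norm_eq_inner algebra_simps)
      also have "ccross w (cvec c) \<bullet> ccross w (cvec (x - c))
        = (x $ 1 - c $ 1) * (ccross w (cvec c) \<bullet> ccross w (cvec (axis 1 1)))
        + (x $ 2 - c $ 2) * (ccross w (cvec c) \<bullet> ccross w (cvec (axis 2 1)))
        + (x $ 3 - c $ 3) * (ccross w (cvec c) \<bullet> ccross w (cvec (axis 3 1)))"
        by (subst ccross_cvec_components[of w "x - c"]) (simp add: inner_add_right)
      finally show ?thesis by (simp add: algebra_simps)
    qed
    show ?thesis unfolding eq using f_int moment by simp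
  qed
  moreover have "(LINT x|lborel. rotation_field \<Omega> w x \<bullet> vortex r c w x) = abs_l2 (rotation_field \<Omega> w) \<bullet> abs_l2 (vortex r c w)"
    by (simp add: inner_abs_l2 rotation_field_sq_int test_sq_int[OF test])
  moreover have "abs_l2 (rotation_field \<Omega> w) \<bullet> abs_l2 (vortex r c w) = op_B \<Omega> w \<bullet> abs_l2 (vortex r c w)"
    using P0_inner[OF abs_test_in_J0[OF test], of "abs_l2 (rotation_field \<Omega> w)"] by (simp add: op_B_eq)
  ultimately have "(LINT x|lborel. f x) = 0" by (simp add: assms)
  then have f0: "f x = 0" for x
    by (intro continuous_nonneg_integral_zero[OF f_cont _ f_int]) (auto simp: f_def b_def flat_exp_nonneg)
  have "ccross w (cvec (axis i 1)) = 0" for i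
  proof -
    define x where "x = c + (r / 2) *\<^sub>R axis i 1"
    have "(x - c) \<bullet> (x - c) = (r / 2)\<^sup>2" by (simp add: x_def power2_eq_square inner_axis_axis)
    then have "bump_arg r c x > 0" using mult_pos_pos[OF r(1) r(1)] by (simp add: bump_arg_def power2_eq_square)
    then have "b x > 0" by (simp add: b_def flat_exp_def)
    then have "ccross w (cvec (x - c)) = 0" using f0[of x] by (simp add: f_def)
    then show ?thesis using r(1) by (simp add: x_def C.scaleR)
  qed
  then show ?thesis by (rule ccross_eq_0)
qed

end

section \<open>The energy form of the rotating top\<close>

definition diag_op :: "(3 \<Rightarrow> real) \<Rightarrow> complex^3 \<Rightarrow> complex^3" where
  "diag_op d z = (\<chi> j. d j *\<^sub>R z $ j)"

definition cross_e0 :: "complex^3 \<Rightarrow> complex^3" where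
  "cross_e0 w = \<i> *s op_H w"

lemma sum_UNIV_3: "(\<Sum>j\<in>(UNIV::3 set). f j) = f 0 + f 1 + f 2"
proof -
  have *: "(3::3) = 0" by simp
  show ?thesis unfolding sum_3 * by (simp add: add_ac)
qed

lemma forall_UNIV_3: "(\<forall>j::3. P j) \<longleftrightarrow> P 0 \<and> P 1 \<and> P 2"
proof -
  have *: "(3::3) = 0" by simp
  show ?thesis unfolding forall_3 * by blast
qed

lemma vec_eq_3: "x = y \<longleftrightarrow> x $ 0 = y $ 0 \<and> x $ 1 = y $ 1 \<and> x $ (2::3) = y $ 2"
  by (simp add: vec_eq_iff forall_UNIV_3)

lemma cross_e0_nth [simp]: "cross_e0 w $ 0 = 0" "cross_e0 w $ 1 = w $ 2" "cross_e0 w $ 2 = - w $ 1"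
  by (simp_all add: cross_e0_def op_H_matrix)

lemma diag_op_nth [simp]: "diag_op d z $ j = d j *\<^sub>R z $ j"
  by (simp add: diag_op_def)

lemma op_A_diag: "op_A a w = diag_op (\<lambda>j. a $ j) w"
  by (simp add: op_A_def vec_eq_iff diag_mat_def matrix_vector_mult_def scaleR_conv_of_real if_distrib[of "\<lambda>x. x * _"] cong: if_cong)

lemma linear_diag_op: "bounded_linear (diag_op d)"
  unfolding linear_conv_bounded_linear[symmetric] by (rule linearI) (simp_all add: vec_eq_iff algebra_simps)

lemma linear_cross_e0: "bounded_linear cross_e0"
  unfolding linear_conv_bounded_linear[symmetric] by (rule linearI) (simp_all add: vec_eq_3)

lemma diag_op_i: "diag_op d (\<i> *s z) = \<i> *s diag_op d z"
  by (simp add: vec_eq_iff)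

lemma cross_e0_i: "cross_e0 (\<i> *s z) = \<i> *s cross_e0 z"
  by (simp add: vec_eq_3)

lemma diag_op_inner: "diag_op d x \<bullet> y = x \<bullet> diag_op d y"
  by (simp add: inner_vec_def)

lemma diag_op_self: "diag_op d x \<bullet> x = (\<Sum>j\<in>UNIV. d j * (norm (x $ j))\<^sup>2)"
  by (simp add: inner_vec_def power2_norm_eq_inner)

lemma cross_e0_inner: "cross_e0 x \<bullet> y = - (x \<bullet> cross_e0 y)"
  by (simp add: inner_vec_def sum_UNIV_3)

definition H_l2 :: "l2 \<Rightarrow> l2" where
  "H_l2 v = abs_l2 (\<lambda>x. op_H (rep_l2 v x))"

lemma linear_op_H: "bounded_linear op_H"
  unfolding linear_conv_bounded_linear[symmetric] by (rule linearI) (simp_all add: vec_eq_3 op_H_matrix algebra_simps)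

lemma norm_op_H_le: "norm (op_H z) \<le> norm z"
proof -
  have "(norm (op_H z))\<^sup>2 \<le> (norm z)\<^sup>2"
    by (simp add: power2_norm_eq_inner inner_vec_def sum_UNIV_3 op_H_matrix inner_complex_def algebra_simps)
  then show ?thesis by (rule power2_le_imp_le) simp
qed

lemma op_H_sym: "op_H x \<bullet> y = x \<bullet> op_H y"
  by (simp add: inner_vec_def sum_UNIV_3 op_H_matrix inner_complex_def algebra_simps)

lemma op_H_i: "op_H (\<i> *s z) = \<i> *s op_H z"
  by (simp add: vec_eq_3 op_H_matrix)

lemma sq_int_op_H:
  assumes "sq_int f" shows "sq_int (\<lambda>x. op_H (f x))"
proof -
  have [measurable]: "f \<in> borel_measurable borel" by (rule sq_int_measurable[OF assms])
  have meas[measurable]: "(\<lambda>x. op_H (f x)) \<in> borel_measurable borel"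
    by (rule measurable_compose[OF \<open>f \<in> borel_measurable borel\<close>])
      (intro borel_measurable_continuous_onI linear_continuous_on linear_op_H)
  have "integrable lborel (\<lambda>x. (norm (op_H (f x)))\<^sup>2)"
    by (rule Bochner_Integration.integrable_bound[OF sq_int_integrable[OF assms]])
      (auto intro!: power_mono norm_op_H_le)
  then show ?thesis by (simp add: sq_int_def)
qed

lemma H_l2_abs: "sq_int f \<Longrightarrow> H_l2 (abs_l2 f) = abs_l2 (\<lambda>x. op_H (f x))"
  unfolding H_l2_def
  by (subst abs_l2_eq) (auto intro!: sq_int_op_H eventually_mono[OF rep_abs_l2])

lemma H_l2_sym: "H_l2 v \<bullet> w = v \<bullet> H_l2 w"
proof -
  have "H_l2 v \<bullet> w = (LINT x|lborel. op_H (rep_l2 v x) \<bullet> rep_l2 w x)"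
    unfolding H_l2_def using inner_abs_l2[OF sq_int_op_H[OF sq_int_rep_l2] sq_int_rep_l2, of v w] by simp
  moreover have "v \<bullet> H_l2 w = (LINT x|lborel. rep_l2 v x \<bullet> op_H (rep_l2 w x))"
    unfolding H_l2_def using inner_abs_l2[OF sq_int_rep_l2 sq_int_op_H[OF sq_int_rep_l2], of v w] by simp
  ultimately show ?thesis by (simp add: op_H_sym)
qed

lemma linear_H_l2: "bounded_linear H_l2"
proof (rule bounded_linear_intro[where K=1])
  show "H_l2 (v + w) = H_l2 v + H_l2 w" for v w by (rule l2_eqI) (simp add: H_l2_sym inner_add_left)
  show "H_l2 (r *\<^sub>R v) = r *\<^sub>R H_l2 v" for r v by (rule l2_eqI) (simp add: H_l2_sym)
  fix v
  have "(norm (H_l2 v))\<^sup>2 \<le> (norm v)\<^sup>2"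
  proof -
    have "(norm (H_l2 v))\<^sup>2 = (LINT x|lborel. (norm (op_H (rep_l2 v x)))\<^sup>2)"
      unfolding H_l2_def by (rule norm_abs_l2[OF sq_int_op_H[OF sq_int_rep_l2]])
    also have "\<dots> \<le> (LINT x|lborel. (norm (rep_l2 v x))\<^sup>2)"
      by (intro integral_mono sq_int_integrable sq_int_op_H sq_int_rep_l2 power_mono norm_op_H_le norm_ge_zero)
    also have "\<dots> = (norm v)\<^sup>2" using norm_abs_l2[OF sq_int_rep_l2, of v] by simp
    finally show ?thesis .
  qed
  from power2_le_imp_le[OF this norm_ge_zero] show "norm (H_l2 v) \<le> norm v * 1" by simp
qed

lemma H_l2_scaleC_i: "H_l2 (scaleC_l2 \<i> v) = scaleC_l2 \<i> (H_l2 v)"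
proof -
  have "scaleC_l2 \<i> v = abs_l2 (\<lambda>x. \<i> *s rep_l2 v x)" using abs_l2_scaleC[OF sq_int_rep_l2, of \<i> v] by simp
  then have "H_l2 (scaleC_l2 \<i> v) = abs_l2 (\<lambda>x. \<i> *s op_H (rep_l2 v x))"
    by (simp only: H_l2_abs[OF sq_int_scale[OF sq_int_rep_l2]] op_H_i)
  also have "\<dots> = scaleC_l2 \<i> (H_l2 v)"
    unfolding H_l2_def by (rule abs_l2_scaleC[OF sq_int_op_H[OF sq_int_rep_l2], symmetric])
  finally show ?thesis .
qed

lemma bounded_bilinear_inner_comp:
  assumes "bounded_linear L" "bounded_linear L'"
  shows "bounded_bilinear (\<lambda>x y. L x \<bullet> L' y)"
  by (rule bounded_bilinear.comp[OF bounded_bilinear_inner assms])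

text \<open>
  The hypothesis \<open>inertia_gap\<close> is what remains of the mass distribution: the inertia of the body exceeds
  that of the motion of the fluid which is entrained by a rotation. \<open>Q0\<close> is the operator of
  \<open>stokes_inverse\<close>.
\<close>

locale rotating_top =
  fixes \<Omega> :: "(real^3) set" and a :: "real^3" and k \<nu> \<omega> :: real and Q0 :: "l2 \<Rightarrow> l2"
  assumes \<Omega>: "open \<Omega>" "bounded \<Omega>" "\<Omega> \<noteq> {}" and \<omega>_pos: "\<omega> > 0" and \<nu>_pos: "\<nu> > 0"
    and inertia_gap: "w \<noteq> 0 \<Longrightarrow> (norm (op_B \<Omega> w))\<^sup>2 < op_A a w \<bullet> w"
    and n_nonzero: "n_coeff a k \<omega> 1 \<noteq> 0" "n_coeff a k \<omega> 2 \<noteq> 0"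
    and linear_Q0: "bounded_linear Q0" and Q0_sym: "Q0 v \<bullet> v' = v \<bullet> Q0 v'" and Q0_nonneg: "0 \<le> Q0 v \<bullet> v"
    and Q0_i: "Q0 (scaleC_l2 \<i> v) = scaleC_l2 \<i> (Q0 v)" and Q0_P0: "Q0 v = Q0 (P0 \<Omega> v)"
    and Q0_dom: "Q0 v \<in> stokes_dom \<Omega>" and stokes_Q0: "stokes \<Omega> (Q0 v) = P0 \<Omega> v"
    and Q0_stokes: "v \<in> stokes_dom \<Omega> \<Longrightarrow> Q0 (stokes \<Omega> v) = v"
    and stokes_J0: "v \<in> stokes_dom \<Omega> \<Longrightarrow> v \<in> J0 \<Omega> \<and> stokes \<Omega> v \<in> J0 \<Omega>"
begin

definition n :: "3 \<Rightarrow> real" where "n j = (if j = 0 then 1 else n_coeff a k \<omega> j)"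

abbreviation "A \<equiv> diag_op (\<lambda>j. a $ j)"
abbreviation "N \<equiv> diag_op n"
abbreviation "B \<equiv> op_B \<Omega>"
abbreviation "P \<equiv> P0 \<Omega>"
abbreviation "h \<equiv> cross_e0"

definition neg :: "3 set" where "neg = {j. n j < 0}"

text \<open>
  The Coriolis operator \<open>\<i> G\<close>, extended by zero to the orthogonal complement of \<open>J0 \<Omega>\<close>.
\<close>

definition gyro :: "l2 \<Rightarrow> l2" where
  "gyro v = (- 2) *\<^sub>R P (scaleC_l2 \<i> (H_l2 (P v)))"

text \<open>
  Twice the energy, polarised, in the variables \<open>(z, w - \<omega> z, v)\<close>.
\<close>

definition form :: "state \<Rightarrow> state \<Rightarrow> real" where
  "form x y = A (fst (snd x)) \<bullet> fst (snd y) + snd (snd x) \<bullet> B (fst (snd y)) + B (fst (snd x)) \<bullet> snd (snd y)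
     + snd (snd x) \<bullet> snd (snd y) + (\<omega>\<^sup>2 *\<^sub>R N (fst x)) \<bullet> fst y"

text \<open>
  The right-hand sides of the equations for these variables without viscosity, tested with \<open>y\<close>. The
  factors \<open>\<omega>\<^sup>2 N\<close> come from the gravity and the centrifugal terms.
\<close>

definition skew :: "state \<Rightarrow> state \<Rightarrow> real" where
  "skew x y = (\<omega> *\<^sub>R h (A (fst (snd x)))) \<bullet> fst (snd y) + (\<omega> *\<^sub>R A (h (fst (snd x)))) \<bullet> fst (snd y)
     + ((- \<omega> * a $ 0) *\<^sub>R h (fst (snd x))) \<bullet> fst (snd y)
     + (\<omega> *\<^sub>R B (h (fst (snd x)))) \<bullet> snd (snd y) + ((- \<omega>) *\<^sub>R snd (snd x)) \<bullet> B (h (fst (snd y)))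
     + (\<omega> *\<^sub>R gyro (snd (snd x))) \<bullet> snd (snd y)
     + ((- \<omega>\<^sup>2) *\<^sub>R h (N (fst x))) \<bullet> fst (snd y) + ((- \<omega>\<^sup>2) *\<^sub>R N (h (fst (snd x)))) \<bullet> fst y"

definition rot :: "state \<Rightarrow> state" where
  "rot x = (\<i> *s fst x, \<i> *s fst (snd x), scaleC_l2 \<i> (snd (snd x)))"

definition unstable_part :: "state \<Rightarrow> complex^3" where
  "unstable_part x = coord_proj neg (fst x)"

definition unstable_emb :: "complex^3 \<Rightarrow> state" where
  "unstable_emb z = (coord_proj neg z, 0, 0)"

text \<open>
  The inverse of the damping operator: \<open>\<nu> R\<close> on \<open>J0 \<Omega>\<close> and the identity on its orthogonal complement.
\<close>

definition Q :: "l2 \<Rightarrow> l2" where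
  "Q v = (1 / \<nu>) *\<^sub>R Q0 v + (v - P v)"

sublocale B: bounded_linear B by (rule linear_op_B[OF \<Omega>])
sublocale P: bounded_linear P by (rule linear_P0)
sublocale h: bounded_linear cross_e0 by (rule linear_cross_e0)
sublocale Ci: bounded_linear "scaleC_l2 \<i>" by (rule linear_scaleC_i)
sublocale Q0: bounded_linear Q0 by (rule linear_Q0)

lemmas bl_fst = bounded_linear_fst
lemmas bl_fst_snd = bounded_linear_compose[OF bounded_linear_fst bounded_linear_snd]
lemmas bl_snd_snd = bounded_linear_compose[OF bounded_linear_snd bounded_linear_snd]

lemma linear_gyro: "bounded_linear gyro"
  unfolding gyro_def[abs_def]
  by (rule bounded_linear_compose[OF bounded_linear_scaleR_right bounded_linear_compose[OF linear_P0
        bounded_linear_compose[OF linear_scaleC_i bounded_linear_compose[OF linear_H_l2 linear_P0]]]])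

lemma gyro_skew: "gyro v \<bullet> w = - (v \<bullet> gyro w)"
  by (simp add: gyro_def P0_sym inner_scaleC_i_left H_l2_sym H_l2_scaleC_i[symmetric])

lemma gyro_i: "gyro (scaleC_l2 \<i> v) = scaleC_l2 \<i> (gyro v)"
  by (simp add: gyro_def P0_scaleC_i H_l2_scaleC_i Ci.scaleR Ci.neg)

lemma bilinear_form: "bounded_bilinear form"
  unfolding form_def[abs_def]
  by (intro bounded_bilinear_add bounded_bilinear_inner_comp
      bl_fst bl_fst_snd bl_snd_snd bounded_linear_compose[OF linear_diag_op bl_fst_snd]
      bounded_linear_compose[OF B.bounded_linear bl_fst_snd]
      bounded_linear_compose[OF bounded_linear_scaleR_right bounded_linear_compose[OF linear_diag_op bl_fst]])

lemma bilinear_skew: "bounded_bilinear skew"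
  unfolding skew_def[abs_def]
  by (intro bounded_bilinear_add bounded_bilinear_inner_comp
      bl_fst bl_fst_snd bl_snd_snd
      bounded_linear_compose[OF B.bounded_linear bounded_linear_compose[OF linear_cross_e0 bl_fst_snd]]
      bounded_linear_compose[OF bounded_linear_scaleR_right bl_snd_snd]
      bounded_linear_compose[OF bounded_linear_scaleR_right bounded_linear_compose[OF linear_cross_e0 bl_fst_snd]]
      bounded_linear_compose[OF bounded_linear_scaleR_right bounded_linear_compose[OF linear_gyro bl_snd_snd]]
      bounded_linear_compose[OF bounded_linear_scaleR_right bounded_linear_compose[OF linear_cross_e0 bounded_linear_compose[OF linear_diag_op bl_fst_snd]]]
      bounded_linear_compose[OF bounded_linear_scaleR_right bounded_linear_compose[OF linear_diag_op bounded_linear_compose[OF linear_cross_e0 bl_fst_snd]]]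
      bounded_linear_compose[OF bounded_linear_scaleR_right bounded_linear_compose[OF linear_cross_e0 bounded_linear_compose[OF linear_diag_op bl_fst]]]
      bounded_linear_compose[OF bounded_linear_scaleR_right bounded_linear_compose[OF B.bounded_linear bounded_linear_compose[OF linear_cross_e0 bl_fst_snd]]])

lemma form_sym: "form x y = form y x"
  using diag_op_inner[of "\<lambda>j. a $ j" "fst (snd x)" "fst (snd y)"] diag_op_inner[of n "fst x" "fst y"]
  unfolding form_def by (simp add: inner_commute)

lemma skew_anti: "skew x y = - skew y x"
proof -
  have 1: "h (diag_op d u) \<bullet> w = - (diag_op d (h w) \<bullet> u)" "diag_op d (h u) \<bullet> w = - (h (diag_op d w) \<bullet> u)" for d u w
    unfolding cross_e0_inner[of "diag_op d u"] diag_op_inner[of d u] diag_op_inner[of d "h u"] cross_e0_inner[of u]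
    by (simp_all only: inner_commute)
  have 2: "h u \<bullet> w = - (h w \<bullet> u)" for u w unfolding cross_e0_inner[of u] by (simp only: inner_commute)
  have 3: "gyro u \<bullet> w = - (gyro w \<bullet> u)" for u w unfolding gyro_skew[of u] by (simp only: inner_commute)
  show ?thesis
    unfolding skew_def inner_scaleR_left
      1(1)[of _ "fst (snd x)" "fst (snd y)"] 1(2)[of _ "fst (snd x)" "fst (snd y)"] 1(1)[of _ "fst x" "fst (snd y)"]
      1(2)[of _ "fst (snd x)" "fst y"] 2[of "fst (snd x)" "fst (snd y)"] 3[of "snd (snd x)" "snd (snd y)"]
      inner_commute[of "B (h (fst (snd x)))"] inner_commute[of "snd (snd x)"]
    by (simp add: algebra_simps)
qed

lemma linear_rot: "bounded_linear rot"
  unfolding rot_def[abs_def]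
  by (intro bounded_linear_Pair bounded_linear_compose[OF bounded_linear_vector_scale bl_fst]
      bounded_linear_compose[OF bounded_linear_vector_scale bl_fst_snd] bounded_linear_compose[OF linear_scaleC_i bl_snd_snd])

lemma rot_rot: "rot (rot x) = - x"
  by (cases x) (simp add: rot_def scaleC_i_i vec_eq_iff)

lemma B_i: "B (\<i> *s w) = scaleC_l2 \<i> (B w)"
  by (rule op_B_scaleC_i[OF \<Omega>])

lemma form_rot: "form (rot x) (rot y) = form x y"
  by (simp add: form_def rot_def diag_op_i B_i inner_mult_i inner_scaleC_i)

lemma scaleR_i: "r *\<^sub>R (\<i> *s z) = \<i> *s (r *\<^sub>R z)"
  by (simp add: vec_eq_iff)

lemma skew_rot: "skew (rot x) (rot y) = skew x y"
  by (simp add: skew_def rot_def diag_op_i cross_e0_i B_i gyro_i inner_mult_i inner_scaleC_i)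

lemma inner_rot: "rot x \<bullet> rot y = x \<bullet> y"
  by (cases x, cases y) (simp add: rot_def inner_mult_i inner_scaleC_i)

lemma a0_pos: "a $ 0 > 0"
proof -
  have "(axis 0 1 :: complex^3) \<noteq> 0" by (simp add: axis_eq_0_iff)
  from order.strict_trans1[OF zero_le_power2 inertia_gap[OF this]]
  have "0 < op_A a (axis 0 1) \<bullet> axis 0 1" .
  also have "op_A a (axis 0 1) \<bullet> axis 0 1 = a $ 0"
    by (simp add: op_A_diag diag_op_self sum_UNIV_3 axis_def)
  finally show ?thesis .
qed

text \<open>
  Completing the square, the kinetic energy is \<open>|v + B w|\<^sup>2 + (A w \<bullet> w - |B w|\<^sup>2)\<close>, and the second summand
  is positive by \<open>inertia_gap\<close>.
\<close>

lemma kinetic_coercive: "\<exists>d>0. \<forall>w v. d * ((norm w)\<^sup>2 + (norm v)\<^sup>2) \<le> A w \<bullet> w + 2 * (v \<bullet> B w) + v \<bullet> v"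
proof -
  define f where "f w = A w \<bullet> w - (norm (B w))\<^sup>2" for w
  interpret A: bounded_linear A by (rule linear_diag_op)
  have "continuous_on UNIV f" unfolding f_def[abs_def]
    by (intro continuous_intros linear_continuous_on linear_diag_op B.bounded_linear)
  moreover have "f (r *\<^sub>R w) = r\<^sup>2 * f w" for r w
    by (simp add: f_def A.scaleR B.scaleR power_mult_distrib power2_eq_square algebra_simps)
  moreover have "0 < f w" if "w \<noteq> 0" for w using inertia_gap[OF that] by (simp add: f_def op_A_diag)
  ultimately obtain m where m: "m > 0" "\<And>w. m * (norm w)\<^sup>2 \<le> f w"
    using positive_form_coercive[of f] by blast
  obtain b where b: "b > 0" "\<And>w. norm (B w) \<le> norm w * b" using B.pos_bounded by blast
  define d where "d = min 1 (m) / (3 + 2 * b\<^sup>2)"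
  have b2: "3 + 2 * b\<^sup>2 > 0" by (simp add: add_pos_nonneg)
  have "d * ((norm w)\<^sup>2 + (norm v)\<^sup>2) \<le> A w \<bullet> w + 2 * (v \<bullet> B w) + v \<bullet> v" for w v
  proof -
    define q where "q = (norm (v + B w))\<^sup>2"
    have q: "A w \<bullet> w + 2 * (v \<bullet> B w) + v \<bullet> v = q + f w"
      by (simp add: q_def f_def power2_norm_eq_inner inner_add_left inner_add_right inner_commute)
    have "norm v \<le> norm (v + B w) + norm (B w)" using norm_triangle_ineq4[of "v + B w" "B w"] by simp
    then have "norm v \<le> norm (v + B w) + b * norm w" using b(2)[of w] by (simp add: mult.commute)
    from square_le_sum_squares[OF norm_ge_zero this]
    have "(norm v)\<^sup>2 \<le> (2 + 2 * b\<^sup>2) * (q + (norm w)\<^sup>2)" by (simp add: q_def)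
    moreover have "q \<ge> 0" by (simp add: q_def)
    ultimately have "(norm w)\<^sup>2 + (norm v)\<^sup>2 \<le> (3 + 2 * b\<^sup>2) * (q + (norm w)\<^sup>2)" by (simp add: algebra_simps)
    then have "d * ((norm w)\<^sup>2 + (norm v)\<^sup>2) \<le> d * ((3 + 2 * b\<^sup>2) * (q + (norm w)\<^sup>2))"
      using m(1) b2 by (intro mult_left_mono) (auto simp: d_def)
    also have "\<dots> = min 1 (m) * q + min 1 (m) * (norm w)\<^sup>2" using b2 by (simp add: d_def distrib_left)
    also have "\<dots> \<le> 1 * q + m * (norm w)\<^sup>2" using \<open>q \<ge> 0\<close> by (intro add_mono mult_right_mono) auto
    finally show ?thesis using m(2)[of w] q by linarith
  qed
  moreover have "d > 0" using m(1) b2 by (simp add: d_def)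
  ultimately show ?thesis by blast
qed

lemma n_neq_0: "n j \<noteq> 0"
  using n_nonzero forall_UNIV_3[of "\<lambda>j. n j \<noteq> 0"] by (simp add: n_def)

definition gap :: real where "gap = Min (range (\<lambda>j. \<bar>n j\<bar>))"

lemma gap: "gap > 0" "gap \<le> \<bar>n j\<bar>"
  unfolding gap_def using n_neq_0 by auto

lemma N_positive: "coord_proj neg z = 0 \<Longrightarrow> gap * (norm z)\<^sup>2 \<le> N z \<bullet> z"
proof -
  assume z: "coord_proj neg z = 0"
  have "gap * (norm (z $ j))\<^sup>2 \<le> n j * (norm (z $ j))\<^sup>2" for j
  proof (cases "n j < 0")
    case True
    then have "z $ j = 0" using arg_cong[OF z, of "\<lambda>x. x $ j"] by (simp add: coord_proj_def neg_def)
    then show ?thesis by simp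
  next
    case False
    then show ?thesis using gap(2)[of j] by (intro mult_right_mono) auto
  qed
  then have "(\<Sum>j\<in>UNIV. gap * (norm (z $ j))\<^sup>2) \<le> N z \<bullet> z" unfolding diag_op_self by (rule sum_mono)
  then show ?thesis by (simp add: sum_distrib_left[symmetric] norm_vec_def L2_set_def sum_nonneg)
qed

lemma N_negative: "N (coord_proj neg z) \<bullet> coord_proj neg z \<le> - gap * (norm (coord_proj neg z))\<^sup>2"
proof -
  define y where "y = coord_proj neg z"
  have "n j * (norm (y $ j))\<^sup>2 \<le> - gap * (norm (y $ j))\<^sup>2" for j
  proof (cases "n j < 0")
    case True
    then show ?thesis using gap(2)[of j] by (intro mult_right_mono) auto
  next
    case False
    then have "y $ j = 0" by (simp add: y_def coord_proj_def neg_def)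
    then show ?thesis by simp
  qed
  then have "N y \<bullet> y \<le> (\<Sum>j\<in>UNIV. - gap * (norm (y $ j))\<^sup>2)" unfolding diag_op_self by (rule sum_mono)
  also have "\<dots> = - gap * (norm y)\<^sup>2"
    unfolding sum_distrib_left[symmetric] by (simp add: norm_vec_def L2_set_def sum_nonneg)
  finally show ?thesis by (simp add: y_def)
qed

lemma N_orthogonal: "coord_proj neg y = 0 \<Longrightarrow> N (coord_proj neg z) \<bullet> y = 0"
proof -
  assume y: "coord_proj neg y = 0"
  have "N (coord_proj neg z) $ j \<bullet> y $ j = 0" for j
    using arg_cong[OF y, of "\<lambda>x. x $ j"] by (cases "j \<in> neg") (simp_all add: coord_proj_def)
  then show ?thesis unfolding inner_vec_def by (intro sum.neutral ballI)
qed

lemma form_expand: "form (z, w, v) (z, w, v) = A w \<bullet> w + 2 * (v \<bullet> B w) + v \<bullet> v + \<omega>\<^sup>2 * (N z \<bullet> z)"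
  by (simp add: form_def inner_commute)

lemma norm_state: "(norm ((z, w, v) :: state))\<^sup>2 = (norm z)\<^sup>2 + (norm w)\<^sup>2 + (norm v)\<^sup>2"
  by (simp add: norm_prod_def)

lemma pontryagin: "\<exists>c. pontryagin_space form rot unstable_part unstable_emb neg c"
proof -
  obtain d where d: "d > 0" "\<And>w v. d * ((norm w)\<^sup>2 + (norm v)\<^sup>2) \<le> A w \<bullet> w + 2 * (v \<bullet> B w) + v \<bullet> v"
    using kinetic_coercive by blast
  define c where "c = min d (\<omega>\<^sup>2 * gap)"
  have c: "c > 0" "c \<le> d" "c \<le> \<omega>\<^sup>2 * gap" using d(1) gap(1) \<omega>_pos by (auto simp: c_def)
  have lin_p: "bounded_linear (coord_proj neg)" using linear_coord_proj by (simp add: linear_conv_bounded_linear)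
  have "pontryagin_space form rot unstable_part unstable_emb neg c"
  proof (rule pontryagin_space.intro)
    show "form x y = form y x" for x y by (rule form_sym)
    show "rot (rot x) = - x" for x by (rule rot_rot)
    show "form (rot x) (rot y) = form x y" for x y by (rule form_rot)
    show "rot x \<bullet> rot y = x \<bullet> y" for x y by (rule inner_rot)
    show "unstable_part (rot x) = \<i> *s unstable_part x" for x
      by (simp add: unstable_part_def rot_def coord_proj_scale)
    show "unstable_emb (\<i> *s z) = rot (unstable_emb z)" for z
      by (simp add: unstable_emb_def rot_def coord_proj_scale Ci.zero)
    show "unstable_part (unstable_emb z) = coord_proj neg z" for z
      by (simp add: unstable_part_def unstable_emb_def)
    show "coord_proj neg (unstable_part x) = unstable_part x" for x by (simp add: unstable_part_def)
    show "unstable_emb (coord_proj neg z) = unstable_emb z" for z by (simp add: unstable_emb_def)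
    show "0 < c" by (rule c)
    show "c * (norm x)\<^sup>2 \<le> form x x" if "unstable_part x = 0" for x
    proof -
      obtain z w v where x: "x = (z, w, v)" by (cases x)
      have "\<omega>\<^sup>2 * (gap * (norm z)\<^sup>2) \<le> \<omega>\<^sup>2 * (N z \<bullet> z)"
        using that by (intro mult_left_mono N_positive) (auto simp: x unstable_part_def)
      moreover have "c * (norm z)\<^sup>2 \<le> (\<omega>\<^sup>2 * gap) * (norm z)\<^sup>2" by (intro mult_right_mono c) auto
      moreover have "c * ((norm w)\<^sup>2 + (norm v)\<^sup>2) \<le> d * ((norm w)\<^sup>2 + (norm v)\<^sup>2)" by (intro mult_right_mono c) auto
      ultimately show ?thesis using d(2)[of w v]
        unfolding x form_expand norm_state by (simp add: algebra_simps)
    qed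
    show "form (unstable_emb z) (unstable_emb z) \<le> - c * (norm (coord_proj neg z))\<^sup>2" for z
    proof -
      have "form (unstable_emb z) (unstable_emb z) = \<omega>\<^sup>2 * (N (coord_proj neg z) \<bullet> coord_proj neg z)"
        unfolding unstable_emb_def form_expand by (simp add: B.zero)
      also have "\<dots> \<le> \<omega>\<^sup>2 * (- gap * (norm (coord_proj neg z))\<^sup>2)" by (intro mult_left_mono N_negative) auto
      also have "\<dots> = - ((\<omega>\<^sup>2 * gap) * (norm (coord_proj neg z))\<^sup>2)" by simp
      also have "\<dots> \<le> - (c * (norm (coord_proj neg z))\<^sup>2)"
        using c(3) by (intro le_imp_neg_le mult_right_mono) auto
      finally show ?thesis by simp
    qed
    show "form (unstable_emb z) x = 0" if "unstable_part x = 0" for x z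
      using N_orthogonal[of "fst x" z] that by (simp add: form_def unstable_emb_def unstable_part_def B.zero linear_0[OF bounded_linear.linear[OF linear_diag_op]])
    show "bounded_linear unstable_part" unfolding unstable_part_def[abs_def] by (rule bounded_linear_compose[OF lin_p bl_fst])
    show "bounded_linear unstable_emb" unfolding unstable_emb_def[abs_def]
      by (intro bounded_linear_Pair lin_p bounded_linear_zero)
  qed (rule bilinear_form linear_rot)+
  then show ?thesis by blast
qed

lemma Q_sym: "Q v \<bullet> w = v \<bullet> Q w"
  by (simp add: Q_def inner_add_left inner_add_right inner_diff_left inner_diff_right Q0_sym P0_sym)

lemma Q0_in_J0: "Q0 v \<in> J0 \<Omega>"
  using stokes_J0[OF Q0_dom] by blast

lemma P_P: "P (P v) = P v"
  by (rule P0_ident[OF P0_in_J0])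

lemma P_Q: "P (Q v) = (1 / \<nu>) *\<^sub>R Q0 v"
  by (simp add: Q_def P.add P.diff P.scaleR P_P P0_ident[OF Q0_in_J0])

lemma Q_nonneg: "0 \<le> Q v \<bullet> v"
proof -
  have "(v - P v) \<bullet> v = (v - P v) \<bullet> (v - P v)" using P0_orth[OF P0_in_J0, of v \<Omega> v] by (simp add: inner_diff_right)
  then show ?thesis using Q0_nonneg[of v] \<nu>_pos by (simp add: Q_def inner_add_left)
qed

lemma Q_inj: "Q v = 0 \<Longrightarrow> v = 0"
proof -
  assume Q: "Q v = 0"
  have "Q0 v = 0" using P_Q[of v] \<nu>_pos by (simp add: Q P.zero)
  then have "v = P v" using Q by (simp add: Q_def)
  also have "P v = stokes \<Omega> (Q0 v)" by (simp add: stokes_Q0)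
  also have "\<dots> = stokes \<Omega> 0" by (simp add: \<open>Q0 v = 0\<close>)
  also have "\<dots> = 0" using stokes_Q0[of 0] by (simp add: Q0.zero P.zero)
  finally show "v = 0" .
qed

lemma linear_Q: "bounded_linear Q"
  unfolding Q_def[abs_def]
  by (intro bounded_linear_add bounded_linear_sub bounded_linear_ident linear_P0
      bounded_linear_compose[OF bounded_linear_scaleR_right linear_Q0])

lemma Q_i: "Q (scaleC_l2 \<i> v) = scaleC_l2 \<i> (Q v)"
  by (simp add: Q_def Q0_i P0_scaleC_i Ci.add Ci.diff Ci.scaleR)

text \<open>
  With \<open>l = \<alpha> + \<beta> \<i>\<close> and \<open>x = (z, w, 0)\<close>, the equation for the fluid says \<open>B (l w - \<omega> h w) = 0\<close>, so
  \<open>l w = \<omega> h w\<close> by the injectivity of \<open>B\<close>; the first equation is \<open>l z = - h w\<close>. The equation for the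
  angular momentum then reduces to \<open>(a\<^sub>j - a\<^sub>0) w\<^sub>j = \<omega> n\<^sub>j z\<^sub>j\<close> for \<open>j = 1, 2\<close>.
  If \<open>l = 0\<close>, then \<open>w\<^sub>1 = w\<^sub>2 = 0\<close>, so \<open>z\<^sub>1 = z\<^sub>2 = 0\<close> because of \<open>n\<^sub>j \<noteq> 0\<close>, and the energy in the
  remaining coordinates is positive definite. If \<open>l \<noteq> 0\<close>, then \<open>w\<^sub>0 = z\<^sub>0 = 0\<close> and \<open>w = - \<omega> z\<close>; inserting this
  gives \<open>k z = 0\<close>, and the energy becomes \<open>\<omega>\<^sup>2 a\<^sub>0 |z|\<^sup>2\<close>.
\<close>

lemma no_neutral_mode:
  assumes v: "snd (snd x) = 0" and nonpos: "form x x \<le> 0"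
    and eigen: "\<And>y. form (\<alpha> *\<^sub>R x + \<beta> *\<^sub>R rot x) y = skew x y"
  shows "x = 0"
proof -
  interpret A: bounded_linear A by (rule linear_diag_op)
  obtain z w where x: "x = (z, w, 0)" using v by (cases x) auto
  define l where "l = Complex \<alpha> \<beta>"
  have scale: "\<alpha> *\<^sub>R u + \<beta> *\<^sub>R (\<i> *s u) = l *s u" for u :: "complex^3"
    by (simp add: vec_eq_iff complex_eq_iff l_def)
  have lx: "\<alpha> *\<^sub>R x + \<beta> *\<^sub>R rot x = (l *s z, l *s w, 0)"
    by (simp add: x rot_def Ci.zero scale)
  have gyro0: "gyro 0 = 0" using linear_0[OF bounded_linear.linear[OF linear_gyro]] .
  have "B (l *s w) \<bullet> u = (\<omega> *\<^sub>R B (h w)) \<bullet> u" for u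
    using eigen[of "(0, 0, u)"] unfolding lx
    by (simp add: x form_def skew_def gyro0 B.zero h.zero A.zero)
  then have "B (l *s w) = \<omega> *\<^sub>R B (h w)" by (rule l2_eqI)
  then have "B (l *s w - \<omega> *\<^sub>R h w) = 0" by (simp add: B.diff B.scaleR)
  then have "l *s w - \<omega> *\<^sub>R h w = 0" by (rule op_B_injective[OF \<Omega>])
  then have E1: "l *s w = \<omega> *\<^sub>R h w" by simp
  have "N (l *s z) \<bullet> u = (- N (h w)) \<bullet> u" for u
  proof -
    have "\<omega>\<^sup>2 * (N (l *s z) \<bullet> u + N (h w) \<bullet> u) = 0"
      using eigen[of "(u, 0, 0)"] unfolding lx by (simp add: x form_def skew_def gyro0 B.zero h.zero distrib_left)
    then show ?thesis using \<omega>_pos by (simp add: eq_neg_iff_add_eq_0)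
  qed
  then have "N (l *s z) = - N (h w)" using vector_eq_rdot by blast
  then have E2: "l * z $ j = - (h w $ j)" for j
    using n_neq_0[of j] by (auto simp: vec_eq_iff dest!: spec[of _ j] simp flip: scaleR_minus_right)
  have "A (l *s w) \<bullet> u = (\<omega> *\<^sub>R h (A w) + \<omega> *\<^sub>R A (h w) + (- \<omega> * a $ 0) *\<^sub>R h w + (- \<omega>\<^sup>2) *\<^sub>R h (N z)) \<bullet> u" for u
    using eigen[of "(0, u, 0)"] unfolding lx
    by (simp add: x form_def skew_def gyro0 B.zero inner_add_left inner_diff_left)
  then have "A (l *s w) = \<omega> *\<^sub>R h (A w) + \<omega> *\<^sub>R A (h w) + (- \<omega> * a $ 0) *\<^sub>R h w + (- \<omega>\<^sup>2) *\<^sub>R h (N z)"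
    using vector_eq_rdot by blast
  then have E3: "0 = \<omega> *\<^sub>R h (A w) + (- \<omega> * a $ 0) *\<^sub>R h w + (- \<omega>\<^sup>2) *\<^sub>R h (N z)"
    unfolding E1 by (simp add: A.scaleR algebra_simps)
  have w: "l * w $ 0 = 0" "l * w $ 1 = \<omega> * w $ 2" "l * w $ 2 = - \<omega> * w $ 1"
    using arg_cong[OF E1, of "\<lambda>u. u $ 0"] arg_cong[OF E1, of "\<lambda>u. u $ 1"] arg_cong[OF E1, of "\<lambda>u. u $ 2"]
    unfolding vector_scaleR_component by (simp_all add: scaleR_conv_of_real)
  have z: "l * z $ 0 = 0" "l * z $ 1 = - w $ 2" "l * z $ 2 = w $ 1"
    using E2[of 0] E2[of 1] E2[of 2] by simp_all
  have bal: "(a $ j - a $ 0) *\<^sub>R w $ j = (\<omega> * n j) *\<^sub>R z $ j" if "j = 1 \<or> j = 2" for j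
  proof -
    have E3': "0 = \<omega> *\<^sub>R (h (A w) $ i) - (\<omega> * a $ 0) *\<^sub>R (h w $ i) - (\<omega> * \<omega>) *\<^sub>R (h (N z) $ i)" for i
      using arg_cong[OF E3, of "\<lambda>u. u $ i"] by (simp add: power2_eq_square)
    have "0 = \<omega> *\<^sub>R ((a $ j - a $ 0) *\<^sub>R w $ j - (\<omega> * n j) *\<^sub>R z $ j)"
      using E3'[of 1] E3'[of 2] that by (auto simp: algebra_simps)
    then show ?thesis using \<omega>_pos by simp
  qed
  have energy: "(\<Sum>j\<in>UNIV. a $ j * (norm (w $ j))\<^sup>2) + \<omega>\<^sup>2 * (\<Sum>j\<in>UNIV. n j * (norm (z $ j))\<^sup>2) \<le> 0"
    using nonpos unfolding x form_expand diag_op_self by simp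
  have "z = 0 \<and> w = 0"
  proof (cases "l = 0")
    case True
    then have w12: "w $ 1 = 0" "w $ 2 = 0" using w \<omega>_pos by auto
    have z12: "z $ 1 = 0" "z $ 2 = 0" using bal[of 1] bal[of 2] w12 \<omega>_pos n_neq_0 by auto
    have "a $ 0 * (norm (w $ 0))\<^sup>2 + \<omega>\<^sup>2 * (norm (z $ 0))\<^sup>2 \<le> 0"
      using energy by (simp add: sum_UNIV_3 w12 z12 n_def)
    moreover have "0 \<le> a $ 0 * (norm (w $ 0))\<^sup>2" "0 \<le> \<omega>\<^sup>2 * (norm (z $ 0))\<^sup>2" using a0_pos by auto
    ultimately have "a $ 0 * (norm (w $ 0))\<^sup>2 = 0" "\<omega>\<^sup>2 * (norm (z $ 0))\<^sup>2 = 0" by linarith+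
    then show ?thesis using a0_pos \<omega>_pos w12 z12 by (simp add: vec_eq_3)
  next
    case False
    then have 0: "w $ 0 = 0" "z $ 0 = 0" using w(1) z(1) by auto
    have "l * w $ 1 = l * (- \<omega> * z $ 1)" "l * w $ 2 = l * (- \<omega> * z $ 2)"
      unfolding mult.left_commute[of l] w(2,3) z(2,3) by simp_all
    then have wz: "w $ 1 = - \<omega> * z $ 1" "w $ 2 = - \<omega> * z $ 2"
      unfolding mult_left_cancel[OF False] by blast+
    have kz: "k * (norm (z $ j))\<^sup>2 = 0" if j: "j = 1 \<or> j = 2" for j
    proof -
      have "w $ j = (- \<omega>) *\<^sub>R z $ j" using wz j by (auto simp: scaleR_conv_of_real)
      then have "\<omega> *\<^sub>R ((a $ 0 - a $ j - n j) *\<^sub>R z $ j) = 0"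
        using bal[OF j] by (simp add: algebra_simps)
      moreover have "a $ 0 - a $ j - n j = k / \<omega>\<^sup>2" using j by (auto simp: n_def n_coeff_def)
      ultimately show ?thesis using \<omega>_pos by auto
    qed
    have summand: "a $ j * (norm (w $ j))\<^sup>2 + \<omega>\<^sup>2 * (n j * (norm (z $ j))\<^sup>2) = \<omega>\<^sup>2 * a $ 0 * (norm (z $ j))\<^sup>2"
      if j: "j = 1 \<or> j = 2" for j
    proof -
      have "norm (w $ j) = \<omega> * norm (z $ j)" using wz j \<omega>_pos by (auto simp: norm_mult)
      moreover have "\<omega>\<^sup>2 * n j = \<omega>\<^sup>2 * (a $ 0) - \<omega>\<^sup>2 * (a $ j) - k"
        using j \<omega>_pos by (auto simp: n_def n_coeff_def field_simps)
      then have "\<omega>\<^sup>2 * (n j * (norm (z $ j))\<^sup>2) = (\<omega>\<^sup>2 * (a $ 0) - \<omega>\<^sup>2 * (a $ j) - k) * (norm (z $ j))\<^sup>2"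
        by (simp add: mult.assoc[symmetric])
      ultimately show ?thesis using kz[OF j] by (simp add: power_mult_distrib algebra_simps)
    qed
    have "\<omega>\<^sup>2 * a $ 0 * (norm (z $ 1))\<^sup>2 + \<omega>\<^sup>2 * a $ 0 * (norm (z $ 2))\<^sup>2 \<le> 0"
      using energy summand[of 1] summand[of 2] 0 by (simp add: sum_UNIV_3 distrib_left)
    moreover have "0 \<le> \<omega>\<^sup>2 * a $ 0 * (norm (z $ 1))\<^sup>2" "0 \<le> \<omega>\<^sup>2 * a $ 0 * (norm (z $ 2))\<^sup>2" using a0_pos by auto
    ultimately have "\<omega>\<^sup>2 * a $ 0 * (norm (z $ 1))\<^sup>2 = 0" "\<omega>\<^sup>2 * a $ 0 * (norm (z $ 2))\<^sup>2 = 0" by linarith+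
    then have "z $ 1 = 0" "z $ 2 = 0" using a0_pos \<omega>_pos by auto
    then show ?thesis using 0 wz by (simp add: vec_eq_3)
  qed
  then show ?thesis by (simp add: x zero_prod_def)
qed

lemma growing: "\<exists>c. growing_pontryagin form rot unstable_part unstable_emb neg c skew
    (\<lambda>x. snd (snd x)) (\<lambda>v. (0, 0, v)) Q (scaleC_l2 \<i>)"
proof -
  obtain c where c: "pontryagin_space form rot unstable_part unstable_emb neg c" using pontryagin by blast
  have "dissipative_pontryagin form rot unstable_part unstable_emb neg c skew
    (\<lambda>x. snd (snd x)) (\<lambda>v. (0, 0, v)) Q (scaleC_l2 \<i>)"
  proof (rule dissipative_pontryagin.intro[OF c], rule dissipative_pontryagin_axioms.intro)
    show "bounded_linear (\<lambda>v. (0, 0, v) :: state)"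
      by (intro bounded_linear_Pair bounded_linear_zero bounded_linear_ident)
    show "snd (snd (unstable_emb z)) = 0" for z by (simp add: unstable_emb_def)
    show "snd (snd (rot x)) = scaleC_l2 \<i> (snd (snd x))" for x by (simp add: rot_def)
  qed (fact bilinear_skew skew_anti skew_rot bl_snd_snd linear_Q Q_sym Q_nonneg Q_inj linear_scaleC_i
      inner_scaleC_i Q_i | simp)+
  then have "growing_pontryagin form rot unstable_part unstable_emb neg c skew
    (\<lambda>x. snd (snd x)) (\<lambda>v. (0, 0, v)) Q (scaleC_l2 \<i>)"
    by (rule growing_pontryagin.intro, intro growing_pontryagin_axioms.intro) (rule no_neutral_mode)
  then show ?thesis by blast
qed

end

section \<open>Solutions\<close>

context rotating_top begin

definition comoving :: "state \<Rightarrow> state" where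
  "comoving u = (fst u, fst (snd u) - \<omega> *\<^sub>R fst u, snd (snd u))"

definition lab_frame :: "state \<Rightarrow> state" where
  "lab_frame u = (fst u, fst (snd u) + \<omega> *\<^sub>R fst u, snd (snd u))"

lemma lab_comoving [simp]: "lab_frame (comoving u) = u" and comoving_lab [simp]: "comoving (lab_frame u) = u"
  by (simp_all add: lab_frame_def comoving_def)

lemma linear_comoving: "bounded_linear comoving"
  unfolding comoving_def[abs_def]
  by (intro bounded_linear_Pair bounded_linear_sub bl_fst bl_fst_snd bl_snd_snd
      bounded_linear_compose[OF bounded_linear_scaleR_right bl_fst])

lemma linear_lab_frame: "bounded_linear lab_frame"
  unfolding lab_frame_def[abs_def]
  by (intro bounded_linear_Pair bounded_linear_add bl_fst bl_fst_snd bl_snd_snd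
      bounded_linear_compose[OF bounded_linear_scaleR_right bl_fst])

sublocale comoving: bounded_linear comoving by (rule linear_comoving)
sublocale rot: bounded_linear rot by (rule linear_rot)
sublocale form: bounded_bilinear form by (rule bilinear_form)
sublocale skew: bounded_bilinear skew by (rule bilinear_skew)

lemma comoving_rot: "comoving (rot u) = rot (comoving u)"
  by (simp add: comoving_def rot_def vec_eq_iff algebra_simps)

lemma state_scale_eq: "state_scale l u = Re l *\<^sub>R u + Im l *\<^sub>R rot u"
  by (cases u) (simp add: state_scale_def rot_def scaleC_l2_Re_Im[of l] vector_scale_Re_Im[of l])

lemma form_nondegenerate: "(\<And>y. form x y = form x' y) \<Longrightarrow> x = x'"
proof -
  obtain c where "pontryagin_space form rot unstable_part unstable_emb neg c" using pontryagin by blast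
  then interpret pontryagin_space form rot unstable_part unstable_emb neg c .
  show "(\<And>y. form x y = form x' y) \<Longrightarrow> x = x'" by (rule V_nondegenerate)
qed

lemma op_B_adj_eqI: "v \<in> J0 \<Omega> \<Longrightarrow> (\<And>w. v \<bullet> B w = x \<bullet> w) \<Longrightarrow> op_B_adj \<Omega> v = x"
  using op_B_adj_inner[OF \<Omega>] vector_eq_rdot by metis

text \<open>
  The Schur complement \<open>A - B\<^sup>* B\<close> of \<open>W\<close> is positive definite by \<open>inertia_gap\<close>.
\<close>

lemma op_W_surj:
  assumes y: "y \<in> state_space \<Omega>"
  shows "\<exists>u\<in>state_space \<Omega>. op_W \<Omega> a u = y"
proof -
  obtain z f g where yy: "y = (z, f, g)" "g \<in> J0 \<Omega>" using y by (auto simp: state_space_def)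
  interpret A: bounded_linear A by (rule linear_diag_op)
  define S where "S w = A w - op_B_adj \<Omega> (B w)" for w
  have S_inner: "S w \<bullet> u = A w \<bullet> u - B w \<bullet> B u" for w u
    by (simp add: S_def inner_diff_left op_B_adj_inner[OF \<Omega> op_B_J0[OF \<Omega>]])
  have "linear S"
  proof (rule linearI)
    show "S (x + y) = S x + S y" for x y
      by (rule vector_eq_rdot[THEN iffD1], rule allI)
        (simp add: S_inner inner_add_left A.add B.add)
    show "S (r *\<^sub>R x) = r *\<^sub>R S x" for r x
      by (rule vector_eq_rdot[THEN iffD1], rule allI)
        (simp add: S_inner A.scaleR B.scaleR algebra_simps)
  qed
  moreover have "inj S"
  proof (rule linear_injective_0[OF \<open>linear S\<close>, THEN iffD2], intro allI impI, rule ccontr)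
    fix w assume "S w = 0" "w \<noteq> 0"
    then show False using S_inner[of w w] inertia_gap[of w] by (simp add: op_A_diag power2_norm_eq_inner)
  qed
  ultimately have "surj S" by (rule linear_injective_imp_surjective) simp
  then obtain w where w: "S w = f - op_B_adj \<Omega> g" by (metis surjD)
  define v where "v = g - B w"
  have v: "v \<in> J0 \<Omega>" unfolding v_def by (intro subspace_diff subspace_J0 yy op_B_J0 \<Omega>)
  have adj_v: "op_B_adj \<Omega> v = op_B_adj \<Omega> g - op_B_adj \<Omega> (B w)"
    by (rule op_B_adj_eqI[OF v])
      (simp add: v_def inner_diff_left op_B_adj_inner[OF \<Omega> yy(2)] op_B_adj_inner[OF \<Omega> op_B_J0[OF \<Omega>]])
  have "A w + op_B_adj \<Omega> v = S w + op_B_adj \<Omega> g" by (simp add: adj_v S_def)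
  also have "\<dots> = f" by (simp add: w)
  finally have "op_W \<Omega> a (z, w, v) = y" by (simp add: op_W_def op_A_diag v_def yy(1))
  then show ?thesis using v by (auto simp: state_space_def)
qed

lemma op_M_state_space:
  assumes "u \<in> dom_M \<Omega>" shows "op_M \<Omega> a k \<nu> \<omega> u \<in> state_space \<Omega>"
proof -
  have "op_D \<Omega> \<nu> \<omega> v \<in> J0 \<Omega>" if "v \<in> stokes_dom \<Omega>" for v
    unfolding op_D_def op_G_def using stokes_J0[OF that]
    by (intro subspace_add subspace_J0 J0_scaleC P0_in_J0) auto
  then show ?thesis using assms by (auto simp: op_M_def dom_M_def state_space_def)
qed

text \<open>
  The equation \<open>W y = \<i> \<omega> M u\<close>, tested with \<open>\<phi>\<close>. After the substitution \<open>w' = w - \<omega> z\<close> its right-hand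
  side is antisymmetric except for the viscous term: those with \<open>k\<close> and \<open>a\<^sub>0\<close> combine to the coefficient
  \<open>\<omega>\<^sup>2 N\<close> of \<open>z\<close>.
\<close>

lemma op_T_form:
  assumes u: "u \<in> dom_M \<Omega>"
  defines "y \<equiv> state_scale (\<i> * \<omega>) (op_T \<Omega> a k \<nu> \<omega> u)"
  shows "form (comoving y) \<phi> = skew (comoving u) \<phi> - (\<nu> *\<^sub>R stokes \<Omega> (snd (snd u))) \<bullet> snd (snd \<phi>)"
    and "y \<in> state_space \<Omega>"
proof -
  obtain z w v where uu: "u = (z, w, v)" "v \<in> stokes_dom \<Omega>" using u by (auto simp: dom_M_def)
  define x where "x = op_T \<Omega> a k \<nu> \<omega> u"
  have ex: "\<exists>x\<in>state_space \<Omega>. op_W \<Omega> a x = op_M \<Omega> a k \<nu> \<omega> u"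
    by (rule op_W_surj[OF op_M_state_space[OF u]])
  then have img: "op_M \<Omega> a k \<nu> \<omega> u \<in> op_W \<Omega> a ` state_space \<Omega>" by (auto simp: image_iff) metis
  have x: "x \<in> state_space \<Omega>" "op_W \<Omega> a x = op_M \<Omega> a k \<nu> \<omega> u"
    unfolding x_def op_T_def using inv_into_into[OF img] f_inv_into_f[OF img] by auto
  obtain xz xw xv where xx: "x = (xz, xw, xv)" "xv \<in> J0 \<Omega>" using x(1) by (auto simp: state_space_def)
  interpret A: bounded_linear A by (rule linear_diag_op)
  show ys: "y \<in> state_space \<Omega>"
    unfolding y_def x_def[symmetric] xx(1) using J0_scaleC[OF xx(2)] by (simp add: state_scale_def state_space_def)
  have M: "xz = op_H z - (1 / \<omega>) *\<^sub>R op_H w"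
    "A xw + op_B_adj \<Omega> xv = (k / \<omega>) *\<^sub>R op_H z + op_H (A w - a $ 0 *\<^sub>R w) + op_H (op_B_adj \<Omega> v)"
    "B xw + xv = op_D \<Omega> \<nu> \<omega> v"
    using x(2) by (simp_all add: xx uu op_W_def op_M_def op_A_diag)
  have v: "v \<in> J0 \<Omega>" using stokes_J0 uu(2) by blast
  have io: "(\<i> * complex_of_real \<omega>) *s q = \<omega> *\<^sub>R (\<i> *s q)" for q :: "complex^3"
    unfolding vec_eq_iff vector_scaleR_component by (simp add: scaleR_conv_of_real)
  have iol: "scaleC_l2 (\<i> * complex_of_real \<omega>) q = \<omega> *\<^sub>R scaleC_l2 \<i> q" for q
    using scaleC_l2_Re_Im[of "\<i> * complex_of_real \<omega>" q] by simp
  have ih: "\<i> *s op_H q = h q" for q by (simp add: cross_e0_def)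
  define yz where "yz = \<omega> *\<^sub>R (\<i> *s xz)"
  define yw where "yw = \<omega> *\<^sub>R (\<i> *s xw)"
  define yv where "yv = \<omega> *\<^sub>R scaleC_l2 \<i> xv"
  have y: "y = (yz, yw, yv)"
    by (simp add: y_def x_def[symmetric] xx(1) state_scale_def io iol yz_def yw_def yv_def)
  have yv: "yv \<in> J0 \<Omega>" using ys by (simp add: y state_space_def)
  define w' where "w' = w - \<omega> *\<^sub>R z"
  have Y1: "yz = - h w'"
    using \<omega>_pos by (simp add: yz_def M(1) w'_def h.diff h.scaleR scaleR_i[symmetric] ih
        vector_sub_rdistrib vector_ssub_ldistrib scaleR_diff_right)
  have Y2: "A yw + op_B_adj \<Omega> yv = k *\<^sub>R h z + \<omega> *\<^sub>R h (A w - a $ 0 *\<^sub>R w) + \<omega> *\<^sub>R h (op_B_adj \<Omega> v)"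
  proof -
    have "op_B_adj \<Omega> yv = \<omega> *\<^sub>R (\<i> *s op_B_adj \<Omega> xv)"
    proof (rule op_B_adj_eqI[OF yv])
      fix q
      have "yv \<bullet> B q = - \<omega> * (xv \<bullet> B (\<i> *s q))" by (simp add: yv_def inner_scaleC_i_left B_i)
      also have "\<dots> = - \<omega> * (op_B_adj \<Omega> xv \<bullet> (\<i> *s q))" by (simp add: op_B_adj_inner[OF \<Omega> xx(2)])
      also have "op_B_adj \<Omega> xv \<bullet> (\<i> *s q) = - ((\<i> *s op_B_adj \<Omega> xv) \<bullet> q)"
        by (simp add: inner_vec_def inner_complex_def sum_negf[symmetric] algebra_simps)
      finally show "yv \<bullet> B q = (\<omega> *\<^sub>R (\<i> *s op_B_adj \<Omega> xv)) \<bullet> q" by simp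
    qed
    then have "A yw + op_B_adj \<Omega> yv = \<omega> *\<^sub>R (\<i> *s (A xw + op_B_adj \<Omega> xv))"
      by (simp add: yw_def A.scaleR diag_op_i vector_add_ldistrib scaleR_add_right)
    also have "\<dots> = k *\<^sub>R h z + \<omega> *\<^sub>R h (A w - a $ 0 *\<^sub>R w) + \<omega> *\<^sub>R h (op_B_adj \<Omega> v)"
      unfolding M(2) vector_add_ldistrib scaleR_i[symmetric] ih using \<omega>_pos by (simp add: scaleR_add_right)
    finally show ?thesis .
  qed
  have Y3: "B yw + yv = \<omega> *\<^sub>R gyro v - \<nu> *\<^sub>R stokes \<Omega> v"
  proof -
    have diff: "scaleC_l2 \<i> (p - q) = scaleC_l2 \<i> p - scaleC_l2 \<i> q" for p q by (rule Ci.diff)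
    have "B yw + yv = \<omega> *\<^sub>R scaleC_l2 \<i> (B xw + xv)"
      by (simp add: yw_def yv_def B.scaleR B_i Ci.add scaleR_add_right)
    also have "scaleC_l2 \<i> (B xw + xv) = (- 2) *\<^sub>R scaleC_l2 \<i> (P (H_l2 v)) + scaleC_l2 \<i> (scaleC_l2 (\<i> * \<nu> / \<omega>) (stokes \<Omega> v))"
      unfolding M(3) op_D_def op_G_def H_l2_def[symmetric]
      using scaleC_l2_Re_Im[of "-2"] by (simp add: diff Ci.scaleR)
    also have "scaleC_l2 (\<i> * \<nu> / \<omega>) (stokes \<Omega> v) = (\<nu> / \<omega>) *\<^sub>R scaleC_l2 \<i> (stokes \<Omega> v)"
      using scaleC_l2_Re_Im[of "\<i> * \<nu> / \<omega>"] by simp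
    finally show ?thesis
      using \<omega>_pos by (simp add: gyro_def P0_ident[OF v] P0_scaleC_i Ci.scaleR scaleC_i_i scaleR_add_right scaleR_diff_right)
  qed
  define e where "e = k *\<^sub>R h z + \<omega> *\<^sub>R h (A w - a $ 0 *\<^sub>R w) + \<omega> *\<^sub>R A (h w')"
  have e: "e = \<omega> *\<^sub>R h (A w') + \<omega> *\<^sub>R A (h w') + (- \<omega> * a $ 0) *\<^sub>R h w' + (- \<omega>\<^sup>2) *\<^sub>R h (N z)"
  proof -
    have w: "w = w' + \<omega> *\<^sub>R z" by (simp add: w'_def)
    have n12: "\<omega>\<^sup>2 * n 1 = \<omega>\<^sup>2 * (a $ 0) - \<omega>\<^sup>2 * (a $ 1) - k" "\<omega>\<^sup>2 * n 2 = \<omega>\<^sup>2 * (a $ 0) - \<omega>\<^sup>2 * (a $ 2) - k"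
      using \<omega>_pos by (simp_all add: n_def n_coeff_def field_simps)
    have Nz: "(\<omega>\<^sup>2) *\<^sub>R (n 1 *\<^sub>R z $ 1) = (\<omega>\<^sup>2 * (a $ 0) - \<omega>\<^sup>2 * (a $ 1) - k) *\<^sub>R z $ 1"
      "(\<omega>\<^sup>2) *\<^sub>R (n 2 *\<^sub>R z $ 2) = (\<omega>\<^sup>2 * (a $ 0) - \<omega>\<^sup>2 * (a $ 2) - k) *\<^sub>R z $ 2"
      by (simp_all only: scaleR_scaleR n12)
    show ?thesis
      unfolding vec_eq_3 e_def w
      using Nz by (simp add: algebra_simps power2_eq_square)
  qed
  obtain \<phi>z \<phi>w \<phi>v where \<phi>: "\<phi> = (\<phi>z, \<phi>w, \<phi>v)" by (cases \<phi>)
  have cy: "comoving y = (yz, yw - \<omega> *\<^sub>R yz, yv)" and cu: "comoving u = (z, w', v)"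
    by (simp_all add: comoving_def y uu w'_def)
  have 1: "A (yw - \<omega> *\<^sub>R yz) \<bullet> \<phi>w + yv \<bullet> B \<phi>w = e \<bullet> \<phi>w - (\<omega> *\<^sub>R v) \<bullet> B (h \<phi>w)"
  proof -
    have "yv \<bullet> B \<phi>w = op_B_adj \<Omega> yv \<bullet> \<phi>w" by (simp add: op_B_adj_inner[OF \<Omega> yv])
    then have "A (yw - \<omega> *\<^sub>R yz) \<bullet> \<phi>w + yv \<bullet> B \<phi>w = (A yw + op_B_adj \<Omega> yv) \<bullet> \<phi>w + (\<omega> *\<^sub>R A (h w')) \<bullet> \<phi>w"
      by (simp add: A.diff A.add A.scaleR Y1 A.neg inner_add_left inner_diff_left)
    also have "\<dots> = e \<bullet> \<phi>w + \<omega> * (h (op_B_adj \<Omega> v) \<bullet> \<phi>w)"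
      unfolding Y2 e_def by (simp add: inner_add_left)
    also have "h (op_B_adj \<Omega> v) \<bullet> \<phi>w = - (v \<bullet> B (h \<phi>w))"
      by (simp add: cross_e0_inner op_B_adj_inner[OF \<Omega> v])
    finally show ?thesis by simp
  qed
  have 2: "B (yw - \<omega> *\<^sub>R yz) \<bullet> \<phi>v + yv \<bullet> \<phi>v
      = (\<omega> *\<^sub>R gyro v) \<bullet> \<phi>v - (\<nu> *\<^sub>R stokes \<Omega> v) \<bullet> \<phi>v + (\<omega> *\<^sub>R B (h w')) \<bullet> \<phi>v"
  proof -
    have "B (yw - \<omega> *\<^sub>R yz) \<bullet> \<phi>v + yv \<bullet> \<phi>v = (B yw + yv) \<bullet> \<phi>v + (\<omega> *\<^sub>R B (h w')) \<bullet> \<phi>v"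
      by (simp add: B.diff B.add B.scaleR Y1 B.neg inner_add_left inner_diff_left)
    then show ?thesis unfolding Y3 by (simp add: inner_diff_left)
  qed
  have 3: "(\<omega>\<^sup>2 *\<^sub>R N yz) \<bullet> \<phi>z = ((- \<omega>\<^sup>2) *\<^sub>R N (h w')) \<bullet> \<phi>z"
    by (simp add: Y1 bounded_linear.linear[OF linear_diag_op] linear_neg)
  have "form (comoving y) \<phi> = (A (yw - \<omega> *\<^sub>R yz) \<bullet> \<phi>w + yv \<bullet> B \<phi>w) + (B (yw - \<omega> *\<^sub>R yz) \<bullet> \<phi>v + yv \<bullet> \<phi>v) + (\<omega>\<^sup>2 *\<^sub>R N yz) \<bullet> \<phi>z"
    unfolding cy \<phi> form_def by (simp del: inner_scaleR_left)
  also have "\<dots> = skew (comoving u) \<phi> - (\<nu> *\<^sub>R stokes \<Omega> v) \<bullet> \<phi>v"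
    unfolding 1 2 3 e cu \<phi> skew_def by (simp add: inner_add_left inner_diff_left)
  finally show "form (comoving y) \<phi> = skew (comoving u) \<phi> - (\<nu> *\<^sub>R stokes \<Omega> (snd (snd u))) \<bullet> snd (snd \<phi>)"
    by (simp add: uu \<phi>)
qed

text \<open>
  The relation \<open>y = \<i> \<omega> T u\<close> in weak form; \<open>r\<close> stands for \<open>\<nu> R v\<close>.
\<close>

definition generates :: "state \<Rightarrow> state \<Rightarrow> bool" where
  "generates u y \<longleftrightarrow> (\<exists>r\<in>J0 \<Omega>. snd (snd u) = Q r \<and> (\<forall>\<phi>. form (comoving y) \<phi> = skew (comoving u) \<phi> - r \<bullet> snd (snd \<phi>)))"

lemma Q_J0: "r \<in> J0 \<Omega> \<Longrightarrow> Q r = (1 / \<nu>) *\<^sub>R Q0 r"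
  by (simp add: Q_def P0_ident)

lemma generates_iff: "generates u y \<longleftrightarrow> u \<in> dom_M \<Omega> \<and> y = state_scale (\<i> * \<omega>) (op_T \<Omega> a k \<nu> \<omega> u)"
proof -
  have gen: "generates u (state_scale (\<i> * \<omega>) (op_T \<Omega> a k \<nu> \<omega> u))" if u: "u \<in> dom_M \<Omega>" for u
  proof -
    have v: "snd (snd u) \<in> stokes_dom \<Omega>" using u by (auto simp: dom_M_def)
    have J: "\<nu> *\<^sub>R stokes \<Omega> (snd (snd u)) \<in> J0 \<Omega>" using stokes_J0[OF v] subspace_J0 subspace_scale by blast
    moreover have "snd (snd u) = Q (\<nu> *\<^sub>R stokes \<Omega> (snd (snd u)))"
      using \<nu>_pos by (simp add: Q_J0[OF J] Q0.scaleR Q0_stokes[OF v])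
    ultimately show ?thesis unfolding generates_def using op_T_form(1)[OF u] by blast
  qed
  show ?thesis
  proof
    assume g: "generates u y"
    then obtain r where r: "r \<in> J0 \<Omega>" "snd (snd u) = Q r"
      "\<And>\<phi>. form (comoving y) \<phi> = skew (comoving u) \<phi> - r \<bullet> snd (snd \<phi>)" unfolding generates_def by blast
    have "Q r = Q0 ((1 / \<nu>) *\<^sub>R r)" using r(1) by (simp add: Q_J0 Q0.scaleR)
    then have "snd (snd u) \<in> stokes_dom \<Omega>" using r(2) Q0_dom by simp
    then have u: "u \<in> dom_M \<Omega>" by (cases u) (auto simp: dom_M_def)
    obtain r' where r': "r' \<in> J0 \<Omega>" "snd (snd u) = Q r'"
      "\<And>\<phi>. form (comoving (state_scale (\<i> * \<omega>) (op_T \<Omega> a k \<nu> \<omega> u))) \<phi> = skew (comoving u) \<phi> - r' \<bullet> snd (snd \<phi>)"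
      using gen[OF u] unfolding generates_def by blast
    have "Q (r - r') = 0" using r(2) r'(2) bounded_linear.linear[OF linear_Q] by (simp add: linear_diff)
    then have "r = r'" using Q_inj by fastforce
    then have "comoving y = comoving (state_scale (\<i> * \<omega>) (op_T \<Omega> a k \<nu> \<omega> u))"
      by (intro form_nondegenerate) (simp add: r(3) r'(3))
    then have "y = state_scale (\<i> * \<omega>) (op_T \<Omega> a k \<nu> \<omega> u)" by (metis lab_comoving)
    with u show "u \<in> dom_M \<Omega> \<and> y = state_scale (\<i> * \<omega>) (op_T \<Omega> a k \<nu> \<omega> u)" by blast
  qed (use gen in blast)
qed

abbreviation "Sol \<equiv> solutions (op_T \<Omega> a k \<nu> \<omega>) (dom_M \<Omega>) \<omega>"
abbreviation "Bdd \<equiv> bounded_solutions (op_T \<Omega> a k \<nu> \<omega>) (dom_M \<Omega>) \<omega>"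

lemma solutions_iff:
  "u \<in> Sol \<longleftrightarrow> (\<forall>t<0. u t = 0) \<and> (\<forall>t\<ge>0. \<exists>y. generates (u t) y \<and> (u has_vector_derivative y) (at t within {0..}))"
  unfolding solutions_def generates_iff by auto

lemma generates_add: "generates u y \<Longrightarrow> generates u' y' \<Longrightarrow> generates (u + u') (y + y')"
proof -
  assume "generates u y" "generates u' y'"
  then obtain r r' where "r \<in> J0 \<Omega>" "snd (snd u) = Q r" "\<forall>\<phi>. form (comoving y) \<phi> = skew (comoving u) \<phi> - r \<bullet> snd (snd \<phi>)"
    "r' \<in> J0 \<Omega>" "snd (snd u') = Q r'" "\<forall>\<phi>. form (comoving y') \<phi> = skew (comoving u') \<phi> - r' \<bullet> snd (snd \<phi>)"
    unfolding generates_def by blast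
  then show ?thesis
    unfolding generates_def
    by (intro bexI[of _ "r + r'"])
      (simp_all add: comoving.add form.add_left skew.add_left inner_add_left
        linear_add[OF bounded_linear.linear[OF linear_Q]] subspace_add[OF subspace_J0])
qed

lemma generates_scaleR: "generates u y \<Longrightarrow> generates (c *\<^sub>R u) (c *\<^sub>R y)"
proof -
  assume "generates u y"
  then obtain r where "r \<in> J0 \<Omega>" "snd (snd u) = Q r" "\<forall>\<phi>. form (comoving y) \<phi> = skew (comoving u) \<phi> - r \<bullet> snd (snd \<phi>)"
    unfolding generates_def by blast
  then show ?thesis
    unfolding generates_def
    by (intro bexI[of _ "c *\<^sub>R r"])
      (simp_all add: comoving.scaleR form.scaleR_left skew.scaleR_left right_diff_distrib
        linear_scale[OF bounded_linear.linear[OF linear_Q]] subspace_scale[OF subspace_J0])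
qed

lemma form_rot_left: "form (rot x) y = - form x (rot y)"
  using form_rot[of x "rot y"] by (simp add: rot_rot form.minus_right)

lemma skew_rot_left: "skew (rot x) y = - skew x (rot y)"
  using skew_rot[of x "rot y"] by (simp add: rot_rot skew.minus_right)

lemma generates_rot: "generates u y \<Longrightarrow> generates (rot u) (rot y)"
proof -
  assume "generates u y"
  then obtain r where "r \<in> J0 \<Omega>" "snd (snd u) = Q r" "\<forall>\<phi>. form (comoving y) \<phi> = skew (comoving u) \<phi> - r \<bullet> snd (snd \<phi>)"
    unfolding generates_def by blast
  then show ?thesis
    unfolding generates_def
    by (intro bexI[of _ "scaleC_l2 \<i> r"])
      (simp_all add: comoving_rot form_rot_left skew_rot_left J0_scaleC_i Q_i, simp_all add: rot_def inner_scaleC_i_left)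
qed

lemma solutions_lincomb:
  assumes X: "finite X" "X \<subseteq> Sol"
  shows "(\<lambda>t. \<Sum>x\<in>X. state_scale (c x) (x t)) \<in> Sol"
  using X
proof (induction X rule: finite_induct)
  case empty
  have "generates 0 0"
    unfolding generates_def
    by (intro bexI[of _ 0])
      (simp_all add: comoving.zero form.zero_left skew.zero_left linear_0[OF bounded_linear.linear[OF linear_Q]] subspace_0[OF subspace_J0])
  then show ?case unfolding solutions_iff by (auto intro!: exI[of _ 0] simp: zero_prod_def[symmetric])
next
  case (insert u X)
  show ?case
    unfolding solutions_iff
  proof (intro conjI allI impI)
    fix t :: real assume "t < 0"
    then show "(\<Sum>x\<in>insert u X. state_scale (c x) (x t)) = 0"
      using insert.prems by (intro sum.neutral) (auto simp: solutions_iff state_scale_eq rot.zero)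
  next
    fix t :: real assume t: "t \<ge> 0"
    obtain y where y: "generates (u t) y" "(u has_vector_derivative y) (at t within {0..})"
      using insert.prems t by (auto simp: solutions_iff)
    obtain y' where y': "generates (\<Sum>x\<in>X. state_scale (c x) (x t)) y'"
      "((\<lambda>t. \<Sum>x\<in>X. state_scale (c x) (x t)) has_vector_derivative y') (at t within {0..})"
      using insert t unfolding solutions_iff by auto
    have bl: "bounded_linear (state_scale (c u))"
      unfolding state_scale_eq[abs_def]
      by (intro bounded_linear_add bounded_linear_scaleR_right bounded_linear_compose[OF bounded_linear_scaleR_right linear_rot])
    have "generates (state_scale (c u) (u t)) (state_scale (c u) y)"
      unfolding state_scale_eq by (intro generates_add generates_scaleR generates_rot y(1))
    from generates_add[OF this y'(1)]
      has_vector_derivative_add[OF bounded_linear.has_vector_derivative[OF bl y(2)] y'(2)]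
    show "\<exists>y. generates (\<Sum>x\<in>insert u X. state_scale (c x) (x t)) y \<and>
        ((\<lambda>t. \<Sum>x\<in>insert u X. state_scale (c x) (x t)) has_vector_derivative y) (at t within {0..})"
      using insert.hyps by (intro exI[of _ "state_scale (c u) y + y'"]) simp
  qed
qed

lemma sum_fun_apply: "(\<Sum>x\<in>X. (\<lambda>t. f x t)) = (\<lambda>t. \<Sum>x\<in>X. f x t)"
  by (induction X rule: infinite_finite_induct) (auto simp: fun_eq_iff)

lemma solution_bounded_if_orthogonal:
  assumes c: "growing_pontryagin form rot unstable_part unstable_emb neg c skew
    (\<lambda>x. snd (snd x)) (\<lambda>v. (0, 0, v)) Q (scaleC_l2 \<i>)"
    and graph: "growing_pontryagin.invariant_graph_of form rot unstable_part neg (\<lambda>x y. - skew x y) (\<lambda>x. snd (snd x)) Q K S"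
    and u: "u \<in> Sol" and orth: "\<And>z. form (comoving (u 0)) (K z) = 0"
  shows "bounded (u ` {0..})"
proof -
  interpret growing_pontryagin form rot unstable_part unstable_emb neg c skew
    "\<lambda>x. snd (snd x)" "\<lambda>v. (0, 0, v)" Q "scaleC_l2 \<i>" by (rule c)
  have "\<forall>t. \<exists>y r. t \<ge> 0 \<longrightarrow> (u has_vector_derivative y) (at t within {0..}) \<and> snd (snd (u t)) = Q r
      \<and> (\<forall>\<phi>. form (comoving y) \<phi> = skew (comoving (u t)) \<phi> - r \<bullet> snd (snd \<phi>))"
    using u unfolding solutions_iff generates_def by blast
  then obtain y r where yr: "\<And>t. t \<ge> 0 \<Longrightarrow> (u has_vector_derivative y t) (at t within {0..})"
    "\<And>t. t \<ge> 0 \<Longrightarrow> snd (snd (u t)) = Q (r t)"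
    "\<And>t \<phi>. t \<ge> 0 \<Longrightarrow> form (comoving (y t)) \<phi> = skew (comoving (u t)) \<phi> - r t \<bullet> snd (snd \<phi>)"
    by metis
  have "bounded ((\<lambda>t. comoving (u t)) ` {0..})"
  proof (rule solution_bounded[OF graph])
    show "((\<lambda>t. comoving (u t)) has_vector_derivative comoving (y t)) (at t within {0..})" if "t \<ge> 0" for t
      by (rule comoving.has_vector_derivative[OF yr(1)[OF that]])
    show "form (comoving (y t)) x = skew (comoving (u t)) x - r t \<bullet> snd (snd x)" if "t \<ge> 0" for t x
      by (rule yr(3)[OF that])
    show "Q (r t) = snd (snd (comoving (u t)))" if "t \<ge> 0" for t
      using yr(2)[OF that] by (simp add: comoving_def)
  qed (rule orth)
  from bounded_linear_image[OF this linear_lab_frame] show ?thesis by (simp add: image_image)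
qed

text \<open>
  Orthogonality to the invariant subspace of the adjoint amounts to \<open>card neg\<close> complex linear conditions.
  Among more than \<open>card neg\<close> solutions there is a nontrivial combination that satisfies them, and it is
  bounded.
\<close>

lemma quotient_dim_le: "quotient_dim (\<lambda>c u t. state_scale c (u t)) Sol Bdd \<le> enat (card neg)"
  unfolding quotient_dim_def
proof (rule SUP_least)
  fix X assume "X \<in> {X. finite X \<and> X \<subseteq> Sol \<and> (\<forall>c. (\<Sum>x\<in>X. (\<lambda>t. state_scale (c x) (x t))) \<in> Bdd \<longrightarrow> (\<forall>x\<in>X. c x = 0))}"
  then have X: "finite X" "X \<subseteq> Sol"
    and indep: "\<And>c. (\<Sum>x\<in>X. (\<lambda>t. state_scale (c x) (x t))) \<in> Bdd \<Longrightarrow> \<forall>x\<in>X. c x = 0" by auto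
  obtain c where c: "growing_pontryagin form rot unstable_part unstable_emb neg c skew
    (\<lambda>x. snd (snd x)) (\<lambda>v. (0, 0, v)) Q (scaleC_l2 \<i>)" using growing by blast
  then interpret growing_pontryagin form rot unstable_part unstable_emb neg c skew
    "\<lambda>x. snd (snd x)" "\<lambda>v. (0, 0, v)" Q "scaleC_l2 \<i>" .
  interpret adj: growing_pontryagin form rot unstable_part unstable_emb neg c "\<lambda>x y. - skew x y"
    "\<lambda>x. snd (snd x)" "\<lambda>v. (0, 0, v)" Q "scaleC_l2 \<i>" by (rule adjoint)
  obtain K S where graph: "adj.invariant_graph_of K S" using adj.exists_invariant_graph by blast
  note K = adj.K[OF graph]
  define g where "g x j = Complex (form (comoving (x 0)) (K (axis j 1))) (form (comoving (x 0)) (rot (K (axis j 1))))" for x :: "real \<Rightarrow> state" and j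
  define f where "f x = (\<chi> j. if j \<in> neg then g x j else 0)" for x
  have "card X \<le> card neg"
  proof (rule ccontr)
    assume "\<not> card X \<le> card neg"
    then have "card neg < card X" by simp
    from nontrivial_relation[OF X(1) this, of f]
    obtain d where d: "\<exists>x\<in>X. d x \<noteq> 0" "(\<Sum>x\<in>X. d x *s f x) = 0" by (auto simp: f_def)
    define s where "s t = (\<Sum>x\<in>X. state_scale (d x) (x t))" for t
    have s: "s \<in> Sol" unfolding s_def[abs_def] by (rule solutions_lincomb[OF X])
    have complex_form: "Complex (form (comoving (state_scale l u)) y) (form (comoving (state_scale l u)) (rot y))
        = l * Complex (form (comoving u) y) (form (comoving u) (rot y))" for l u y
      by (simp add: state_scale_eq comoving.add comoving.scaleR comoving_rot form.add_left form.scaleR_left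
          form_rot_left rot_rot form.minus_right complex_eq_iff)
    have zero: "Complex (form (comoving (s 0)) (K (axis j 1))) (form (comoving (s 0)) (rot (K (axis j 1)))) = 0" if "j \<in> neg" for j
    proof -
      have "Complex (form (comoving (s 0)) (K (axis j 1))) (form (comoving (s 0)) (rot (K (axis j 1))))
        = (\<Sum>x\<in>X. Complex (form (comoving (state_scale (d x) (x 0))) (K (axis j 1))) (form (comoving (state_scale (d x) (x 0))) (rot (K (axis j 1)))))"
        by (simp add: s_def comoving.sum form.sum_left complex_eq_iff)
      also have "\<dots> = (\<Sum>x\<in>X. d x * g x j)" by (simp add: complex_form g_def)
      also have "\<dots> = (\<Sum>x\<in>X. d x *s f x) $ j" using that by (simp add: f_def)
      finally show ?thesis by (simp add: d(2))
    qed
    have orth: "form (comoving (s 0)) (K z) = 0" for z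
    proof -
      have "coord_proj neg z = (\<Sum>j\<in>neg. z $ j *s axis j 1)"
        by (simp add: vec_eq_iff coord_proj_def axis_def if_distrib[of "\<lambda>x. _ * x"] cong: if_cong)
      then have "K z = (\<Sum>j\<in>neg. K (z $ j *s axis j 1))" using K(2)[of z] by (simp add: linear_sum[OF K(1)])
      then have "form (comoving (s 0)) (K z) = (\<Sum>j\<in>neg. form (comoving (s 0)) (K (z $ j *s axis j 1)))"
        by (simp add: form.sum_right)
      also have "\<dots> = 0"
        using zero by (intro sum.neutral ballI) (simp add: adj.K_scale[OF graph] form.add_right form.scaleR_right complex_eq_iff)
      finally show ?thesis .
    qed
    have "bounded (s ` {0..})" by (rule solution_bounded_if_orthogonal[OF c graph s orth])
    then have "s \<in> Bdd" using s by (simp add: bounded_solutions_def)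
    then have "\<forall>x\<in>X. d x = 0" by (intro indep) (simp add: sum_fun_apply s_def[abs_def])
    with d(1) show False by blast
  qed
  then show "enat (card X) \<le> enat (card neg)" by simp
qed

text \<open>
  The invariant subspace is constructed in the extended space, whose velocity fields are arbitrary.
  Projecting them to \<open>J0 \<Omega>\<close> gives states of the fluid and is compatible with the forms and with \<open>Q\<close>.
\<close>

definition to_J0 :: "state \<Rightarrow> state" where
  "to_J0 u = (fst u, fst (snd u), P (snd (snd u)))"

lemma linear_to_J0: "bounded_linear to_J0"
  unfolding to_J0_def[abs_def]
  by (intro bounded_linear_Pair bl_fst bl_fst_snd bounded_linear_compose[OF linear_P0 bl_snd_snd])

lemma P_B: "P v \<bullet> B w = v \<bullet> B w" "B w \<bullet> P v = B w \<bullet> v"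
  using P0_inner[OF op_B_J0[OF \<Omega>], of v w] by (simp_all add: inner_commute)

lemma form_to_J0: "form (to_J0 x) y = form x (to_J0 y)"
  by (simp add: form_def to_J0_def P_B P0_sym P0_ident[OF op_B_J0[OF \<Omega>]])

lemma gyro_P: "gyro (P v) = gyro v" "gyro v \<bullet> P w = gyro v \<bullet> w"
proof -
  show "gyro (P v) = gyro v" by (simp add: gyro_def P_P)
  show "gyro v \<bullet> P w = gyro v \<bullet> w" by (simp add: gyro_def P0_sym P_P)
qed

lemma skew_to_J0: "skew (to_J0 x) y = skew x (to_J0 y)"
  by (simp add: skew_def to_J0_def P_B gyro_P)

text \<open>
  \<open>U z\<close> is the motion in the invariant subspace that starts above \<open>z\<close>. The last conjunct makes \<open>U\<close>
  injective on the range of \<open>coord_proj neg\<close>.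
\<close>

lemma unstable_solutions:
  "\<exists>U. (\<forall>z. U z \<in> Sol) \<and> (\<forall>z. coord_proj neg z = z \<longrightarrow> z \<noteq> 0 \<longrightarrow> \<not> bounded (U z ` {0..})) \<and>
    (\<forall>(X :: 3 set) c y. (\<lambda>t. \<Sum>j\<in>X. state_scale (c j) (U (y j) t)) = U (\<Sum>j\<in>X. c j *s y j)) \<and>
    (\<forall>z. coord_proj neg (fst (U z 0)) = coord_proj neg z)"
proof -
  obtain c where "growing_pontryagin form rot unstable_part unstable_emb neg c skew
    (\<lambda>x. snd (snd x)) (\<lambda>v. (0, 0, v)) Q (scaleC_l2 \<i>)" using growing by blast
  then interpret growing_pontryagin form rot unstable_part unstable_emb neg c skew
    "\<lambda>x. snd (snd x)" "\<lambda>v. (0, 0, v)" Q "scaleC_l2 \<i>" .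
  obtain K S where graph: "invariant_graph_of K S" using exists_invariant_graph by blast
  note K = K[OF graph] and S = S[OF graph]
  have Kb: "bounded_linear K" using K(1) by (simp add: linear_conv_bounded_linear)
  have L: "bounded_linear (\<lambda>z. lab_frame (to_J0 (K z)))"
    by (intro bounded_linear_compose[OF linear_lab_frame] bounded_linear_compose[OF linear_to_J0] Kb)
  define U where "U z t = (if t < 0 then 0 else lab_frame (to_J0 (K (flow S t z))))" for z t
  have p_flow: "coord_proj neg (flow S t z) = flow S t (coord_proj neg z)" for t z
    using flow_bounded_linear[OF S(1) linear_coord_proj[unfolded linear_conv_bounded_linear], of neg S t z]
    by (simp add: S(2,3) flow_def)
  have fst_U: "coord_proj neg (fst (U z t)) = flow S t (coord_proj neg z)" if "t \<ge> 0" for z t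
    using K(3)[of "flow S t z"] that by (simp add: U_def lab_frame_def to_J0_def unstable_part_def p_flow)
  have gen: "generates (lab_frame (to_J0 (K z))) (lab_frame (to_J0 (K (S z))))" for z
  proof -
    obtain r where r: "Q r = snd (snd (K z))" "\<forall>y. form (K (S z)) y = skew (K z) y - r \<bullet> snd (snd y)"
      using K_equation[OF graph] by blast
    have "snd (snd (lab_frame (to_J0 (K z)))) = P (Q r)" by (simp add: lab_frame_def to_J0_def r(1))
    also have "\<dots> = Q (P r)" using P_Q[of r] Q_J0[OF P0_in_J0, of r] Q0_P0[of r] by simp
    finally have "snd (snd (lab_frame (to_J0 (K z)))) = Q (P r)" .
    moreover have "form (to_J0 (K (S z))) y = skew (to_J0 (K z)) y - P r \<bullet> snd (snd y)" for y
      using r(2)[rule_format, of "to_J0 y"] unfolding form_to_J0 skew_to_J0 by (simp add: to_J0_def P0_sym)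
    ultimately show ?thesis
      unfolding generates_def by (intro bexI[OF _ P0_in_J0[of \<Omega> r]]) simp
  qed
  have sol: "U z \<in> Sol" for z
    unfolding solutions_iff
  proof (intro conjI allI impI)
    fix t :: real assume t: "t \<ge> 0"
    have "((\<lambda>t. lab_frame (to_J0 (K (flow S t z)))) has_vector_derivative lab_frame (to_J0 (K (S (flow S t z))))) (at t within {0..})"
      by (rule bounded_linear.has_vector_derivative[OF L flow_has_derivative[OF S(1)]])
    then have "(U z has_vector_derivative lab_frame (to_J0 (K (S (flow S t z))))) (at t within {0..})"
      by (rule has_vector_derivative_transform[rotated 2]) (use t in \<open>auto simp: U_def\<close>)
    then show "\<exists>y. generates (U z t) y \<and> (U z has_vector_derivative y) (at t within {0..})"
      using gen[of "flow S t z"] t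
      by (intro exI[of _ "lab_frame (to_J0 (K (S (flow S t z))))"]) (simp add: U_def)
  qed (simp add: U_def)
  have unbdd: "\<not> bounded (U z ` {0..})" if z: "coord_proj neg z = z" "z \<noteq> 0" for z
  proof
    assume "bounded (U z ` {0..})"
    moreover have "bounded_linear (\<lambda>u. coord_proj neg (fst u))"
      using bounded_linear_compose[OF linear_coord_proj[unfolded linear_conv_bounded_linear] bl_fst] .
    ultimately have "bounded ((\<lambda>u. coord_proj neg (fst u)) ` U z ` {0..})" by (rule bounded_linear_image)
    moreover have "(\<lambda>u. coord_proj neg (fst u)) ` U z ` {0..} = (\<lambda>t. flow S t z) ` {0..}"
      unfolding image_image using fst_U z(1) by (intro image_cong) auto
    ultimately show False using orbit_unbounded[OF graph z] by simp
  qed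
  have to_J0_rot: "lab_frame (to_J0 (rot u)) = rot (lab_frame (to_J0 u))" for u
    by (simp add: lab_frame_def to_J0_def rot_def P0_scaleC_i vec_eq_iff algebra_simps)
  interpret L: bounded_linear "\<lambda>z. lab_frame (to_J0 (K z))" by (rule L)
  have flow_scale: "flow S t (l *s x) = l *s flow S t x" for t l x
    using flow_bounded_linear[OF S(1) bounded_linear_vector_scale[of l], of S t x]
    by (simp add: S_scale[OF graph] flow_def)
  have lin: "state_scale l (U z t) = U (l *s z) t" for l z t
    using linear_scale_complex[OF L.linear, of rot l "flow S t z"]
    by (simp add: U_def state_scale_eq flow_scale K(5) to_J0_rot rot.zero)
  have add: "U (y + z) t = U y t + U z t" for y z t
    by (simp add: U_def flow_add[OF S(1)] L.add)
  have zero: "U 0 t = 0" for t using lin[of 0 0 t] by (simp add: state_scale_eq rot.zero)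
  have sum: "(\<lambda>t. \<Sum>j\<in>X. state_scale (c j) (U (y j) t)) = U (\<Sum>j\<in>X. c j *s y j)" for X :: "3 set" and c y
    by (induction X rule: infinite_finite_induct) (auto simp: lin add zero fun_eq_iff)
  have init: "coord_proj neg (fst (U z 0)) = coord_proj neg z" for z
    using fst_U[of 0 z] flow_0[OF S(1)] by simp
  show ?thesis
    by (intro exI[of _ U] conjI allI impI sol unbdd sum init)
qed

text \<open>
  A combination of the solutions \<open>U (axis j 1)\<close>, \<open>j \<in> neg\<close>, is again some \<open>U z\<close>, so it is unbounded unless all
  coefficients vanish.
\<close>

lemma quotient_dim_ge: "enat (card neg) \<le> quotient_dim (\<lambda>c u t. state_scale c (u t)) Sol Bdd"
proof -
  obtain U where U_all: "\<forall>z. U z \<in> Sol" "\<forall>z. coord_proj neg z = z \<longrightarrow> z \<noteq> 0 \<longrightarrow> \<not> bounded (U z ` {0..})"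
    "\<forall>(X :: 3 set) c y. (\<lambda>t. \<Sum>j\<in>X. state_scale (c j) (U (y j) t)) = U (\<Sum>j\<in>X. c j *s y j)"
    "\<forall>z. coord_proj neg (fst (U z 0)) = coord_proj neg z"
    using unstable_solutions by (elim exE conjE) (rule that)
  note U = U_all[rule_format]
  define e where "e j = (axis j 1 :: complex^3)" for j
  have pe: "coord_proj neg (e j) = e j" if "j \<in> neg" for j
    using that by (auto simp: e_def coord_proj_def vec_eq_iff axis_def)
  have inj: "inj_on (\<lambda>j. U (e j)) neg"
  proof (rule inj_onI)
    fix i j assume ij: "i \<in> neg" "j \<in> neg" "U (e i) = U (e j)"
    have "coord_proj neg (e i) = coord_proj neg (e j)"
      using U(4)[of "e i"] U(4)[of "e j"] unfolding ij(3) by (rule trans[OF sym])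
    then have "e i = e j" unfolding pe[OF ij(1)] pe[OF ij(2)] .
    then show "i = j" by (simp add: e_def axis_eq_axis)
  qed
  define X where "X = (\<lambda>j. U (e j)) ` neg"
  have indep: "\<forall>x\<in>X. d x = 0" if b: "(\<Sum>x\<in>X. (\<lambda>t. state_scale (d x) (x t))) \<in> Bdd" for d
  proof -
    define z where "z = (\<Sum>j\<in>neg. d (U (e j)) *s e j)"
    have zj: "z $ j = (if j \<in> neg then d (U (e j)) else 0)" for j
      by (simp add: z_def e_def axis_def if_distrib[of "\<lambda>x. _ * x"] cong: if_cong)
    have "(\<lambda>t. \<Sum>j\<in>neg. state_scale (d (U (e j))) (U (e j) t)) = U (\<Sum>j\<in>neg. d (U (e j)) *s e j)"
      by (rule U(3))
    then have "(\<Sum>x\<in>X. (\<lambda>t. state_scale (d x) (x t))) = U z"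
      unfolding sum_fun_apply X_def z_def
      by (simp add: sum.reindex[OF inj])
    then have "bounded (U z ` {0..})" using b by (simp add: bounded_solutions_def)
    moreover have "coord_proj neg z = z" by (simp add: vec_eq_iff coord_proj_def zj)
    ultimately have "z = 0" using U(2) by blast
    have "d (U (e j)) = 0" if "j \<in> neg" for j using zj[of j] that unfolding \<open>z = 0\<close> by simp
    then show ?thesis by (simp add: X_def)
  qed
  have card: "card X = card neg" unfolding X_def by (rule card_image[OF inj])
  have "X \<in> {X. finite X \<and> X \<subseteq> Sol \<and> (\<forall>c. (\<Sum>x\<in>X. (\<lambda>t. state_scale (c x) (x t))) \<in> Bdd \<longrightarrow> (\<forall>x\<in>X. c x = 0))}"
    using indep U(1) by (auto simp: X_def)
  then show ?thesis unfolding quotient_dim_def card[symmetric] by (rule SUP_upper)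
qed

lemma index_eq: "instability_index (op_T \<Omega> a k \<nu> \<omega>) (dom_M \<Omega>) \<omega> = enat (card neg)"
  unfolding instability_index_def by (rule antisym[OF quotient_dim_le quotient_dim_ge])

lemma stable_iff: "is_stable (op_T \<Omega> a k \<nu> \<omega>) (dom_M \<Omega>) \<omega> \<longleftrightarrow> neg = {}"
proof
  assume stable: "is_stable (op_T \<Omega> a k \<nu> \<omega>) (dom_M \<Omega>) \<omega>"
  show "neg = {}"
  proof (rule ccontr)
    assume "neg \<noteq> {}"
    then obtain j where j: "j \<in> neg" by blast
    obtain U where U: "\<forall>z. U z \<in> Sol" "\<forall>z. coord_proj neg z = z \<longrightarrow> z \<noteq> 0 \<longrightarrow> \<not> bounded (U z ` {0..})"
      using unstable_solutions by (elim exE conjE) (rule that)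
    have "coord_proj neg (axis j 1) = axis j 1" using j by (auto simp: coord_proj_def vec_eq_iff axis_def)
    then show False using U(1)[rule_format, of "axis j 1"] U(2)[rule_format, of "axis j 1"] stable by (simp add: is_stable_def axis_eq_0_iff)
  qed
next
  assume neg: "neg = {}"
  obtain c where c: "growing_pontryagin form rot unstable_part unstable_emb neg c skew
    (\<lambda>x. snd (snd x)) (\<lambda>v. (0, 0, v)) Q (scaleC_l2 \<i>)" using growing by blast
  then interpret growing_pontryagin form rot unstable_part unstable_emb neg c skew
    "\<lambda>x. snd (snd x)" "\<lambda>v. (0, 0, v)" Q "scaleC_l2 \<i>" .
  interpret adj: growing_pontryagin form rot unstable_part unstable_emb neg c "\<lambda>x y. - skew x y"
    "\<lambda>x. snd (snd x)" "\<lambda>v. (0, 0, v)" Q "scaleC_l2 \<i>" by (rule adjoint)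
  obtain K S where graph: "adj.invariant_graph_of K S" using adj.exists_invariant_graph by blast
  have "K z = 0" for z
  proof -
    have "coord_proj neg z = 0" by (simp add: neg coord_proj_def vec_eq_iff)
    then show ?thesis using adj.K(2)[OF graph, of z] linear_0[OF adj.K(1)[OF graph]] by simp
  qed
  then show "is_stable (op_T \<Omega> a k \<nu> \<omega>) (dom_M \<Omega>) \<omega>"
    unfolding is_stable_def using solution_bounded_if_orthogonal[OF c graph] by (simp add: form.zero_right)
qed

end

lemma pi_minus_diag:
  fixes d :: "'n::finite \<Rightarrow> real"
  shows "pi_minus (diag_mat (\<lambda>j. complex_of_real (d j))) = card {j. d j < 0}"
proof -
  define N where "N = (diag_mat (\<lambda>j. complex_of_real (d j)) :: complex^'n^'n)"
  have N: "(N *v x) $ j = complex_of_real (d j) * x $ j" for x j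
    by (simp add: N_def matrix_vector_mult_def diag_mat_def if_distrib[of "\<lambda>x. x * _"] cong: if_cong)
  have space: "{x. N *v x = complex_of_real l *s x} = {x. \<forall>i. i \<notin> {j. d j = l} \<longrightarrow> x $ i = 0}" for l
    by (auto simp: vec_eq_iff N)
  have ev: "(\<exists>x. x \<noteq> 0 \<and> N *v x = complex_of_real l *s x) \<longleftrightarrow> l \<in> range d" for l
  proof
    assume "\<exists>x. x \<noteq> 0 \<and> N *v x = complex_of_real l *s x"
    then obtain x j where "x $ j \<noteq> 0" "N *v x = complex_of_real l *s x" by (auto simp: vec_eq_iff)
    have "(N *v x) $ j = (complex_of_real l *s x) $ j" by (simp only: \<open>N *v x = _\<close>)
    then have "d j = l" using \<open>x $ j \<noteq> 0\<close> by (simp add: N)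
    then show "l \<in> range d" by blast
  next
    assume "l \<in> range d"
    then obtain j where "l = d j" by blast
    then have "N *v axis j 1 = complex_of_real l *s axis j 1" by (simp add: vec_eq_iff N axis_def)
    then show "\<exists>x. x \<noteq> 0 \<and> N *v x = complex_of_real l *s x" by (intro exI[of _ "axis j 1"]) (simp add: axis_eq_0_iff)
  qed
  have "pi_minus N = (\<Sum>l | l < 0 \<and> l \<in> range d. card {j. d j = l})"
    unfolding pi_minus_def ev space dim_substandard_cart ..
  also have "\<dots> = card (\<Union>l\<in>{l. l < 0 \<and> l \<in> range d}. {j. d j = l})"
    by (rule card_UN_disjoint[symmetric]) auto
  also have "(\<Union>l\<in>{l. l < 0 \<and> l \<in> range d}. {j. d j = l}) = {j. d j < 0}" by auto
  finally show ?thesis by (simp add: N_def)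
qed

text \<open>
  As \<open>P0\<close> is a projection, \<open>|B w|\<^sup>2\<close> is at most the inertia of the frozen fluid, and the shell adds a
  positive amount to it.
\<close>

lemma inertia_exceeds_entrained:
  fixes \<Omega> \<Omega>\<^sub>1 :: "(real^3) set" and \<rho> :: "(real^3) measure"
  assumes \<Omega>: "open \<Omega>" "bounded \<Omega>" "\<Omega> \<noteq> {}" and \<Omega>1: "bounded \<Omega>\<^sub>1" "\<Omega> \<subseteq> \<Omega>\<^sub>1"
    and sets: "sets \<rho> = sets (restrict_space borel \<Omega>\<^sub>1)" and fin: "finite_measure \<rho>"
    and fluid: "restrict_space \<rho> \<Omega> = restrict_space lborel \<Omega>"
    and inertia: "\<And>w. herm (op_A a w) w = complex_of_real (LINT x:\<Omega>\<^sub>1|\<rho>. (norm (ccross w (cvec x)))\<^sup>2)"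
    and shell: "\<And>w. w \<noteq> 0 \<Longrightarrow> 0 < (LINT x:(\<Omega>\<^sub>1 - \<Omega>)|\<rho>. (norm (ccross w (cvec x)))\<^sup>2)"
    and "w \<noteq> 0"
  shows "(norm (op_B \<Omega> w))\<^sup>2 < op_A a w \<bullet> w"
proof -
  interpret finite_measure \<rho> by (rule fin)
  define f where "f x = (norm (ccross w (cvec x)))\<^sup>2" for x
  have space: "space \<rho> = \<Omega>\<^sub>1" using sets_eq_imp_space_eq[OF sets] by (simp add: space_restrict_space)
  have \<Omega>_sets: "\<Omega> \<in> sets \<rho>"
    unfolding sets sets_restrict_space using \<Omega>(1) \<Omega>1(2) by (auto simp: image_iff intro!: bexI[of _ \<Omega>])
  have "f \<in> borel_measurable borel" unfolding f_def[abs_def]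
    using bounded_linear_ccross_cvec[of w]
    by (intro borel_measurable_continuous_onI continuous_intros linear_continuous_on)
  then have f_meas: "f \<in> borel_measurable \<rho>"
    using measurable_restrict_space1[of f borel borel \<Omega>\<^sub>1] measurable_cong_sets[OF sets refl] by blast
  obtain R where R: "\<And>x. x \<in> \<Omega>\<^sub>1 \<Longrightarrow> norm x \<le> R" using \<Omega>1(1) by (auto simp: bounded_iff)
  obtain K where K: "K > 0" "\<And>x. norm (ccross w (cvec x)) \<le> norm x * K"
    using bounded_linear.pos_bounded[OF bounded_linear_ccross_cvec[of w]] by blast
  have f_bound: "norm (f x) \<le> (R * K)\<^sup>2" if "x \<in> space \<rho>" for x
  proof -
    have "norm (ccross w (cvec x)) \<le> R * K"
      using order.trans[OF K(2)[of x] mult_right_mono[OF R[of x] less_imp_le[OF K(1)]]] that space by simp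
    then show ?thesis unfolding f_def by (simp add: power_mono)
  qed
  have int: "integrable \<rho> f"
    by (rule integrable_const_bound[OF _ f_meas, of "(R * K)\<^sup>2"]) (use f_bound in auto)
  have int': "set_integrable \<rho> S f" if "S \<in> sets \<rho>" for S
    unfolding set_integrable_def using int that by (rule integrable_mult_indicator[rotated])
  have top: "\<Omega>\<^sub>1 \<in> sets \<rho>" using sets.top[of \<rho>] by (simp add: space)
  have "(LINT x:(\<Omega>\<^sub>1 - \<Omega>) \<union> \<Omega>|\<rho>. f x) = (LINT x:(\<Omega>\<^sub>1 - \<Omega>)|\<rho>. f x) + (LINT x:\<Omega>|\<rho>. f x)"
    by (rule set_integral_Un) (auto intro!: int' \<Omega>_sets top)
  moreover have "(\<Omega>\<^sub>1 - \<Omega>) \<union> \<Omega> = \<Omega>\<^sub>1" using \<Omega>1(2) by blast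
  moreover have "(LINT x:\<Omega>|\<rho>. f x) = (LINT x:\<Omega>|lborel. f x)"
  proof -
    have "(LINT x:\<Omega>|\<rho>. f x) = integral\<^sup>L (restrict_space \<rho> \<Omega>) f"
      using \<Omega>_sets \<Omega>1(2) unfolding set_lebesgue_integral_def by (intro integral_restrict_space[symmetric]) (simp add: space Int_absorb2)
    also have "\<dots> = (LINT x:\<Omega>|lborel. f x)"
      unfolding fluid set_lebesgue_integral_def using \<Omega>(1) by (intro integral_restrict_space) simp
    finally show ?thesis .
  qed
  moreover have "op_A a w \<bullet> w = (LINT x:\<Omega>\<^sub>1|\<rho>. f x)"
    using arg_cong[OF inertia[of w], of Re] by (simp add: Re_herm f_def)
  ultimately show ?thesis
    using shell[OF \<open>w \<noteq> 0\<close>] norm_op_B_le[OF \<Omega>, of w] by (simp add: f_def)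
qed

theorem theorem14p3:
  fixes \<Omega> \<Omega>\<^sub>1 :: "(real^3) set" and \<rho> :: "(real^3) measure"
    and \<omega> \<nu> k :: real and a :: "real^3"
  assumes "open \<Omega>" "connected \<Omega>" "\<Omega> \<noteq> {}" "bounded \<Omega>"
    and "open \<Omega>\<^sub>1" "connected \<Omega>\<^sub>1" "bounded \<Omega>\<^sub>1" "\<Omega> \<subseteq> \<Omega>\<^sub>1"
    and "sets \<rho> = sets (restrict_space borel \<Omega>\<^sub>1)" "finite_measure \<rho>"
    and fluid_density: "restrict_space \<rho> \<Omega> = restrict_space lborel \<Omega>"
    and inertia: "\<And>w. herm (op_A a w) w
                    = complex_of_real (LINT x:\<Omega>\<^sub>1|\<rho>. (norm (ccross w (cvec x)))\<^sup>2)"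
    and shell_inertia: "\<And>w. w \<noteq> 0 \<Longrightarrow>
                    0 < (LINT x:(\<Omega>\<^sub>1 - \<Omega>)|\<rho>. (norm (ccross w (cvec x)))\<^sup>2)"
    and "\<omega> > 0" "\<nu> > 0"
    and "n_coeff a k \<omega> 1 * n_coeff a k \<omega> 2 \<noteq> 0"
  shows "instability_index (op_T \<Omega> a k \<nu> \<omega>) (dom_M \<Omega>) \<omega> = enat (pi_minus (N_mat a k \<omega>))
       \<and> (is_stable (op_T \<Omega> a k \<nu> \<omega>) (dom_M \<Omega>) \<omega>
            \<longleftrightarrow> n_coeff a k \<omega> 1 > 0 \<and> n_coeff a k \<omega> 2 > 0)"
proof -
  obtain Q0 where Q0: "bounded_linear Q0" "\<And>v w. Q0 v \<bullet> w = v \<bullet> Q0 w" "\<And>v. 0 \<le> Q0 v \<bullet> v"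
    "\<And>v. Q0 (scaleC_l2 \<i> v) = scaleC_l2 \<i> (Q0 v)" "\<And>v. Q0 v = Q0 (P0 \<Omega> v)"
    "\<And>v. Q0 v \<in> stokes_dom \<Omega>" "\<And>v. stokes \<Omega> (Q0 v) = P0 \<Omega> v"
    "\<And>v. v \<in> stokes_dom \<Omega> \<Longrightarrow> Q0 (stokes \<Omega> v) = v" "\<And>v. v \<in> stokes_dom \<Omega> \<Longrightarrow> v \<in> J0 \<Omega> \<and> stokes \<Omega> v \<in> J0 \<Omega>"
    using stokes_inverse[OF \<open>bounded \<Omega>\<close>] by blast
  have gap: "(norm (op_B \<Omega> w))\<^sup>2 < op_A a w \<bullet> w" if "w \<noteq> 0" for w
    by (rule inertia_exceeds_entrained[OF assms(1,4,3,7,8,9,10,11) inertia shell_inertia that])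
  have n: "n_coeff a k \<omega> 1 \<noteq> 0" "n_coeff a k \<omega> 2 \<noteq> 0" using assms(16) by auto
  interpret rotating_top \<Omega> a k \<nu> \<omega> Q0
    by (rule rotating_top.intro[OF assms(1,4,3) \<open>\<omega> > 0\<close> \<open>\<nu> > 0\<close> gap n Q0(1) Q0(2) Q0(3) Q0(4) Q0(5) Q0(6) Q0(7) Q0(8) Q0(9)])
  have "N_mat a k \<omega> = diag_mat (\<lambda>j. complex_of_real (n j))"
    unfolding N_mat_def n_def by (rule arg_cong[of _ _ diag_mat]) (auto simp: fun_eq_iff)
  then have "pi_minus (N_mat a k \<omega>) = card neg" by (simp add: pi_minus_diag neg_def)
  moreover have "neg = {} \<longleftrightarrow> n_coeff a k \<omega> 1 > 0 \<and> n_coeff a k \<omega> 2 > 0"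
    using n forall_UNIV_3[of "\<lambda>j. \<not> n j < 0"] by (auto simp: neg_def n_def not_less)
  ultimately show ?thesis using index_eq stable_iff by simp
qed

end
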